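(* Let $\mathbf{C}$ be a locally small $\mathcal{M}$-category, and let $\mathbf{D}$ be a locally small, cocomplete $\mathcal{M}$-category. Then precomposition with the Yoneda embedding $\mathbf{y}\colon\mathbf{C}\to\mathcal{P}_{\mathcal{M}}(\mathbf{C})$, $$(-)\circ\mathbf{y}\colon\mathcal{M}\mathbf{Cocomp}(\mathcal{P}_{\mathcal{M}}(\mathbf{C}),\mathbf{D})\to\mathcal{M}\mathbf{CAT}(\mathbf{C},\mathbf{D}),$$ is an equivalence of categories.
   Context: A stable system of monics $\mathcal{M}_{\mathbf{C}}$ in a category $\mathbf{C}$ is a collection of monics containing all isomorphisms, closed under composition, and such that the pullback of any $m\in\mathcal{M}_{\mathbf{C}}$ along any map exists and lies in $\mathcal{M}_{\mathbf{C}}$. An $\mathcal{M}$-category is a category $\mathbf{C}$ with a stable system of monics $\mathcal{M}_{\mathbf{C}}$. It is locally small if $\mathbf{C}$ is locally small and, for each object $D$, the isomorphism classes (over $D$) of maps in $\mathcal{M}_{\mathbf{C}}$ with codomain $D$ form a small partially ordered set. An $\mathcal{M}$-functor $F\colon\mathbf{C}\to\mathbf{D}$ is a functor sending $\mathcal{M}_{\mathbf{C}}$ into $\mathcal{M}_{\mathbf{D}}$ and preserving pullbacks of monics in $\mathcal{M}_{\mathbf{C}}$. A natural transformation between $\mathcal{M}$-functors is $\mathcal{M}$-cartesian if its naturality square at each $m\in\mathcal{M}_{\mathbf{C}}$ is a pullback. $\mathcal{M}\mathbf{CAT}$ is the 2-category of locally small $\mathcal{M}$-categories, $\mathcal{M}$-functors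 and $\mathcal{M}$-cartesian natural transformations. $\mathsf{Par}(\mathbf{C})$ is the category with the objects of $\mathbf{C}$, whose morphisms $X\to Y$ are isomorphism classes $(m,f)$ of spans $X\xleftarrow{m}Z\xrightarrow{f}Y$ with $m\in\mathcal{M}_{\mathbf{C}}$; composition is by pullback. The inclusion $\mathbf{C}\hookrightarrow\mathsf{Par}(\mathbf{C})$ sends $f$ to $(1,f)$. An $\mathcal{M}$-category $\mathbf{C}$ is cocomplete if $\mathbf{C}$ has all small colimits and $\mathbf{C}\hookrightarrow\mathsf{Par}(\mathbf{C})$ preserves them; an $\mathcal{M}$-functor is cocontinuous if its underlying functor preserves small colimits. $\mathcal{M}\mathbf{Cocomp}$ is the 2-category of cocomplete $\mathcal{M}$-categories, cocontinuous $\mathcal{M}$-functors and $\mathcal{M}$-cartesian natural transformations. A presheaf on $\mathbf{C}$ is small if it is a small colimit of representables; $\mathcal{P}(\mathbf{C})$ is the category of small presheaves. $\mathcal{P}_{\mathcal{M}}(\mathbf{C})=(\mathcal{P}(\mathbf{C}),\mathcal{M}_{\mathcal{P}(\mathbf{C})})$, where $\mu\colon P\Rightarrow Q$ is in $\mathcal{M}_{\mathcal{P}(\mathbf{C})}$ iff for every $\gamma\colon\mathbf{y}D\Rightarrow Q$ there is $m\colon C\to D$ in $\mathcal{M}_{\mathbf{C}}$ such that $\mathbf{y}m$ is a pullback of $\mu$ along $\gamma$. For $\mathbf{C}$ a locally small $\mathcal{M}$-category, $\mathcal{P}_{\mathcal{M}}(\mathbf{C})$ is a locally small cocomplete $\mathcal{M}$-category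 and $\mathbf{y}$ is an $\mathcal{M}$-functor. *)

theory Defs
  imports Main "HOL-Library.FuncSet"
begin

unbundle cardinal_syntax

section \<open>Size\<close>

text \<open>
  The size distinction is made relative to a type \<open>'u\<close> whose cardinality is an (uncountable)
  inaccessible cardinal, i.e. that of a Grothendieck universe: a set, of any element type, is small
  if it has fewer elements than \<open>'u\<close>. Every small set is then in bijection with a subset
  of \<open>'u\<close>. The object and arrow types of a category may be arbitrarily large.
\<close>

definition small :: "'u itself \<Rightarrow> 'x set \<Rightarrow> bool" where
  "small U A \<longleftrightarrow> |A| <o |UNIV :: 'u set|"

definition inaccessible :: "'u itself \<Rightarrow> bool" where
  "inaccessible U \<longleftrightarrow>
     natLeq <o |UNIV :: 'u set| \<and>
     regularCard |UNIV :: 'u set| \<and>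
     (\<forall>A :: 'u set. small U A \<longrightarrow> small U (Pow A))"


section \<open>Categories, functors and natural transformations\<close>

record ('o, 'a) cat =
  Obj :: "'o set"
  Arr :: "'a set"
  Dom :: "'a \<Rightarrow> 'o"
  Cod :: "'a \<Rightarrow> 'o"
  Ident :: "'o \<Rightarrow> 'a"
  Comp :: "'a \<Rightarrow> 'a \<Rightarrow> 'a"  \<comment> \<open>\<open>Comp C g f\<close> is \<open>g\<close> after \<open>f\<close>\<close>

definition hom :: "('o, 'a, 'm) cat_scheme \<Rightarrow> 'o \<Rightarrow> 'o \<Rightarrow> 'a set" where
  "hom C X Y = {f \<in> Arr C. Dom C f = X \<and> Cod C f = Y}"

definition category :: "('o, 'a, 'm) cat_scheme \<Rightarrow> bool" where
  "category C \<longleftrightarrow>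
     (\<forall>f\<in>Arr C. Dom C f \<in> Obj C \<and> Cod C f \<in> Obj C) \<and>
     (\<forall>X\<in>Obj C. Ident C X \<in> hom C X X) \<and>
     (\<forall>f\<in>Arr C. \<forall>g\<in>Arr C. Dom C g = Cod C f \<longrightarrow> Comp C g f \<in> hom C (Dom C f) (Cod C g)) \<and>
     (\<forall>f\<in>Arr C. Comp C f (Ident C (Dom C f)) = f \<and> Comp C (Ident C (Cod C f)) f = f) \<and>
     (\<forall>f\<in>Arr C. \<forall>g\<in>Arr C. \<forall>h\<in>Arr C. Dom C g = Cod C f \<longrightarrow> Dom C h = Cod C g \<longrightarrow>
        Comp C h (Comp C g f) = Comp C (Comp C h g) f)"

definition op_cat :: "('o, 'a, 'm) cat_scheme \<Rightarrow> ('o, 'a) cat" where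
  "op_cat C = \<lparr>Obj = Obj C, Arr = Arr C, Dom = Cod C, Cod = Dom C, Ident = Ident C,
               Comp = (\<lambda>g f. Comp C f g)\<rparr>"

definition iso :: "('o, 'a, 'm) cat_scheme \<Rightarrow> 'a \<Rightarrow> bool" where
  "iso C f \<longleftrightarrow> f \<in> Arr C \<and>
     (\<exists>g \<in> hom C (Cod C f) (Dom C f).
        Comp C g f = Ident C (Dom C f) \<and> Comp C f g = Ident C (Cod C f))"

definition isomorphic :: "('o, 'a, 'm) cat_scheme \<Rightarrow> 'o \<Rightarrow> 'o \<Rightarrow> bool" where
  "isomorphic C X Y \<longleftrightarrow> (\<exists>f \<in> hom C X Y. iso C f)"

definition monic :: "('o, 'a, 'm) cat_scheme \<Rightarrow> 'a \<Rightarrow> bool" where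
  "monic C m \<longleftrightarrow> m \<in> Arr C \<and>
     (\<forall>f\<in>Arr C. \<forall>g\<in>Arr C. Dom C f = Dom C g \<longrightarrow> Cod C f = Dom C m \<longrightarrow> Cod C g = Dom C m \<longrightarrow>
        Comp C m f = Comp C m g \<longrightarrow> f = g)"

text \<open>\<open>pullback C p q f g\<close>: the square \<open>f \<circ> p = g \<circ> q\<close> is a pullback,
  so \<open>q\<close> is a pullback of \<open>f\<close> along \<open>g\<close> and \<open>p\<close> one of \<open>g\<close> along \<open>f\<close>.\<close>

definition pullback :: "('o, 'a, 'm) cat_scheme \<Rightarrow> 'a \<Rightarrow> 'a \<Rightarrow> 'a \<Rightarrow> 'a \<Rightarrow> bool" where
  "pullback C p q f g \<longleftrightarrow>
     {p, q, f, g} \<subseteq> Arr C \<and>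
     Cod C f = Cod C g \<and> Dom C p = Dom C q \<and> Cod C p = Dom C f \<and> Cod C q = Dom C g \<and>
     Comp C f p = Comp C g q \<and>
     (\<forall>a\<in>Arr C. \<forall>b\<in>Arr C.
        Dom C a = Dom C b \<longrightarrow> Cod C a = Dom C f \<longrightarrow> Cod C b = Dom C g \<longrightarrow>
        Comp C f a = Comp C g b \<longrightarrow>
        (\<exists>!h. h \<in> hom C (Dom C a) (Dom C p) \<and> Comp C p h = a \<and> Comp C q h = b))"

text \<open>
  Functors are required to be \<^const>\<open>extensional\<close>, so that HOL equality of functors is equality
  of functors. The same applies to the components of natural transformations below.
\<close>

record ('o, 'a, 'p, 'b) fctr =
  FObj :: "'o \<Rightarrow> 'p"
  FArr :: "'a \<Rightarrow> 'b"

definition is_functor ::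
  "('o, 'a, 'm) cat_scheme \<Rightarrow> ('p, 'b, 'n) cat_scheme \<Rightarrow> ('o, 'a, 'p, 'b) fctr \<Rightarrow> bool" where
  "is_functor A B F \<longleftrightarrow>
     FObj F \<in> Obj A \<rightarrow>\<^sub>E Obj B \<and> FArr F \<in> Arr A \<rightarrow>\<^sub>E Arr B \<and>
     (\<forall>f\<in>Arr A. Dom B (FArr F f) = FObj F (Dom A f) \<and> Cod B (FArr F f) = FObj F (Cod A f)) \<and>
     (\<forall>X\<in>Obj A. FArr F (Ident A X) = Ident B (FObj F X)) \<and>
     (\<forall>f\<in>Arr A. \<forall>g\<in>Arr A. Dom A g = Cod A f \<longrightarrow>
        FArr F (Comp A g f) = Comp B (FArr F g) (FArr F f))"

definition id_functor :: "('o, 'a, 'm) cat_scheme \<Rightarrow> ('o, 'a, 'o, 'a) fctr" where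
  "id_functor A = \<lparr>FObj = (\<lambda>X\<in>Obj A. X), FArr = (\<lambda>f\<in>Arr A. f)\<rparr>"

text \<open>\<open>comp_functor A G F\<close> is \<open>G\<close> after \<open>F\<close>, where \<open>F\<close> has domain \<open>A\<close>.\<close>

definition comp_functor ::
  "('o, 'a, 'm) cat_scheme \<Rightarrow> ('p, 'b, 'q, 'c) fctr \<Rightarrow> ('o, 'a, 'p, 'b) fctr
     \<Rightarrow> ('o, 'a, 'q, 'c) fctr" where
  "comp_functor A G F =
     \<lparr>FObj = (\<lambda>X\<in>Obj A. FObj G (FObj F X)), FArr = (\<lambda>f\<in>Arr A. FArr G (FArr F f))\<rparr>"

text \<open>A map tagged with its source and target; used for functions between sets, for natural
  transformations and for partial maps.\<close>

datatype ('x, 'c) tagged = Tagged (src: 'x) (body: 'c) (tgt: 'x)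

type_synonym ('o, 'a, 'p, 'b) nat_trans = "(('o, 'a, 'p, 'b) fctr, 'o \<Rightarrow> 'b) tagged"

definition is_nat_trans ::
  "('o, 'a, 'm) cat_scheme \<Rightarrow> ('p, 'b, 'n) cat_scheme \<Rightarrow> ('o, 'a, 'p, 'b) nat_trans \<Rightarrow> bool" where
  "is_nat_trans A B \<alpha> \<longleftrightarrow>
     is_functor A B (src \<alpha>) \<and> is_functor A B (tgt \<alpha>) \<and>
     body \<alpha> \<in> extensional (Obj A) \<and>
     (\<forall>X\<in>Obj A. body \<alpha> X \<in> hom B (FObj (src \<alpha>) X) (FObj (tgt \<alpha>) X)) \<and>
     (\<forall>f\<in>Arr A. Comp B (body \<alpha> (Cod A f)) (FArr (src \<alpha>) f)
               = Comp B (FArr (tgt \<alpha>) f) (body \<alpha> (Dom A f)))"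

definition functor_cat ::
  "('o, 'a, 'm) cat_scheme \<Rightarrow> ('p, 'b, 'n) cat_scheme
     \<Rightarrow> (('o, 'a, 'p, 'b) fctr, ('o, 'a, 'p, 'b) nat_trans) cat" where
  "functor_cat A B =
     \<lparr>Obj = {F. is_functor A B F},
      Arr = {\<alpha>. is_nat_trans A B \<alpha>},
      Dom = src,
      Cod = tgt,
      Ident = (\<lambda>F. Tagged F (\<lambda>X\<in>Obj A. Ident B (FObj F X)) F),
      Comp = (\<lambda>\<beta> \<alpha>. Tagged (src \<alpha>) (\<lambda>X\<in>Obj A. Comp B (body \<beta> X) (body \<alpha> X)) (tgt \<beta>))\<rparr>"

definition equivalence ::
  "('o, 'a, 'm) cat_scheme \<Rightarrow> ('p, 'b, 'n) cat_scheme \<Rightarrow> ('o, 'a, 'p, 'b) fctr \<Rightarrow> bool" where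
  "equivalence A B F \<longleftrightarrow> category A \<and> category B \<and> is_functor A B F \<and>
     (\<exists>G. is_functor B A G \<and>
        isomorphic (functor_cat A A) (id_functor A) (comp_functor A G F) \<and>
        isomorphic (functor_cat B B) (comp_functor B F G) (id_functor B))"


section \<open>Small colimits\<close>

definition is_cocone ::
  "('j, 'k, 'l) cat_scheme \<Rightarrow> ('o, 'a, 'm) cat_scheme \<Rightarrow> ('j, 'k, 'o, 'a) fctr
     \<Rightarrow> 'o \<Rightarrow> ('j \<Rightarrow> 'a) \<Rightarrow> bool" where
  "is_cocone J C T c \<kappa> \<longleftrightarrow> c \<in> Obj C \<and>
     (\<forall>j\<in>Obj J. \<kappa> j \<in> hom C (FObj T j) c) \<and>
     (\<forall>u\<in>Arr J. Comp C (\<kappa> (Cod J u)) (FArr T u) = \<kappa> (Dom J u))"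

definition is_colimit ::
  "('j, 'k, 'l) cat_scheme \<Rightarrow> ('o, 'a, 'm) cat_scheme \<Rightarrow> ('j, 'k, 'o, 'a) fctr
     \<Rightarrow> 'o \<Rightarrow> ('j \<Rightarrow> 'a) \<Rightarrow> bool" where
  "is_colimit J C T c \<kappa> \<longleftrightarrow> is_cocone J C T c \<kappa> \<and>
     (\<forall>d \<mu>. is_cocone J C T d \<mu> \<longrightarrow>
        (\<exists>!h. h \<in> hom C c d \<and> (\<forall>j\<in>Obj J. Comp C h (\<kappa> j) = \<mu> j)))"

text \<open>Small index categories are taken with objects and arrows in \<open>'u\<close>; every small category
  is isomorphic to one of these.\<close>

definition small_category :: "'u itself \<Rightarrow> ('u, 'u) cat \<Rightarrow> bool" where
  "small_category U J \<longleftrightarrow> category J \<and> small U (Obj J) \<and> small U (Arr J)"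

definition has_small_colimits :: "'u itself \<Rightarrow> ('o, 'a, 'm) cat_scheme \<Rightarrow> bool" where
  "has_small_colimits U C \<longleftrightarrow>
     (\<forall>J T. small_category U J \<and> is_functor J C T \<longrightarrow> (\<exists>c \<kappa>. is_colimit J C T c \<kappa>))"

definition preserves_small_colimits ::
  "'u itself \<Rightarrow> ('o, 'a, 'm) cat_scheme \<Rightarrow> ('p, 'b, 'n) cat_scheme
     \<Rightarrow> ('o, 'a, 'p, 'b) fctr \<Rightarrow> bool" where
  "preserves_small_colimits U A B F \<longleftrightarrow>
     (\<forall>J T c \<kappa>. small_category U J \<and> is_functor J A T \<and> is_colimit J A T c \<kappa> \<longrightarrow>
        is_colimit J B (comp_functor J F T) (FObj F c) (\<lambda>j. FArr F (\<kappa> j)))"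


section \<open>M-categories\<close>

record ('o, 'a) mcat = "('o, 'a) cat" +
  Mon :: "'a set"

definition stable_system_of_monics :: "('o, 'a, 'm) cat_scheme \<Rightarrow> 'a set \<Rightarrow> bool" where
  "stable_system_of_monics C M \<longleftrightarrow>
     (\<forall>m\<in>M. monic C m) \<and>
     (\<forall>i. iso C i \<longrightarrow> i \<in> M) \<and>
     (\<forall>m\<in>M. \<forall>n\<in>M. Dom C n = Cod C m \<longrightarrow> Comp C n m \<in> M) \<and>
     (\<forall>m\<in>M. \<forall>f\<in>Arr C. Cod C f = Cod C m \<longrightarrow>
        (\<exists>p q. pullback C p q f m) \<and> (\<forall>p q. pullback C p q f m \<longrightarrow> p \<in> M))"

definition mcategory :: "('o, 'a, 'm) mcat_scheme \<Rightarrow> bool" where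
  "mcategory C \<longleftrightarrow> category C \<and> stable_system_of_monics C (Mon C)"

definition iso_over :: "('o, 'a, 'm) cat_scheme \<Rightarrow> ('a \<times> 'a) set" where
  "iso_over C = {(m, n). m \<in> Arr C \<and> n \<in> Arr C \<and>
     (\<exists>i \<in> hom C (Dom C m) (Dom C n). iso C i \<and> Comp C n i = m)}"

definition locally_small_mcategory :: "'u itself \<Rightarrow> ('o, 'a, 'm) mcat_scheme \<Rightarrow> bool" where
  "locally_small_mcategory U C \<longleftrightarrow> mcategory C \<and>
     (\<forall>X\<in>Obj C. \<forall>Y\<in>Obj C. small U (hom C X Y)) \<and>
     (\<forall>X\<in>Obj C. small U ({m \<in> Mon C. Cod C m = X} // iso_over C))"

definition is_mfunctor ::
  "('o, 'a, 'm) mcat_scheme \<Rightarrow> ('p, 'b, 'n) mcat_scheme \<Rightarrow> ('o, 'a, 'p, 'b) fctr \<Rightarrow> bool" where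
  "is_mfunctor C D F \<longleftrightarrow> is_functor C D F \<and>
     (\<forall>m\<in>Mon C. FArr F m \<in> Mon D) \<and>
     (\<forall>p q f. \<forall>m\<in>Mon C. pullback C p q f m \<longrightarrow>
        pullback D (FArr F p) (FArr F q) (FArr F f) (FArr F m))"

definition mcartesian ::
  "('o, 'a, 'm) mcat_scheme \<Rightarrow> ('p, 'b, 'n) mcat_scheme \<Rightarrow> ('o, 'a, 'p, 'b) nat_trans \<Rightarrow> bool" where
  "mcartesian C D \<alpha> \<longleftrightarrow> is_nat_trans C D \<alpha> \<and>
     (\<forall>m\<in>Mon C. pullback D (FArr (src \<alpha>) m) (body \<alpha> (Dom C m))
                          (body \<alpha> (Cod C m)) (FArr (tgt \<alpha>) m))"

definition MCAT_hom ::
  "('o, 'a, 'm) mcat_scheme \<Rightarrow> ('p, 'b, 'n) mcat_scheme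
     \<Rightarrow> (('o, 'a, 'p, 'b) fctr, ('o, 'a, 'p, 'b) nat_trans) cat" where
  "MCAT_hom C D = (functor_cat C D)
     \<lparr>Obj := {F. is_mfunctor C D F},
      Arr := {\<alpha>. mcartesian C D \<alpha> \<and> is_mfunctor C D (src \<alpha>) \<and> is_mfunctor C D (tgt \<alpha>)}\<rparr>"


section \<open>Partial maps and cocompleteness\<close>

text \<open>The isomorphism class of the span \<open>(m, f)\<close>.\<close>

definition span_class ::
  "('o, 'a, 'm) mcat_scheme \<Rightarrow> 'a \<Rightarrow> 'a \<Rightarrow> ('a \<times> 'a) set" where
  "span_class C m f = {(m', f'). m' \<in> Mon C \<and> f' \<in> Arr C \<and> Dom C m' = Dom C f' \<and>
     (\<exists>i \<in> hom C (Dom C m') (Dom C m). iso C i \<and> Comp C m i = m' \<and> Comp C f i = f')}"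

text \<open>
  Pullbacks being determined up to isomorphism, the spans arising as pullback composites of
  representatives of two classes form exactly one isomorphism class, which is the composite.
\<close>

definition Par :: "('o, 'a, 'm) mcat_scheme \<Rightarrow> ('o, ('o, ('a \<times> 'a) set) tagged) cat" where
  "Par C =
     \<lparr>Obj = Obj C,
      Arr = {Tagged (Cod C m) (span_class C m f) (Cod C f) | m f.
               m \<in> Mon C \<and> f \<in> Arr C \<and> Dom C m = Dom C f},
      Dom = src,
      Cod = tgt,
      Ident = (\<lambda>X. Tagged X (span_class C (Ident C X) (Ident C X)) X),
      Comp = (\<lambda>\<psi> \<phi>. Tagged (src \<phi>)
               {(Comp C m p, Comp C g q) | m f n g p q.
                  (m, f) \<in> body \<phi> \<and> (n, g) \<in> body \<psi> \<and> pullback C p q f n}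
               (tgt \<psi>))\<rparr>"

definition Par_incl ::
  "('o, 'a, 'm) mcat_scheme \<Rightarrow> ('o, 'a, 'o, ('o, ('a \<times> 'a) set) tagged) fctr" where
  "Par_incl C =
     \<lparr>FObj = (\<lambda>X\<in>Obj C. X),
      FArr = (\<lambda>f\<in>Arr C. Tagged (Dom C f) (span_class C (Ident C (Dom C f)) f) (Cod C f))\<rparr>"

definition cocomplete :: "'u itself \<Rightarrow> ('o, 'a, 'm) mcat_scheme \<Rightarrow> bool" where
  "cocomplete U C \<longleftrightarrow> mcategory C \<and> has_small_colimits U C \<and>
     preserves_small_colimits U C (Par C) (Par_incl C)"

definition is_cocont_mfunctor ::
  "'u itself \<Rightarrow> ('o, 'a, 'm) mcat_scheme \<Rightarrow> ('p, 'b, 'n) mcat_scheme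
     \<Rightarrow> ('o, 'a, 'p, 'b) fctr \<Rightarrow> bool" where
  "is_cocont_mfunctor U C D F \<longleftrightarrow> is_mfunctor C D F \<and> preserves_small_colimits U C D F"

definition MCocomp_hom ::
  "'u itself \<Rightarrow> ('o, 'a, 'm) mcat_scheme \<Rightarrow> ('p, 'b, 'n) mcat_scheme
     \<Rightarrow> (('o, 'a, 'p, 'b) fctr, ('o, 'a, 'p, 'b) nat_trans) cat" where
  "MCocomp_hom U C D = (functor_cat C D)
     \<lparr>Obj := {F. is_cocont_mfunctor U C D F},
      Arr := {\<alpha>. mcartesian C D \<alpha> \<and>
                 is_cocont_mfunctor U C D (src \<alpha>) \<and> is_cocont_mfunctor U C D (tgt \<alpha>)}\<rparr>"


section \<open>Small presheaves and the Yoneda embedding\<close>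

definition Set_cat :: "'u itself \<Rightarrow> ('x set, ('x set, 'x \<Rightarrow> 'x) tagged) cat" where
  "Set_cat U =
     \<lparr>Obj = {A. small U A},
      Arr = {Tagged A f B | A f B. small U A \<and> small U B \<and> f \<in> A \<rightarrow>\<^sub>E B},
      Dom = src,
      Cod = tgt,
      Ident = (\<lambda>A. Tagged A (\<lambda>x\<in>A. x) A),
      Comp = (\<lambda>g f. Tagged (src f) (compose (src f) (body g) (body f)) (tgt g))\<rparr>"

text \<open>
  Presheaves on a category with arrow type \<open>'a\<close> take as values small sets of elements of the type
  \<open>'a + 'u\<close>. This type contains a copy of every small set (through \<open>'u\<close>), so these sets and the
  functions between them form a category equivalent to that of all small sets; and it contains the
  hom-sets of the given category without further encoding (through \<open>'a\<close>).
\<close>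

type_synonym ('o, 'a, 'u) presheaf =
  "('o, 'a, ('a + 'u) set, (('a + 'u) set, 'a + 'u \<Rightarrow> 'a + 'u) tagged) fctr"

type_synonym ('o, 'a, 'u) presheaf_map =
  "('o, 'a, ('a + 'u) set, (('a + 'u) set, 'a + 'u \<Rightarrow> 'a + 'u) tagged) nat_trans"

definition presheaf_cat ::
  "'u itself \<Rightarrow> ('o, 'a, 'm) cat_scheme
     \<Rightarrow> (('o, 'a, 'u) presheaf, ('o, 'a, 'u) presheaf_map) cat" where
  "presheaf_cat U C = functor_cat (op_cat C) (Set_cat U)"

definition hom_set :: "('o, 'a, 'm) cat_scheme \<Rightarrow> 'o \<Rightarrow> 'o \<Rightarrow> ('a + 'u) set" where
  "hom_set C X D = Inl ` hom C X D"

definition representable :: "('o, 'a, 'm) cat_scheme \<Rightarrow> 'o \<Rightarrow> ('o, 'a, 'u) presheaf" where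
  "representable C D =
     \<lparr>FObj = (\<lambda>X\<in>Obj C. hom_set C X D),
      FArr = (\<lambda>f\<in>Arr C. Tagged (hom_set C (Cod C f) D)
                               (\<lambda>x\<in>hom_set C (Cod C f) D. Inl (Comp C (projl x) f))
                               (hom_set C (Dom C f) D))\<rparr>"

definition yoneda ::
  "('o, 'a, 'm) cat_scheme
     \<Rightarrow> ('o, 'a, ('o, 'a, 'u) presheaf, ('o, 'a, 'u) presheaf_map) fctr" where
  "yoneda C =
     \<lparr>FObj = (\<lambda>D\<in>Obj C. representable C D),
      FArr = (\<lambda>g\<in>Arr C. Tagged (representable C (Dom C g))
               (\<lambda>X\<in>Obj C. Tagged (hom_set C X (Dom C g))
                                 (\<lambda>x\<in>hom_set C X (Dom C g). Inl (Comp C g (projl x)))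
                                 (hom_set C X (Cod C g)))
               (representable C (Cod C g)))\<rparr>"

text \<open>The colimit of representables is taken in the category of all presheaves.\<close>

definition small_presheaf ::
  "'u itself \<Rightarrow> ('o, 'a, 'm) cat_scheme \<Rightarrow> ('o, 'a, 'u) presheaf \<Rightarrow> bool" where
  "small_presheaf U C P \<longleftrightarrow>
     (\<exists>J K \<kappa>. small_category U J \<and> is_functor J C K \<and>
        is_colimit J (presheaf_cat U C) (comp_functor J (yoneda C) K) P \<kappa>)"

definition small_presheaf_cat ::
  "'u itself \<Rightarrow> ('o, 'a, 'm) cat_scheme
     \<Rightarrow> (('o, 'a, 'u) presheaf, ('o, 'a, 'u) presheaf_map) cat" where
  "small_presheaf_cat U C = (presheaf_cat U C)
     \<lparr>Obj := {P. small_presheaf U C P},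
      Arr := {\<mu> \<in> Arr (presheaf_cat U C). small_presheaf U C (src \<mu>) \<and> small_presheaf U C (tgt \<mu>)}\<rparr>"

definition presheaf_monics ::
  "'u itself \<Rightarrow> ('o, 'a, 'm) mcat_scheme \<Rightarrow> ('o, 'a, 'u) presheaf_map set" where
  "presheaf_monics U C =
     {\<mu> \<in> Arr (small_presheaf_cat U C).
        \<forall>D\<in>Obj C. \<forall>\<gamma> \<in> hom (small_presheaf_cat U C) (representable C D) (tgt \<mu>).
          \<exists>m\<in>Mon C. Cod C m = D \<and>
            (\<exists>q. pullback (small_presheaf_cat U C) (FArr (yoneda C) m) q \<gamma> \<mu>)}"

definition PM ::
  "'u itself \<Rightarrow> ('o, 'a, 'm) mcat_scheme
     \<Rightarrow> (('o, 'a, 'u) presheaf, ('o, 'a, 'u) presheaf_map) mcat" where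
  "PM U C = cat.extend (small_presheaf_cat U C) \<lparr>Mon = presheaf_monics U C\<rparr>"


section \<open>Precomposition\<close>

text \<open>\<open>precomposition C Y \<A>\<close> is \<open>(-) \<circ> Y\<close> on a category \<open>\<A>\<close> of functors and natural
  transformations, where \<open>Y\<close> has domain \<open>C\<close>.\<close>

definition precomposition ::
  "('o, 'a, 'm) cat_scheme \<Rightarrow> ('o, 'a, 'p, 'b) fctr
     \<Rightarrow> (('p, 'b, 'q, 'c) fctr, ('p, 'b, 'q, 'c) nat_trans, 'n) cat_scheme
     \<Rightarrow> (('p, 'b, 'q, 'c) fctr, ('p, 'b, 'q, 'c) nat_trans,
         ('o, 'a, 'q, 'c) fctr, ('o, 'a, 'q, 'c) nat_trans) fctr" where
  "precomposition C Y \<A> =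
     \<lparr>FObj = (\<lambda>F\<in>Obj \<A>. comp_functor C F Y),
      FArr = (\<lambda>\<alpha>\<in>Arr \<A>. Tagged (comp_functor C (src \<alpha>) Y)
                               (\<lambda>X\<in>Obj C. body \<alpha> (FObj Y X))
                               (comp_functor C (tgt \<alpha>) Y))\<rparr>"

end

theory Submission
  imports Defs
begin

text \<open>
  Every small presheaf is a small colimit of representables. So a cocontinuous functor on small
  presheaves is determined by its values on representables, and a functor \<open>F\<close> from \<open>C\<close> to \<open>D\<close> extends to
  small presheaves by sending \<open>P\<close> to the colimit of \<open>F\<close> weighted by \<open>P\<close> (\<open>wcolim\<close>), which is the value at
  \<open>P\<close> of the left Kan extension of \<open>F\<close> along the Yoneda embedding. This is the classical part of the
  theorem. The new part is that the extension of an M-functor is an M-functor, and that the extension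
  of an M-cartesian transformation is M-cartesian. It rests on a reformulation of the hypothesis on
  \<open>D\<close> and one of the monics between presheaves.

  As \<open>D\<close> is cocomplete, its colimits are colimits in the category of partial maps. Hence
  partial maps out of a colimit are the compatible families of partial maps out of the diagram
  (\<open>par_glue\<close>, \<open>par_unique\<close>). In particular a cartesian family of monics over a diagram glues to a
  monic into the colimit, whose domain is the colimit of the domains (\<open>mon_glue\<close>); and a square with
  such a monic on one side is a pullback as soon as it is one over each object of the diagram
  (\<open>pullback_over_colimit\<close>).

  By the Yoneda lemma, \<open>\<mu>\<close> from \<open>P\<close> to \<open>Q\<close> belongs to the monics between presheaves when, for each
  element \<open>x\<close> of \<open>Q\<close>, the maps along which \<open>x\<close> restricts to an element of \<open>P\<close> are those that factor
  through one monic \<open>m\<close> of \<open>C\<close> (\<open>classifies\<close>). If \<open>Q\<close> is the colimit of representables at \<open>K j\<close>, the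
  monics that belong to the coprojections form a cartesian family over \<open>K\<close>. The M-functor \<open>F\<close> carries
  it to a cartesian family over \<open>F K\<close>, whose colimit is the value of the extension at \<open>Q\<close>, and the
  domain of the glued monic has the universal property of the value at \<open>P\<close> (\<open>wcolim_monic\<close>). So the
  extension preserves these monics. That it preserves their pullbacks (\<open>extends_mfunctor\<close>), and
  that extended transformations are cartesian (\<open>extends_cartesian\<close>), can now be checked over each
  \<open>F (K j)\<close>, where it is the corresponding property on \<open>C\<close>.

  For cocontinuity of the extension one wants to map into the presheaf \<open>D(F -, d)\<close>, which need not be
  small. This is possible because small colimits of small presheaves are colimits among all presheaves
  (\<open>colimit_PM_Psh\<close>). The reason is that a presheaf is small when it is determined by its restriction to
  a small set of objects, a property that passes to small colimits (\<open>small_presheaf_colimit\<close>).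

  Finally, the value of the extension of \<open>F\<close> at the representable of \<open>X\<close> can be chosen to be \<open>F X\<close>.
  So the functor of the theorem is surjective on objects, and it remains to see that it is full and
  faithful (\<open>restr_fully_faithful\<close>).
\<close>

section \<open>Small sets\<close>

lemma small_ordLeq: "small U B \<Longrightarrow> |A| \<le>o |B| \<Longrightarrow> small U A"
  unfolding small_def using ordLeq_ordLess_trans by blast

lemma small_subset: "small U B \<Longrightarrow> A \<subseteq> B \<Longrightarrow> small U A"
  using small_ordLeq card_of_mono1 by blast

lemma small_image: "small U A \<Longrightarrow> small U (f ` A)"
  using small_ordLeq card_of_image by blast

lemma small_embedding:
  fixes U :: "'u itself"
  assumes "small U A"
  obtains e :: "'a \<Rightarrow> 'u" where "inj_on e A"
proof -
  have "|A| \<le>o |UNIV :: 'u set|"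
    using assms ordLess_imp_ordLeq unfolding small_def by blast
  then show ?thesis
    using that by (auto simp flip: card_of_ordLeq)
qed

lemma
  fixes U :: "'u itself"
  assumes "inaccessible U"
  shows small_UNION: "small U I \<Longrightarrow> (\<And>i. i \<in> I \<Longrightarrow> small U (A i)) \<Longrightarrow> small U (\<Union>i\<in>I. A i)"
    and small_Sigma: "small U I \<Longrightarrow> (\<And>i. i \<in> I \<Longrightarrow> small U (B i)) \<Longrightarrow> small U (Sigma I B)"
    and small_finite: "finite F \<Longrightarrow> small U F"
proof -
  have "natLeq \<le>o |UNIV :: 'u set|"
    using assms ordLess_imp_ordLeq unfolding inaccessible_def by blast
  then have infinite: "infinite (UNIV :: 'u set)"
    using infinite_iff_natLeq_ordLeq by blast
  then have stable: "stable |UNIV :: 'u set|"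
    using assms by (intro regularCard_stable)
      (simp_all add: inaccessible_def card_of_card_order_on Field_card_of)
  show "small U I \<Longrightarrow> (\<And>i. i \<in> I \<Longrightarrow> small U (A i)) \<Longrightarrow> small U (\<Union>i\<in>I. A i)"
    using stable_UNION[OF stable] unfolding small_def by blast
  show "small U I \<Longrightarrow> (\<And>i. i \<in> I \<Longrightarrow> small U (B i)) \<Longrightarrow> small U (Sigma I B)"
    using stable_elim[OF stable] unfolding small_def by blast
  show "finite F \<Longrightarrow> small U F"
    using infinite unfolding small_def
    by (auto intro!: finite_ordLess_infinite simp: card_of_well_order_on Field_card_of)
qed


section \<open>Categories and pullbacks\<close>

abbreviation comp_in :: "'a \<Rightarrow> ('o, 'a, 'm) cat_scheme \<Rightarrow> 'a \<Rightarrow> 'a"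
    ("(_ \<circ>\<^bsub>_\<^esub> _)" [56, 0, 55] 55) where
  "g \<circ>\<^bsub>C\<^esub> f \<equiv> Comp C g f"

lemma hom_iff: "f \<in> hom C X Y \<longleftrightarrow> f \<in> Arr C \<and> Dom C f = X \<and> Cod C f = Y"
  by (auto simp: hom_def)

lemma hom_arr: "f \<in> hom C X Y \<Longrightarrow> f \<in> Arr C"
  and hom_dom: "f \<in> hom C X Y \<Longrightarrow> Dom C f = X"
  and hom_cod: "f \<in> hom C X Y \<Longrightarrow> Cod C f = Y"
  by (auto simp: hom_def)

lemma arr_hom: "f \<in> Arr C \<Longrightarrow> f \<in> hom C (Dom C f) (Cod C f)"
  by (auto simp: hom_def)

lemma categoryI:
  assumes "\<And>f. f \<in> Arr C \<Longrightarrow> Dom C f \<in> Obj C \<and> Cod C f \<in> Obj C"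
    and "\<And>X. X \<in> Obj C \<Longrightarrow> Ident C X \<in> hom C X X"
    and "\<And>X Y Z f g. f \<in> hom C X Y \<Longrightarrow> g \<in> hom C Y Z \<Longrightarrow> g \<circ>\<^bsub>C\<^esub> f \<in> hom C X Z"
    and "\<And>X Y f. f \<in> hom C X Y \<Longrightarrow> f \<circ>\<^bsub>C\<^esub> Ident C X = f \<and> Ident C Y \<circ>\<^bsub>C\<^esub> f = f"
    and "\<And>W X Y Z f g h. f \<in> hom C W X \<Longrightarrow> g \<in> hom C X Y \<Longrightarrow> h \<in> hom C Y Z \<Longrightarrow>
           h \<circ>\<^bsub>C\<^esub> (g \<circ>\<^bsub>C\<^esub> f) = (h \<circ>\<^bsub>C\<^esub> g) \<circ>\<^bsub>C\<^esub> f"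
  shows "category C"
  unfolding category_def using assms by (simp add: hom_iff)

locale Category =
  fixes C :: "('o, 'a, 'm) cat_scheme"
  assumes category: "category C"
begin

lemma dom_obj: "f \<in> hom C X Y \<Longrightarrow> X \<in> Obj C"
  and cod_obj: "f \<in> hom C X Y \<Longrightarrow> Y \<in> Obj C"
  using category unfolding category_def hom_def by blast+

lemma id_hom: "X \<in> Obj C \<Longrightarrow> Ident C X \<in> hom C X X"
  using category unfolding category_def by blast

lemma comp_hom: "f \<in> hom C X Y \<Longrightarrow> g \<in> hom C Y Z \<Longrightarrow> g \<circ>\<^bsub>C\<^esub> f \<in> hom C X Z"
  using category unfolding category_def hom_def by fastforce

lemma comp_arr: "f \<in> Arr C \<Longrightarrow> g \<in> Arr C \<Longrightarrow> Dom C g = Cod C f \<Longrightarrow> g \<circ>\<^bsub>C\<^esub> f \<in> Arr C"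
  using category unfolding category_def hom_def by fastforce

lemma comp_id_right: "f \<in> hom C X Y \<Longrightarrow> f \<circ>\<^bsub>C\<^esub> Ident C X = f"
  and comp_id_left: "f \<in> hom C X Y \<Longrightarrow> Ident C Y \<circ>\<^bsub>C\<^esub> f = f"
  using category unfolding category_def hom_def by auto

lemma comp_assoc:
  assumes "f \<in> hom C W X" "g \<in> hom C X Y" "h \<in> hom C Y Z"
  shows "h \<circ>\<^bsub>C\<^esub> (g \<circ>\<^bsub>C\<^esub> f) = (h \<circ>\<^bsub>C\<^esub> g) \<circ>\<^bsub>C\<^esub> f"
  using category assms unfolding category_def by (simp add: hom_iff)

lemma monicD:
  assumes "monic C m" "m \<in> hom C Y Z" "f \<in> hom C X Y" "g \<in> hom C X Y"
    "m \<circ>\<^bsub>C\<^esub> f = m \<circ>\<^bsub>C\<^esub> g"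
  shows "f = g"
  using assms unfolding monic_def by (simp add: hom_iff)

lemma isoI:
  assumes "f \<in> hom C X Y" "g \<in> hom C Y X" "g \<circ>\<^bsub>C\<^esub> f = Ident C X" "f \<circ>\<^bsub>C\<^esub> g = Ident C Y"
  shows "iso C f"
  using assms unfolding iso_def hom_def by auto

lemma isoE:
  assumes "iso C f" "f \<in> hom C X Y"
  obtains g where "g \<in> hom C Y X" "g \<circ>\<^bsub>C\<^esub> f = Ident C X" "f \<circ>\<^bsub>C\<^esub> g = Ident C Y" "iso C g"
proof -
  obtain g where g: "g \<in> hom C Y X" "g \<circ>\<^bsub>C\<^esub> f = Ident C X" "f \<circ>\<^bsub>C\<^esub> g = Ident C Y"
    using assms unfolding iso_def hom_def by auto
  with that isoI[OF g(1) assms(2)] show thesis by blast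
qed

lemma id_iso: "X \<in> Obj C \<Longrightarrow> iso C (Ident C X)"
  using isoI id_hom comp_id_left by meson

lemma pullbackD:
  assumes "pullback C p q f g"
  shows "p \<in> hom C (Dom C p) (Dom C f)" "q \<in> hom C (Dom C p) (Dom C g)"
    "f \<in> hom C (Dom C f) (Cod C f)" "g \<in> hom C (Dom C g) (Cod C f)"
    "f \<circ>\<^bsub>C\<^esub> p = g \<circ>\<^bsub>C\<^esub> q"
  using assms unfolding pullback_def hom_def by auto

lemma pullbackE:
  assumes "pullback C p q f g"
  obtains W A B X where "p \<in> hom C W A" "q \<in> hom C W B" "f \<in> hom C A X" "g \<in> hom C B X"
    "f \<circ>\<^bsub>C\<^esub> p = g \<circ>\<^bsub>C\<^esub> q"
  by (rule that[OF pullbackD[OF assms]])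

lemma pullback_universal:
  assumes "pullback C p q f g" "p \<in> hom C W A" "q \<in> hom C W B"
    "a \<in> hom C V A" "b \<in> hom C V B" "f \<circ>\<^bsub>C\<^esub> a = g \<circ>\<^bsub>C\<^esub> b"
  shows "\<exists>!h. h \<in> hom C V W \<and> p \<circ>\<^bsub>C\<^esub> h = a \<and> q \<circ>\<^bsub>C\<^esub> h = b"
proof -
  have *: "\<forall>a\<in>Arr C. \<forall>b\<in>Arr C.
        Dom C a = Dom C b \<longrightarrow> Cod C a = Dom C f \<longrightarrow> Cod C b = Dom C g \<longrightarrow>
        f \<circ>\<^bsub>C\<^esub> a = g \<circ>\<^bsub>C\<^esub> b \<longrightarrow>
        (\<exists>!h. h \<in> hom C (Dom C a) (Dom C p) \<and> p \<circ>\<^bsub>C\<^esub> h = a \<and> q \<circ>\<^bsub>C\<^esub> h = b)"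
    using assms(1) unfolding pullback_def by (elim conjE)
  have eqs: "Dom C a = V" "Dom C b = V" "Cod C a = Dom C f" "Cod C b = Dom C g" "Dom C p = W"
    using assms(2-5) pullbackD(1,2)[OF assms(1)] unfolding hom_def by auto
  show ?thesis
    using *[rule_format, of a b] eqs assms(6) hom_arr[OF assms(4)] hom_arr[OF assms(5)] by simp
qed

lemma pullback_lift:
  assumes "pullback C p q f g" "p \<in> hom C W A" "q \<in> hom C W B"
    "a \<in> hom C V A" "b \<in> hom C V B" "f \<circ>\<^bsub>C\<^esub> a = g \<circ>\<^bsub>C\<^esub> b"
  obtains h where "h \<in> hom C V W" "p \<circ>\<^bsub>C\<^esub> h = a" "q \<circ>\<^bsub>C\<^esub> h = b"
  using ex1_implies_ex[OF pullback_universal[OF assms]] by (elim exE conjE)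

lemma pullback_unique:
  assumes "pullback C p q f g" "p \<in> hom C W A" "q \<in> hom C W B"
    "h \<in> hom C V W" "k \<in> hom C V W" "p \<circ>\<^bsub>C\<^esub> h = p \<circ>\<^bsub>C\<^esub> k" "q \<circ>\<^bsub>C\<^esub> h = q \<circ>\<^bsub>C\<^esub> k"
  shows "h = k"
proof -
  note pb = pullbackD[OF assms(1)]
  have eqs: "Dom C p = W" "A = Dom C f" "B = Dom C g"
    using assms(2,3) pb(1,2) unfolding hom_def by auto
  have "f \<circ>\<^bsub>C\<^esub> (p \<circ>\<^bsub>C\<^esub> h) = g \<circ>\<^bsub>C\<^esub> (q \<circ>\<^bsub>C\<^esub> h)"
    using comp_assoc[OF assms(4), of p "Dom C f" f] comp_assoc[OF assms(4), of q "Dom C g" g] pb eqs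
    by simp
  then have "\<exists>!l. l \<in> hom C V W \<and> p \<circ>\<^bsub>C\<^esub> l = p \<circ>\<^bsub>C\<^esub> h \<and> q \<circ>\<^bsub>C\<^esub> l = q \<circ>\<^bsub>C\<^esub> h"
    using pullback_universal[OF assms(1-3)] comp_hom[OF assms(4,2)] comp_hom[OF assms(4,3)] by simp
  then show ?thesis
    using assms(4-7) by (elim ex1E) metis
qed

lemma pullbackI:
  assumes "p \<in> hom C W A" "q \<in> hom C W B" "f \<in> hom C A X" "g \<in> hom C B X"
    "f \<circ>\<^bsub>C\<^esub> p = g \<circ>\<^bsub>C\<^esub> q"
    and "\<And>V a b. a \<in> hom C V A \<Longrightarrow> b \<in> hom C V B \<Longrightarrow> f \<circ>\<^bsub>C\<^esub> a = g \<circ>\<^bsub>C\<^esub> b \<Longrightarrow>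
      \<exists>!h. h \<in> hom C V W \<and> p \<circ>\<^bsub>C\<^esub> h = a \<and> q \<circ>\<^bsub>C\<^esub> h = b"
  shows "pullback C p q f g"
  unfolding pullback_def
proof (intro conjI ballI impI)
  fix a b
  assume ab: "a \<in> Arr C" "b \<in> Arr C" "Dom C a = Dom C b" "Cod C a = Dom C f"
    "Cod C b = Dom C g" "f \<circ>\<^bsub>C\<^esub> a = g \<circ>\<^bsub>C\<^esub> b"
  then have "a \<in> hom C (Dom C a) A" "b \<in> hom C (Dom C a) B"
    using assms(3,4) by (auto simp: hom_iff)
  from assms(6)[OF this ab(6)] assms(1)
  show "\<exists>!h. h \<in> hom C (Dom C a) (Dom C p) \<and> p \<circ>\<^bsub>C\<^esub> h = a \<and> q \<circ>\<^bsub>C\<^esub> h = b"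
    by (simp add: hom_dom)
qed (use assms in \<open>auto simp: hom_iff\<close>)

text \<open>Between monics only the existence of lifts needs proof: cancelling \<open>m\<close> gives the second
  triangle, cancelling \<open>p\<close> gives uniqueness.\<close>

lemma pullback_monicI:
  assumes "p \<in> hom C W A" "q \<in> hom C W B" "f \<in> hom C A X" "m \<in> hom C B X"
    "f \<circ>\<^bsub>C\<^esub> p = m \<circ>\<^bsub>C\<^esub> q" "monic C p" "monic C m"
    and lift: "\<And>V a b. a \<in> hom C V A \<Longrightarrow> b \<in> hom C V B \<Longrightarrow> f \<circ>\<^bsub>C\<^esub> a = m \<circ>\<^bsub>C\<^esub> b \<Longrightarrow>
      \<exists>h \<in> hom C V W. p \<circ>\<^bsub>C\<^esub> h = a"
  shows "pullback C p q f m"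
proof (rule pullbackI[OF assms(1-5)])
  fix V a b assume ab: "a \<in> hom C V A" "b \<in> hom C V B" "f \<circ>\<^bsub>C\<^esub> a = m \<circ>\<^bsub>C\<^esub> b"
  obtain h where h: "h \<in> hom C V W" "p \<circ>\<^bsub>C\<^esub> h = a"
    using lift[OF ab] by blast
  have "m \<circ>\<^bsub>C\<^esub> (q \<circ>\<^bsub>C\<^esub> h) = m \<circ>\<^bsub>C\<^esub> b"
    using comp_assoc[OF h(1) assms(2,4)] comp_assoc[OF h(1) assms(1,3)] assms(5) h(2) ab(3) by simp
  then have "q \<circ>\<^bsub>C\<^esub> h = b"
    using monicD[OF assms(7,4) _ ab(2)] comp_hom[OF h(1) assms(2)] by blast
  with h monicD[OF assms(6,1)]
  show "\<exists>!h. h \<in> hom C V W \<and> p \<circ>\<^bsub>C\<^esub> h = a \<and> q \<circ>\<^bsub>C\<^esub> h = b" by metis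
qed

lemma pullback_paste:
  assumes "pullback C p q f m" "pullback C p' q' f' p"
  shows "pullback C p' (q \<circ>\<^bsub>C\<^esub> q') (f \<circ>\<^bsub>C\<^esub> f') m"
proof -
  obtain W A B X where 1: "p \<in> hom C W A" "q \<in> hom C W B" "f \<in> hom C A X" "m \<in> hom C B X"
    "f \<circ>\<^bsub>C\<^esub> p = m \<circ>\<^bsub>C\<^esub> q"
    using pullbackE[OF assms(1)] .
  obtain W' A' where 2: "p' \<in> hom C W' A'" "q' \<in> hom C W' W" "f' \<in> hom C A' A"
    "f' \<circ>\<^bsub>C\<^esub> p' = p \<circ>\<^bsub>C\<^esub> q'"
    using pullbackE[OF assms(2)] 1(1) by (metis hom_cod hom_dom)
  show ?thesis
  proof (rule pullbackI)
    show "p' \<in> hom C W' A'" "q \<circ>\<^bsub>C\<^esub> q' \<in> hom C W' B" "f \<circ>\<^bsub>C\<^esub> f' \<in> hom C A' X"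
      "m \<in> hom C B X"
      using 1 2 comp_hom by blast+
    show "(f \<circ>\<^bsub>C\<^esub> f') \<circ>\<^bsub>C\<^esub> p' = m \<circ>\<^bsub>C\<^esub> (q \<circ>\<^bsub>C\<^esub> q')"
      using comp_assoc[OF 2(1,3) 1(3)] comp_assoc[OF 2(2) 1(1,3)] comp_assoc[OF 2(2) 1(2,4)]
        1(5) 2(4) by simp
    fix V a b assume ab: "a \<in> hom C V A'" "b \<in> hom C V B"
      and eq: "(f \<circ>\<^bsub>C\<^esub> f') \<circ>\<^bsub>C\<^esub> a = m \<circ>\<^bsub>C\<^esub> b"
    have fa: "f' \<circ>\<^bsub>C\<^esub> a \<in> hom C V A" using ab 2 comp_hom by blast
    moreover have "f \<circ>\<^bsub>C\<^esub> (f' \<circ>\<^bsub>C\<^esub> a) = m \<circ>\<^bsub>C\<^esub> b"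
      using eq comp_assoc[OF ab(1) 2(3) 1(3)] by simp
    ultimately obtain h where h: "h \<in> hom C V W" "p \<circ>\<^bsub>C\<^esub> h = f' \<circ>\<^bsub>C\<^esub> a" "q \<circ>\<^bsub>C\<^esub> h = b"
      using pullback_lift[OF assms(1) 1(1,2) _ ab(2)] by metis
    obtain k where k: "k \<in> hom C V W'" "p' \<circ>\<^bsub>C\<^esub> k = a" "q' \<circ>\<^bsub>C\<^esub> k = h"
      using pullback_lift[OF assms(2) 2(1,2) ab(1) h(1)] h(2) by metis
    show "\<exists>!h. h \<in> hom C V W' \<and> p' \<circ>\<^bsub>C\<^esub> h = a \<and> (q \<circ>\<^bsub>C\<^esub> q') \<circ>\<^bsub>C\<^esub> h = b"
    proof (rule ex1I[of _ k])
      show "k \<in> hom C V W' \<and> p' \<circ>\<^bsub>C\<^esub> k = a \<and> (q \<circ>\<^bsub>C\<^esub> q') \<circ>\<^bsub>C\<^esub> k = b"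
        using k h comp_assoc[OF k(1) 2(2) 1(2)] by simp
      fix l assume l: "l \<in> hom C V W' \<and> p' \<circ>\<^bsub>C\<^esub> l = a \<and> (q \<circ>\<^bsub>C\<^esub> q') \<circ>\<^bsub>C\<^esub> l = b"
      then have lh: "l \<in> hom C V W'" by blast
      have "p \<circ>\<^bsub>C\<^esub> (q' \<circ>\<^bsub>C\<^esub> l) = p \<circ>\<^bsub>C\<^esub> h"
        using comp_assoc[OF lh 2(2) 1(1)] comp_assoc[OF lh 2(1,3)] 2(4) l h(2) by simp
      moreover have "q \<circ>\<^bsub>C\<^esub> (q' \<circ>\<^bsub>C\<^esub> l) = q \<circ>\<^bsub>C\<^esub> h"
        using comp_assoc[OF lh 2(2) 1(2)] l h(3) by simp
      ultimately have "q' \<circ>\<^bsub>C\<^esub> l = h"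
        using pullback_unique[OF assms(1) 1(1,2) comp_hom[OF lh 2(2)] h(1)] by blast
      then show "l = k"
        using pullback_unique[OF assms(2) 2(1,2) lh k(1)] l k by simp
    qed
  qed
qed

lemma pullback_cancel:
  assumes "pullback C p q f m" "pullback C p' r (f \<circ>\<^bsub>C\<^esub> f') m"
    and "f' \<in> hom C A' (Dom C f)" "q' \<in> hom C (Dom C p') (Dom C p)"
    and "f' \<circ>\<^bsub>C\<^esub> p' = p \<circ>\<^bsub>C\<^esub> q'" "q \<circ>\<^bsub>C\<^esub> q' = r"
  shows "pullback C p' q' f' p"
proof -
  obtain W A B X where 1: "p \<in> hom C W A" "q \<in> hom C W B" "f \<in> hom C A X" "m \<in> hom C B X"
    "f \<circ>\<^bsub>C\<^esub> p = m \<circ>\<^bsub>C\<^esub> q"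
    using pullbackE[OF assms(1)] .
  have f': "f' \<in> hom C A' A" using assms(3) 1(3) hom_dom by metis
  obtain W' where 2: "p' \<in> hom C W' A'" "r \<in> hom C W' B"
    using pullbackE[OF assms(2)] comp_hom[OF f' 1(3)] 1(4) by (metis hom_dom)
  have q': "q' \<in> hom C W' W" using assms(4) 1(1) 2(1) hom_dom by metis
  show ?thesis
  proof (rule pullbackI[OF 2(1) q' f' 1(1) assms(5)])
    fix V a b assume ab: "a \<in> hom C V A'" "b \<in> hom C V W" and eq: "f' \<circ>\<^bsub>C\<^esub> a = p \<circ>\<^bsub>C\<^esub> b"
    have "(f \<circ>\<^bsub>C\<^esub> f') \<circ>\<^bsub>C\<^esub> a = m \<circ>\<^bsub>C\<^esub> (q \<circ>\<^bsub>C\<^esub> b)"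
      using comp_assoc[OF ab(1) f' 1(3)] comp_assoc[OF ab(2) 1(2,4)] comp_assoc[OF ab(2) 1(1,3)]
        eq 1(5) by simp
    then obtain h where h: "h \<in> hom C V W'" "p' \<circ>\<^bsub>C\<^esub> h = a" "r \<circ>\<^bsub>C\<^esub> h = q \<circ>\<^bsub>C\<^esub> b"
      using pullback_lift[OF assms(2) 2 ab(1) comp_hom[OF ab(2) 1(2)]] by metis
    have key: "q' \<circ>\<^bsub>C\<^esub> h = b"
    proof (rule pullback_unique[OF assms(1) 1(1,2) comp_hom[OF h(1) q'] ab(2)])
      show "p \<circ>\<^bsub>C\<^esub> (q' \<circ>\<^bsub>C\<^esub> h) = p \<circ>\<^bsub>C\<^esub> b"
        using comp_assoc[OF h(1) q' 1(1)] comp_assoc[OF h(1) 2(1) f'] assms(5) h(2) eq by simp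
      show "q \<circ>\<^bsub>C\<^esub> (q' \<circ>\<^bsub>C\<^esub> h) = q \<circ>\<^bsub>C\<^esub> b"
        using comp_assoc[OF h(1) q' 1(2)] assms(6) h(3) by simp
    qed
    show "\<exists>!h. h \<in> hom C V W' \<and> p' \<circ>\<^bsub>C\<^esub> h = a \<and> q' \<circ>\<^bsub>C\<^esub> h = b"
    proof (rule ex1I[of _ h])
      show "h \<in> hom C V W' \<and> p' \<circ>\<^bsub>C\<^esub> h = a \<and> q' \<circ>\<^bsub>C\<^esub> h = b" using h key by blast
      fix l assume l: "l \<in> hom C V W' \<and> p' \<circ>\<^bsub>C\<^esub> l = a \<and> q' \<circ>\<^bsub>C\<^esub> l = b"
      then have "r \<circ>\<^bsub>C\<^esub> l = r \<circ>\<^bsub>C\<^esub> h"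
        using comp_assoc[OF conjunct1[OF l] q' 1(2)] assms(6) h(3) by simp
      then show "l = h"
        using pullback_unique[OF assms(2) 2 conjunct1[OF l] h(1)] l h(2) by simp
    qed
  qed
qed

lemma pullback_cancelE:
  assumes "pullback C p q f m" "pullback C p' r (f \<circ>\<^bsub>C\<^esub> f') m" "f' \<in> hom C A' (Dom C f)"
  obtains q' where "pullback C p' q' f' p" "q \<circ>\<^bsub>C\<^esub> q' = r"
proof -
  note 1 = pullbackD[OF assms(1)] and 2 = pullbackD[OF assms(2)]
  have ff': "f \<circ>\<^bsub>C\<^esub> f' \<in> hom C A' (Cod C f)"
    using comp_hom[OF assms(3) 1(3)] .
  then have p': "p' \<in> hom C (Dom C p') A'"
    using 2(1) hom_dom by metis
  have "f \<circ>\<^bsub>C\<^esub> (f' \<circ>\<^bsub>C\<^esub> p') = m \<circ>\<^bsub>C\<^esub> r"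
    using comp_assoc[OF p' assms(3) 1(3)] 2(5) by simp
  then obtain q' where "q' \<in> hom C (Dom C p') (Dom C p)" "p \<circ>\<^bsub>C\<^esub> q' = f' \<circ>\<^bsub>C\<^esub> p'"
    "q \<circ>\<^bsub>C\<^esub> q' = r"
    using pullback_lift[OF assms(1) 1(1,2) comp_hom[OF p' assms(3)] 2(2)] by metis
  with that pullback_cancel[OF assms] show thesis by metis
qed

lemma pullback_iso_unique:
  assumes "pullback C p q f m" "pullback C p' q' f m"
  obtains i where "i \<in> hom C (Dom C p') (Dom C p)" "iso C i" "p \<circ>\<^bsub>C\<^esub> i = p'" "q \<circ>\<^bsub>C\<^esub> i = q'"
proof -
  note 1 = pullbackD[OF assms(1)] and 2 = pullbackD[OF assms(2)]
  obtain i where i: "i \<in> hom C (Dom C p') (Dom C p)" "p \<circ>\<^bsub>C\<^esub> i = p'" "q \<circ>\<^bsub>C\<^esub> i = q'"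
    using pullback_lift[OF assms(1) 1(1,2) 2(1,2,5)] .
  obtain j where j: "j \<in> hom C (Dom C p) (Dom C p')" "p' \<circ>\<^bsub>C\<^esub> j = p" "q' \<circ>\<^bsub>C\<^esub> j = q"
    using pullback_lift[OF assms(2) 2(1,2) 1(1,2,5)] .
  have "i \<circ>\<^bsub>C\<^esub> j = Ident C (Dom C p)"
  proof (rule pullback_unique[OF assms(1) 1(1,2) comp_hom[OF j(1) i(1)]])
    show "Ident C (Dom C p) \<in> hom C (Dom C p) (Dom C p)" using id_hom dom_obj 1(1) by blast
  qed (use comp_assoc[OF j(1) i(1) 1(1)] comp_assoc[OF j(1) i(1) 1(2)] i j
      comp_id_right[OF 1(1)] comp_id_right[OF 1(2)] in simp_all)
  moreover have "j \<circ>\<^bsub>C\<^esub> i = Ident C (Dom C p')"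
  proof (rule pullback_unique[OF assms(2) 2(1,2) comp_hom[OF i(1) j(1)]])
    show "Ident C (Dom C p') \<in> hom C (Dom C p') (Dom C p')" using id_hom dom_obj 2(1) by blast
  qed (use comp_assoc[OF i(1) j(1) 2(1)] comp_assoc[OF i(1) j(1) 2(2)] i j
      comp_id_right[OF 2(1)] comp_id_right[OF 2(2)] in simp_all)
  ultimately show thesis using that i isoI[OF i(1) j(1)] by blast
qed

lemma pullback_of_isos:
  assumes "p \<in> hom C W A" "q \<in> hom C W B" "f \<in> hom C A X" "g \<in> hom C B X"
    "f \<circ>\<^bsub>C\<^esub> p = g \<circ>\<^bsub>C\<^esub> q" "iso C q" "iso C f"
  shows "pullback C p q f g"
proof (rule pullbackI[OF assms(1-5)])
  obtain q' where q': "q' \<in> hom C B W" "q' \<circ>\<^bsub>C\<^esub> q = Ident C W" "q \<circ>\<^bsub>C\<^esub> q' = Ident C B"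
    using isoE[OF assms(6,2)] by metis
  obtain f' where f': "f' \<in> hom C X A" "f' \<circ>\<^bsub>C\<^esub> f = Ident C A"
    using isoE[OF assms(7,3)] by metis
  fix V a b assume ab: "a \<in> hom C V A" "b \<in> hom C V B" and eq: "f \<circ>\<^bsub>C\<^esub> a = g \<circ>\<^bsub>C\<^esub> b"
  let ?h = "q' \<circ>\<^bsub>C\<^esub> b"
  have h: "?h \<in> hom C V W" using comp_hom ab q' by blast
  have qh: "q \<circ>\<^bsub>C\<^esub> ?h = b"
    using comp_assoc[OF ab(2) q'(1) assms(2)] q'(3) comp_id_left[OF ab(2)] by simp
  have "f \<circ>\<^bsub>C\<^esub> (p \<circ>\<^bsub>C\<^esub> ?h) = f \<circ>\<^bsub>C\<^esub> a"
    using comp_assoc[OF h assms(1,3)] comp_assoc[OF h assms(2,4)] assms(5) qh eq by simp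
  then have "f' \<circ>\<^bsub>C\<^esub> (f \<circ>\<^bsub>C\<^esub> (p \<circ>\<^bsub>C\<^esub> ?h)) = f' \<circ>\<^bsub>C\<^esub> (f \<circ>\<^bsub>C\<^esub> a)" by simp
  then have ph: "p \<circ>\<^bsub>C\<^esub> ?h = a"
    using comp_assoc[OF comp_hom[OF h assms(1)] assms(3) f'(1)] comp_assoc[OF ab(1) assms(3) f'(1)]
      f'(2) comp_id_left[OF ab(1)] comp_id_left[OF comp_hom[OF h assms(1)]] by simp
  show "\<exists>!h. h \<in> hom C V W \<and> p \<circ>\<^bsub>C\<^esub> h = a \<and> q \<circ>\<^bsub>C\<^esub> h = b"
  proof (rule ex1I[of _ ?h])
    fix l assume l: "l \<in> hom C V W \<and> p \<circ>\<^bsub>C\<^esub> l = a \<and> q \<circ>\<^bsub>C\<^esub> l = b"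
    then have "q' \<circ>\<^bsub>C\<^esub> (q \<circ>\<^bsub>C\<^esub> l) = l"
      using comp_assoc[OF _ assms(2) q'(1)] q'(2) comp_id_left by metis
    with l show "l = ?h" by simp
  qed (use h ph qh in blast)
qed

lemma pullback_isos_transfer:
  assumes "pullback C p q f m" "i \<in> hom C W (Dom C p)" "iso C i"
  shows "pullback C (p \<circ>\<^bsub>C\<^esub> i) (q \<circ>\<^bsub>C\<^esub> i) f m"
proof -
  note pb = pullbackD[OF assms(1)]
  obtain j where j: "j \<in> hom C (Dom C p) W" "j \<circ>\<^bsub>C\<^esub> i = Ident C W"
    "i \<circ>\<^bsub>C\<^esub> j = Ident C (Dom C p)"
    using isoE[OF assms(3,2)] by metis
  have pi: "p \<circ>\<^bsub>C\<^esub> i \<in> hom C W (Dom C f)" and qi: "q \<circ>\<^bsub>C\<^esub> i \<in> hom C W (Dom C m)"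
    using comp_hom[OF assms(2)] pb(1,2) by blast+
  show ?thesis
  proof (rule pullbackI[OF pi qi pb(3,4)])
    show "f \<circ>\<^bsub>C\<^esub> (p \<circ>\<^bsub>C\<^esub> i) = m \<circ>\<^bsub>C\<^esub> (q \<circ>\<^bsub>C\<^esub> i)"
      using comp_assoc[OF assms(2)] pb by metis
    fix V a b assume ab: "a \<in> hom C V (Dom C f)" "b \<in> hom C V (Dom C m)" "f \<circ>\<^bsub>C\<^esub> a = m \<circ>\<^bsub>C\<^esub> b"
    obtain h where h: "h \<in> hom C V (Dom C p)" "p \<circ>\<^bsub>C\<^esub> h = a" "q \<circ>\<^bsub>C\<^esub> h = b"
      using pullback_lift[OF assms(1) pb(1,2) ab] .
    let ?k = "j \<circ>\<^bsub>C\<^esub> h"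
    have k: "?k \<in> hom C V W" using comp_hom h j by blast
    have ik: "i \<circ>\<^bsub>C\<^esub> ?k = h"
      using comp_assoc[OF h(1) j(1) assms(2)] j(3) comp_id_left[OF h(1)] by simp
    show "\<exists>!h. h \<in> hom C V W \<and> (p \<circ>\<^bsub>C\<^esub> i) \<circ>\<^bsub>C\<^esub> h = a \<and> (q \<circ>\<^bsub>C\<^esub> i) \<circ>\<^bsub>C\<^esub> h = b"
    proof (rule ex1I[of _ ?k])
      show "?k \<in> hom C V W \<and> (p \<circ>\<^bsub>C\<^esub> i) \<circ>\<^bsub>C\<^esub> ?k = a \<and> (q \<circ>\<^bsub>C\<^esub> i) \<circ>\<^bsub>C\<^esub> ?k = b"
        using k ik h comp_assoc[OF k assms(2) pb(1)] comp_assoc[OF k assms(2) pb(2)] by simp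
      fix l assume l: "l \<in> hom C V W \<and> (p \<circ>\<^bsub>C\<^esub> i) \<circ>\<^bsub>C\<^esub> l = a \<and> (q \<circ>\<^bsub>C\<^esub> i) \<circ>\<^bsub>C\<^esub> l = b"
      then have lh: "l \<in> hom C V W" by blast
      have "i \<circ>\<^bsub>C\<^esub> l = h"
        using pullback_unique[OF assms(1) pb(1,2) comp_hom[OF lh assms(2)] h(1)] l h
          comp_assoc[OF lh assms(2) pb(1)] comp_assoc[OF lh assms(2) pb(2)] by metis
      then show "l = ?k"
        using comp_assoc[OF lh assms(2) j(1)] j(2) comp_id_left[OF lh] by simp
    qed
  qed
qed

end

lemma is_colimitD:
  assumes "is_colimit J C T c \<kappa>"
  shows "is_cocone J C T c \<kappa>"
    and "is_cocone J C T d \<mu> \<Longrightarrow> \<exists>h \<in> hom C c d. \<forall>j\<in>Obj J. h \<circ>\<^bsub>C\<^esub> \<kappa> j = \<mu> j"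
  using assms unfolding is_colimit_def by blast+

lemma is_functorD:
  assumes "is_functor A B F"
  shows "X \<in> Obj A \<Longrightarrow> FObj F X \<in> Obj B"
    and "f \<in> hom A X Y \<Longrightarrow> FArr F f \<in> hom B (FObj F X) (FObj F Y)"
    and "X \<in> Obj A \<Longrightarrow> FArr F (Ident A X) = Ident B (FObj F X)"
    and "f \<in> hom A X Y \<Longrightarrow> g \<in> hom A Y Z \<Longrightarrow> FArr F (g \<circ>\<^bsub>A\<^esub> f) = FArr F g \<circ>\<^bsub>B\<^esub> FArr F f"
  using assms unfolding is_functor_def hom_def by (auto simp: PiE_iff)

lemma is_functorI:
  assumes "FObj F \<in> extensional (Obj A)" "FArr F \<in> extensional (Arr A)"
    and "\<And>X. X \<in> Obj A \<Longrightarrow> FObj F X \<in> Obj B"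
    and "\<And>X Y f. f \<in> hom A X Y \<Longrightarrow> FArr F f \<in> hom B (FObj F X) (FObj F Y)"
    and "\<And>X. X \<in> Obj A \<Longrightarrow> FArr F (Ident A X) = Ident B (FObj F X)"
    and "\<And>X Y Z f g. f \<in> hom A X Y \<Longrightarrow> g \<in> hom A Y Z \<Longrightarrow>
           FArr F (g \<circ>\<^bsub>A\<^esub> f) = FArr F g \<circ>\<^bsub>B\<^esub> FArr F f"
  shows "is_functor A B F"
  unfolding is_functor_def using assms by (auto simp: PiE_iff hom_iff)

lemma fctr_eqI:
  assumes "is_functor A B F" "is_functor A B G"
    and "\<And>X. X \<in> Obj A \<Longrightarrow> FObj F X = FObj G X" "\<And>f. f \<in> Arr A \<Longrightarrow> FArr F f = FArr G f"
  shows "F = G"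
proof -
  have "FObj F = FObj G"
    by (rule PiE_ext[of _ "Obj A" "\<lambda>_. Obj B"]) (use assms in \<open>auto simp: is_functor_def\<close>)
  moreover have "FArr F = FArr G"
    by (rule PiE_ext[of _ "Arr A" "\<lambda>_. Arr B"]) (use assms in \<open>auto simp: is_functor_def\<close>)
  ultimately show ?thesis by (cases F; cases G) simp
qed

lemma comp_functor_is_functor:
  assumes "category A" "is_functor A B F" "is_functor B C G"
  shows "is_functor A C (comp_functor A G F)"
proof (rule is_functorI)
  interpret A: Category A using assms(1) by unfold_locales
  note F = is_functorD[OF assms(2)] and G = is_functorD[OF assms(3)]
  show "FObj (comp_functor A G F) X \<in> Obj C" if "X \<in> Obj A" for X
    using that F G by (simp add: comp_functor_def)
  show "FArr (comp_functor A G F) f \<in> hom C (FObj (comp_functor A G F) X) (FObj (comp_functor A G F) Y)"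
    if "f \<in> hom A X Y" for f X Y
    using G(2)[OF F(2)[OF that]] that A.dom_obj[OF that] A.cod_obj[OF that]
    by (simp add: comp_functor_def hom_arr[OF that])
  show "FArr (comp_functor A G F) (Ident A X) = Ident C (FObj (comp_functor A G F) X)"
    if "X \<in> Obj A" for X
    using that F G hom_arr[OF A.id_hom[OF that]] by (simp add: comp_functor_def)
  show "FArr (comp_functor A G F) (g \<circ>\<^bsub>A\<^esub> f) =
      FArr (comp_functor A G F) g \<circ>\<^bsub>C\<^esub> FArr (comp_functor A G F) f"
    if "f \<in> hom A X Y" "g \<in> hom A Y Z" for f g X Y Z
    using that F(2)[OF that(1)] F(2)[OF that(2)] F(4)[OF that] G(4) A.comp_hom[OF that]
    by (simp add: comp_functor_def hom_arr[OF that(1)] hom_arr[OF that(2)]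
        hom_arr[OF A.comp_hom[OF that]])
qed (auto simp: comp_functor_def)

context Category
begin

lemma pullback_sym: "pullback C p q f g \<Longrightarrow> pullback C q p g f"
proof -
  assume pb: "pullback C p q f g"
  note 1 = pullbackD[OF pb]
  show ?thesis
  proof (rule pullbackI[OF 1(2,1,4,3) 1(5)[symmetric]])
    fix V a b assume "a \<in> hom C V (Dom C g)" "b \<in> hom C V (Dom C f)" "g \<circ>\<^bsub>C\<^esub> a = f \<circ>\<^bsub>C\<^esub> b"
    with pullback_universal[OF pb 1(1,2), of b V a]
    show "\<exists>!h. h \<in> hom C V (Dom C p) \<and> q \<circ>\<^bsub>C\<^esub> h = a \<and> p \<circ>\<^bsub>C\<^esub> h = b"
      by (simp add: conj_commute)
  qed
qed

text \<open>Composition of partial maps ranges over all representatives of two classes of spans, that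
  is, over all replacements of the legs of a cospan by isomorphic ones. Pasting with squares whose
  opposite sides are invertible removes the isomorphisms again.\<close>

lemma pullback_cospan_isos:
  assumes "pullback C p q (f \<circ>\<^bsub>C\<^esub> i) (n \<circ>\<^bsub>C\<^esub> k)"
    "i \<in> hom C X' X" "iso C i" "k \<in> hom C Z' Z" "iso C k" "f \<in> hom C X Y" "n \<in> hom C Z Y"
  shows "pullback C (i \<circ>\<^bsub>C\<^esub> p) (k \<circ>\<^bsub>C\<^esub> q) f n"
proof -
  have Y: "Ident C Y \<in> hom C Y Y" "iso C (Ident C Y)"
    using id_hom id_iso cod_obj[OF assms(6)] by blast+
  have absorb: "pullback C (f \<circ>\<^bsub>C\<^esub> i) i (Ident C Y) f"
    if "f \<in> hom C X Y" "i \<in> hom C X' X" "iso C i" for f i X X'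
    using pullback_of_isos[OF comp_hom[OF that(2,1)] that(2) Y(1) that(1) _ that(3) Y(2)]
      comp_id_left[OF comp_hom[OF that(2,1)]] by simp
  have "pullback C p (k \<circ>\<^bsub>C\<^esub> q) (Ident C Y \<circ>\<^bsub>C\<^esub> (f \<circ>\<^bsub>C\<^esub> i)) n"
    using pullback_paste[OF absorb[OF assms(7,4,5)] assms(1)] .
  then have "pullback C p (k \<circ>\<^bsub>C\<^esub> q) (f \<circ>\<^bsub>C\<^esub> i) n"
    using comp_id_left[OF comp_hom[OF assms(2,6)]] by simp
  then have "pullback C (k \<circ>\<^bsub>C\<^esub> q) p n (f \<circ>\<^bsub>C\<^esub> i)"
    by (rule pullback_sym)
  then have "pullback C (k \<circ>\<^bsub>C\<^esub> q) (i \<circ>\<^bsub>C\<^esub> p) (Ident C Y \<circ>\<^bsub>C\<^esub> n) f"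
    by (rule pullback_paste[OF absorb[OF assms(6,2,3)]])
  then show ?thesis
    using pullback_sym comp_id_left[OF assms(7)] by simp
qed

end


section \<open>Partial maps\<close>

locale MCategory =
  fixes C :: "('o, 'a, 'm) mcat_scheme"
  assumes mcategory: "mcategory C"

sublocale MCategory \<subseteq> Category C
  using mcategory unfolding mcategory_def by unfold_locales blast

context MCategory
begin

lemma mon_monic: "m \<in> Mon C \<Longrightarrow> monic C m"
  and iso_mon: "iso C m \<Longrightarrow> m \<in> Mon C"
  and mon_comp: "m \<in> Mon C \<Longrightarrow> n \<in> Mon C \<Longrightarrow> Dom C n = Cod C m \<Longrightarrow> n \<circ>\<^bsub>C\<^esub> m \<in> Mon C"
  using mcategory unfolding mcategory_def stable_system_of_monics_def by blast+

lemma mon_pullback_ex: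
  "m \<in> Mon C \<Longrightarrow> f \<in> Arr C \<Longrightarrow> Cod C f = Cod C m \<Longrightarrow> \<exists>p q. pullback C p q f m"
  using mcategory unfolding mcategory_def stable_system_of_monics_def by simp

lemma mon_arr: "m \<in> Mon C \<Longrightarrow> m \<in> Arr C"
  using mon_monic unfolding monic_def by blast

lemma mon_hom: "m \<in> Mon C \<Longrightarrow> m \<in> hom C (Dom C m) (Cod C m)"
  by (rule arr_hom[OF mon_arr])

lemma mon_pullbackE:
  assumes "m \<in> Mon C" "f \<in> hom C X (Cod C m)"
  obtains p q where "pullback C p q f m"
  using mon_pullback_ex[OF assms(1) hom_arr[OF assms(2)] hom_cod[OF assms(2)]] by (elim exE)

lemma mon_pullback:
  assumes "m \<in> Mon C" "pullback C p q f m"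
  shows "p \<in> Mon C"
proof -
  have "f \<in> Arr C" "Cod C f = Cod C m"
    using assms(2) unfolding pullback_def by auto
  then show ?thesis
    using assms mcategory unfolding mcategory_def stable_system_of_monics_def by blast
qed

definition par :: "'a \<Rightarrow> 'a \<Rightarrow> ('o, ('a \<times> 'a) set) tagged" where
  "par m f = Tagged (Cod C m) (span_class C m f) (Cod C f)"

lemma span_class_refl:
  assumes "m \<in> Mon C" "f \<in> hom C (Dom C m) Y"
  shows "(m, f) \<in> span_class C m f"
proof -
  have "iso C (Ident C (Dom C m))" "Ident C (Dom C m) \<in> hom C (Dom C m) (Dom C m)"
    using id_iso id_hom dom_obj[OF mon_hom[OF assms(1)]] by blast+
  moreover have "m \<circ>\<^bsub>C\<^esub> Ident C (Dom C m) = m" "f \<circ>\<^bsub>C\<^esub> Ident C (Dom C m) = f"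
    using comp_id_right[OF mon_hom[OF assms(1)]] comp_id_right[OF assms(2)] by blast+
  ultimately show ?thesis
    using assms unfolding span_class_def by (auto simp: hom_dom hom_arr)
qed

lemma span_class_sub:
  assumes "m \<in> Mon C" "f \<in> hom C (Dom C m) Y" "i \<in> hom C W (Dom C m)" "iso C i"
  shows "span_class C (m \<circ>\<^bsub>C\<^esub> i) (f \<circ>\<^bsub>C\<^esub> i) \<subseteq> span_class C m f"
proof
  fix z assume "z \<in> span_class C (m \<circ>\<^bsub>C\<^esub> i) (f \<circ>\<^bsub>C\<^esub> i)"
  moreover have "Dom C (m \<circ>\<^bsub>C\<^esub> i) = W"
    by (rule hom_dom[OF comp_hom[OF assms(3) mon_hom[OF assms(1)]]])
  ultimately obtain m' f' k where z: "z = (m', f')" "m' \<in> Mon C" "f' \<in> Arr C" "Dom C m' = Dom C f'"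
    and k: "k \<in> hom C (Dom C m') W" "iso C k"
    and eqs: "(m \<circ>\<^bsub>C\<^esub> i) \<circ>\<^bsub>C\<^esub> k = m'" "(f \<circ>\<^bsub>C\<^esub> i) \<circ>\<^bsub>C\<^esub> k = f'"
    unfolding span_class_def by auto
  have "i \<circ>\<^bsub>C\<^esub> k \<in> hom C (Dom C m') (Dom C m)"
    using comp_hom[OF k(1) assms(3)] .
  moreover have "iso C (i \<circ>\<^bsub>C\<^esub> k)"
  proof -
    obtain i' where i': "i' \<in> hom C (Dom C m) W" "i' \<circ>\<^bsub>C\<^esub> i = Ident C W"
      "i \<circ>\<^bsub>C\<^esub> i' = Ident C (Dom C m)"
      using isoE[OF assms(4,3)] by metis
    obtain k' where k': "k' \<in> hom C W (Dom C m')" "k' \<circ>\<^bsub>C\<^esub> k = Ident C (Dom C m')"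
      "k \<circ>\<^bsub>C\<^esub> k' = Ident C W"
      using isoE[OF k(2,1)] by metis
    show ?thesis
    proof (rule isoI[OF comp_hom[OF k(1) assms(3)] comp_hom[OF i'(1) k'(1)]])
      show "(k' \<circ>\<^bsub>C\<^esub> i') \<circ>\<^bsub>C\<^esub> (i \<circ>\<^bsub>C\<^esub> k) = Ident C (Dom C m')"
        using comp_assoc[OF comp_hom[OF k(1) assms(3)] i'(1) k'(1)] comp_assoc[OF k(1) assms(3) i'(1)]
          i'(2) k'(2) comp_id_left[OF k(1)] by simp
      show "(i \<circ>\<^bsub>C\<^esub> k) \<circ>\<^bsub>C\<^esub> (k' \<circ>\<^bsub>C\<^esub> i') = Ident C (Dom C m)"
        using comp_assoc[OF comp_hom[OF i'(1) k'(1)] k(1) assms(3)] comp_assoc[OF i'(1) k'(1) k(1)]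
          i'(3) k'(3) comp_id_left[OF i'(1)] by simp
    qed
  qed
  moreover have "m \<circ>\<^bsub>C\<^esub> (i \<circ>\<^bsub>C\<^esub> k) = m'" "f \<circ>\<^bsub>C\<^esub> (i \<circ>\<^bsub>C\<^esub> k) = f'"
    using comp_assoc[OF k(1) assms(3) mon_hom[OF assms(1)]] comp_assoc[OF k(1) assms(3,2)] eqs by simp_all
  ultimately show "z \<in> span_class C m f"
    using z unfolding span_class_def by auto
qed

lemma par_iso:
  assumes "m \<in> Mon C" "f \<in> hom C (Dom C m) Y" "i \<in> hom C W (Dom C m)" "iso C i"
  shows "par (m \<circ>\<^bsub>C\<^esub> i) (f \<circ>\<^bsub>C\<^esub> i) = par m f"
proof -
  obtain i' where i': "i' \<in> hom C (Dom C m) W" "i \<circ>\<^bsub>C\<^esub> i' = Ident C (Dom C m)" "iso C i'"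
    using isoE[OF assms(4,3)] by metis
  note mi = comp_hom[OF assms(3) mon_hom[OF assms(1)]] and fi = comp_hom[OF assms(3,2)]
  have "span_class C ((m \<circ>\<^bsub>C\<^esub> i) \<circ>\<^bsub>C\<^esub> i') ((f \<circ>\<^bsub>C\<^esub> i) \<circ>\<^bsub>C\<^esub> i') \<subseteq> span_class C (m \<circ>\<^bsub>C\<^esub> i) (f \<circ>\<^bsub>C\<^esub> i)"
  proof (rule span_class_sub)
    show "m \<circ>\<^bsub>C\<^esub> i \<in> Mon C"
      using mon_comp[OF iso_mon[OF assms(4)] assms(1)] assms(3) hom_cod by metis
  qed (use mi fi i' hom_dom in \<open>simp_all add: hom_dom\<close>)
  moreover have "(m \<circ>\<^bsub>C\<^esub> i) \<circ>\<^bsub>C\<^esub> i' = m" "(f \<circ>\<^bsub>C\<^esub> i) \<circ>\<^bsub>C\<^esub> i' = f"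
    using comp_assoc[OF i'(1) assms(3) mon_hom[OF assms(1)]] comp_assoc[OF i'(1) assms(3,2)]
      comp_id_right[OF mon_hom[OF assms(1)]] comp_id_right[OF assms(2)] i'(2) by simp_all
  ultimately have "span_class C (m \<circ>\<^bsub>C\<^esub> i) (f \<circ>\<^bsub>C\<^esub> i) = span_class C m f"
    using span_class_sub[OF assms] by simp
  then show ?thesis
    unfolding par_def using hom_cod[OF mi] hom_cod[OF fi] hom_cod[OF assms(2)] by simp
qed

lemma par_eqD:
  assumes "par m f = par m' f'" "m' \<in> Mon C" "f' \<in> hom C (Dom C m') Y"
  obtains i where "i \<in> hom C (Dom C m') (Dom C m)" "iso C i" "m \<circ>\<^bsub>C\<^esub> i = m'" "f \<circ>\<^bsub>C\<^esub> i = f'"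
proof -
  have "(m', f') \<in> span_class C m f"
    using span_class_refl[OF assms(2,3)] assms(1) unfolding par_def by simp
  then show thesis
    unfolding span_class_def by (auto intro: that)
qed

lemma par_restriction_unique:
  assumes "pullback C p q f n" "pullback C p' q' f n" "n \<in> Mon C" "g \<in> hom C (Dom C n) Y"
  shows "par p' (g \<circ>\<^bsub>C\<^esub> q') = par p (g \<circ>\<^bsub>C\<^esub> q)"
proof -
  note pb = pullbackD[OF assms(1)]
  obtain i where i: "i \<in> hom C (Dom C p') (Dom C p)" "iso C i" "p \<circ>\<^bsub>C\<^esub> i = p'" "q \<circ>\<^bsub>C\<^esub> i = q'"
    using pullback_iso_unique[OF assms(1,2)] .
  have "par (p \<circ>\<^bsub>C\<^esub> i) ((g \<circ>\<^bsub>C\<^esub> q) \<circ>\<^bsub>C\<^esub> i) = par p (g \<circ>\<^bsub>C\<^esub> q)"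
    using par_iso[OF mon_pullback[OF assms(3,1)] comp_hom[OF pb(2) assms(4)] i(1,2)] .
  with i show ?thesis
    using comp_assoc[OF i(1) pb(2) assms(4)] by simp
qed

lemma Par_sel [simp]:
  "Obj (Par C) = Obj C" "Dom (Par C) = src" "Cod (Par C) = tgt"
  by (simp_all add: Par_def)

lemma par_hom:
  assumes "m \<in> Mon C" "f \<in> hom C (Dom C m) Y"
  shows "par m f \<in> hom (Par C) (Cod C m) Y"
proof -
  have "f \<in> Arr C" "Dom C m = Dom C f" "Cod C f = Y"
    using assms(2) by (auto simp: hom_iff)
  then show ?thesis
    using assms(1) unfolding par_def Par_def hom_def by auto
qed

lemma Par_homE:
  assumes "\<psi> \<in> hom (Par C) X Y"
  obtains m f where "\<psi> = par m f" "m \<in> Mon C" "Cod C m = X" "f \<in> hom C (Dom C m) Y"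
  using assms unfolding par_def Par_def hom_def by auto

lemma Par_incl_arr: "f \<in> hom C X Y \<Longrightarrow> FArr (Par_incl C) f = par (Ident C X) f"
  using hom_cod[OF id_hom[OF dom_obj]] hom_arr hom_dom hom_cod
  unfolding Par_incl_def par_def by (metis (no_types, lifting) fctr.select_convs(2) restrict_apply')

text \<open>The composite in the category of partial maps is a union over all representatives. For a
  total map followed by a partial one, all of them give pullbacks of one cospan up to isomorphism,
  so that the union is the class of any one of them.\<close>

lemma par_restrict:
  assumes "n \<in> Mon C" "g \<in> hom C (Dom C n) Y" "f \<in> hom C X (Cod C n)" "pullback C p q f n"
  shows "par n g \<circ>\<^bsub>Par C\<^esub> FArr (Par_incl C) f = par p (g \<circ>\<^bsub>C\<^esub> q)"
proof -
  note n = mon_hom[OF assms(1)] and pb = pullbackD[OF assms(4)]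
  have X: "Dom C f = X" "Ident C X \<in> hom C X X" "Ident C X \<in> Mon C"
    using assms(3) hom_dom id_hom[OF dom_obj[OF assms(3)]] iso_mon[OF id_iso[OF dom_obj[OF assms(3)]]]
    by auto
  note p = pb(1)[unfolded X(1)]
  have "{(m \<circ>\<^bsub>C\<^esub> p', g' \<circ>\<^bsub>C\<^esub> q') | m f' n' g' p' q'.
            (m, f') \<in> span_class C (Ident C X) f \<and> (n', g') \<in> span_class C n g \<and>
            pullback C p' q' f' n'} = span_class C p (g \<circ>\<^bsub>C\<^esub> q)" (is "?S = _")
  proof (intro equalityI subsetI)
    fix z assume "z \<in> ?S"
    then obtain m f' n' g' p' q' where z: "z = (m \<circ>\<^bsub>C\<^esub> p', g' \<circ>\<^bsub>C\<^esub> q')"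
      and mf: "(m, f') \<in> span_class C (Ident C X) f" and ng: "(n', g') \<in> span_class C n g"
      and pb': "pullback C p' q' f' n'" by auto
    obtain i where i: "i \<in> hom C (Dom C m) X" "iso C i" "Ident C X \<circ>\<^bsub>C\<^esub> i = m" "f \<circ>\<^bsub>C\<^esub> i = f'"
      using mf hom_dom[OF X(2)] unfolding span_class_def by auto
    then have m: "m = i" using comp_id_left by simp
    obtain k where k: "k \<in> hom C (Dom C n') (Dom C n)" "iso C k" "n \<circ>\<^bsub>C\<^esub> k = n'" "g \<circ>\<^bsub>C\<^esub> k = g'"
      using ng unfolding span_class_def by auto
    have ipk: "pullback C (i \<circ>\<^bsub>C\<^esub> p') (k \<circ>\<^bsub>C\<^esub> q') f n"
      using pullback_cospan_isos[OF _ i(1,2) k(1,2) assms(3) n] pb' i(4) k(3) by simp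
    note pb'' = pullbackD[OF ipk]
    have q': "q' \<in> hom C (Dom C p') (Dom C n')"
      using pullbackD[OF pb'] by blast
    have "par (i \<circ>\<^bsub>C\<^esub> p') (g \<circ>\<^bsub>C\<^esub> (k \<circ>\<^bsub>C\<^esub> q')) = par p (g \<circ>\<^bsub>C\<^esub> q)"
      using par_restriction_unique[OF assms(4) ipk assms(1,2)] .
    then have "(i \<circ>\<^bsub>C\<^esub> p', g \<circ>\<^bsub>C\<^esub> (k \<circ>\<^bsub>C\<^esub> q')) \<in> span_class C p (g \<circ>\<^bsub>C\<^esub> q)"
      using span_class_refl[OF mon_pullback[OF assms(1) ipk] comp_hom[OF pb''(2) assms(2)]]
      unfolding par_def by simp
    then show "z \<in> span_class C p (g \<circ>\<^bsub>C\<^esub> q)"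
      using z m comp_assoc[OF q' k(1) assms(2)] k(4) by simp
  next
    fix z assume "z \<in> span_class C p (g \<circ>\<^bsub>C\<^esub> q)"
    then obtain j where j: "j \<in> hom C (Dom C j) (Dom C p)" "iso C j"
      and z: "z = (p \<circ>\<^bsub>C\<^esub> j, (g \<circ>\<^bsub>C\<^esub> q) \<circ>\<^bsub>C\<^esub> j)"
      unfolding span_class_def hom_def by auto
    have "z = (Ident C X \<circ>\<^bsub>C\<^esub> (p \<circ>\<^bsub>C\<^esub> j), g \<circ>\<^bsub>C\<^esub> (q \<circ>\<^bsub>C\<^esub> j))"
      using z comp_assoc[OF j(1) pb(2) assms(2)] comp_id_left[OF comp_hom[OF j(1) p]] by simp
    moreover have "(Ident C X, f) \<in> span_class C (Ident C X) f"
      using span_class_refl[OF X(3)] hom_dom[OF X(2)] assms(3) by simp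
    moreover have "(n, g) \<in> span_class C n g"
      using span_class_refl[OF assms(1,2)] .
    ultimately show "z \<in> ?S"
      using pullback_isos_transfer[OF assms(4) j] by blast
  qed
  then show ?thesis
    unfolding Par_incl_arr[OF assms(3)] par_def Par_def
    using hom_cod[OF p] hom_cod[OF X(2)] hom_cod[OF assms(2)] hom_cod[OF comp_hom[OF pb(2) assms(2)]]
    by simp
qed

end


section \<open>Gluing over colimits in a cocomplete M-category\<close>

locale Cocomplete = MCategory C for C :: "('o, 'a, 'm) mcat_scheme" +
  fixes U :: "'u itself"
  assumes cocomplete: "cocomplete U C"
begin

lemma colimit_ex:
  "small_category U J \<Longrightarrow> is_functor J C T \<Longrightarrow> \<exists>c \<kappa>. is_colimit J C T c \<kappa>"
  using cocomplete unfolding cocomplete_def has_small_colimits_def by blast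

lemma Par_colimit:
  assumes "small_category U J" "is_functor J C T" "is_colimit J C T c \<iota>"
  shows "is_colimit J (Par C) (comp_functor J (Par_incl C) T) c (\<lambda>j. FArr (Par_incl C) (\<iota> j))"
proof -
  have "c \<in> Obj C" using assms(3) unfolding is_colimit_def is_cocone_def by blast
  then have "FObj (Par_incl C) c = c" unfolding Par_incl_def by simp
  then show ?thesis
    using cocomplete assms unfolding cocomplete_def preserves_small_colimits_def by metis
qed

text \<open>Partial maps from \<open>c\<close> to \<open>Y\<close> are arrows out of a colimit in the category of partial maps,
  where the composites with the coprojections are restrictions. The family of restrictions is a
  cocone because restrictions compose by pasting.\<close>

lemma par_unique:
  assumes J: "small_category U J" "is_functor J C T" "is_colimit J C T c \<iota>"
    and n: "n \<in> Mon C" "Cod C n = c" "g \<in> hom C (Dom C n) Y"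
    and n': "n' \<in> Mon C" "Cod C n' = c" "g' \<in> hom C (Dom C n') Y"
    and restr: "\<And>j. j \<in> Obj J \<Longrightarrow> pullback C (m j) (\<theta> j) (\<iota> j) n \<and> pullback C (m j) (\<theta>' j) (\<iota> j) n' \<and>
      g \<circ>\<^bsub>C\<^esub> \<theta> j = g' \<circ>\<^bsub>C\<^esub> \<theta>' j"
  obtains i where "i \<in> hom C (Dom C n') (Dom C n)" "iso C i" "n \<circ>\<^bsub>C\<^esub> i = n'" "g \<circ>\<^bsub>C\<^esub> i = g'"
proof -
  have catJ: "category J" using J(1) unfolding small_category_def by blast
  interpret J: Category J using catJ by unfold_locales
  note T = is_functorD[OF J(2)] and ParJ = Par_colimit[OF J]
  have coc: "is_cocone J C T c \<iota>" using J(3) unfolding is_colimit_def by blast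
  have \<iota>: "\<iota> j \<in> hom C (FObj T j) c" if "j \<in> Obj J" for j
    using coc that unfolding is_cocone_def by blast
  let ?\<mu> = "\<lambda>j. par (m j) (g \<circ>\<^bsub>C\<^esub> \<theta> j)"
  have h: "par n g \<circ>\<^bsub>Par C\<^esub> FArr (Par_incl C) (\<iota> j) = ?\<mu> j" if "j \<in> Obj J" for j
    using par_restrict[OF n(1,3) _ conjunct1[OF restr[OF that]]] \<iota>[OF that] n(2) by simp
  have h': "par n' g' \<circ>\<^bsub>Par C\<^esub> FArr (Par_incl C) (\<iota> j) = ?\<mu> j" if "j \<in> Obj J" for j
    using par_restrict[OF n'(1,3) _ conjunct1[OF conjunct2[OF restr[OF that]]]] restr[OF that]
      \<iota>[OF that] n'(2) by simp
  have "is_cocone J (Par C) (comp_functor J (Par_incl C) T) Y ?\<mu>"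
    unfolding is_cocone_def
  proof (intro conjI ballI)
    show "Y \<in> Obj (Par C)" using cod_obj[OF n(3)] by simp
    fix j assume j: "j \<in> Obj J"
    then have pb: "pullback C (m j) (\<theta> j) (\<iota> j) n" using restr by blast
    note pb' = pullbackD[OF pb]
    have "Cod C (m j) = FObj T j" using \<iota>[OF j] pb'(1) by (simp add: hom_iff)
    then show "?\<mu> j \<in> hom (Par C) (FObj (comp_functor J (Par_incl C) T) j) Y"
      using par_hom[OF mon_pullback[OF n(1) pb] comp_hom[OF pb'(2) n(3)]] j T(1)[OF j]
      by (simp add: comp_functor_def Par_incl_def)
  next
    fix u assume u: "u \<in> Arr J"
    let ?j = "Dom J u" and ?k = "Cod J u"
    have uh: "u \<in> hom J ?j ?k" using arr_hom[OF u] .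
    have jk: "?j \<in> Obj J" "?k \<in> Obj J" using J.dom_obj[OF uh] J.cod_obj[OF uh] .
    note Tu = T(2)[OF uh]
    have comm: "\<iota> ?k \<circ>\<^bsub>C\<^esub> FArr T u = \<iota> ?j" using coc u unfolding is_cocone_def by blast
    have pbj: "pullback C (m ?j) (\<theta> ?j) (\<iota> ?j) n" and pbk: "pullback C (m ?k) (\<theta> ?k) (\<iota> ?k) n"
      using restr jk by blast+
    note pbk' = pullbackD[OF pbk]
    have mk: "m ?k \<in> Mon C" "Cod C (m ?k) = FObj T ?k"
      using mon_pullback[OF n(1) pbk] \<iota>[OF jk(2)] pbk'(1) by (auto simp: hom_iff)
    obtain p q where pq: "pullback C p q (FArr T u) (m ?k)"
      using mon_pullbackE[OF mk(1)] Tu mk(2) by metis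
    have q: "q \<in> hom C (Dom C p) (Dom C (m ?k))" using pullbackD[OF pq] by blast
    have "pullback C p (\<theta> ?k \<circ>\<^bsub>C\<^esub> q) (\<iota> ?j) n"
      using pullback_paste[OF pbk pq] comm by simp
    then have "par p (g \<circ>\<^bsub>C\<^esub> (\<theta> ?k \<circ>\<^bsub>C\<^esub> q)) = ?\<mu> ?j"
      using par_restriction_unique[OF pbj _ n(1,3)] by blast
    moreover have "?\<mu> ?k \<circ>\<^bsub>Par C\<^esub> FArr (Par_incl C) (FArr T u) = par p ((g \<circ>\<^bsub>C\<^esub> \<theta> ?k) \<circ>\<^bsub>C\<^esub> q)"
      using par_restrict[OF mk(1) comp_hom[OF pbk'(2) n(3)] _ pq] Tu mk(2) by simp
    ultimately show "?\<mu> ?k \<circ>\<^bsub>Par C\<^esub> FArr (comp_functor J (Par_incl C) T) u = ?\<mu> ?j"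
      using u comp_assoc[OF q pbk'(2) n(3)] by (simp add: comp_functor_def)
  qed
  then have "\<exists>!h. h \<in> hom (Par C) c Y \<and> (\<forall>j\<in>Obj J. h \<circ>\<^bsub>Par C\<^esub> FArr (Par_incl C) (\<iota> j) = ?\<mu> j)"
    using ParJ unfolding is_colimit_def by blast
  moreover have "par n g \<in> hom (Par C) c Y" "par n' g' \<in> hom (Par C) c Y"
    using par_hom[OF n(1,3)] par_hom[OF n'(1,3)] n(2) n'(2) by simp_all
  ultimately have "par n g = par n' g'"
    using h h' by blast
  then show thesis
    using par_eqD[OF _ n'(1,3)] that by metis
qed

text \<open>The existence half of the same universal property: a family of partial maps is
  a cocone when restricting the member at the codomain of a diagram arrow along this arrow gives the
  member at its domain.\<close>

lemma par_glue:
  assumes J: "small_category U J" "is_functor J C T" "is_colimit J C T c \<iota>" and Y: "Y \<in> Obj C"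
    and m: "\<And>j. j \<in> Obj J \<Longrightarrow> m j \<in> Mon C \<and> Cod C (m j) = FObj T j \<and> f j \<in> hom C (Dom C (m j)) Y"
    and Z: "\<And>u. u \<in> Arr J \<Longrightarrow> pullback C (m (Dom J u)) (Z u) (FArr T u) (m (Cod J u)) \<and>
      f (Cod J u) \<circ>\<^bsub>C\<^esub> Z u = f (Dom J u)"
  obtains n g \<theta> where "n \<in> Mon C" "Cod C n = c" "g \<in> hom C (Dom C n) Y"
    "\<And>j. j \<in> Obj J \<Longrightarrow> pullback C (m j) (\<theta> j) (\<iota> j) n \<and> g \<circ>\<^bsub>C\<^esub> \<theta> j = f j"
proof -
  have catJ: "category J" using J(1) unfolding small_category_def by blast
  interpret J: Category J using catJ by unfold_locales
  note T = is_functorD[OF J(2)] and ParJ = Par_colimit[OF J]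
  have coc: "is_cocone J C T c \<iota>" using J(3) unfolding is_colimit_def by blast
  have \<iota>: "\<iota> j \<in> hom C (FObj T j) c" if "j \<in> Obj J" for j
    using coc that unfolding is_cocone_def by blast
  let ?\<mu> = "\<lambda>j. par (m j) (f j)"
  have "is_cocone J (Par C) (comp_functor J (Par_incl C) T) Y ?\<mu>"
    unfolding is_cocone_def
  proof (intro conjI ballI)
    show "Y \<in> Obj (Par C)" using Y by simp
    fix j assume j: "j \<in> Obj J"
    then show "?\<mu> j \<in> hom (Par C) (FObj (comp_functor J (Par_incl C) T) j) Y"
      using m[OF j] par_hom[of "m j" "f j" Y] T(1)[OF j]
      by (simp add: comp_functor_def Par_incl_def)
  next
    fix u assume u: "u \<in> Arr J"
    have uh: "u \<in> hom J (Dom J u) (Cod J u)" using arr_hom[OF u] .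
    have k: "Cod J u \<in> Obj J" using J.cod_obj[OF uh] .
    have "?\<mu> (Cod J u) \<circ>\<^bsub>Par C\<^esub> FArr (Par_incl C) (FArr T u) =
        par (m (Dom J u)) (f (Cod J u) \<circ>\<^bsub>C\<^esub> Z u)"
      using par_restrict[OF conjunct1[OF m[OF k]] conjunct2[OF conjunct2[OF m[OF k]]] _
          conjunct1[OF Z[OF u]]] m[OF k] T(2)[OF uh] by simp
    then show "?\<mu> (Cod J u) \<circ>\<^bsub>Par C\<^esub> FArr (comp_functor J (Par_incl C) T) u = ?\<mu> (Dom J u)"
      using u Z[OF u] by (simp add: comp_functor_def)
  qed
  then obtain h where h: "h \<in> hom (Par C) c Y"
    "\<And>j. j \<in> Obj J \<Longrightarrow> h \<circ>\<^bsub>Par C\<^esub> FArr (Par_incl C) (\<iota> j) = ?\<mu> j"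
    using is_colimitD(2)[OF ParJ] by blast
  obtain n g where n: "h = par n g" "n \<in> Mon C" "Cod C n = c" "g \<in> hom C (Dom C n) Y"
    using Par_homE[OF h(1)] .
  have "\<exists>\<theta>. pullback C (m j) \<theta> (\<iota> j) n \<and> g \<circ>\<^bsub>C\<^esub> \<theta> = f j" if j: "j \<in> Obj J" for j
  proof -
    have \<iota>j: "\<iota> j \<in> hom C (FObj T j) (Cod C n)" using \<iota>[OF j] n(3) by simp
    obtain p q where pq: "pullback C p q (\<iota> j) n" using mon_pullbackE[OF n(2) \<iota>j] .
    have q: "q \<in> hom C (Dom C p) (Dom C n)" using pullbackD[OF pq] by blast
    have "par p (g \<circ>\<^bsub>C\<^esub> q) = par (m j) (f j)"
      using par_restrict[OF n(2,4) \<iota>j pq] h(2)[OF j] n(1) by simp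
    then obtain i where i: "i \<in> hom C (Dom C (m j)) (Dom C p)" "iso C i" "p \<circ>\<^bsub>C\<^esub> i = m j"
      "(g \<circ>\<^bsub>C\<^esub> q) \<circ>\<^bsub>C\<^esub> i = f j"
      using par_eqD m[OF j] by metis
    then show ?thesis
      using pullback_isos_transfer[OF pq i(1,2)] comp_assoc[OF i(1) q n(4)] by metis
  qed
  then obtain \<theta> where "\<And>j. j \<in> Obj J \<Longrightarrow> pullback C (m j) (\<theta> j) (\<iota> j) n \<and> g \<circ>\<^bsub>C\<^esub> \<theta> j = f j"
    by metis
  with that n show thesis by blast
qed

text \<open>The conclusion says that the domain of \<open>n\<close> is the colimit of the domains of the \<open>m j\<close>. It is
  phrased for families \<open>f\<close> and not for cocones, as the \<open>Z u\<close> are not organised into a functor.\<close>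

lemma mon_glue:
  assumes J: "small_category U J" "is_functor J C T" "is_colimit J C T c \<iota>"
    and m: "\<And>j. j \<in> Obj J \<Longrightarrow> m j \<in> Mon C \<and> Cod C (m j) = FObj T j"
    and Z: "\<And>u. u \<in> Arr J \<Longrightarrow> pullback C (m (Dom J u)) (Z u) (FArr T u) (m (Cod J u))"
  obtains n \<theta> where "n \<in> Mon C" "Cod C n = c"
    "\<And>j. j \<in> Obj J \<Longrightarrow> pullback C (m j) (\<theta> j) (\<iota> j) n"
    "\<And>Y f. (\<And>j. j \<in> Obj J \<Longrightarrow> f j \<in> hom C (Dom C (m j)) Y) \<Longrightarrow>
        (\<And>u. u \<in> Arr J \<Longrightarrow> f (Cod J u) \<circ>\<^bsub>C\<^esub> Z u = f (Dom J u)) \<Longrightarrow> Y \<in> Obj C \<Longrightarrow>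
        \<exists>!h. h \<in> hom C (Dom C n) Y \<and> (\<forall>j\<in>Obj J. h \<circ>\<^bsub>C\<^esub> \<theta> j = f j)"
proof -
  have catJ: "category J" using J(1) unfolding small_category_def by blast
  interpret J: Category J using catJ by unfold_locales
  note T = is_functorD[OF J(2)]
  have coc: "is_cocone J C T c \<iota>" using J(3) unfolding is_colimit_def by blast
  have c: "c \<in> Obj C" and \<iota>: "\<And>j. j \<in> Obj J \<Longrightarrow> \<iota> j \<in> hom C (FObj T j) c"
    using coc unfolding is_cocone_def by blast+
  have mh: "m j \<in> hom C (Dom C (m j)) (FObj T j)" if "j \<in> Obj J" for j
    using mon_hom m[OF that] by metis
  \<comment> \<open>The domain \<open>n\<close> is obtained from partial maps into \<open>c\<close>: each \<open>m j\<close> is paired with its own inclusion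
    into \<open>c\<close>. For any other target, \<open>par_unique\<close> then identifies the domain that comes out with \<open>n\<close>.\<close>
  have im: "m j \<in> Mon C \<and> Cod C (m j) = FObj T j \<and> \<iota> j \<circ>\<^bsub>C\<^esub> m j \<in> hom C (Dom C (m j)) c"
    if "j \<in> Obj J" for j
    using m[OF that] comp_hom[OF mh[OF that] \<iota>[OF that]] by simp
  have imZ: "pullback C (m (Dom J u)) (Z u) (FArr T u) (m (Cod J u)) \<and>
      (\<iota> (Cod J u) \<circ>\<^bsub>C\<^esub> m (Cod J u)) \<circ>\<^bsub>C\<^esub> Z u = \<iota> (Dom J u) \<circ>\<^bsub>C\<^esub> m (Dom J u)" if u: "u \<in> Arr J" for u
  proof -
    have uh: "u \<in> hom J (Dom J u) (Cod J u)" using arr_hom[OF u] .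
    have jk: "Dom J u \<in> Obj J" "Cod J u \<in> Obj J" using J.dom_obj[OF uh] J.cod_obj[OF uh] .
    note pb = pullbackD[OF Z[OF u]]
    have comm: "\<iota> (Cod J u) \<circ>\<^bsub>C\<^esub> FArr T u = \<iota> (Dom J u)" using coc u unfolding is_cocone_def by blast
    have "(\<iota> (Cod J u) \<circ>\<^bsub>C\<^esub> m (Cod J u)) \<circ>\<^bsub>C\<^esub> Z u = \<iota> (Cod J u) \<circ>\<^bsub>C\<^esub> (m (Cod J u) \<circ>\<^bsub>C\<^esub> Z u)"
      using comp_assoc[OF pb(2) mh[OF jk(2)] \<iota>[OF jk(2)]] by simp
    also have "\<dots> = \<iota> (Cod J u) \<circ>\<^bsub>C\<^esub> (FArr T u \<circ>\<^bsub>C\<^esub> m (Dom J u))"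
      using pb(5) by simp
    also have "\<dots> = \<iota> (Dom J u) \<circ>\<^bsub>C\<^esub> m (Dom J u)"
      using comp_assoc[OF mh[OF jk(1)] T(2)[OF uh] \<iota>[OF jk(2)]] comm by simp
    finally show ?thesis using Z[OF u] by blast
  qed
  obtain n g0 \<theta> where n: "n \<in> Mon C" "Cod C n = c" and
    \<theta>: "\<And>j. j \<in> Obj J \<Longrightarrow> pullback C (m j) (\<theta> j) (\<iota> j) n \<and> g0 \<circ>\<^bsub>C\<^esub> \<theta> j = \<iota> j \<circ>\<^bsub>C\<^esub> m j"
    using par_glue[OF J c, of m "\<lambda>j. \<iota> j \<circ>\<^bsub>C\<^esub> m j" Z, OF im imZ] by metis
  note nh = mon_hom[OF n(1)]
  have "\<exists>!h. h \<in> hom C (Dom C n) Y \<and> (\<forall>j\<in>Obj J. h \<circ>\<^bsub>C\<^esub> \<theta> j = f j)"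
    if f: "\<And>j. j \<in> Obj J \<Longrightarrow> f j \<in> hom C (Dom C (m j)) Y"
      and fZ: "\<And>u. u \<in> Arr J \<Longrightarrow> f (Cod J u) \<circ>\<^bsub>C\<^esub> Z u = f (Dom J u)" and Y: "Y \<in> Obj C" for Y f
  proof -
    obtain n' g' \<theta>' where n': "n' \<in> Mon C" "Cod C n' = c" "g' \<in> hom C (Dom C n') Y" and
      \<theta>': "\<And>j. j \<in> Obj J \<Longrightarrow> pullback C (m j) (\<theta>' j) (\<iota> j) n' \<and> g' \<circ>\<^bsub>C\<^esub> \<theta>' j = f j"
    proof (rule par_glue[OF J Y, of m f Z])
      show "m j \<in> Mon C \<and> Cod C (m j) = FObj T j \<and> f j \<in> hom C (Dom C (m j)) Y"
        if "j \<in> Obj J" for j using m f that by blast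
      show "pullback C (m (Dom J u)) (Z u) (FArr T u) (m (Cod J u)) \<and>
          f (Cod J u) \<circ>\<^bsub>C\<^esub> Z u = f (Dom J u)" if "u \<in> Arr J" for u using Z fZ that by blast
    qed blast
    have "pullback C (m j) (\<theta>' j) (\<iota> j) n' \<and> pullback C (m j) (\<theta> j) (\<iota> j) n \<and> n' \<circ>\<^bsub>C\<^esub> \<theta>' j = n \<circ>\<^bsub>C\<^esub> \<theta> j"
      if "j \<in> Obj J" for j
      using \<theta>[OF that] \<theta>'[OF that] pullbackD(5) by metis
    then obtain i where i: "i \<in> hom C (Dom C n) (Dom C n')" "n' \<circ>\<^bsub>C\<^esub> i = n"
      using par_unique[OF J n'(1,2) _ n(1,2)] mon_hom[OF n'(1)] nh n(2) n'(2) by metis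
    have gi: "g' \<circ>\<^bsub>C\<^esub> i \<in> hom C (Dom C n) Y" using comp_hom[OF i(1) n'(3)] .
    have gi\<theta>: "(g' \<circ>\<^bsub>C\<^esub> i) \<circ>\<^bsub>C\<^esub> \<theta> j = f j" if j: "j \<in> Obj J" for j
    proof -
      have t: "\<theta> j \<in> hom C (Dom C (m j)) (Dom C n)" and t': "\<theta>' j \<in> hom C (Dom C (m j)) (Dom C n')"
        using pullbackD(2) \<theta>[OF j] \<theta>'[OF j] by blast+
      have "n' \<circ>\<^bsub>C\<^esub> (i \<circ>\<^bsub>C\<^esub> \<theta> j) = n' \<circ>\<^bsub>C\<^esub> \<theta>' j"
        using comp_assoc[OF t i(1) mon_hom[OF n'(1)]] i(2) \<theta>[OF j] \<theta>'[OF j] pullbackD(5) by metis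
      then have "i \<circ>\<^bsub>C\<^esub> \<theta> j = \<theta>' j"
        using monicD[OF mon_monic[OF n'(1)] mon_hom[OF n'(1)] comp_hom[OF t i(1)] t'] by simp
      then show ?thesis using comp_assoc[OF t i(1) n'(3)] \<theta>'[OF j] by simp
    qed
    show ?thesis
    proof (rule ex1I[of _ "g' \<circ>\<^bsub>C\<^esub> i"])
      show "g' \<circ>\<^bsub>C\<^esub> i \<in> hom C (Dom C n) Y \<and> (\<forall>j\<in>Obj J. (g' \<circ>\<^bsub>C\<^esub> i) \<circ>\<^bsub>C\<^esub> \<theta> j = f j)"
        using gi gi\<theta> by blast
      fix h assume h: "h \<in> hom C (Dom C n) Y \<and> (\<forall>j\<in>Obj J. h \<circ>\<^bsub>C\<^esub> \<theta> j = f j)"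
      have *: "pullback C (m j) (\<theta> j) (\<iota> j) n \<and> pullback C (m j) (\<theta> j) (\<iota> j) n \<and>
          h \<circ>\<^bsub>C\<^esub> \<theta> j = (g' \<circ>\<^bsub>C\<^esub> i) \<circ>\<^bsub>C\<^esub> \<theta> j" if "j \<in> Obj J" for j
        using \<theta>[OF that] h gi\<theta>[OF that] that by simp
      obtain e where e: "e \<in> hom C (Dom C n) (Dom C n)" "n \<circ>\<^bsub>C\<^esub> e = n" "h \<circ>\<^bsub>C\<^esub> e = g' \<circ>\<^bsub>C\<^esub> i"
        using par_unique[OF J n conjunct1[OF h] n gi *] by metis
      have "e = Ident C (Dom C n)"
        using monicD[OF mon_monic[OF n(1)] nh e(1) id_hom[OF dom_obj[OF nh]]] e(2)
          comp_id_right[OF nh] by simp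
      then show "h = g' \<circ>\<^bsub>C\<^esub> i"
        using e(3) comp_id_right[OF conjunct1[OF h]] by simp
    qed
  qed
  with that n \<theta> show thesis by blast
qed

text \<open>Compare \<open>n\<close> with a pullback \<open>n'\<close> of \<open>k\<close> along \<open>t\<close>. Both are domains of partial maps from \<open>c\<close>
  to the domain of \<open>k\<close>, with the same restrictions to the diagram, so they agree.\<close>

lemma pullback_over_colimit:
  assumes J: "small_category U J" "is_functor J C T" "is_colimit J C T c \<iota>"
    and n: "n \<in> Mon C" "Cod C n = c" and k: "k \<in> Mon C" and t: "t \<in> hom C c (Cod C k)"
    and s: "s \<in> hom C (Dom C n) (Dom C k)"
    and restr: "\<And>j. j \<in> Obj J \<Longrightarrow> pullback C (m j) (\<theta> j) (\<iota> j) n"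
    and local: "\<And>j. j \<in> Obj J \<Longrightarrow> pullback C (m j) (s \<circ>\<^bsub>C\<^esub> \<theta> j) (t \<circ>\<^bsub>C\<^esub> \<iota> j) k"
  shows "pullback C n s t k"
proof -
  have coc: "is_cocone J C T c \<iota>" using J(3) unfolding is_colimit_def by blast
  have \<iota>: "\<iota> j \<in> hom C (FObj T j) c" if "j \<in> Obj J" for j
    using coc that unfolding is_cocone_def by blast
  obtain n' s' where pb: "pullback C n' s' t k" using mon_pullbackE[OF k t] .
  note pb' = pullbackD[OF pb]
  have n': "n' \<in> Mon C" "Cod C n' = c"
    using mon_pullback[OF k pb] hom_cod[OF pb'(1)] hom_dom[OF t] by simp_all
  have "\<exists>\<theta>'. pullback C (m j) \<theta>' (\<iota> j) n' \<and> s' \<circ>\<^bsub>C\<^esub> \<theta>' = s \<circ>\<^bsub>C\<^esub> \<theta> j" if j: "j \<in> Obj J" for j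
  proof -
    have "\<iota> j \<in> hom C (FObj T j) (Dom C t)" using \<iota>[OF j] hom_dom[OF t] by simp
    from pullback_cancelE[OF pb local[OF j] this] show ?thesis by metis
  qed
  then obtain \<theta>' where \<theta>': "\<And>j. j \<in> Obj J \<Longrightarrow> pullback C (m j) (\<theta>' j) (\<iota> j) n' \<and>
      s' \<circ>\<^bsub>C\<^esub> \<theta>' j = s \<circ>\<^bsub>C\<^esub> \<theta> j"
    by metis
  have *: "pullback C (m j) (\<theta>' j) (\<iota> j) n' \<and> pullback C (m j) (\<theta> j) (\<iota> j) n \<and>
      s' \<circ>\<^bsub>C\<^esub> \<theta>' j = s \<circ>\<^bsub>C\<^esub> \<theta> j" if "j \<in> Obj J" for j
    using \<theta>'[OF that] restr[OF that] by blast
  have "s' \<in> hom C (Dom C n') (Dom C k)" using pb'(2) .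
  from par_unique[OF J n' this n s *]
  obtain i where "i \<in> hom C (Dom C n) (Dom C n')" "iso C i" "n' \<circ>\<^bsub>C\<^esub> i = n" "s' \<circ>\<^bsub>C\<^esub> i = s"
    by metis
  then show ?thesis
    using pullback_isos_transfer[OF pb] by metis
qed

end

section \<open>Categories of functors\<close>

lemma nat_transD:
  assumes "is_nat_trans A B \<alpha>"
  shows "is_functor A B (src \<alpha>)" "is_functor A B (tgt \<alpha>)"
    "X \<in> Obj A \<Longrightarrow> body \<alpha> X \<in> hom B (FObj (src \<alpha>) X) (FObj (tgt \<alpha>) X)"
    "f \<in> hom A X Y \<Longrightarrow> body \<alpha> Y \<circ>\<^bsub>B\<^esub> FArr (src \<alpha>) f = FArr (tgt \<alpha>) f \<circ>\<^bsub>B\<^esub> body \<alpha> X"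
  using assms unfolding is_nat_trans_def hom_def by auto

lemma nat_transI:
  assumes "is_functor A B F" "is_functor A B G" "\<alpha> \<in> extensional (Obj A)"
    and "\<And>X. X \<in> Obj A \<Longrightarrow> \<alpha> X \<in> hom B (FObj F X) (FObj G X)"
    and "\<And>X Y f. f \<in> hom A X Y \<Longrightarrow> \<alpha> Y \<circ>\<^bsub>B\<^esub> FArr F f = FArr G f \<circ>\<^bsub>B\<^esub> \<alpha> X"
  shows "is_nat_trans A B (Tagged F \<alpha> G)"
  using assms unfolding is_nat_trans_def by (simp add: arr_hom)

lemma nat_trans_eqI:
  assumes "is_nat_trans A B \<alpha>" "is_nat_trans A B \<beta>" "src \<alpha> = src \<beta>" "tgt \<alpha> = tgt \<beta>"
    and "\<And>X. X \<in> Obj A \<Longrightarrow> body \<alpha> X = body \<beta> X"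
  shows "\<alpha> = \<beta>"
proof -
  have "body \<alpha> = body \<beta>"
    using assms unfolding is_nat_trans_def by (intro extensionalityI[of _ "Obj A"]) auto
  then show ?thesis using assms(3,4) by (cases \<alpha>; cases \<beta>) simp
qed

lemma functor_cat_sel [simp]:
  "Obj (functor_cat A B) = {F. is_functor A B F}"
  "Arr (functor_cat A B) = {\<alpha>. is_nat_trans A B \<alpha>}"
  "Dom (functor_cat A B) = src" "Cod (functor_cat A B) = tgt"
  "Ident (functor_cat A B) F = Tagged F (\<lambda>X\<in>Obj A. Ident B (FObj F X)) F"
  "\<beta> \<circ>\<^bsub>functor_cat A B\<^esub> \<alpha> =
    Tagged (src \<alpha>) (\<lambda>X\<in>Obj A. body \<beta> X \<circ>\<^bsub>B\<^esub> body \<alpha> X) (tgt \<beta>)"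
  by (simp_all add: functor_cat_def)

lemma category_functor_cat:
  assumes "category A" "category B"
  shows "category (functor_cat A B)"
proof -
  interpret A: Category A using assms(1) by unfold_locales
  interpret B: Category B using assms(2) by unfold_locales
  show ?thesis
  proof (rule categoryI)
    fix F assume "F \<in> Obj (functor_cat A B)"
    then have F: "is_functor A B F" by simp
    have "is_nat_trans A B (Ident (functor_cat A B) F)"
      unfolding functor_cat_sel
    proof (rule nat_transI[OF F F])
      fix X Y f assume f: "f \<in> hom A X Y"
      show "(\<lambda>X\<in>Obj A. Ident B (FObj F X)) Y \<circ>\<^bsub>B\<^esub> FArr F f =
          FArr F f \<circ>\<^bsub>B\<^esub> (\<lambda>X\<in>Obj A. Ident B (FObj F X)) X"
        using A.dom_obj[OF f] A.cod_obj[OF f] B.comp_id_left B.comp_id_right is_functorD(2)[OF F f]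
        by simp
    qed (use is_functorD(1)[OF F] B.id_hom in auto)
    then show "Ident (functor_cat A B) F \<in> hom (functor_cat A B) F F"
      by (simp add: hom_iff)
  next
    fix F G H \<alpha> \<beta> assume "\<alpha> \<in> hom (functor_cat A B) F G" "\<beta> \<in> hom (functor_cat A B) G H"
    then have \<alpha>: "is_nat_trans A B \<alpha>" "src \<alpha> = F" "tgt \<alpha> = G"
      and \<beta>: "is_nat_trans A B \<beta>" "src \<beta> = G" "tgt \<beta> = H"
      by (auto simp: hom_iff)
    note a = nat_transD[OF \<alpha>(1), unfolded \<alpha>(2,3)] and b = nat_transD[OF \<beta>(1), unfolded \<beta>(2,3)]
    have "is_nat_trans A B (\<beta> \<circ>\<^bsub>functor_cat A B\<^esub> \<alpha>)"
      unfolding functor_cat_sel \<alpha>(2) \<beta>(3)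
    proof (rule nat_transI[OF a(1) b(2)])
      fix X Y f assume f: "f \<in> hom A X Y"
      then have X: "X \<in> Obj A" and Y: "Y \<in> Obj A" using A.dom_obj A.cod_obj by blast+
      have "(body \<beta> Y \<circ>\<^bsub>B\<^esub> body \<alpha> Y) \<circ>\<^bsub>B\<^esub> FArr F f = FArr H f \<circ>\<^bsub>B\<^esub> (body \<beta> X \<circ>\<^bsub>B\<^esub> body \<alpha> X)"
        using B.comp_assoc[OF is_functorD(2)[OF a(1) f] a(3)[OF Y] b(3)[OF Y]]
          B.comp_assoc[OF a(3)[OF X] is_functorD(2)[OF b(1) f] b(3)[OF Y]]
          B.comp_assoc[OF a(3)[OF X] b(3)[OF X] is_functorD(2)[OF b(2) f]] a(4)[OF f] b(4)[OF f]
        by simp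
      then show "(\<lambda>X\<in>Obj A. body \<beta> X \<circ>\<^bsub>B\<^esub> body \<alpha> X) Y \<circ>\<^bsub>B\<^esub> FArr F f =
          FArr H f \<circ>\<^bsub>B\<^esub> (\<lambda>X\<in>Obj A. body \<beta> X \<circ>\<^bsub>B\<^esub> body \<alpha> X) X"
        using X Y by simp
    qed (use B.comp_hom[OF a(3) b(3)] in auto)
    then show "\<beta> \<circ>\<^bsub>functor_cat A B\<^esub> \<alpha> \<in> hom (functor_cat A B) F H"
      using \<alpha> \<beta> by (simp add: hom_iff)
  next
    fix F G \<alpha> assume "\<alpha> \<in> hom (functor_cat A B) F G"
    then have \<alpha>: "is_nat_trans A B \<alpha>" "src \<alpha> = F" "tgt \<alpha> = G" by (auto simp: hom_iff)
    note a = nat_transD[OF \<alpha>(1), unfolded \<alpha>(2,3)]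
    have ext: "body \<alpha> \<in> extensional (Obj A)" using \<alpha>(1) unfolding is_nat_trans_def by blast
    have "(\<lambda>X\<in>Obj A. body \<alpha> X \<circ>\<^bsub>B\<^esub> (\<lambda>X\<in>Obj A. Ident B (FObj F X)) X) = body \<alpha>"
      using B.comp_id_right[OF a(3)] ext by (intro extensionalityI[of _ "Obj A"]) auto
    moreover have "(\<lambda>X\<in>Obj A. (\<lambda>X\<in>Obj A. Ident B (FObj G X)) X \<circ>\<^bsub>B\<^esub> body \<alpha> X) = body \<alpha>"
      using B.comp_id_left[OF a(3)] ext by (intro extensionalityI[of _ "Obj A"]) auto
    ultimately show "\<alpha> \<circ>\<^bsub>functor_cat A B\<^esub> Ident (functor_cat A B) F = \<alpha> \<and>
        Ident (functor_cat A B) G \<circ>\<^bsub>functor_cat A B\<^esub> \<alpha> = \<alpha>"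
      using \<alpha>(2,3) by (cases \<alpha>) simp
  next
    fix F G H K \<alpha> \<beta> \<gamma> assume "\<alpha> \<in> hom (functor_cat A B) F G" "\<beta> \<in> hom (functor_cat A B) G H"
      "\<gamma> \<in> hom (functor_cat A B) H K"
    then have \<alpha>: "is_nat_trans A B \<alpha>" "src \<alpha> = F" "tgt \<alpha> = G"
      and \<beta>: "is_nat_trans A B \<beta>" "src \<beta> = G" "tgt \<beta> = H"
      and \<gamma>: "is_nat_trans A B \<gamma>" "src \<gamma> = H" "tgt \<gamma> = K"
      by (auto simp: hom_iff)
    show "\<gamma> \<circ>\<^bsub>functor_cat A B\<^esub> (\<beta> \<circ>\<^bsub>functor_cat A B\<^esub> \<alpha>) = (\<gamma> \<circ>\<^bsub>functor_cat A B\<^esub> \<beta>) \<circ>\<^bsub>functor_cat A B\<^esub> \<alpha>"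
      using B.comp_assoc[OF nat_transD(3)[OF \<alpha>(1), unfolded \<alpha>] nat_transD(3)[OF \<beta>(1), unfolded \<beta>]
          nat_transD(3)[OF \<gamma>(1), unfolded \<gamma>]]
      by (auto intro!: restrict_ext)
  qed (auto simp: nat_transD)
qed

lemma category_subcategory:
  assumes "category A"
    and "\<And>X. X \<in> O' \<Longrightarrow> X \<in> Obj A \<and> Ident A X \<in> R"
    and "\<And>f. f \<in> R \<Longrightarrow> f \<in> Arr A \<and> Dom A f \<in> O' \<and> Cod A f \<in> O'"
    and "\<And>X Y Z f g. f \<in> R \<Longrightarrow> g \<in> R \<Longrightarrow> f \<in> hom A X Y \<Longrightarrow> g \<in> hom A Y Z \<Longrightarrow> g \<circ>\<^bsub>A\<^esub> f \<in> R"
  shows "category (A\<lparr>Obj := O', Arr := R\<rparr>)"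
proof -
  interpret A: Category A using assms(1) by unfold_locales
  have hom: "f \<in> hom (A\<lparr>Obj := O', Arr := R\<rparr>) X Y \<longleftrightarrow> f \<in> R \<and> f \<in> hom A X Y" for f X Y
    using assms(3) by (auto simp: hom_iff)
  show ?thesis
  proof (rule categoryI, unfold hom)
    show "g \<circ>\<^bsub>A\<lparr>Obj := O', Arr := R\<rparr>\<^esub> f \<in> R \<and> g \<circ>\<^bsub>A\<lparr>Obj := O', Arr := R\<rparr>\<^esub> f \<in> hom A X Z"
      if "f \<in> R \<and> f \<in> hom A X Y" "g \<in> R \<and> g \<in> hom A Y Z" for X Y Z f g
      using assms(4)[of f g X Y Z] A.comp_hom[of f X Y g Z] that by simp
    show "f \<circ>\<^bsub>A\<lparr>Obj := O', Arr := R\<rparr>\<^esub> Ident (A\<lparr>Obj := O', Arr := R\<rparr>) X = f \<and>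
        Ident (A\<lparr>Obj := O', Arr := R\<rparr>) Y \<circ>\<^bsub>A\<lparr>Obj := O', Arr := R\<rparr>\<^esub> f = f"
      if "f \<in> R \<and> f \<in> hom A X Y" for X Y f
      using A.comp_id_left[of f X Y] A.comp_id_right[of f X Y] that by simp
    show "h \<circ>\<^bsub>A\<lparr>Obj := O', Arr := R\<rparr>\<^esub> (g \<circ>\<^bsub>A\<lparr>Obj := O', Arr := R\<rparr>\<^esub> f) =
        (h \<circ>\<^bsub>A\<lparr>Obj := O', Arr := R\<rparr>\<^esub> g) \<circ>\<^bsub>A\<lparr>Obj := O', Arr := R\<rparr>\<^esub> f"
      if "f \<in> R \<and> f \<in> hom A W X" "g \<in> R \<and> g \<in> hom A X Y" "h \<in> R \<and> h \<in> hom A Y Z"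
      for W X Y Z f g h
      using A.comp_assoc[of f W X g Y h Z] that by simp
  qed (use assms(2,3) A.id_hom in simp_all)
qed

lemma op_cat_sel [simp]:
  "Obj (op_cat C) = Obj C" "Arr (op_cat C) = Arr C" "Dom (op_cat C) = Cod C"
  "Cod (op_cat C) = Dom C" "Ident (op_cat C) = Ident C" "g \<circ>\<^bsub>op_cat C\<^esub> f = f \<circ>\<^bsub>C\<^esub> g"
  by (simp_all add: op_cat_def)

lemma hom_op_cat [simp]: "hom (op_cat C) X Y = hom C Y X"
  by (auto simp: hom_def)

lemma (in Category) category_op_cat: "category (op_cat C)"
  by (rule categoryI)
    (use dom_obj[OF arr_hom] cod_obj[OF arr_hom] id_hom comp_hom comp_id_left comp_id_right comp_assoc
      in simp_all)

lemma Set_cat_sel [simp]: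
  "Obj (Set_cat U) = {A. small U A}" "Dom (Set_cat U) = src" "Cod (Set_cat U) = tgt"
  "Ident (Set_cat U) A = Tagged A (\<lambda>x\<in>A. x) A"
  "g \<circ>\<^bsub>Set_cat U\<^esub> f = Tagged (src f) (compose (src f) (body g) (body f)) (tgt g)"
  by (simp_all add: Set_cat_def)

lemma Set_cat_hom_iff:
  "\<phi> \<in> hom (Set_cat U) A B \<longleftrightarrow>
    \<phi> = Tagged A (body \<phi>) B \<and> small U A \<and> small U B \<and> body \<phi> \<in> A \<rightarrow>\<^sub>E B"
  by (cases \<phi>) (auto simp: hom_def Set_cat_def)

lemma category_Set_cat: "category (Set_cat U)"
proof (rule categoryI)
  show "Dom (Set_cat U) f \<in> Obj (Set_cat U) \<and> Cod (Set_cat U) f \<in> Obj (Set_cat U)"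
    if "f \<in> Arr (Set_cat U)" for f
    using that by (auto simp: Set_cat_def)
  show "f \<circ>\<^bsub>Set_cat U\<^esub> Ident (Set_cat U) X = f \<and> Ident (Set_cat U) Y \<circ>\<^bsub>Set_cat U\<^esub> f = f"
    if "f \<in> hom (Set_cat U) X Y" for X Y f
  proof -
    from that have f: "f = Tagged X (body f) Y" "body f \<in> X \<rightarrow>\<^sub>E Y"
      by (auto simp: Set_cat_hom_iff)
    have "compose X (body f) (\<lambda>x\<in>X. x) = body f" "compose X (\<lambda>x\<in>Y. x) (body f) = body f"
      using f(2) by (auto simp: compose_def fun_eq_iff PiE_iff extensional_def)
    with f(1) show ?thesis
      by (metis Set_cat_sel(4,5) tagged.sel)
  qed
  show "h \<circ>\<^bsub>Set_cat U\<^esub> (g \<circ>\<^bsub>Set_cat U\<^esub> f) = (h \<circ>\<^bsub>Set_cat U\<^esub> g) \<circ>\<^bsub>Set_cat U\<^esub> f"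
    if "f \<in> hom (Set_cat U) W X" "g \<in> hom (Set_cat U) X Y" "h \<in> hom (Set_cat U) Y Z" for W X Y Z f g h
  proof -
    have eqs: "src f = W" "src g = X" using that by (auto simp: hom_iff)
    have "body f x \<in> X" if "x \<in> W" for x
      using \<open>f \<in> hom (Set_cat U) W X\<close> that unfolding Set_cat_hom_iff by blast
    then have "compose W (body h) (compose W (body g) (body f)) =
        compose W (compose X (body h) (body g)) (body f)"
      by (auto simp: compose_def intro!: restrict_ext)
    with eqs show ?thesis by simp
  qed
  show "g \<circ>\<^bsub>Set_cat U\<^esub> f \<in> hom (Set_cat U) X Z"
    if "f \<in> hom (Set_cat U) X Y" "g \<in> hom (Set_cat U) Y Z" for X Y Z f g
    using that by (cases f; cases g) (auto simp: Set_cat_hom_iff compose_def)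
qed (auto simp: Set_cat_hom_iff)


section \<open>Presheaves in terms of elements\<close>

text \<open>Presheaves and their maps are handled through elements: \<open>act P f x\<close> is the restriction of
  \<open>x\<close> along \<open>f\<close>, and \<open>app \<mu> X x\<close> is the image of \<open>x\<close>. The functors and natural transformations
  that underlie them are only built by the two constructors below, which take care of
  extensionality.\<close>

definition act :: "('o, 'a, 'u) presheaf \<Rightarrow> 'a \<Rightarrow> 'a + 'u \<Rightarrow> 'a + 'u" where
  "act P f x = body (FArr P f) x"

definition app :: "('o, 'a, 'u) presheaf_map \<Rightarrow> 'o \<Rightarrow> 'a + 'u \<Rightarrow> 'a + 'u" where
  "app \<mu> X x = body (body \<mu> X) x"

definition mk_presheaf ::
  "('o, 'a, 'm) cat_scheme \<Rightarrow> ('o \<Rightarrow> ('a + 'u) set) \<Rightarrow> ('a \<Rightarrow> 'a + 'u \<Rightarrow> 'a + 'u)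
     \<Rightarrow> ('o, 'a, 'u) presheaf" where
  "mk_presheaf C E a =
     \<lparr>FObj = (\<lambda>X\<in>Obj C. E X),
      FArr = (\<lambda>f\<in>Arr C. Tagged (E (Cod C f)) (\<lambda>x\<in>E (Cod C f). a f x) (E (Dom C f)))\<rparr>"

definition mk_presheaf_map ::
  "('o, 'a, 'm) cat_scheme \<Rightarrow> ('o, 'a, 'u) presheaf \<Rightarrow> ('o, 'a, 'u) presheaf
     \<Rightarrow> ('o \<Rightarrow> 'a + 'u \<Rightarrow> 'a + 'u) \<Rightarrow> ('o, 'a, 'u) presheaf_map" where
  "mk_presheaf_map C P Q t =
     Tagged P (\<lambda>X\<in>Obj C. Tagged (FObj P X) (\<lambda>x\<in>FObj P X. t X x) (FObj Q X)) Q"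

text \<open>The map out of a representable that corresponds to an element under the Yoneda lemma.\<close>

definition elem_map ::
  "('o, 'a, 'm) cat_scheme \<Rightarrow> ('o, 'a, 'u) presheaf \<Rightarrow> 'o \<Rightarrow> 'a + 'u
     \<Rightarrow> ('o, 'a, 'u) presheaf_map" where
  "elem_map C P X x = mk_presheaf_map C (representable C X) P (\<lambda>W e. act P (projl e) x)"

lemma presheaf_cat_sel [simp]:
  "Obj (presheaf_cat U C) = {P. is_functor (op_cat C) (Set_cat U) P}"
  "Dom (presheaf_cat U C) = src" "Cod (presheaf_cat U C) = tgt"
  by (simp_all add: presheaf_cat_def)

locale Presheaves = Category C for C :: "('o, 'a, 'm) cat_scheme" +
  fixes U :: "'u itself"
  assumes hom_small: "X \<in> Obj C \<Longrightarrow> Y \<in> Obj C \<Longrightarrow> small U (hom C X Y)"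
begin

abbreviation Psh :: "(('o, 'a, 'u) presheaf, ('o, 'a, 'u) presheaf_map) cat" where
  "Psh \<equiv> presheaf_cat U C"

abbreviation psh :: "('o, 'a, 'u) presheaf \<Rightarrow> bool" where
  "psh P \<equiv> is_functor (op_cat C) (Set_cat U) P"

abbreviation rep :: "'o \<Rightarrow> ('o, 'a, 'u) presheaf" where
  "rep \<equiv> representable C"

abbreviation yo :: "('o, 'a, ('o, 'a, 'u) presheaf, ('o, 'a, 'u) presheaf_map) fctr" where
  "yo \<equiv> yoneda C"

lemma category_Psh: "category Psh"
  unfolding presheaf_cat_def using category_functor_cat[OF category_op_cat category_Set_cat] .

sublocale Psh: Category Psh
  using category_Psh by unfold_locales

lemma psh_arr:
  assumes "psh P" "f \<in> hom C W X"
  shows "FArr P f = Tagged (FObj P X) (body (FArr P f)) (FObj P W)"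
    and "body (FArr P f) \<in> FObj P X \<rightarrow>\<^sub>E FObj P W"
proof -
  have "FArr P f \<in> hom (Set_cat U) (FObj P X) (FObj P W)"
    using is_functorD(2)[OF assms(1), of f X W] assms(2) by simp
  then show "FArr P f = Tagged (FObj P X) (body (FArr P f)) (FObj P W)"
    and "body (FArr P f) \<in> FObj P X \<rightarrow>\<^sub>E FObj P W"
    unfolding Set_cat_hom_iff by blast+
qed

lemma psh_small: "psh P \<Longrightarrow> X \<in> Obj C \<Longrightarrow> small U (FObj P X)"
  using is_functorD(1)[of "op_cat C" "Set_cat U" P X] by simp

lemma act_in: "psh P \<Longrightarrow> f \<in> hom C W X \<Longrightarrow> x \<in> FObj P X \<Longrightarrow> act P f x \<in> FObj P W"
  unfolding act_def by (rule PiE_mem[OF psh_arr(2)])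

lemma act_id: "psh P \<Longrightarrow> X \<in> Obj C \<Longrightarrow> x \<in> FObj P X \<Longrightarrow> act P (Ident C X) x = x"
  using is_functorD(3)[of "op_cat C" "Set_cat U" P X] unfolding act_def by simp

lemma act_comp:
  assumes "psh P" "f \<in> hom C V W" "g \<in> hom C W X" "x \<in> FObj P X"
  shows "act P (g \<circ>\<^bsub>C\<^esub> f) x = act P f (act P g x)"
proof -
  have "FArr P (g \<circ>\<^bsub>C\<^esub> f) = FArr P f \<circ>\<^bsub>Set_cat U\<^esub> FArr P g"
    using is_functorD(4)[OF assms(1), of g X W f V] assms(2,3) by simp
  moreover have "src (FArr P g) = FObj P X"
    using psh_arr(1)[OF assms(1,3)] by (metis tagged.sel(1))
  ultimately show ?thesis
    using assms(4) unfolding act_def by (simp add: compose_def)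
qed

lemma mk_presheaf_obj [simp]: "X \<in> Obj C \<Longrightarrow> FObj (mk_presheaf C E a) X = E X"
  by (simp add: mk_presheaf_def)

lemma mk_presheaf_act:
  "f \<in> hom C W X \<Longrightarrow> x \<in> E X \<Longrightarrow> act (mk_presheaf C E a) f x = a f x"
  by (simp add: mk_presheaf_def act_def hom_iff)

lemma psh_mk_presheaf:
  assumes "\<And>X. X \<in> Obj C \<Longrightarrow> small U (E X)"
    and "\<And>W X f x. f \<in> hom C W X \<Longrightarrow> x \<in> E X \<Longrightarrow> a f x \<in> E W"
    and "\<And>X x. X \<in> Obj C \<Longrightarrow> x \<in> E X \<Longrightarrow> a (Ident C X) x = x"
    and "\<And>V W X f g x. f \<in> hom C V W \<Longrightarrow> g \<in> hom C W X \<Longrightarrow> x \<in> E X \<Longrightarrow>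
           a (g \<circ>\<^bsub>C\<^esub> f) x = a f (a g x)"
  shows "psh (mk_presheaf C E a)"
proof (rule is_functorI)
  fix X assume X: "X \<in> Obj (op_cat C)"
  then show "FObj (mk_presheaf C E a) X \<in> Obj (Set_cat U)"
    using assms(1) by simp
  have "(\<lambda>x\<in>E X. a (Ident C X) x) = (\<lambda>x\<in>E X. x)"
    using assms(3) X by (auto intro!: restrict_ext)
  then show "FArr (mk_presheaf C E a) (Ident (op_cat C) X) =
      Ident (Set_cat U) (FObj (mk_presheaf C E a) X)"
    using id_hom[of X] X by (simp add: mk_presheaf_def hom_iff)
next
  fix X W f assume "f \<in> hom (op_cat C) X W"
  then have f: "f \<in> hom C W X" by simp
  then have "W \<in> Obj C" "X \<in> Obj C" using dom_obj cod_obj by blast+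
  with f assms(2)[OF f] show "FArr (mk_presheaf C E a) f \<in>
      hom (Set_cat U) (FObj (mk_presheaf C E a) X) (FObj (mk_presheaf C E a) W)"
    using assms(1) unfolding Set_cat_hom_iff by (auto simp: mk_presheaf_def hom_iff)
next
  fix X W V g f assume "g \<in> hom (op_cat C) X W" "f \<in> hom (op_cat C) W V"
  then have g: "g \<in> hom C W X" and f: "f \<in> hom C V W" by auto
  have "(\<lambda>x\<in>E X. a (g \<circ>\<^bsub>C\<^esub> f) x) = compose (E X) (\<lambda>x\<in>E W. a f x) (\<lambda>x\<in>E X. a g x)"
    using assms(2)[OF g] assms(4)[OF f g] unfolding compose_def by (auto intro!: restrict_ext)
  then show "FArr (mk_presheaf C E a) (f \<circ>\<^bsub>op_cat C\<^esub> g) =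
      FArr (mk_presheaf C E a) f \<circ>\<^bsub>Set_cat U\<^esub> FArr (mk_presheaf C E a) g"
    using comp_hom[OF f g] f g by (simp add: mk_presheaf_def hom_iff)
qed (auto simp: mk_presheaf_def)

lemma map_psh: "\<mu> \<in> hom Psh P Q \<Longrightarrow> psh P" "\<mu> \<in> hom Psh P Q \<Longrightarrow> psh Q"
  using Psh.dom_obj Psh.cod_obj by auto

lemma map_component:
  assumes "\<mu> \<in> hom Psh P Q" "X \<in> Obj C"
  shows "body \<mu> X = Tagged (FObj P X) (body (body \<mu> X)) (FObj Q X)"
    and "body (body \<mu> X) \<in> FObj P X \<rightarrow>\<^sub>E FObj Q X"
proof -
  have "is_nat_trans (op_cat C) (Set_cat U) \<mu>" "src \<mu> = P" "tgt \<mu> = Q"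
    using assms(1) by (auto simp: hom_iff presheaf_cat_def)
  then have "body \<mu> X \<in> hom (Set_cat U) (FObj P X) (FObj Q X)"
    using nat_transD(3)[of "op_cat C" "Set_cat U" \<mu> X] assms(2) by simp
  then show "body \<mu> X = Tagged (FObj P X) (body (body \<mu> X)) (FObj Q X)"
    and "body (body \<mu> X) \<in> FObj P X \<rightarrow>\<^sub>E FObj Q X"
    unfolding Set_cat_hom_iff by blast+
qed

lemma app_in: "\<mu> \<in> hom Psh P Q \<Longrightarrow> X \<in> Obj C \<Longrightarrow> x \<in> FObj P X \<Longrightarrow> app \<mu> X x \<in> FObj Q X"
  unfolding app_def by (rule PiE_mem[OF map_component(2)])

lemma app_natural:
  assumes "\<mu> \<in> hom Psh P Q" "f \<in> hom C W X" "x \<in> FObj P X"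
  shows "app \<mu> W (act P f x) = act Q f (app \<mu> X x)"
proof -
  have W: "W \<in> Obj C" "X \<in> Obj C" using dom_obj[OF assms(2)] cod_obj[OF assms(2)] .
  have "is_nat_trans (op_cat C) (Set_cat U) \<mu>" "src \<mu> = P" "tgt \<mu> = Q"
    using assms(1) by (auto simp: hom_iff presheaf_cat_def)
  then have "body \<mu> W \<circ>\<^bsub>Set_cat U\<^esub> FArr P f = FArr Q f \<circ>\<^bsub>Set_cat U\<^esub> body \<mu> X"
    using nat_transD(4)[of "op_cat C" "Set_cat U" \<mu> f X W] assms(2) by (simp del: Set_cat_sel(5))
  from arg_cong[OF this, of body]
  have eq: "compose (src (FArr P f)) (body (body \<mu> W)) (body (FArr P f)) =
      compose (src (body \<mu> X)) (body (FArr Q f)) (body (body \<mu> X))"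
    unfolding Set_cat_sel tagged.sel .
  have "src (FArr P f) = FObj P X" "src (body \<mu> X) = FObj P X"
    using psh_arr(1)[OF map_psh(1)[OF assms(1)] assms(2)] map_component(1)[OF assms(1) W(2)]
    by (metis tagged.sel(1))+
  then show ?thesis
    using fun_cong[OF eq, of x] assms(3) by (simp add: app_def act_def compose_eq)
qed

lemma map_eqI:
  assumes "\<mu> \<in> hom Psh P Q" "\<nu> \<in> hom Psh P Q"
    and "\<And>X x. X \<in> Obj C \<Longrightarrow> x \<in> FObj P X \<Longrightarrow> app \<mu> X x = app \<nu> X x"
  shows "\<mu> = \<nu>"
proof (rule nat_trans_eqI[of "op_cat C" "Set_cat U"])
  fix X assume "X \<in> Obj (op_cat C)"
  then have X: "X \<in> Obj C" by simp
  have "body (body \<mu> X) = body (body \<nu> X)"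
    using map_component(2)[OF assms(1) X] map_component(2)[OF assms(2) X] assms(3)[OF X]
    unfolding app_def by (rule PiE_ext)
  then show "body \<mu> X = body \<nu> X"
    using map_component(1)[OF assms(1) X] map_component(1)[OF assms(2) X] by simp
qed (use assms in \<open>auto simp: hom_iff presheaf_cat_def\<close>)

lemma mk_presheaf_map_hom:
  assumes "psh P" "psh Q"
    and t: "\<And>X x. X \<in> Obj C \<Longrightarrow> x \<in> FObj P X \<Longrightarrow> t X x \<in> FObj Q X"
    and nat: "\<And>W X f x. f \<in> hom C W X \<Longrightarrow> x \<in> FObj P X \<Longrightarrow> t W (act P f x) = act Q f (t X x)"
  shows "mk_presheaf_map C P Q t \<in> hom Psh P Q"
proof -
  have "is_nat_trans (op_cat C) (Set_cat U) (mk_presheaf_map C P Q t)"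
    unfolding mk_presheaf_map_def
  proof (rule nat_transI[OF assms(1,2)])
    fix X assume X: "X \<in> Obj (op_cat C)"
    then show "(\<lambda>X\<in>Obj C. Tagged (FObj P X) (\<lambda>x\<in>FObj P X. t X x) (FObj Q X)) X \<in>
        hom (Set_cat U) (FObj P X) (FObj Q X)"
      using psh_small[OF assms(1)] psh_small[OF assms(2)] t by (auto simp: Set_cat_hom_iff)
  next
    fix X W f assume "f \<in> hom (op_cat C) X W"
    then have f: "f \<in> hom C W X" by simp
    have W: "W \<in> Obj C" "X \<in> Obj C" using dom_obj[OF f] cod_obj[OF f] .
    note Pf = psh_arr[OF assms(1) f] and Qf = psh_arr[OF assms(2) f]
    have "src (FArr P f) = FObj P X" "tgt (FArr Q f) = FObj Q W"
      using Pf(1) Qf(1) by (metis tagged.sel)+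
    moreover have "compose (FObj P X) (\<lambda>x\<in>FObj P W. t W x) (body (FArr P f)) =
        compose (FObj P X) (body (FArr Q f)) (\<lambda>x\<in>FObj P X. t X x)"
      using nat[OF f] act_in[OF assms(1) f] unfolding compose_def act_def by (auto intro!: restrict_ext)
    ultimately show "(\<lambda>X\<in>Obj C. Tagged (FObj P X) (\<lambda>x\<in>FObj P X. t X x) (FObj Q X)) W
          \<circ>\<^bsub>Set_cat U\<^esub> FArr P f =
        FArr Q f \<circ>\<^bsub>Set_cat U\<^esub> (\<lambda>X\<in>Obj C. Tagged (FObj P X) (\<lambda>x\<in>FObj P X. t X x) (FObj Q X)) X"
      using W by simp
  qed simp
  then show ?thesis
    by (simp add: hom_iff presheaf_cat_def) (simp add: mk_presheaf_map_def)
qed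

lemma app_mk_presheaf_map [simp]:
  "X \<in> Obj C \<Longrightarrow> x \<in> FObj P X \<Longrightarrow> app (mk_presheaf_map C P Q t) X x = t X x"
  by (simp add: app_def mk_presheaf_map_def)

lemma app_id: "X \<in> Obj C \<Longrightarrow> x \<in> FObj P X \<Longrightarrow> app (Ident Psh P) X x = x"
  by (simp add: app_def presheaf_cat_def)

lemma app_comp:
  assumes "\<mu> \<in> hom Psh P Q" "\<nu> \<in> hom Psh Q R" "X \<in> Obj C" "x \<in> FObj P X"
  shows "app (\<nu> \<circ>\<^bsub>Psh\<^esub> \<mu>) X x = app \<nu> X (app \<mu> X x)"
proof -
  have "src (body \<mu> X) = FObj P X"
    using map_component(1)[OF assms(1,3)] by (metis tagged.sel(1))
  then show ?thesis
    using assms(3,4) by (simp add: app_def presheaf_cat_def compose_eq)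
qed

lemma rep_eq: "rep X = mk_presheaf C (\<lambda>W. hom_set C W X) (\<lambda>f x. Inl (projl x \<circ>\<^bsub>C\<^esub> f))"
  by (simp add: representable_def mk_presheaf_def)

lemma rep_obj: "W \<in> Obj C \<Longrightarrow> FObj (rep X) W = Inl ` hom C W X"
  by (simp add: representable_def hom_set_def)

lemma rep_act: "f \<in> hom C V W \<Longrightarrow> g \<in> hom C W X \<Longrightarrow> act (rep X) f (Inl g) = Inl (g \<circ>\<^bsub>C\<^esub> f)"
  unfolding rep_eq by (subst mk_presheaf_act[where X = W]) (auto simp: hom_set_def)

lemma psh_rep: "X \<in> Obj C \<Longrightarrow> psh (rep X)"
  unfolding rep_eq
  by (rule psh_mk_presheaf)
    (auto simp: hom_set_def comp_hom comp_id_right comp_assoc intro!: small_image hom_small)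

lemma elem_map_hom:
  assumes "psh P" "X \<in> Obj C" "x \<in> FObj P X"
  shows "elem_map C P X x \<in> hom Psh (rep X) P"
  unfolding elem_map_def
proof (rule mk_presheaf_map_hom[OF psh_rep[OF assms(2)] assms(1)])
  show "act P (projl e) x \<in> FObj P W" if "W \<in> Obj C" "e \<in> FObj (rep X) W" for W e
    using that assms act_in by (auto simp: rep_obj)
  show "act P (projl (act (rep X) f e)) x = act P f (act P (projl e) x)"
    if "f \<in> hom C V W" "e \<in> FObj (rep X) W" for V W f e
    using that assms act_comp by (auto simp: rep_obj[OF cod_obj[OF that(1)]] rep_act[OF that(1)])
qed

lemma app_elem_map [simp]:
  fixes P :: "('o, 'a, 'u) presheaf"
  shows "f \<in> hom C W X \<Longrightarrow> app (elem_map C P X x) W (Inl f) = act P f x"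
proof -
  assume f: "f \<in> hom C W X"
  then show ?thesis
    using dom_obj[OF f] by (simp add: elem_map_def rep_obj)
qed

lemma app_elem_map_id:
  "psh P \<Longrightarrow> X \<in> Obj C \<Longrightarrow> x \<in> FObj P X \<Longrightarrow> app (elem_map C P X x) X (Inl (Ident C X)) = x"
  by (simp add: app_elem_map[OF id_hom] act_id)

lemma rep_id: "X \<in> Obj C \<Longrightarrow> Inl (Ident C X) \<in> FObj (rep X) X"
  by (simp add: rep_obj id_hom)

lemma elem_map_app:
  assumes "\<nu> \<in> hom Psh (rep X) P" "X \<in> Obj C"
  shows "elem_map C P X (app \<nu> X (Inl (Ident C X))) = \<nu>"
proof (rule map_eqI[OF elem_map_hom[OF map_psh(2)[OF assms(1)] assms(2)
        app_in[OF assms rep_id[OF assms(2)]]] assms(1)])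
  fix W e assume W: "W \<in> Obj C" and "e \<in> FObj (rep X) W"
  then obtain f where f: "e = Inl f" "f \<in> hom C W X" by (auto simp: rep_obj)
  show "app (elem_map C P X (app \<nu> X (Inl (Ident C X)))) W e = app \<nu> W e"
    using app_natural[OF assms(1) f(2) rep_id[OF assms(2)]] rep_act[OF f(2) id_hom[OF assms(2)]]
      comp_id_left[OF f(2)] f by simp
qed

lemma comp_elem_map:
  assumes "\<mu> \<in> hom Psh P Q" "X \<in> Obj C" "x \<in> FObj P X"
  shows "\<mu> \<circ>\<^bsub>Psh\<^esub> elem_map C P X x = elem_map C Q X (app \<mu> X x)"
proof -
  note e = elem_map_hom[OF map_psh(1)[OF assms(1)] assms(2,3)]
  have "app (\<mu> \<circ>\<^bsub>Psh\<^esub> elem_map C P X x) X (Inl (Ident C X)) = app \<mu> X x"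
    using app_comp[OF e assms(1,2) rep_id[OF assms(2)]]
      app_elem_map_id[OF map_psh(1)[OF assms(1)] assms(2,3)] by simp
  then show ?thesis
    using elem_map_app[OF Psh.comp_hom[OF e assms(1)] assms(2)] by simp
qed

lemma yo_obj: "X \<in> Obj C \<Longrightarrow> FObj yo X = rep X"
  by (simp add: yoneda_def)

lemma yo_arr: "g \<in> hom C W X \<Longrightarrow> FArr yo g = elem_map C (rep X) W (Inl g)"
proof -
  assume g: "g \<in> hom C W X"
  have "(\<lambda>V\<in>Obj C. Tagged (hom_set C V W) (\<lambda>x\<in>hom_set C V W. Inl (g \<circ>\<^bsub>C\<^esub> projl x)) (hom_set C V X)) =
     (\<lambda>V\<in>Obj C. Tagged (FObj (rep W) V) (\<lambda>x\<in>FObj (rep W) V. act (rep X) (projl x) (Inl g))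
       (FObj (rep X) V))"
    using g by (auto intro!: restrict_ext simp: rep_obj hom_set_def rep_act)
  then show ?thesis
    using g unfolding elem_map_def mk_presheaf_map_def by (simp add: yoneda_def hom_iff)
qed

lemma yo_hom: "g \<in> hom C W X \<Longrightarrow> FArr yo g \<in> hom Psh (rep W) (rep X)"
  using elem_map_hom[OF psh_rep] dom_obj cod_obj by (simp add: yo_arr rep_obj)

lemma app_yo: "g \<in> hom C W X \<Longrightarrow> f \<in> hom C V W \<Longrightarrow> app (FArr yo g) V (Inl f) = Inl (g \<circ>\<^bsub>C\<^esub> f)"
  by (simp add: yo_arr rep_act)

lemma elem_map_yo:
  assumes "psh P" "x \<in> FObj P X" "g \<in> hom C W X"
  shows "elem_map C P X x \<circ>\<^bsub>Psh\<^esub> FArr yo g = elem_map C P W (act P g x)"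
  using comp_elem_map[OF elem_map_hom[OF assms(1) cod_obj[OF assms(3)] assms(2)] dom_obj[OF assms(3)],
      of "Inl g"] assms(3) by (simp add: yo_arr rep_obj[OF dom_obj[OF assms(3)]])

lemma yo_functor: "is_functor C Psh yo"
proof (rule is_functorI)
  show "FArr yo (Ident C X) = Ident Psh (FObj yo X)" if X: "X \<in> Obj C" for X
  proof -
    have idp: "Ident Psh (rep X) \<in> hom Psh (rep X) (rep X)"
      using Psh.id_hom psh_rep[OF X] by simp
    have "elem_map C (rep X) X (app (Ident Psh (rep X)) X (Inl (Ident C X))) = Ident Psh (rep X)"
      using elem_map_app[OF idp X] .
    then show ?thesis
      using X app_id[OF X rep_id[OF X]] by (simp add: yo_arr[OF id_hom[OF X]] yo_obj)
  qed
  show "FArr yo (g \<circ>\<^bsub>C\<^esub> f) = FArr yo g \<circ>\<^bsub>Psh\<^esub> FArr yo f"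
    if f: "f \<in> hom C V W" and g: "g \<in> hom C W X" for V W X f g
    using elem_map_yo[OF psh_rep[OF cod_obj[OF g]] _ f, of "Inl g"] g f
    by (simp add: yo_arr[OF comp_hom[OF f g]] yo_arr[OF g] rep_obj[OF dom_obj[OF g]] rep_act)
qed (use yo_hom psh_rep dom_obj cod_obj in \<open>auto simp: yo_obj yoneda_def\<close>)

end

section \<open>Small presheaves\<close>

text \<open>Small index categories are categories on the type \<open>'u\<close>; this makes any category with small
  sets of objects and arrows available as one.\<close>

lemma small_category_copy:
  fixes U :: "'u itself" and E :: "('j, 'k) cat"
  assumes "category E" "small U (Obj E)" "small U (Arr E)"
  obtains J :: "('u, 'u) cat" and I where "small_category U J" "is_functor J E I"
    "inj_on (FObj I) (Obj J)" "FObj I ` Obj J = Obj E" "FArr I ` Arr J = Arr E"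
proof -
  interpret E: Category E using assms(1) by unfold_locales
  obtain eo :: "'j \<Rightarrow> 'u" where eo: "inj_on eo (Obj E)" using small_embedding[OF assms(2)] .
  obtain ea :: "'k \<Rightarrow> 'u" where ea: "inj_on ea (Arr E)" using small_embedding[OF assms(3)] .
  define io where "io = the_inv_into (Obj E) eo"
  define ia where "ia = the_inv_into (Arr E) ea"
  have io [simp]: "io (eo x) = x" if "x \<in> Obj E" for x
    unfolding io_def using the_inv_into_f_f[OF eo that] .
  have ia [simp]: "ia (ea f) = f" if "f \<in> Arr E" for f
    unfolding ia_def using the_inv_into_f_f[OF ea that] .
  define J :: "('u, 'u) cat" where
    "J = \<lparr>Obj = eo ` Obj E, Arr = ea ` Arr E, Dom = \<lambda>a. eo (Dom E (ia a)), Cod = \<lambda>a. eo (Cod E (ia a)),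
          Ident = \<lambda>x. ea (Ident E (io x)), Comp = \<lambda>b a. ea (ia b \<circ>\<^bsub>E\<^esub> ia a)\<rparr>"
  have obj: "Obj J = eo ` Obj E" and arr: "Arr J = ea ` Arr E"
    and ident: "Ident J (eo X) = ea (Ident E X)" if "X \<in> Obj E" for X
    using that by (simp_all add: J_def)
  have ext: "Dom E f \<in> Obj E" "Cod E f \<in> Obj E" if "f \<in> Arr E" for f
    using E.dom_obj[OF arr_hom[OF that]] E.cod_obj[OF arr_hom[OF that]] .
  have homE: "\<exists>X' Y' f'. f = ea f' \<and> X = eo X' \<and> Y = eo Y' \<and> f' \<in> hom E X' Y' \<and> X' \<in> Obj E \<and> Y' \<in> Obj E"
    if "f \<in> hom J X Y" for f X Y
    using that ext by (auto simp: hom_iff J_def)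
  have homI: "ea f \<in> hom J (eo X) (eo Y)" if "f \<in> hom E X Y" for f X Y
    using that by (auto simp: hom_iff J_def)
  have comp: "ea g \<circ>\<^bsub>J\<^esub> ea f = ea (g \<circ>\<^bsub>E\<^esub> f)" if "f \<in> Arr E" "g \<in> Arr E" for f g
    using that by (simp add: J_def)
  have eo_eq: "eo X = eo Y \<longleftrightarrow> X = Y" if "X \<in> Obj E" "Y \<in> Obj E" for X Y
    using inj_on_eq_iff[OF eo that] .
  have catJ: "category J"
  proof (rule categoryI)
    show "Dom J f \<in> Obj J \<and> Cod J f \<in> Obj J" if "f \<in> Arr J" for f
      using that ext by (auto simp: J_def)
    show "Ident J X \<in> hom J X X" if "X \<in> Obj J" for X
      using that homI[OF E.id_hom] by (auto simp: J_def)
    show "g \<circ>\<^bsub>J\<^esub> f \<in> hom J X Z" if f: "f \<in> hom J X Y" and g: "g \<in> hom J Y Z" for f g X Y Z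
    proof -
      obtain X' Y' f' Y'' Z' g' where f': "f = ea f'" "X = eo X'" "Y = eo Y'" "f' \<in> hom E X' Y'"
          "Y' \<in> Obj E"
        and g': "g = ea g'" "Y = eo Y''" "Z = eo Z'" "g' \<in> hom E Y'' Z'" "Y'' \<in> Obj E"
        using homE[OF f] homE[OF g] by metis
      then have "Y'' = Y'" using eo_eq by metis
      with f' g' show ?thesis
        using homI[OF E.comp_hom[OF f'(4), of g' Z']] comp[OF hom_arr[OF f'(4)] hom_arr[OF g'(4)]] by simp
    qed
    show "f \<circ>\<^bsub>J\<^esub> Ident J X = f \<and> Ident J Y \<circ>\<^bsub>J\<^esub> f = f" if "f \<in> hom J X Y" for f X Y
    proof -
      obtain X' Y' f' where f': "f = ea f'" "X = eo X'" "Y = eo Y'" "f' \<in> hom E X' Y'"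
          "X' \<in> Obj E" "Y' \<in> Obj E"
        using homE[OF \<open>f \<in> hom J X Y\<close>] by metis
      then show ?thesis
        using comp[OF hom_arr[OF E.id_hom[OF f'(5)]] hom_arr[OF f'(4)]]
          comp[OF hom_arr[OF f'(4)] hom_arr[OF E.id_hom[OF f'(6)]]]
          ident E.comp_id_left[OF f'(4)] E.comp_id_right[OF f'(4)] by simp
    qed
    show "h \<circ>\<^bsub>J\<^esub> (g \<circ>\<^bsub>J\<^esub> f) = (h \<circ>\<^bsub>J\<^esub> g) \<circ>\<^bsub>J\<^esub> f"
      if f: "f \<in> hom J W X" and g: "g \<in> hom J X Y" and h: "h \<in> hom J Y Z" for f g h W X Y Z
    proof -
      obtain W' X' f' X'' Y' g' Y'' Z' h' where f': "f = ea f'" "X = eo X'" "f' \<in> hom E W' X'" "X' \<in> Obj E"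
        and g': "g = ea g'" "X = eo X''" "Y = eo Y'" "g' \<in> hom E X'' Y'" "X'' \<in> Obj E" "Y' \<in> Obj E"
        and h': "h = ea h'" "Y = eo Y''" "h' \<in> hom E Y'' Z'" "Y'' \<in> Obj E"
        using homE[OF f] homE[OF g] homE[OF h] by metis
      have eqs: "X'' = X'" "Y'' = Y'"
        using eo_eq[OF g'(5) f'(4)] eo_eq[OF h'(4) g'(6)] f'(2) g'(2,3) h'(2) by simp_all
      note g4 = g'(4)[unfolded eqs] and h3 = h'(3)[unfolded eqs]
      note arrs = hom_arr[OF f'(3)] hom_arr[OF g4] hom_arr[OF h3]
        hom_arr[OF E.comp_hom[OF f'(3) g4]] hom_arr[OF E.comp_hom[OF g4 h3]]
      show ?thesis
        unfolding f'(1) g'(1) h'(1)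
        using E.comp_assoc[OF f'(3) g4 h3] arrs by (simp add: comp)
    qed
  qed
  define I :: "('u, 'u, 'j, 'k) fctr" where
    "I = \<lparr>FObj = (\<lambda>x\<in>Obj J. io x), FArr = (\<lambda>a\<in>Arr J. ia a)\<rparr>"
  have Io: "FObj I (eo X) = X" if "X \<in> Obj E" for X using that by (simp add: I_def J_def)
  have Ia: "FArr I (ea f) = f" if "f \<in> Arr E" for f using that by (simp add: I_def J_def)
  have "is_functor J E I"
  proof (rule is_functorI)
    show "FObj I \<in> extensional (Obj J)" "FArr I \<in> extensional (Arr J)" by (simp_all add: I_def)
    show "FObj I X \<in> Obj E" if "X \<in> Obj J" for X using that Io by (auto simp: J_def)
    show "FArr I f \<in> hom E (FObj I X) (FObj I Y)" if "f \<in> hom J X Y" for f X Y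
      using homE[OF that] Io Ia by (metis hom_arr)
    show "FArr I (Ident J X) = Ident E (FObj I X)" if "X \<in> Obj J" for X
      using that Io Ia ident hom_arr[OF E.id_hom] by (auto simp: obj[OF ext(1)] J_def)
    show "FArr I (g \<circ>\<^bsub>J\<^esub> f) = FArr I g \<circ>\<^bsub>E\<^esub> FArr I f"
      if f: "f \<in> hom J X Y" and g: "g \<in> hom J Y Z" for f g X Y Z
    proof -
      obtain X' Y' f' Y'' Z' g' where f': "f = ea f'" "Y = eo Y'" "f' \<in> hom E X' Y'" "Y' \<in> Obj E"
        and g': "g = ea g'" "Y = eo Y''" "g' \<in> hom E Y'' Z'" "Y'' \<in> Obj E"
        using homE[OF f] homE[OF g] by metis
      then have "Y'' = Y'" using eo_eq by metis
      then have "g' \<circ>\<^bsub>E\<^esub> f' \<in> Arr E" using hom_arr[OF E.comp_hom[OF f'(3)]] g'(3) by blast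
      then show ?thesis
        using comp[OF hom_arr[OF f'(3)] hom_arr[OF g'(3)]] Ia hom_arr[OF f'(3)] hom_arr[OF g'(3)]
        unfolding f'(1) g'(1) by simp
    qed
  qed
  moreover have "small_category U J"
    using catJ small_image[OF assms(2), of eo] small_image[OF assms(3), of ea] unfolding small_category_def
    by (simp add: J_def)
  moreover have "FObj I ` Obj J = Obj E" "FArr I ` Arr J = Arr E"
    using Io Ia by (force simp: J_def image_iff)+
  moreover have "inj_on (FObj I) (Obj J)"
    using Io by (auto simp: J_def inj_on_def)
  ultimately show thesis using that by blast
qed

context Presheaves
begin

text \<open>\<open>P\<close> is the colimit of the representables at the \<open>K j\<close>, with coprojections the maps that
  correspond to the elements \<open>x j\<close>.\<close>

definition presents ::
  "('j, 'k, 'l) cat_scheme \<Rightarrow> ('j, 'k, 'o, 'a) fctr \<Rightarrow> ('o, 'a, 'u) presheaf \<Rightarrow> ('j \<Rightarrow> 'a + 'u) \<Rightarrow> bool"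
  where
  "presents J K P x \<longleftrightarrow> is_functor J C K \<and> psh P \<and>
     (\<forall>j\<in>Obj J. x j \<in> FObj P (FObj K j)) \<and>
     (\<forall>u\<in>Arr J. act P (FArr K u) (x (Cod J u)) = x (Dom J u)) \<and>
     (\<forall>Q y. psh Q \<longrightarrow> (\<forall>j\<in>Obj J. y j \<in> FObj Q (FObj K j)) \<longrightarrow>
        (\<forall>u\<in>Arr J. act Q (FArr K u) (y (Cod J u)) = y (Dom J u)) \<longrightarrow>
        (\<exists>!\<tau>. \<tau> \<in> hom Psh P Q \<and> (\<forall>j\<in>Obj J. app \<tau> (FObj K j) (x j) = y j)))"

lemma presentsD:
  assumes "presents J K P x"
  shows "is_functor J C K" "psh P" "j \<in> Obj J \<Longrightarrow> x j \<in> FObj P (FObj K j)"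
    "u \<in> Arr J \<Longrightarrow> act P (FArr K u) (x (Cod J u)) = x (Dom J u)"
  using assms unfolding presents_def by blast+

lemma presents_map_ex:
  assumes "presents J K P x" "psh Q" "\<And>j. j \<in> Obj J \<Longrightarrow> y j \<in> FObj Q (FObj K j)"
    "\<And>u. u \<in> Arr J \<Longrightarrow> act Q (FArr K u) (y (Cod J u)) = y (Dom J u)"
  obtains \<tau> where "\<tau> \<in> hom Psh P Q" "\<And>j. j \<in> Obj J \<Longrightarrow> app \<tau> (FObj K j) (x j) = y j"
proof -
  have "\<exists>!\<tau>. \<tau> \<in> hom Psh P Q \<and> (\<forall>j\<in>Obj J. app \<tau> (FObj K j) (x j) = y j)"
    using assms unfolding presents_def by simp
  then show thesis using that by (elim ex1E) blast
qed

lemma presents_map_unique: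
  assumes "category J" "presents J K P x" "\<sigma> \<in> hom Psh P Q" "\<tau> \<in> hom Psh P Q"
    "\<And>j. j \<in> Obj J \<Longrightarrow> app \<sigma> (FObj K j) (x j) = app \<tau> (FObj K j) (x j)"
  shows "\<sigma> = \<tau>"
proof -
  interpret J: Category J using assms(1) by unfold_locales
  let ?y = "\<lambda>j. app \<tau> (FObj K j) (x j)"
  note K = is_functorD[OF presentsD(1)[OF assms(2)]]
  have "?y j \<in> FObj Q (FObj K j)" if "j \<in> Obj J" for j
    using app_in[OF assms(4) K(1)[OF that] presentsD(3)[OF assms(2) that]] .
  moreover have "act Q (FArr K u) (?y (Cod J u)) = ?y (Dom J u)" if u: "u \<in> Arr J" for u
    using app_natural[OF assms(4) K(2)[OF arr_hom[OF u]] presentsD(3)[OF assms(2) J.cod_obj[OF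
        arr_hom[OF u]]]]
      presentsD(4)[OF assms(2) u] by simp
  ultimately have "\<exists>!\<tau>. \<tau> \<in> hom Psh P Q \<and> (\<forall>j\<in>Obj J. app \<tau> (FObj K j) (x j) = ?y j)"
    using assms(2) map_psh(2)[OF assms(4)] unfolding presents_def by simp
  with assms(3-5) show ?thesis by metis
qed

lemma presentsI:
  assumes "is_functor J C K" "psh P" "\<And>j. j \<in> Obj J \<Longrightarrow> x j \<in> FObj P (FObj K j)"
    "\<And>u. u \<in> Arr J \<Longrightarrow> act P (FArr K u) (x (Cod J u)) = x (Dom J u)"
    and "\<And>Q y. psh Q \<Longrightarrow> (\<And>j. j \<in> Obj J \<Longrightarrow> y j \<in> FObj Q (FObj K j)) \<Longrightarrow>
        (\<And>u. u \<in> Arr J \<Longrightarrow> act Q (FArr K u) (y (Cod J u)) = y (Dom J u)) \<Longrightarrow>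
        \<exists>\<tau>. \<tau> \<in> hom Psh P Q \<and> (\<forall>j\<in>Obj J. app \<tau> (FObj K j) (x j) = y j)"
    and "\<And>Q \<sigma> \<tau>. \<sigma> \<in> hom Psh P Q \<Longrightarrow> \<tau> \<in> hom Psh P Q \<Longrightarrow>
        (\<And>j. j \<in> Obj J \<Longrightarrow> app \<sigma> (FObj K j) (x j) = app \<tau> (FObj K j) (x j)) \<Longrightarrow> \<sigma> = \<tau>"
  shows "presents J K P x"
  unfolding presents_def
proof (intro conjI ballI allI impI)
  fix Q y assume "psh Q" "\<forall>j\<in>Obj J. y j \<in> FObj Q (FObj K j)"
    "\<forall>u\<in>Arr J. act Q (FArr K u) (y (Cod J u)) = y (Dom J u)"
  then obtain \<tau> where \<tau>: "\<tau> \<in> hom Psh P Q \<and> (\<forall>j\<in>Obj J. app \<tau> (FObj K j) (x j) = y j)"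
    using assms(5) by metis
  then show "\<exists>!\<tau>. \<tau> \<in> hom Psh P Q \<and> (\<forall>j\<in>Obj J. app \<tau> (FObj K j) (x j) = y j)"
    using assms(6) by (intro ex1I[of _ \<tau>]) (blast, metis)
qed (use assms(1-4) in auto)

text \<open>Under the Yoneda lemma, cocones on a diagram of representables with vertex \<open>Q\<close> are
  compatible families of elements of \<open>Q\<close>, so that the two universal properties are the same.\<close>

lemma presents_colimit:
  assumes "category J" "presents J K P x"
  shows "is_colimit J Psh (comp_functor J yo K) P (\<lambda>j. elem_map C P (FObj K j) (x j))"
proof -
  interpret J: Category J using assms(1) by unfold_locales
  note p = presentsD[OF assms(2)]
  note K = is_functorD[OF p(1)]
  have e: "elem_map C P (FObj K j) (x j) \<in> hom Psh (rep (FObj K j)) P" if "j \<in> Obj J" for j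
    using elem_map_hom[OF p(2) K(1)[OF that] p(3)[OF that]] .
  show ?thesis
    unfolding is_colimit_def
  proof (intro conjI allI impI)
    show "is_cocone J Psh (comp_functor J yo K) P (\<lambda>j. elem_map C P (FObj K j) (x j))"
      unfolding is_cocone_def
    proof (intro conjI ballI)
      show "P \<in> Obj Psh" using p(2) by simp
      show "elem_map C P (FObj K j) (x j) \<in> hom Psh (FObj (comp_functor J yo K) j) P" if "j \<in> Obj J" for j
        using e[OF that] that K(1) by (simp add: comp_functor_def yo_obj)
      fix u assume u: "u \<in> Arr J"
      show "elem_map C P (FObj K (Cod J u)) (x (Cod J u)) \<circ>\<^bsub>Psh\<^esub> FArr (comp_functor J yo K) u =
          elem_map C P (FObj K (Dom J u)) (x (Dom J u))"
        using elem_map_yo[OF p(2) p(3)[OF J.cod_obj[OF arr_hom[OF u]]] K(2)[OF arr_hom[OF u]]] p(4)[OF u] u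
        by (simp add: comp_functor_def)
    qed
    fix Q \<mu> assume coc: "is_cocone J Psh (comp_functor J yo K) Q \<mu>"
    then have Q: "psh Q" and \<mu>: "\<And>j. j \<in> Obj J \<Longrightarrow> \<mu> j \<in> hom Psh (rep (FObj K j)) Q"
      and nat: "\<And>u. u \<in> Arr J \<Longrightarrow> \<mu> (Cod J u) \<circ>\<^bsub>Psh\<^esub> FArr yo (FArr K u) = \<mu> (Dom J u)"
      using K(1) unfolding is_cocone_def by (auto simp: comp_functor_def yo_obj)
    define y where "y j = app (\<mu> j) (FObj K j) (Inl (Ident C (FObj K j)))" for j
    have y: "y j \<in> FObj Q (FObj K j)" if "j \<in> Obj J" for j
      unfolding y_def using app_in[OF \<mu>[OF that] K(1)[OF that] rep_id[OF K(1)[OF that]]] .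
    have \<mu>y: "\<mu> j = elem_map C Q (FObj K j) (y j)" if "j \<in> Obj J" for j
      unfolding y_def using elem_map_app[OF \<mu>[OF that] K(1)[OF that]] by simp
    have elem_inj: "a = b" if "elem_map C Q X a = elem_map C Q X b" "X \<in> Obj C" "a \<in> FObj Q X"
        "b \<in> FObj Q X"
      for a b X
      using app_elem_map_id[OF Q that(2,3)] app_elem_map_id[OF Q that(2,4)] that(1) by metis
    have "act Q (FArr K u) (y (Cod J u)) = y (Dom J u)" if u: "u \<in> Arr J" for u
    proof (rule elem_inj)
      have jk: "Dom J u \<in> Obj J" "Cod J u \<in> Obj J"
        using J.dom_obj[OF arr_hom[OF u]] J.cod_obj[OF arr_hom[OF u]] .
      note Ku = K(2)[OF arr_hom[OF u]]
      show "elem_map C Q (FObj K (Dom J u)) (act Q (FArr K u) (y (Cod J u))) =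
          elem_map C Q (FObj K (Dom J u)) (y (Dom J u))"
        using elem_map_yo[OF Q y[OF jk(2)] Ku] nat[OF u] \<mu>y[OF jk(1)] \<mu>y[OF jk(2)] by simp
      show "FObj K (Dom J u) \<in> Obj C" "act Q (FArr K u) (y (Cod J u)) \<in> FObj Q (FObj K (Dom J u))"
        "y (Dom J u) \<in> FObj Q (FObj K (Dom J u))"
        using K(1)[OF jk(1)] act_in[OF Q Ku y[OF jk(2)]] y[OF jk(1)] .
    qed
    then obtain \<tau> where \<tau>: "\<tau> \<in> hom Psh P Q" "\<And>j. j \<in> Obj J \<Longrightarrow> app \<tau> (FObj K j) (x j) = y j"
      using presents_map_ex[OF assms(2) Q y] by metis
    have iff: "h \<circ>\<^bsub>Psh\<^esub> elem_map C P (FObj K j) (x j) = \<mu> j \<longleftrightarrow> app h (FObj K j) (x j) = y j"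
      if "h \<in> hom Psh P Q" "j \<in> Obj J" for h j
      using comp_elem_map[OF that(1) K(1)[OF that(2)] p(3)[OF that(2)]] \<mu>y[OF that(2)]
        elem_inj[OF _ K(1)[OF that(2)] app_in[OF that(1) K(1)[OF that(2)] p(3)[OF that(2)]] y[OF that(2)]]
      by auto
    show "\<exists>!h. h \<in> hom Psh P Q \<and> (\<forall>j\<in>Obj J. h \<circ>\<^bsub>Psh\<^esub> elem_map C P (FObj K j) (x j) = \<mu> j)"
    proof (rule ex1I[of _ \<tau>])
      show "\<tau> \<in> hom Psh P Q \<and> (\<forall>j\<in>Obj J. \<tau> \<circ>\<^bsub>Psh\<^esub> elem_map C P (FObj K j) (x j) = \<mu> j)"
        using \<tau> iff by blast
      show "h = \<tau>" if "h \<in> hom Psh P Q \<and> (\<forall>j\<in>Obj J. h \<circ>\<^bsub>Psh\<^esub> elem_map C P (FObj K j) (x j) = \<mu> j)" for h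
      proof (rule presents_map_unique[OF assms conjunct1[OF that] \<tau>(1)])
        show "app h (FObj K j) (x j) = app \<tau> (FObj K j) (x j)" if "j \<in> Obj J" for j
          using iff[of h j] \<tau>(2)[OF that] that \<open>h \<in> hom Psh P Q \<and> _\<close> by simp
      qed
    qed
  qed
qed

lemma colimit_presents:
  assumes "category J" "is_functor J C K" "is_colimit J Psh (comp_functor J yo K) P \<kappa>"
  shows "presents J K P (\<lambda>j. app (\<kappa> j) (FObj K j) (Inl (Ident C (FObj K j))))"
proof -
  interpret J: Category J using assms(1) by unfold_locales
  note K = is_functorD[OF assms(2)]
  have "is_cocone J Psh (comp_functor J yo K) P \<kappa>" using assms(3) unfolding is_colimit_def by blast
  then have P: "psh P" and \<kappa>: "\<And>j. j \<in> Obj J \<Longrightarrow> \<kappa> j \<in> hom Psh (rep (FObj K j)) P"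
    and nat: "\<And>u. u \<in> Arr J \<Longrightarrow> \<kappa> (Cod J u) \<circ>\<^bsub>Psh\<^esub> FArr yo (FArr K u) = \<kappa> (Dom J u)"
    using K(1) unfolding is_cocone_def by (auto simp: comp_functor_def yo_obj)
  define x where "x j = app (\<kappa> j) (FObj K j) (Inl (Ident C (FObj K j)))" for j
  have x: "x j \<in> FObj P (FObj K j)" if "j \<in> Obj J" for j
    unfolding x_def using app_in[OF \<kappa>[OF that] K(1)[OF that] rep_id[OF K(1)[OF that]]] .
  have \<kappa>x: "\<kappa> j = elem_map C P (FObj K j) (x j)" if "j \<in> Obj J" for j
    unfolding x_def using elem_map_app[OF \<kappa>[OF that] K(1)[OF that]] by simp
  have elem_eq: "a = b"
    if "elem_map C Q X a = elem_map C Q X b" "psh Q" "X \<in> Obj C" "a \<in> FObj Q X" "b \<in> FObj Q X"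
    for a b X Q
    using app_elem_map_id[OF that(2,3,4)] app_elem_map_id[OF that(2,3,5)] that(1) by metis
  have cocone: "is_cocone J Psh (comp_functor J yo K) Q (\<lambda>j. elem_map C Q (FObj K j) (y j))"
    if Q: "psh Q" and y: "\<And>j. j \<in> Obj J \<Longrightarrow> y j \<in> FObj Q (FObj K j)"
      and "\<And>u. u \<in> Arr J \<Longrightarrow> act Q (FArr K u) (y (Cod J u)) = y (Dom J u)" for Q y
    unfolding is_cocone_def
  proof (intro conjI ballI)
    show "elem_map C Q (FObj K j) (y j) \<in> hom Psh (FObj (comp_functor J yo K) j) Q" if "j \<in> Obj J" for j
      using elem_map_hom[OF Q K(1)[OF that] y[OF that]] that K(1) by (simp add: comp_functor_def yo_obj)
    fix u assume u: "u \<in> Arr J"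
    show "elem_map C Q (FObj K (Cod J u)) (y (Cod J u)) \<circ>\<^bsub>Psh\<^esub> FArr (comp_functor J yo K) u =
          elem_map C Q (FObj K (Dom J u)) (y (Dom J u))"
      using elem_map_yo[OF Q y[OF J.cod_obj[OF arr_hom[OF u]]] K(2)[OF arr_hom[OF u]]] that(3)[OF u] u
      by (simp add: comp_functor_def)
  qed (use Q in simp)
  have "presents J K P x"
  proof (rule presentsI[OF assms(2) P x])
    show "act P (FArr K u) (x (Cod J u)) = x (Dom J u)" if u: "u \<in> Arr J" for u
    proof (rule elem_eq[OF _ P])
      have jk: "Dom J u \<in> Obj J" "Cod J u \<in> Obj J"
        using J.dom_obj[OF arr_hom[OF u]] J.cod_obj[OF arr_hom[OF u]] .
      note Ku = K(2)[OF arr_hom[OF u]]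
      show "elem_map C P (FObj K (Dom J u)) (act P (FArr K u) (x (Cod J u))) =
          elem_map C P (FObj K (Dom J u)) (x (Dom J u))"
        using elem_map_yo[OF P x[OF jk(2)] Ku] nat[OF u] \<kappa>x[OF jk(1)] \<kappa>x[OF jk(2)] by simp
      show "FObj K (Dom J u) \<in> Obj C" "act P (FArr K u) (x (Cod J u)) \<in> FObj P (FObj K (Dom J u))"
        "x (Dom J u) \<in> FObj P (FObj K (Dom J u))"
        using K(1)[OF jk(1)] act_in[OF P Ku x[OF jk(2)]] x[OF jk(1)] .
    qed
    have comp: "h \<circ>\<^bsub>Psh\<^esub> \<kappa> j = elem_map C Q (FObj K j) (app h (FObj K j) (x j))"
      if "h \<in> hom Psh P Q" "j \<in> Obj J" for h j Q
      using comp_elem_map[OF that(1) K(1)[OF that(2)] x[OF that(2)]] \<kappa>x[OF that(2)] by simp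
    show "\<exists>\<tau>. \<tau> \<in> hom Psh P Q \<and> (\<forall>j\<in>Obj J. app \<tau> (FObj K j) (x j) = y j)"
      if Q: "psh Q" and y: "\<And>j. j \<in> Obj J \<Longrightarrow> y j \<in> FObj Q (FObj K j)"
        and yu: "\<And>u. u \<in> Arr J \<Longrightarrow> act Q (FArr K u) (y (Cod J u)) = y (Dom J u)" for Q y
    proof -
      obtain h where h: "h \<in> hom Psh P Q" "\<And>j. j \<in> Obj J \<Longrightarrow> h \<circ>\<^bsub>Psh\<^esub> \<kappa> j = elem_map C Q (FObj K j) (y j)"
        using is_colimitD(2)[OF assms(3) cocone[OF Q y yu]] by metis
      have "app h (FObj K j) (x j) = y j" if "j \<in> Obj J" for j
        using elem_eq[OF _ Q K(1)[OF that] app_in[OF h(1) K(1)[OF that] x[OF that]] y[OF that]]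
          h(2)[OF that] comp[OF h(1) that] by simp
      with h(1) show ?thesis by blast
    qed
    show "\<sigma> = \<tau>" if s: "\<sigma> \<in> hom Psh P Q" and t: "\<tau> \<in> hom Psh P Q"
      and eq: "\<And>j. j \<in> Obj J \<Longrightarrow> app \<sigma> (FObj K j) (x j) = app \<tau> (FObj K j) (x j)" for Q \<sigma> \<tau>
    proof -
      have "is_cocone J Psh (comp_functor J yo K) Q (\<lambda>j. elem_map C Q (FObj K j) (app \<tau> (FObj K j) (x j)))"
      proof (rule cocone[OF map_psh(2)[OF t]])
        show "app \<tau> (FObj K j) (x j) \<in> FObj Q (FObj K j)" if "j \<in> Obj J" for j
          using app_in[OF t K(1)[OF that] x[OF that]] .
        show "act Q (FArr K u) (app \<tau> (FObj K (Cod J u)) (x (Cod J u))) = app \<tau>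
            (FObj K (Dom J u)) (x (Dom J u))"
          if u: "u \<in> Arr J" for u
          using app_natural[OF t K(2)[OF arr_hom[OF u]] x[OF J.cod_obj[OF arr_hom[OF u]]]]
            \<open>\<And>u. u \<in> Arr J \<Longrightarrow> act P (FArr K u) (x (Cod J u)) = x (Dom J u)\<close>[OF u] by simp
      qed
      then have "\<exists>!h. h \<in> hom Psh P Q \<and>
          (\<forall>j\<in>Obj J. h \<circ>\<^bsub>Psh\<^esub> \<kappa> j = elem_map C Q (FObj K j) (app \<tau> (FObj K j) (x j)))"
        using assms(3) unfolding is_colimit_def by blast
      with s t eq comp show ?thesis by metis
    qed
  qed
  then show ?thesis unfolding x_def .
qed

text \<open>The restrictions of the \<open>x j\<close> form a subpresheaf \<open>E\<close>. By the universal property there is a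
  map from \<open>P\<close> into it that fixes the \<open>x j\<close>, and followed by the inclusion it is the identity of
  \<open>P\<close>.\<close>

lemma presents_surj:
  assumes "category J" "presents J K P x" "X \<in> Obj C" "y \<in> FObj P X"
  obtains j f where "j \<in> Obj J" "f \<in> hom C X (FObj K j)" "y = act P f (x j)"
proof -
  note p = presentsD[OF assms(2)]
  note K = is_functorD[OF p(1)]
  define E where "E X = {act P f (x j) | j f. j \<in> Obj J \<and> f \<in> hom C X (FObj K j)}" for X
  have EP: "E X \<subseteq> FObj P X" for X
    using act_in[OF p(2) _ p(3)] unfolding E_def by blast
  \<comment> \<open>The subpresheaf of \<open>P\<close> with the elements \<open>E\<close>.\<close>
  let ?P' = "mk_presheaf C E (act P)"
  have P': "psh ?P'"
  proof (rule psh_mk_presheaf)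
    show "small U (E X)" if "X \<in> Obj C" for X
      using small_subset[OF psh_small[OF p(2) that] EP] .
    show "act P f e \<in> E W" if f: "f \<in> hom C W X" and e: "e \<in> E X" for W X f e
    proof -
      obtain j g where g: "j \<in> Obj J" "g \<in> hom C X (FObj K j)" "e = act P g (x j)"
        using e unfolding E_def by blast
      have "act P f e = act P (g \<circ>\<^bsub>C\<^esub> f) (x j)"
        using act_comp[OF p(2) f g(2) p(3)[OF g(1)]] g(3) by simp
      then show ?thesis
        using g(1) comp_hom[OF f g(2)] unfolding E_def by blast
    qed
  qed (use EP act_id[OF p(2)] act_comp[OF p(2)] in blast)+
  have xE: "x j \<in> E (FObj K j)" if "j \<in> Obj J" for j
    using act_id[OF p(2) K(1)[OF that] p(3)[OF that]] id_hom[OF K(1)[OF that]] that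
    unfolding E_def by (metis (mono_tags, lifting) mem_Collect_eq)
  interpret J: Category J using assms(1) by unfold_locales
  obtain \<tau> where \<tau>: "\<tau> \<in> hom Psh P ?P'" "\<And>j. j \<in> Obj J \<Longrightarrow> app \<tau> (FObj K j) (x j) = x j"
  proof (rule presents_map_ex[OF assms(2) P', of x])
    show "x j \<in> FObj ?P' (FObj K j)" if "j \<in> Obj J" for j
      using xE[OF that] K(1)[OF that] by simp
    show "act ?P' (FArr K u) (x (Cod J u)) = x (Dom J u)" if "u \<in> Arr J" for u
      using mk_presheaf_act[where E = E, OF K(2)[OF arr_hom[OF that]] xE[OF J.cod_obj[OF arr_hom[OF that]]]]
        p(4)[OF that] by simp
  qed blast
  let ?\<iota> = "mk_presheaf_map C ?P' P (\<lambda>_ e. e)"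
  have \<iota>: "?\<iota> \<in> hom Psh ?P' P"
    by (rule mk_presheaf_map_hom[OF P' p(2)])
      (use EP in \<open>auto simp: cod_obj mk_presheaf_act\<close>)
  have app\<iota>\<tau>: "app (?\<iota> \<circ>\<^bsub>Psh\<^esub> \<tau>) Z z = app \<tau> Z z" if "Z \<in> Obj C" "z \<in> FObj P Z" for Z z
    using app_comp[OF \<tau>(1) \<iota> that] app_in[OF \<tau>(1) that] that(1) by simp
  have "?\<iota> \<circ>\<^bsub>Psh\<^esub> \<tau> = Ident Psh P"
  proof (rule presents_map_unique[OF assms(1,2) Psh.comp_hom[OF \<tau>(1) \<iota>]])
    show "Ident Psh P \<in> hom Psh P P" using Psh.id_hom p(2) by simp
    show "app (?\<iota> \<circ>\<^bsub>Psh\<^esub> \<tau>) (FObj K j) (x j) = app (Ident Psh P) (FObj K j) (x j)" if "j \<in> Obj J" for j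
      using app\<iota>\<tau>[OF K(1)[OF that] p(3)[OF that]] \<tau>(2)[OF that] app_id[OF K(1)[OF that] p(3)[OF that]]
      by simp
  qed
  then have "y = app \<tau> X y"
    using app\<iota>\<tau>[OF assms(3,4)] app_id[OF assms(3,4)] by simp
  moreover have "app \<tau> X y \<in> E X"
    using app_in[OF \<tau>(1) assms(3,4)] assms(3) by simp
  ultimately show thesis
    using that unfolding E_def by auto
qed

text \<open>\<open>P\<close> is the left Kan extension of its restriction to the full subcategory on \<open>S\<close>, expressed
  by its mapping property. Presheaves with this property for one fixed \<open>S\<close> are closed under
  colimits for formal reasons, which cannot be said of the presentations of a presheaf by
  diagrams.\<close>

definition determined :: "'o set \<Rightarrow> ('o, 'a, 'u) presheaf \<Rightarrow> bool" where
  "determined S P \<longleftrightarrow> psh P \<and> S \<subseteq> Obj C \<and>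
     (\<forall>Q \<phi>. psh Q \<longrightarrow> (\<forall>s\<in>S. \<forall>x\<in>FObj P s. \<phi> s x \<in> FObj Q s) \<longrightarrow>
        (\<forall>s\<in>S. \<forall>s'\<in>S. \<forall>f\<in>hom C s s'. \<forall>x\<in>FObj P s'. \<phi> s (act P f x) = act Q f (\<phi> s' x)) \<longrightarrow>
        (\<exists>\<tau>\<in>hom Psh P Q. \<forall>s\<in>S. \<forall>x\<in>FObj P s. app \<tau> s x = \<phi> s x)) \<and>
     (\<forall>Q. \<forall>\<sigma>\<in>hom Psh P Q. \<forall>\<tau>\<in>hom Psh P Q.
        (\<forall>s\<in>S. \<forall>x\<in>FObj P s. app \<sigma> s x = app \<tau> s x) \<longrightarrow> \<sigma> = \<tau>)"

text \<open>A natural family on \<open>S\<close> is in particular a compatible family on the \<open>x j\<close>, which extends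
  uniquely. The extension agrees with the family on all of \<open>S\<close> since every element is a
  restriction of some \<open>x j\<close>.\<close>

lemma presents_determined:
  assumes "category J" "presents J K P x" "FObj K ` Obj J \<subseteq> S" "S \<subseteq> Obj C"
  shows "determined S P"
  unfolding determined_def
proof (intro conjI allI impI ballI)
  interpret J: Category J using assms(1) by unfold_locales
  note p = presentsD[OF assms(2)]
  note K = is_functorD[OF p(1)]
  have KS: "FObj K j \<in> S" if "j \<in> Obj J" for j using that assms(3) by blast
  show "psh P" "S \<subseteq> Obj C" using p(2) assms(4) .
  fix Q \<phi> assume Q: "psh Q" and \<phi>: "\<forall>s\<in>S. \<forall>x\<in>FObj P s. \<phi> s x \<in> FObj Q s"
    and nat: "\<forall>s\<in>S. \<forall>s'\<in>S. \<forall>f\<in>hom C s s'. \<forall>x\<in>FObj P s'. \<phi> s (act P f x) = act Q f (\<phi> s' x)"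
  obtain \<tau> where \<tau>: "\<tau> \<in> hom Psh P Q"
    "\<And>j. j \<in> Obj J \<Longrightarrow> app \<tau> (FObj K j) (x j) = \<phi> (FObj K j) (x j)"
  proof (rule presents_map_ex[OF assms(2) Q, of "\<lambda>j. \<phi> (FObj K j) (x j)"])
    show "\<phi> (FObj K j) (x j) \<in> FObj Q (FObj K j)" if "j \<in> Obj J" for j
      using \<phi> KS[OF that] p(3)[OF that] by blast
    show "act Q (FArr K u) (\<phi> (FObj K (Cod J u)) (x (Cod J u))) = \<phi> (FObj K (Dom J u)) (x (Dom J u))"
      if u: "u \<in> Arr J" for u
    proof -
      have jk: "Dom J u \<in> Obj J" "Cod J u \<in> Obj J"
        using J.dom_obj[OF arr_hom[OF u]] J.cod_obj[OF arr_hom[OF u]] .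
      show ?thesis
        using nat[rule_format, OF KS[OF jk(1)] KS[OF jk(2)] K(2)[OF arr_hom[OF u]] p(3)[OF jk(2)]]
          p(4)[OF u] by simp
    qed
  qed blast
  have "app \<tau> s y = \<phi> s y" if s: "s \<in> S" and y: "y \<in> FObj P s" for s y
  proof -
    have sC: "s \<in> Obj C" using s assms(4) by blast
    obtain j f where f: "j \<in> Obj J" "f \<in> hom C s (FObj K j)" "y = act P f (x j)"
      using presents_surj[OF assms(1,2) sC y] .
    show ?thesis
      using app_natural[OF \<tau>(1) f(2) p(3)[OF f(1)]] \<tau>(2)[OF f(1)] f(3)
        nat[rule_format, OF s KS[OF f(1)] f(2) p(3)[OF f(1)]] by simp
  qed
  with \<tau>(1) show "\<exists>\<tau>\<in>hom Psh P Q. \<forall>s\<in>S. \<forall>x\<in>FObj P s. app \<tau> s x = \<phi> s x" by blast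
next
  fix Q \<sigma> \<tau> assume "\<sigma> \<in> hom Psh P Q" "\<tau> \<in> hom Psh P Q"
    and "\<forall>s\<in>S. \<forall>x\<in>FObj P s. app \<sigma> s x = app \<tau> s x"
  with presents_map_unique[OF assms(1,2)] presentsD(3)[OF assms(2)] assms(3) show "\<sigma> = \<tau>"
    by blast
qed

lemma presents_reindex:
  assumes E: "presents E K P x" and J: "category J" "is_functor J E I"
    "inj_on (FObj I) (Obj J)" "FObj I ` Obj J = Obj E" "FArr I ` Arr J = Arr E"
  shows "presents J (comp_functor J K I) P (\<lambda>j. x (FObj I j))"
proof -
  interpret J: Category J using J(1) by unfold_locales
  note p = presentsD[OF E] and I = is_functorD[OF J(2)]
  have obj: "FObj (comp_functor J K I) j = FObj K (FObj I j)" if "j \<in> Obj J" for j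
    using that by (simp add: comp_functor_def)
  have arr: "FArr (comp_functor J K I) u = FArr K (FArr I u)" "FArr I u \<in> Arr E"
    "Dom E (FArr I u) = FObj I (Dom J u)" "Cod E (FArr I u) = FObj I (Cod J u)"
    "Dom J u \<in> Obj J" "Cod J u \<in> Obj J" if "u \<in> Arr J" for u
    using that I(2)[OF arr_hom[OF that]] J.dom_obj[OF arr_hom[OF that]] J.cod_obj[OF arr_hom[OF that]]
    by (auto simp: comp_functor_def hom_iff)
  show ?thesis
  proof (rule presentsI)
    show "is_functor J C (comp_functor J K I)"
      using comp_functor_is_functor[OF J(1,2) p(1)] .
    show "x (FObj I j) \<in> FObj P (FObj (comp_functor J K I) j)" if "j \<in> Obj J" for j
      using p(3)[OF I(1)[OF that]] obj[OF that] by simp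
    show "act P (FArr (comp_functor J K I) u) (x (FObj I (Cod J u))) = x (FObj I (Dom J u))"
      if "u \<in> Arr J" for u
      using p(4)[OF arr(2)[OF that]] arr[OF that] by simp
    show "\<exists>\<tau>. \<tau> \<in> hom Psh P Q \<and> (\<forall>j\<in>Obj J. app \<tau> (FObj (comp_functor J K I) j) (x (FObj I j)) = y j)"
      if Q: "psh Q" and y: "\<And>j. j \<in> Obj J \<Longrightarrow> y j \<in> FObj Q (FObj (comp_functor J K I) j)"
        and yu: "\<And>u. u \<in> Arr J \<Longrightarrow> act Q (FArr (comp_functor J K I) u) (y (Cod J u)) = y (Dom J u)" for Q y
    proof -
      define y' where "y' e = y (the_inv_into (Obj J) (FObj I) e)" for e
      have y'I: "y' (FObj I j) = y j" if "j \<in> Obj J" for j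
        unfolding y'_def using the_inv_into_f_f[OF J(3) that] by simp
      obtain \<tau> where "\<tau> \<in> hom Psh P Q" "\<And>e. e \<in> Obj E \<Longrightarrow> app \<tau> (FObj K e) (x e) = y' e"
      proof (rule presents_map_ex[OF E Q, of y'])
        show "y' e \<in> FObj Q (FObj K e)" if e: "e \<in> Obj E" for e
        proof -
          obtain j where "j \<in> Obj J" "e = FObj I j" using e J(4) by blast
          with y y'I obj show ?thesis by simp
        qed
        show "act Q (FArr K v) (y' (Cod E v)) = y' (Dom E v)" if v: "v \<in> Arr E" for v
        proof -
          obtain u where "u \<in> Arr J" "v = FArr I u" using v J(5) by blast
          with yu[of u] y'I arr[of u] show ?thesis by simp
        qed
      qed blast
      then show ?thesis using obj y'I I(1) by (intro exI[of _ \<tau>]) simp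
    qed
    show "\<sigma> = \<tau>" if "\<sigma> \<in> hom Psh P Q" "\<tau> \<in> hom Psh P Q"
      "\<And>j. j \<in> Obj J \<Longrightarrow> app \<sigma> (FObj (comp_functor J K I) j) (x (FObj I j)) =
        app \<tau> (FObj (comp_functor J K I) j) (x (FObj I j))" for Q \<sigma> \<tau>
    proof -
      have "\<forall>e\<in>Obj E. app \<sigma> (FObj K e) (x e) = app \<tau> (FObj K e) (x e)"
        unfolding J(4)[symmetric] using that(3) obj by simp
      moreover have "\<forall>e\<in>Obj E. app \<tau> (FObj K e) (x e) \<in> FObj Q (FObj K e)"
        using app_in[OF that(2)] is_functorD(1)[OF p(1)] p(3) by blast
      moreover have "\<forall>v\<in>Arr E. act Q (FArr K v) (app \<tau> (FObj K (Cod E v)) (x (Cod E v))) =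
          app \<tau> (FObj K (Dom E v)) (x (Dom E v))"
      proof
        fix v assume v: "v \<in> Arr E"
        then obtain u where u: "u \<in> Arr J" "v = FArr I u" using J(5) by blast
        have "Cod E v \<in> Obj E" using arr(4,6)[OF u(1)] I(1) u(2) by simp
        then show "act Q (FArr K v) (app \<tau> (FObj K (Cod E v)) (x (Cod E v))) =
            app \<tau> (FObj K (Dom E v)) (x (Dom E v))"
          using app_natural[OF that(2) is_functorD(2)[OF p(1) arr_hom[OF v]] p(3)] p(4)[OF v] by simp
      qed
      ultimately have "\<exists>!\<rho>. \<rho> \<in> hom Psh P Q \<and> (\<forall>e\<in>Obj E. app \<rho> (FObj K e) (x e) = app \<tau> (FObj K e) (x e))"
        using E map_psh(2)[OF that(2)] unfolding presents_def by simp
      with that(1,2) \<open>\<forall>e\<in>Obj E. app \<sigma> (FObj K e) (x e) = app \<tau> (FObj K e) (x e)\<close> show ?thesis by metis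
    qed
  qed (use p(2) in simp)
qed

lemma small_presheafI:
  fixes E :: "('j, 'k) cat"
  assumes "category E" "small U (Obj E)" "small U (Arr E)" "presents E K P x"
  shows "small_presheaf U C P"
proof -
  obtain J :: "('u, 'u) cat" and I where J: "small_category U J" "is_functor J E I"
    "inj_on (FObj I) (Obj J)" "FObj I ` Obj J = Obj E" "FArr I ` Arr J = Arr E"
    using small_category_copy[OF assms(1-3)] .
  have catJ: "category J" using J(1) unfolding small_category_def by blast
  note pr = presents_reindex[OF assms(4) catJ J(2-5)]
  show ?thesis
    unfolding small_presheaf_def using J(1) presentsD(1)[OF pr] presents_colimit[OF catJ pr] by blast
qed

lemma small_presheafE:
  assumes "small_presheaf U C P"
  obtains J :: "('u, 'u) cat" and K x where "small_category U J" "category J" "presents J K P x"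
proof -
  obtain J :: "('u, 'u) cat" and K \<kappa> where J: "small_category U J" "is_functor J C K"
    "is_colimit J Psh (comp_functor J yo K) P \<kappa>"
    using assms unfolding small_presheaf_def by blast
  have catJ: "category J" using J(1) unfolding small_category_def by blast
  with that J(1) colimit_presents[OF catJ J(2,3)] show thesis by blast
qed

lemma small_presheaf_psh: "small_presheaf U C P \<Longrightarrow> psh P"
  by (elim small_presheafE) (rule presentsD(2))

end

locale SmallPresheaves = Presheaves C U
  for C :: "('o, 'a, 'm) cat_scheme" and U :: "'u itself" +
  assumes inaccessible: "inaccessible U"
begin

lemma small_presheaf_rep:
  assumes X: "X \<in> Obj C"
  shows "small_presheaf U C (rep X)"
proof -
  let ?E = "\<lparr>Obj = {()}, Arr = {()}, Dom = \<lambda>_. (), Cod = \<lambda>_. (), Ident = \<lambda>_. (), Comp =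
      \<lambda>_ _. ()\<rparr> :: (unit, unit) cat"
  let ?K = "\<lparr>FObj = \<lambda>_. X, FArr = \<lambda>_. Ident C X\<rparr> :: (unit, unit, 'o, 'a) fctr"
  have catE: "category ?E" by (rule categoryI) (auto simp: hom_iff)
  have "presents ?E ?K (rep X) (\<lambda>_. Inl (Ident C X))"
  proof (rule presentsI)
    show "is_functor ?E C ?K"
      by (rule is_functorI) (use X id_hom comp_id_left[OF id_hom[OF X]] in \<open>auto simp: extensional_def\<close>)
    show "psh (rep X)" using psh_rep[OF X] .
    show "Inl (Ident C X) \<in> FObj (rep X) (FObj ?K j)" for j using rep_id[OF X] by simp
    show "act (rep X) (FArr ?K u) (Inl (Ident C X)) = Inl (Ident C X)" for u
      using rep_act[OF id_hom[OF X] id_hom[OF X]] comp_id_left[OF id_hom[OF X]] by simp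
    show "\<exists>\<tau>. \<tau> \<in> hom Psh (rep X) Q \<and> (\<forall>j\<in>Obj ?E. app \<tau> (FObj ?K j) (Inl (Ident C X)) = y j)"
      if "psh Q" "\<And>j. j \<in> Obj ?E \<Longrightarrow> y j \<in> FObj Q (FObj ?K j)" for Q y
      using elem_map_hom[OF that(1) X, of "y ()"] app_elem_map_id[OF that(1) X, of "y ()"] that(2)[of "()"]
      by auto
    show "\<sigma> = \<tau>" if "\<sigma> \<in> hom Psh (rep X) Q" "\<tau> \<in> hom Psh (rep X) Q"
      "\<And>j. j \<in> Obj ?E \<Longrightarrow> app \<sigma> (FObj ?K j) (Inl (Ident C X)) = app \<tau> (FObj ?K j) (Inl (Ident C X))"
      for Q \<sigma> \<tau>
    proof -
      have "app \<sigma> X (Inl (Ident C X)) = app \<tau> X (Inl (Ident C X))" using that(3)[of "()"] by simp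
      with elem_map_app[OF that(1) X] elem_map_app[OF that(2) X] show ?thesis by metis
    qed
  qed
  from small_presheafI[OF catE _ _ this] show ?thesis
    using small_finite[OF inaccessible, of "{()}"] by simp
qed

text \<open>The elements of \<open>P\<close> at objects of \<open>S\<close> form a small category, and \<open>P\<close> is the colimit of the
  representables indexed by it.\<close>

lemma determined_small:
  assumes "determined S P" "small U S"
  shows "small_presheaf U C P"
proof -
  have P: "psh P" and S: "S \<subseteq> Obj C" using assms(1) unfolding determined_def by blast+
  define Ob where "Ob = Sigma S (FObj P)"
  define Ar where "Ar = {(a, f, b). a \<in> Ob \<and> b \<in> Ob \<and> f \<in> hom C (fst a) (fst b) \<and> act P f (snd b) = snd a}"
  let ?E = "\<lparr>Obj = Ob, Arr = Ar, Dom = fst, Cod = \<lambda>u. snd (snd u), Ident = \<lambda>a. (a, Ident C (fst a), a),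
     Comp = \<lambda>v u. (fst u, fst (snd v) \<circ>\<^bsub>C\<^esub> fst (snd u), snd (snd v))\<rparr> :: ('o \<times> ('a + 'u), _) cat"
  have Ob: "fst a \<in> S" "fst a \<in> Obj C" "snd a \<in> FObj P (fst a)" if "a \<in> Ob" for a
    using that S unfolding Ob_def by auto
  have homE: "u \<in> hom ?E a b \<longleftrightarrow>
      (\<exists>f. u = (a, f, b) \<and> a \<in> Ob \<and> b \<in> Ob \<and> f \<in> hom C (fst a) (fst b) \<and> act P f (snd b) = snd a)" for u a b
    by (auto simp: hom_iff Ar_def)
  have catE: "category ?E"
  proof (rule categoryI)
    show "Dom ?E u \<in> Obj ?E \<and> Cod ?E u \<in> Obj ?E" if "u \<in> Arr ?E" for u
      using that by (auto simp: Ar_def)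
    show "Ident ?E a \<in> hom ?E a a" if "a \<in> Obj ?E" for a
      using that Ob id_hom act_id[OF P Ob(2,3)] unfolding homE by simp
    show "v \<circ>\<^bsub>?E\<^esub> u \<in> hom ?E a c" if "u \<in> hom ?E a b" "v \<in> hom ?E b c" for u v a b c
    proof -
      obtain f g where f: "u = (a, f, b)" "a \<in> Ob" "b \<in> Ob" "f \<in> hom C (fst a) (fst b)"
          "act P f (snd b) = snd a"
        and g: "v = (b, g, c)" "c \<in> Ob" "g \<in> hom C (fst b) (fst c)" "act P g (snd c) = snd b"
        using \<open>u \<in> hom ?E a b\<close> \<open>v \<in> hom ?E b c\<close> unfolding homE by auto
      show ?thesis
        unfolding homE using f g comp_hom[OF f(4) g(3)] act_comp[OF P f(4) g(3) Ob(3)[OF g(2)]] by simp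
    qed
    show "u \<circ>\<^bsub>?E\<^esub> Ident ?E a = u \<and> Ident ?E b \<circ>\<^bsub>?E\<^esub> u = u" if "u \<in> hom ?E a b" for u a b
      using that comp_id_left comp_id_right unfolding homE by auto
    show "w \<circ>\<^bsub>?E\<^esub> (v \<circ>\<^bsub>?E\<^esub> u) = (w \<circ>\<^bsub>?E\<^esub> v) \<circ>\<^bsub>?E\<^esub> u"
      if "u \<in> hom ?E a b" "v \<in> hom ?E b c" "w \<in> hom ?E c d" for u v w a b c d
      using that comp_assoc unfolding homE by auto
  qed
  let ?K = "\<lparr>FObj = \<lambda>a\<in>Ob. fst a, FArr = \<lambda>u\<in>Ar. fst (snd u)\<rparr> :: ('o \<times> ('a + 'u), _, 'o, 'a) fctr"
  have presE: "presents ?E ?K P snd"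
  proof (rule presentsI)
    show "is_functor ?E C ?K"
    proof (rule is_functorI)
      show "FArr ?K (v \<circ>\<^bsub>?E\<^esub> u) = FArr ?K v \<circ>\<^bsub>C\<^esub> FArr ?K u"
        if u: "u \<in> hom ?E a b" and v: "v \<in> hom ?E b c" for u v a b c
        using hom_arr[OF u] hom_arr[OF v] hom_arr[OF Category.comp_hom[OF Category.intro[OF catE] u v]]
        by simp
      show "FArr ?K (Ident ?E a) = Ident C (FObj ?K a)" if "a \<in> Obj ?E" for a
        using hom_arr[OF Category.id_hom[OF Category.intro[OF catE] that]] that by simp
      show "FArr ?K u \<in> hom C (FObj ?K a) (FObj ?K b)" if "u \<in> hom ?E a b" for u a b
        using hom_arr[OF that] that unfolding homE by auto
    qed (use Ob in auto)
    show "psh P" using P .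
    show "snd a \<in> FObj P (FObj ?K a)" if "a \<in> Obj ?E" for a
      using that Ob(3) by simp
    show "act P (FArr ?K u) (snd (Cod ?E u)) = snd (Dom ?E u)" if "u \<in> Arr ?E" for u
      using that by (auto simp: Ar_def)
    show "\<exists>\<tau>. \<tau> \<in> hom Psh P Q \<and> (\<forall>a\<in>Obj ?E. app \<tau> (FObj ?K a) (snd a) = y a)"
      if Q: "psh Q" and y: "\<And>a. a \<in> Obj ?E \<Longrightarrow> y a \<in> FObj Q (FObj ?K a)"
        and yu: "\<And>u. u \<in> Arr ?E \<Longrightarrow> act Q (FArr ?K u) (y (Cod ?E u)) = y (Dom ?E u)" for Q y
    proof -
      have "\<forall>s\<in>S. \<forall>x\<in>FObj P s. y (s, x) \<in> FObj Q s"
        using y unfolding Ob_def by force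
      moreover have "\<forall>s\<in>S. \<forall>s'\<in>S. \<forall>f\<in>hom C s s'. \<forall>x\<in>FObj P s'. y (s, act P f x) = act Q f (y (s', x))"
      proof (intro ballI)
        fix s s' f x assume *: "s \<in> S" "s' \<in> S" "f \<in> hom C s s'" "x \<in> FObj P s'"
        then have "((s, act P f x), f, (s', x)) \<in> Arr ?E"
          using act_in[OF P *(3,4)] by (simp add: Ar_def Ob_def)
        from yu[OF this] this show "y (s, act P f x) = act Q f (y (s', x))" by simp
      qed
      ultimately obtain \<tau> where "\<tau> \<in> hom Psh P Q" "\<forall>s\<in>S. \<forall>x\<in>FObj P s. app \<tau> s x = y (s, x)"
        using assms(1) Q unfolding determined_def by (elim conjE allE[of _ Q] allE[of _
            "\<lambda>s x. y (s, x)"]) auto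
      then show ?thesis unfolding Ob_def by auto
    qed
    show "\<sigma> = \<tau>" if "\<sigma> \<in> hom Psh P Q" "\<tau> \<in> hom Psh P Q"
      "\<And>a. a \<in> Obj ?E \<Longrightarrow> app \<sigma> (FObj ?K a) (snd a) = app \<tau> (FObj ?K a) (snd a)" for Q \<sigma> \<tau>
    proof -
      have "\<forall>s\<in>S. \<forall>x\<in>FObj P s. app \<sigma> s x = app \<tau> s x"
        using that(3) unfolding Ob_def by force
      with that(1,2) assms(1) show ?thesis unfolding determined_def by blast
    qed
  qed
  have smallOb: "small U Ob"
    unfolding Ob_def using small_Sigma[OF inaccessible assms(2)] psh_small[OF P] S by blast
  have "small U (Sigma (Ob \<times> Ob) (\<lambda>ab. hom C (fst (fst ab)) (fst (snd ab))))"
    using small_Sigma[OF inaccessible small_Sigma[OF inaccessible smallOb smallOb]] hom_small Ob(2) by force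
  then have "small U ((\<lambda>z. (fst (fst z), snd z, snd (fst z))) ` Sigma (Ob \<times> Ob)
      (\<lambda>ab. hom C (fst (fst ab)) (fst (snd ab))))"
    by (rule small_image)
  then have "small U Ar"
    by (rule small_subset) (force simp: Ar_def image_iff)
  with smallOb small_presheafI[OF catE _ _ presE] show ?thesis by simp
qed

end

section \<open>Small colimits of small presheaves\<close>

text \<open>The classes of elements of a small set can be named by elements of \<open>'u\<close>. The names, unlike the
  classes, have the type of elements of a presheaf.\<close>

lemma small_quotient_code:
  fixes U :: "'u itself" and A :: "'z set"
  assumes "small U A"
  obtains code :: "'z \<Rightarrow> 'b + 'u" where
    "\<And>z z'. (z, z') \<in> r \<Longrightarrow> z \<in> A \<Longrightarrow> z' \<in> A \<Longrightarrow> code z = code z'"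
    "\<And>z z'. z \<in> A \<Longrightarrow> z' \<in> A \<Longrightarrow> code z = code z' \<Longrightarrow> (z, z') \<in> (r \<union> r\<inverse>)\<^sup>*"
proof -
  let ?R = "(r \<union> r\<inverse>)\<^sup>*"
  have sym: "(b, a) \<in> ?R" if "(a, b) \<in> ?R" for a b
  proof -
    have "sym (r \<union> r\<inverse>)" by (auto simp: sym_def)
    then show ?thesis using that sym_rtrancl symD by metis
  qed
  obtain e :: "'z set \<Rightarrow> 'u" where e: "inj_on e ((\<lambda>z. ?R `` {z}) ` A)"
    using small_embedding[OF small_image[OF assms]] .
  define code :: "'z \<Rightarrow> 'b + 'u" where "code z = Inr (e (?R `` {z}))" for z
  show thesis
  proof (rule that[of code])
    show "code z = code z'" if "(z, z') \<in> r" "z \<in> A" "z' \<in> A" for z z'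
    proof -
      have zz': "(z, z') \<in> ?R" using that(1) by auto
      have "(z, w) \<in> ?R \<longleftrightarrow> (z', w) \<in> ?R" for w
        using rtrancl_trans[OF zz', of w] rtrancl_trans[OF sym[OF zz'], of w] by blast
      then have "?R `` {z} = ?R `` {z'}" by blast
      then show ?thesis by (simp add: code_def)
    qed
    show "(z, z') \<in> ?R" if "z \<in> A" "z' \<in> A" "code z = code z'" for z z'
    proof -
      have "?R `` {z} = ?R `` {z'}"
        using inj_onD[OF e, of "?R `` {z}" "?R `` {z'}"] that by (simp add: code_def)
      moreover have "z' \<in> ?R `` {z'}" by blast
      ultimately have "z' \<in> ?R `` {z}" by (simp only:)
      then show ?thesis by blast
    qed
  qed
qed

lemma respects_equivalence_closure:
  assumes "(z, z') \<in> (r \<union> r\<inverse>)\<^sup>*" "\<And>a b. (a, b) \<in> r \<Longrightarrow> h a = h b"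
  shows "h z = h z'"
  using assms(1) by induction (auto dest: assms(2))

context Presheaves
begin

text \<open>Colimits of presheaves are pointwise quotients of disjoint unions. The classes themselves
  are not of the type of elements of a presheaf and are replaced by codes.\<close>

lemma Psh_colimit_ex:
  fixes J :: "('j, 'k, 'l) cat_scheme"
  assumes inacc: "inaccessible U" and catJ: "category J" and smallJ: "small U (Obj J)"
    and T: "is_functor J Psh T"
  obtains c \<kappa> where "is_colimit J Psh T c \<kappa>"
    "\<And>X y. X \<in> Obj C \<Longrightarrow> y \<in> FObj c X \<Longrightarrow> \<exists>j\<in>Obj J. \<exists>x\<in>FObj (FObj T j) X. y = app (\<kappa> j) X x"
proof -
  interpret J: Category J using catJ by unfold_locales
  note T = is_functorD[OF T]
  have Tpsh: "psh (FObj T j)" if "j \<in> Obj J" for j using T(1)[OF that] by simp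
  define A where "A X = Sigma (Obj J) (\<lambda>j. FObj (FObj T j) X)" for X
  define r where "r X = {((Dom J u, x), (Cod J u, app (FArr T u) X x)) | u x.
      u \<in> Arr J \<and> x \<in> FObj (FObj T (Dom J u)) X}" for X
  have "\<forall>X. \<exists>code :: 'j \<times> ('a + 'u) \<Rightarrow> 'a + 'u. X \<in> Obj C \<longrightarrow>
      (\<forall>z z'. (z, z') \<in> r X \<longrightarrow> z \<in> A X \<longrightarrow> z' \<in> A X \<longrightarrow> code z = code z') \<and>
      (\<forall>z z'. z \<in> A X \<longrightarrow> z' \<in> A X \<longrightarrow> code z = code z' \<longrightarrow> (z, z') \<in> (r X \<union> (r X)\<inverse>)\<^sup>*)"
  proof
    fix X
    show "\<exists>code :: 'j \<times> ('a + 'u) \<Rightarrow> 'a + 'u. X \<in> Obj C \<longrightarrow>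
      (\<forall>z z'. (z, z') \<in> r X \<longrightarrow> z \<in> A X \<longrightarrow> z' \<in> A X \<longrightarrow> code z = code z') \<and>
      (\<forall>z z'. z \<in> A X \<longrightarrow> z' \<in> A X \<longrightarrow> code z = code z' \<longrightarrow> (z, z') \<in> (r X \<union> (r X)\<inverse>)\<^sup>*)"
    proof (cases "X \<in> Obj C")
      case True
      have "small U (A X)"
        unfolding A_def by (rule small_Sigma[OF inacc smallJ psh_small[OF Tpsh True]])
      then obtain code :: "'j \<times> ('a + 'u) \<Rightarrow> 'a + 'u" where
        "\<And>z z'. (z, z') \<in> r X \<Longrightarrow> z \<in> A X \<Longrightarrow> z' \<in> A X \<Longrightarrow> code z = code z'"
        "\<And>z z'. z \<in> A X \<Longrightarrow> z' \<in> A X \<Longrightarrow> code z = code z' \<Longrightarrow> (z, z') \<in> (r X \<union> (r X)\<inverse>)\<^sup>*"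
        by (rule small_quotient_code[where r = "r X"]) (rule that)
      then show ?thesis by (intro exI[of _ code]) simp
    qed simp
  qed
  then obtain code :: "'o \<Rightarrow> 'j \<times> ('a + 'u) \<Rightarrow> 'a + 'u" where
    code: "\<And>X z z'. X \<in> Obj C \<Longrightarrow> (z, z') \<in> r X \<Longrightarrow> z \<in> A X \<Longrightarrow> z' \<in> A X \<Longrightarrow> code X z = code X z'"
    and code': "\<And>X z z'. X \<in> Obj C \<Longrightarrow> z \<in> A X \<Longrightarrow> z' \<in> A X \<Longrightarrow> code X z = code X z' \<Longrightarrow>
      (z, z') \<in> (r X \<union> (r X)\<inverse>)\<^sup>*"
    by metis
  define rp where "rp X e = inv_into (A X) (code X) e" for X e
  have rp_in: "rp X e \<in> A X" and code_rp: "code X (rp X e) = e" if "e \<in> code X ` A X" for X e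
    unfolding rp_def using inv_into_into[OF that] f_inv_into_f[OF that] by simp_all
  \<comment> \<open>A function of pairs \<open>(j, x)\<close> that is constant on generating pairs descends to the codes.\<close>
  have lift: "h (rp X (code X z)) = h z"
    if X: "X \<in> Obj C" and z: "z \<in> A X"
      and h: "\<And>u x. u \<in> Arr J \<Longrightarrow> x \<in> FObj (FObj T (Dom J u)) X \<Longrightarrow>
        h (Dom J u, x) = h (Cod J u, app (FArr T u) X x)" for X z and h :: "_ \<Rightarrow> 'a + 'u"
  proof (rule respects_equivalence_closure[where r = "r X" and h = h])
    have "code X z \<in> code X ` A X" using z by blast
    from code'[OF X rp_in[OF this] z code_rp[OF this]]
    show "(rp X (code X z), z) \<in> (r X \<union> (r X)\<inverse>)\<^sup>*" .
    show "h a = h b" if "(a, b) \<in> r X" for a b using that h unfolding r_def by auto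
  qed
  have A_u: "(Cod J u, app (FArr T u) X x) \<in> A X" "(Dom J u, x) \<in> A X"
    "((Dom J u, x), (Cod J u, app (FArr T u) X x)) \<in> r X"
    if "X \<in> Obj C" "u \<in> Arr J" "x \<in> FObj (FObj T (Dom J u)) X" for X u x
    using that app_in[OF T(2)[OF arr_hom[OF that(2)]] that(1,3)] J.dom_obj[OF arr_hom[OF that(2)]]
      J.cod_obj[OF arr_hom[OF that(2)]] unfolding A_def r_def by auto
  have A_act: "(j, act (FObj T j) f x) \<in> A W"
    if "f \<in> hom C W X" "j \<in> Obj J" "x \<in> FObj (FObj T j) X" for f W X j x
    using that act_in[OF Tpsh[OF that(2)] that(1,3)] unfolding A_def by simp
  define a where "a f e = (case rp (Cod C f) e of (j, x) \<Rightarrow> code (Dom C f) (j, act (FObj T j) f x))" for f e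
  have a_code: "a f (code X (j, x)) = code W (j, act (FObj T j) f x)"
    if f: "f \<in> hom C W X" and j: "j \<in> Obj J" "x \<in> FObj (FObj T j) X" for f W X j x
  proof -
    let ?h = "\<lambda>(j, x). code W (j, act (FObj T j) f x)"
    have X: "X \<in> Obj C" "W \<in> Obj C" using cod_obj[OF f] dom_obj[OF f] .
    have "?h (rp X (code X (j, x))) = ?h (j, x)"
    proof (rule lift[OF X(1)])
      show "(j, x) \<in> A X" using j unfolding A_def by simp
      fix u y assume u: "u \<in> Arr J" "y \<in> FObj (FObj T (Dom J u)) X"
      have y': "act (FObj T (Dom J u)) f y \<in> FObj (FObj T (Dom J u)) W"
        using act_in[OF Tpsh[OF J.dom_obj[OF arr_hom[OF u(1)]]] f u(2)] .
      show "?h (Dom J u, y) = ?h (Cod J u, app (FArr T u) X y)"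
        using code[OF X(2) A_u(3)[OF X(2) u(1) y'] A_u(2)[OF X(2) u(1) y'] A_u(1)[OF X(2) u(1) y']]
          app_natural[OF T(2)[OF arr_hom[OF u(1)]] f u(2)] by simp
    qed
    then show ?thesis
      using hom_dom[OF f] hom_cod[OF f] unfolding a_def by simp
  qed
  let ?c = "mk_presheaf C (\<lambda>X. code X ` A X) a"
  have A_E: "\<exists>j x. e = code X (j, x) \<and> j \<in> Obj J \<and> x \<in> FObj (FObj T j) X" if "e \<in> code X ` A X" for e X
    using that unfolding A_def by auto
  have c: "psh ?c"
  proof (rule psh_mk_presheaf)
    show "small U (code X ` A X)" if "X \<in> Obj C" for X
      unfolding A_def by (rule small_image[OF small_Sigma[OF inacc smallJ psh_small[OF Tpsh that]]])
    show "a f e \<in> code W ` A W" if f: "f \<in> hom C W X" and e: "e \<in> code X ` A X" for W X f e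
      using A_E[OF e] a_code[OF f] A_act[OF f] by auto
    show "a (Ident C X) e = e" if X: "X \<in> Obj C" and e: "e \<in> code X ` A X" for X e
      using A_E[OF e] a_code[OF id_hom[OF X]] act_id[OF Tpsh X] by auto
    show "a (g \<circ>\<^bsub>C\<^esub> f) e = a f (a g e)"
      if f: "f \<in> hom C V W" and g: "g \<in> hom C W X" and e: "e \<in> code X ` A X" for V W X f g e
    proof -
      obtain j x where jx: "e = code X (j, x)" "j \<in> Obj J" "x \<in> FObj (FObj T j) X" using A_E[OF e] by blast
      show ?thesis
        using a_code[OF comp_hom[OF f g] jx(2,3)] a_code[OF g jx(2,3)]
          a_code[OF f jx(2) act_in[OF Tpsh[OF jx(2)] g jx(3)]] act_comp[OF
              Tpsh[OF jx(2)] f g jx(3)] jx(1) by simp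
    qed
  qed
  define \<kappa> where "\<kappa> j = mk_presheaf_map C (FObj T j) ?c (\<lambda>X x. code X (j, x))" for j
  have \<kappa>: "\<kappa> j \<in> hom Psh (FObj T j) ?c" if j: "j \<in> Obj J" for j
    unfolding \<kappa>_def
  proof (rule mk_presheaf_map_hom[OF Tpsh[OF j] c])
    show "code X (j, x) \<in> FObj ?c X" if "X \<in> Obj C" "x \<in> FObj (FObj T j) X" for X x
      using that j unfolding A_def by simp
    show "code W (j, act (FObj T j) f x) = act ?c f (code X (j, x))"
      if f: "f \<in> hom C W X" and x: "x \<in> FObj (FObj T j) X" for W X f x
    proof -
      have "code X (j, x) \<in> code X ` A X" using j x unfolding A_def by simp
      then show ?thesis
        using mk_presheaf_act[where E = "\<lambda>X. code X ` A X", OF f] a_code[OF f j x] by simp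
    qed
  qed
  have app\<kappa>: "app (\<kappa> j) X x = code X (j, x)" if "X \<in> Obj C" "x \<in> FObj (FObj T j) X" for j X x
    unfolding \<kappa>_def using that by simp
  have surj: "\<exists>j\<in>Obj J. \<exists>x\<in>FObj (FObj T j) X. y = app (\<kappa> j) X x" if X: "X \<in> Obj C"
      and y: "y \<in> FObj ?c X" for X y
  proof -
    have "y \<in> code X ` A X" using X y by simp
    from A_E[OF this] app\<kappa>[OF X] show ?thesis by metis
  qed
  have "is_colimit J Psh T ?c \<kappa>"
    unfolding is_colimit_def
  proof (intro conjI allI impI)
    show "is_cocone J Psh T ?c \<kappa>"
      unfolding is_cocone_def
    proof (intro conjI ballI)
      show "?c \<in> Obj Psh" using c by simp
      show "\<kappa> j \<in> hom Psh (FObj T j) ?c" if "j \<in> Obj J" for j using \<kappa>[OF that] .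
      fix u assume u: "u \<in> Arr J"
      have jk: "Dom J u \<in> Obj J" "Cod J u \<in> Obj J"
        using J.dom_obj[OF arr_hom[OF u]] J.cod_obj[OF arr_hom[OF u]] .
      note Tu = T(2)[OF arr_hom[OF u]]
      show "\<kappa> (Cod J u) \<circ>\<^bsub>Psh\<^esub> FArr T u = \<kappa> (Dom J u)"
      proof (rule map_eqI[OF Psh.comp_hom[OF Tu \<kappa>[OF jk(2)]] \<kappa>[OF jk(1)]])
        fix X x assume Xx: "X \<in> Obj C" "x \<in> FObj (FObj T (Dom J u)) X"
        show "app (\<kappa> (Cod J u) \<circ>\<^bsub>Psh\<^esub> FArr T u) X x = app (\<kappa> (Dom J u)) X x"
          using app_comp[OF Tu \<kappa>[OF jk(2)] Xx] app\<kappa>[OF Xx] app\<kappa>[OF Xx(1) app_in[OF Tu Xx]]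
            code[OF Xx(1) A_u(3)[OF Xx(1) u Xx(2)] A_u(2)[OF Xx(1) u Xx(2)] A_u(1)[OF Xx(1) u Xx(2)]]
                by simp
      qed
    qed
    fix Q \<mu> assume "is_cocone J Psh T Q \<mu>"
    then have Q: "psh Q" and \<mu>: "\<And>j. j \<in> Obj J \<Longrightarrow> \<mu> j \<in> hom Psh (FObj T j) Q"
      and nat: "\<And>u. u \<in> Arr J \<Longrightarrow> \<mu> (Cod J u) \<circ>\<^bsub>Psh\<^esub> FArr T u = \<mu> (Dom J u)"
      unfolding is_cocone_def by auto
    define t where "t X e = (case rp X e of (j, x) \<Rightarrow> app (\<mu> j) X x)" for X e
    have t: "t X (code X (j, x)) = app (\<mu> j) X x"
      if X: "X \<in> Obj C" and j: "j \<in> Obj J" "x \<in> FObj (FObj T j) X" for X j x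
    proof -
      let ?h = "\<lambda>(j, x). app (\<mu> j) X x"
      have "?h (rp X (code X (j, x))) = ?h (j, x)"
      proof (rule lift[OF X])
        show "(j, x) \<in> A X" using j unfolding A_def by simp
        fix u y assume u: "u \<in> Arr J" "y \<in> FObj (FObj T (Dom J u)) X"
        show "?h (Dom J u, y) = ?h (Cod J u, app (FArr T u) X y)"
          using app_comp[OF T(2)[OF arr_hom[OF u(1)]] \<mu>[OF J.cod_obj[OF arr_hom[OF u(1)]]] X u(2)]
            nat[OF u(1)] by simp
      qed
      then show ?thesis unfolding t_def by simp
    qed
    let ?t = "mk_presheaf_map C ?c Q t"
    have th: "?t \<in> hom Psh ?c Q"
    proof (rule mk_presheaf_map_hom[OF c Q])
      show "t X e \<in> FObj Q X" if X: "X \<in> Obj C" and e: "e \<in> FObj ?c X" for X e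
      proof -
        have "e \<in> code X ` A X" using X e by simp
        then obtain j x where "e = code X (j, x)" "j \<in> Obj J" "x \<in> FObj (FObj T j) X" using A_E by blast
        then show ?thesis using t[OF X] app_in[OF \<mu> X] by simp
      qed
      show "t W (act ?c f e) = act Q f (t X e)" if f: "f \<in> hom C W X" and e: "e \<in> FObj ?c X" for W X f e
      proof -
        have X: "X \<in> Obj C" "W \<in> Obj C" using cod_obj[OF f] dom_obj[OF f] .
        have e: "e \<in> code X ` A X" using e X by simp
        then obtain j x where jx: "e = code X (j, x)" "j \<in> Obj J" "x \<in> FObj (FObj T j) X" using A_E by blast
        have "act ?c f e = code W (j, act (FObj T j) f x)"
          using mk_presheaf_act[where E = "\<lambda>X. code X ` A X", OF f e] a_code[OF f jx(2,3)] jx(1) by simp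
        then show ?thesis
          using t[OF X(2) jx(2) act_in[OF Tpsh[OF jx(2)] f jx(3)]] t[OF X(1) jx(2,3)]
            app_natural[OF \<mu>[OF jx(2)] f jx(3)] jx(1) by simp
      qed
    qed
    have t\<kappa>: "?t \<circ>\<^bsub>Psh\<^esub> \<kappa> j = \<mu> j" if j: "j \<in> Obj J" for j
    proof (rule map_eqI[OF Psh.comp_hom[OF \<kappa>[OF j] th] \<mu>[OF j]])
      fix X x assume Xx: "X \<in> Obj C" "x \<in> FObj (FObj T j) X"
      show "app (?t \<circ>\<^bsub>Psh\<^esub> \<kappa> j) X x = app (\<mu> j) X x"
        using app_comp[OF \<kappa>[OF j] th Xx] app\<kappa>[OF Xx] t[OF Xx(1) j Xx(2)]
          app_in[OF \<kappa>[OF j] Xx] Xx(1) by simp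
    qed
    show "\<exists>!h. h \<in> hom Psh ?c Q \<and> (\<forall>j\<in>Obj J. h \<circ>\<^bsub>Psh\<^esub> \<kappa> j = \<mu> j)"
    proof (rule ex1I[of _ ?t])
      show "?t \<in> hom Psh ?c Q \<and> (\<forall>j\<in>Obj J. ?t \<circ>\<^bsub>Psh\<^esub> \<kappa> j = \<mu> j)" using th t\<kappa> by blast
      fix h assume h: "h \<in> hom Psh ?c Q \<and> (\<forall>j\<in>Obj J. h \<circ>\<^bsub>Psh\<^esub> \<kappa> j = \<mu> j)"
      show "h = ?t"
      proof (rule map_eqI[OF conjunct1[OF h] th])
        fix X y assume Xy: "X \<in> Obj C" "y \<in> FObj ?c X"
        obtain j x where jx: "j \<in> Obj J" "x \<in> FObj (FObj T j) X" "y = app (\<kappa> j) X x" using surj[OF Xy]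
            by blast
        show "app h X y = app ?t X y"
          using app_comp[OF \<kappa>[OF jx(1)] conjunct1[OF h] Xy(1) jx(2)] app_comp[OF \<kappa>[OF jx(1)] th Xy(1) jx(2)]
            h jx(1,3) t\<kappa>[OF jx(1)] by simp
      qed
    qed
  qed
  with surj that show thesis by blast
qed

text \<open>The components of a natural family on the colimit extend along each \<open>T j\<close>, and uniqueness of
  these extensions makes them a cocone.\<close>

lemma determined_colimit:
  assumes "category J" "is_functor J Psh T" "is_colimit J Psh T c \<kappa>"
    and surj: "\<And>X y. X \<in> Obj C \<Longrightarrow> y \<in> FObj c X \<Longrightarrow>
      \<exists>j\<in>Obj J. \<exists>x\<in>FObj (FObj T j) X. y = app (\<kappa> j) X x"
    and S: "S \<subseteq> Obj C" and det: "\<And>j. j \<in> Obj J \<Longrightarrow> determined S (FObj T j)"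
  shows "determined S c"
  unfolding determined_def
proof (intro conjI allI impI ballI)
  interpret J: Category J using assms(1) by unfold_locales
  note T = is_functorD[OF assms(2)]
  have coc: "is_cocone J Psh T c \<kappa>" using assms(3) unfolding is_colimit_def by blast
  then have c: "psh c" and \<kappa>: "\<And>j. j \<in> Obj J \<Longrightarrow> \<kappa> j \<in> hom Psh (FObj T j) c"
    and \<kappa>u: "\<And>u. u \<in> Arr J \<Longrightarrow> \<kappa> (Cod J u) \<circ>\<^bsub>Psh\<^esub> FArr T u = \<kappa> (Dom J u)"
    unfolding is_cocone_def by auto
  have SC: "s \<in> Obj C" if "s \<in> S" for s using that S by blast
  have det_ex: "\<exists>\<tau>\<in>hom Psh (FObj T j) Q. \<forall>s\<in>S. \<forall>x\<in>FObj (FObj T j) s. app \<tau> s x = \<phi> s x"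
    if "j \<in> Obj J" "psh Q" "\<forall>s\<in>S. \<forall>x\<in>FObj (FObj T j) s. \<phi> s x \<in> FObj Q s"
      "\<forall>s\<in>S. \<forall>s'\<in>S. \<forall>f\<in>hom C s s'. \<forall>x\<in>FObj (FObj T j) s'. \<phi> s (act (FObj T j) f x) = act Q f (\<phi> s' x)"
          for j Q \<phi>
    using det[OF that(1)] that(2-4) unfolding determined_def by simp
  have det_unique: "\<sigma> = \<tau>"
    if "j \<in> Obj J" "\<sigma> \<in> hom Psh (FObj T j) Q" "\<tau> \<in> hom Psh (FObj T j) Q"
      "\<And>s x. s \<in> S \<Longrightarrow> x \<in> FObj (FObj T j) s \<Longrightarrow> app \<sigma> s x = app \<tau> s x" for j \<sigma> \<tau> Q
    using det[OF that(1)] that(2-4) unfolding determined_def by blast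
  show "psh c" "S \<subseteq> Obj C" using c S .
  fix Q
  show "\<exists>\<tau>\<in>hom Psh c Q. \<forall>s\<in>S. \<forall>x\<in>FObj c s. app \<tau> s x = \<phi> s x"
    if Q: "psh Q" and \<phi>: "\<forall>s\<in>S. \<forall>x\<in>FObj c s. \<phi> s x \<in> FObj Q s"
      and nat: "\<forall>s\<in>S. \<forall>s'\<in>S. \<forall>f\<in>hom C s s'. \<forall>x\<in>FObj c s'. \<phi> s (act c f x) = act Q f (\<phi> s' x)" for \<phi>
  proof -
    have "\<exists>\<tau>\<in>hom Psh (FObj T j) Q. \<forall>s\<in>S. \<forall>x\<in>FObj (FObj T j) s. app \<tau> s x = \<phi> s (app (\<kappa> j) s x)"
      if j: "j \<in> Obj J" for j
    proof (rule det_ex[OF j Q])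
      show "\<forall>s\<in>S. \<forall>x\<in>FObj (FObj T j) s. \<phi> s (app (\<kappa> j) s x) \<in> FObj Q s"
        using \<phi> app_in[OF \<kappa>[OF j] SC] by blast
      show "\<forall>s\<in>S. \<forall>s'\<in>S. \<forall>f\<in>hom C s s'. \<forall>x\<in>FObj (FObj T j) s'.
          \<phi> s (app (\<kappa> j) s (act (FObj T j) f x)) = act Q f (\<phi> s' (app (\<kappa> j) s' x))"
      proof (intro ballI)
        fix s s' f x assume *: "s \<in> S" "s' \<in> S" "f \<in> hom C s s'" "x \<in> FObj (FObj T j) s'"
        show "\<phi> s (app (\<kappa> j) s (act (FObj T j) f x)) = act Q f (\<phi> s' (app (\<kappa> j) s' x))"
          using app_natural[OF \<kappa>[OF j] *(3,4)] nat[rule_format, OF *(1-3) app_in[OF \<kappa>[OF j]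
              SC[OF *(2)] *(4)]]
          by simp
      qed
    qed
    then obtain \<tau> where \<tau>: "\<And>j. j \<in> Obj J \<Longrightarrow> \<tau> j \<in> hom Psh (FObj T j) Q"
      and \<tau>\<phi>: "\<And>j s x. j \<in> Obj J \<Longrightarrow> s \<in> S \<Longrightarrow> x \<in> FObj (FObj T j) s \<Longrightarrow> app (\<tau> j) s x = \<phi> s (app (\<kappa> j) s x)"
      by metis
    have "is_cocone J Psh T Q \<tau>"
      unfolding is_cocone_def
    proof (intro conjI ballI)
      show "Q \<in> Obj Psh" using Q by simp
      show "\<tau> j \<in> hom Psh (FObj T j) Q" if "j \<in> Obj J" for j using \<tau>[OF that] .
      fix u assume u: "u \<in> Arr J"
      have jk: "Dom J u \<in> Obj J" "Cod J u \<in> Obj J"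
        using J.dom_obj[OF arr_hom[OF u]] J.cod_obj[OF arr_hom[OF u]] .
      note Tu = T(2)[OF arr_hom[OF u]]
      show "\<tau> (Cod J u) \<circ>\<^bsub>Psh\<^esub> FArr T u = \<tau> (Dom J u)"
      proof (rule det_unique[OF jk(1) Psh.comp_hom[OF Tu \<tau>[OF jk(2)]] \<tau>[OF jk(1)]])
        fix s x assume s: "s \<in> S" and x: "x \<in> FObj (FObj T (Dom J u)) s"
        show "app (\<tau> (Cod J u) \<circ>\<^bsub>Psh\<^esub> FArr T u) s x = app (\<tau> (Dom J u)) s x"
          using app_comp[OF Tu \<tau>[OF jk(2)] SC[OF s] x] app_comp[OF Tu \<kappa>[OF jk(2)] SC[OF s] x]
            \<tau>\<phi>[OF jk(2) s app_in[OF Tu SC[OF s] x]] \<tau>\<phi>[OF jk(1) s x] \<kappa>u[OF u] by simp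
      qed
    qed
    from is_colimitD(2)[OF assms(3) this]
    obtain h where h: "h \<in> hom Psh c Q" "\<And>j. j \<in> Obj J \<Longrightarrow> h \<circ>\<^bsub>Psh\<^esub> \<kappa> j = \<tau> j" by metis
    have "app h s y = \<phi> s y" if s: "s \<in> S" and y: "y \<in> FObj c s" for s y
    proof -
      obtain j x where jx: "j \<in> Obj J" "x \<in> FObj (FObj T j) s" "y = app (\<kappa> j) s x"
        using surj[OF SC[OF s] y] by blast
      show ?thesis
        using app_comp[OF \<kappa>[OF jx(1)] h(1) SC[OF s] jx(2)] h(2)[OF jx(1)] \<tau>\<phi>[OF jx(1) s jx(2)] jx(3) by simp
    qed
    with h(1) show ?thesis by blast
  qed
  fix \<sigma> \<tau> assume \<sigma>: "\<sigma> \<in> hom Psh c Q" and \<tau>: "\<tau> \<in> hom Psh c Q"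
    and eq: "\<forall>s\<in>S. \<forall>x\<in>FObj c s. app \<sigma> s x = app \<tau> s x"
  have eq': "\<sigma> \<circ>\<^bsub>Psh\<^esub> \<kappa> j = \<tau> \<circ>\<^bsub>Psh\<^esub> \<kappa> j" if j: "j \<in> Obj J" for j
  proof (rule det_unique[OF j Psh.comp_hom[OF \<kappa>[OF j] \<sigma>] Psh.comp_hom[OF \<kappa>[OF j] \<tau>]])
    fix s x assume s: "s \<in> S" and x: "x \<in> FObj (FObj T j) s"
    show "app (\<sigma> \<circ>\<^bsub>Psh\<^esub> \<kappa> j) s x = app (\<tau> \<circ>\<^bsub>Psh\<^esub> \<kappa> j) s x"
      using app_comp[OF \<kappa>[OF j] \<sigma> SC[OF s] x] app_comp[OF \<kappa>[OF j] \<tau> SC[OF s] x]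
        eq app_in[OF \<kappa>[OF j] SC[OF s] x] s by simp
  qed
  show "\<sigma> = \<tau>"
  proof (rule map_eqI[OF \<sigma> \<tau>])
    fix X y assume Xy: "X \<in> Obj C" "y \<in> FObj c X"
    obtain j x where jx: "j \<in> Obj J" "x \<in> FObj (FObj T j) X" "y = app (\<kappa> j) X x"
      using surj[OF Xy] by blast
    show "app \<sigma> X y = app \<tau> X y"
      using app_comp[OF \<kappa>[OF jx(1)] \<sigma> Xy(1) jx(2)] app_comp[OF \<kappa>[OF jx(1)] \<tau> Xy(1) jx(2)]
        eq'[OF jx(1)] jx(3) by simp
  qed
qed

end

context SmallPresheaves
begin

text \<open>Each of the presheaves is determined by a small set of objects and then by any larger set,
  so that the union of these sets serves for all of them.\<close>

lemma small_presheaf_colimit: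
  assumes "category J" "small U (Obj J)" "is_functor J Psh T"
    and small: "\<And>j. j \<in> Obj J \<Longrightarrow> small_presheaf U C (FObj T j)"
  obtains c \<kappa> where "is_colimit J Psh T c \<kappa>" "small_presheaf U C c"
proof -
  obtain c \<kappa> where c: "is_colimit J Psh T c \<kappa>"
    and surj: "\<And>X y. X \<in> Obj C \<Longrightarrow> y \<in> FObj c X \<Longrightarrow> \<exists>j\<in>Obj J. \<exists>x\<in>FObj (FObj T j) X. y = app (\<kappa> j) X x"
    by (rule Psh_colimit_ex[OF inaccessible assms(1-3)]) (rule that)
  have "\<exists>S. small U S \<and> S \<subseteq> Obj C \<and> (\<forall>S'. S \<subseteq> S' \<longrightarrow> S' \<subseteq> Obj C \<longrightarrow> determined S' (FObj T j))"
    if j: "j \<in> Obj J" for j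
  proof -
    obtain I :: "('u, 'u) cat" and K x where I: "small_category U I" "category I"
        "presents I K (FObj T j) x"
      using small_presheafE[OF small[OF j]] .
    have "small U (FObj K ` Obj I)"
      using small_image I(1) unfolding small_category_def by blast
    moreover have "FObj K ` Obj I \<subseteq> Obj C"
      using is_functorD(1)[OF presentsD(1)[OF I(3)]] by blast
    ultimately show ?thesis
      using presents_determined[OF I(2,3)] by blast
  qed
  then obtain S where S: "\<And>j. j \<in> Obj J \<Longrightarrow> small U (S j) \<and> S j \<subseteq> Obj C"
    and det: "\<And>j S'. j \<in> Obj J \<Longrightarrow> S j \<subseteq> S' \<Longrightarrow> S' \<subseteq> Obj C \<Longrightarrow> determined S' (FObj T j)"
    by metis
  let ?S = "\<Union>j\<in>Obj J. S j"
  have SC: "?S \<subseteq> Obj C" using S by blast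
  have "determined ?S c"
    by (rule determined_colimit[OF assms(1,3) c surj SC]) (use det SC in blast)+
  moreover have "small U ?S"
    using small_UNION[OF inaccessible assms(2)] S by blast
  ultimately show thesis
    using that[OF c] determined_small by blast
qed

end

section \<open>The M-category of small presheaves\<close>

lemma PM_sel [simp]:
  "Obj (PM U C) = {P. small_presheaf U C P}"
  "Dom (PM U C) = src" "Cod (PM U C) = tgt"
  "Ident (PM U C) = Ident (presheaf_cat U C)" "Comp (PM U C) = Comp (presheaf_cat U C)"
  "Mon (PM U C) = presheaf_monics U C"
  by (simp_all add: PM_def small_presheaf_cat_def cat.defs)

lemma hom_PM_iff:
  "\<mu> \<in> hom (PM U C) P Q \<longleftrightarrow>
    \<mu> \<in> hom (presheaf_cat U C) P Q \<and> small_presheaf U C P \<and> small_presheaf U C Q"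
  by (auto simp: hom_def PM_def small_presheaf_cat_def cat.defs)

lemma hom_small_presheaf_cat: "hom (small_presheaf_cat U C) P Q = hom (PM U C) P Q"
  by (auto simp: hom_def PM_def cat.defs)

lemma pullback_small_presheaf_cat: "pullback (small_presheaf_cat U C) = pullback (PM U C)"
  by (auto simp: fun_eq_iff pullback_def hom_def PM_def cat.defs)

locale MPresheaves = MCategory C + SmallPresheaves C U
  for C :: "('o, 'a, 'm) mcat_scheme" and U :: "'u itself"
begin

lemma category_PM: "category (PM U C)"
proof (rule categoryI)
  show "Dom (PM U C) f \<in> Obj (PM U C) \<and> Cod (PM U C) f \<in> Obj (PM U C)" if "f \<in> Arr (PM U C)" for f
    using that by (simp add: PM_def small_presheaf_cat_def cat.defs)
  show "Ident (PM U C) P \<in> hom (PM U C) P P" if "P \<in> Obj (PM U C)" for P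
    using that Psh.id_hom[of P] small_presheaf_psh[of P] by (simp add: hom_PM_iff)
  show "g \<circ>\<^bsub>PM U C\<^esub> f \<in> hom (PM U C) P R" if "f \<in> hom (PM U C) P Q" "g \<in> hom (PM U C) Q R" for P Q R f g
    using that Psh.comp_hom[of f P Q g R] by (simp add: hom_PM_iff)
  show "f \<circ>\<^bsub>PM U C\<^esub> Ident (PM U C) P = f \<and> Ident (PM U C) Q \<circ>\<^bsub>PM U C\<^esub> f = f"
    if "f \<in> hom (PM U C) P Q" for P Q f
    using that Psh.comp_id_left[of f P Q] Psh.comp_id_right[of f P Q] by (simp add: hom_PM_iff)
  show "h \<circ>\<^bsub>PM U C\<^esub> (g \<circ>\<^bsub>PM U C\<^esub> f) = (h \<circ>\<^bsub>PM U C\<^esub> g) \<circ>\<^bsub>PM U C\<^esub> f"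
    if "f \<in> hom (PM U C) P Q" "g \<in> hom (PM U C) Q R" "h \<in> hom (PM U C) R S" for P Q R S f g h
    using that Psh.comp_assoc[of f P Q g R h S] by (simp add: hom_PM_iff)
qed

sublocale PM: Category "PM U C"
  using category_PM by unfold_locales

lemma PM_Psh: "\<mu> \<in> hom (PM U C) P Q \<Longrightarrow> \<mu> \<in> hom Psh P Q"
  by (simp add: hom_PM_iff)

lemma elem_map_PM:
  "small_presheaf U C P \<Longrightarrow> X \<in> Obj C \<Longrightarrow> x \<in> FObj P X \<Longrightarrow> elem_map C P X x \<in> hom (PM U C) (rep X) P"
  using elem_map_hom small_presheaf_rep small_presheaf_psh unfolding hom_PM_iff by blast

lemma yo_PM: "g \<in> hom C W X \<Longrightarrow> FArr yo g \<in> hom (PM U C) (rep W) (rep X)"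
  using yo_hom small_presheaf_rep dom_obj cod_obj unfolding hom_PM_iff by blast

lemma yo_functor_PM: "is_functor C (PM U C) yo"
proof (rule is_functorI)
  show "FObj yo X \<in> Obj (PM U C)" if "X \<in> Obj C" for X
    using that small_presheaf_rep by (simp add: yo_obj)
  show "FArr yo f \<in> hom (PM U C) (FObj yo X) (FObj yo Y)" if "f \<in> hom C X Y" for f X Y
    using yo_PM[OF that] dom_obj[OF that] cod_obj[OF that] by (simp add: yo_obj)
  show "FArr yo (g \<circ>\<^bsub>C\<^esub> f) = FArr yo g \<circ>\<^bsub>PM U C\<^esub> FArr yo f" if "f \<in> hom C X Y" "g \<in> hom C Y Z" for X Y Z f g
    using is_functorD(4)[OF yo_functor that] by simp
  show "FObj yo \<in> extensional (Obj C)" "FArr yo \<in> extensional (Arr C)"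
    by (simp_all add: yoneda_def)
qed (simp add: is_functorD(3)[OF yo_functor])

lemma functor_PM_Psh: "is_functor J (PM U C) T \<Longrightarrow> is_functor J Psh T"
  unfolding is_functor_def using small_presheaf_psh
  by (auto simp: PiE_iff PM_def small_presheaf_cat_def cat.defs)

text \<open>Since a small diagram of small presheaves has a colimit in the category of all presheaves that
  is again small, its colimits among small presheaves are colimits among all presheaves.\<close>

lemma colimit_PM_Psh:
  assumes J: "category J" "small U (Obj J)" and T: "is_functor J (PM U C) T"
    and colim: "is_colimit J (PM U C) T c \<kappa>"
  shows "is_colimit J Psh T c \<kappa>"
proof -
  have T': "is_functor J Psh T" using functor_PM_Psh[OF T] .
  have Tsmall: "small_presheaf U C (FObj T j)" if "j \<in> Obj J" for j
    using is_functorD(1)[OF T that] by simp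
  obtain c' \<kappa>' where colim': "is_colimit J Psh T c' \<kappa>'" and small': "small_presheaf U C c'"
    by (rule small_presheaf_colimit[OF J T' Tsmall])
  have coc: "is_cocone J (PM U C) T c \<kappa>" using colim unfolding is_colimit_def by blast
  then have c: "small_presheaf U C c" and \<kappa>: "\<And>j. j \<in> Obj J \<Longrightarrow> \<kappa> j \<in> hom Psh (FObj T j) c"
    unfolding is_cocone_def by (auto simp: hom_PM_iff)
  have cocPsh: "is_cocone J Psh T c \<kappa>"
    using coc small_presheaf_psh[OF c] unfolding is_cocone_def by (simp add: hom_PM_iff)
  have coc': "is_cocone J Psh T c' \<kappa>'" using colim' unfolding is_colimit_def by blast
  then have \<kappa>': "\<And>j. j \<in> Obj J \<Longrightarrow> \<kappa>' j \<in> hom Psh (FObj T j) c'"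
    unfolding is_cocone_def by blast
  have "is_cocone J (PM U C) T c' \<kappa>'"
    using coc' small' Tsmall unfolding is_cocone_def by (simp add: hom_PM_iff)
  from is_colimitD(2)[OF colim this]
  obtain i where i: "i \<in> hom Psh c c'" "\<And>j. j \<in> Obj J \<Longrightarrow> i \<circ>\<^bsub>Psh\<^esub> \<kappa> j = \<kappa>' j"
    by (auto simp: hom_PM_iff)
  from is_colimitD(2)[OF colim' cocPsh]
  obtain i' where i': "i' \<in> hom Psh c' c" "\<And>j. j \<in> Obj J \<Longrightarrow> i' \<circ>\<^bsub>Psh\<^esub> \<kappa>' j = \<kappa> j"
    by auto
  have "\<exists>!h. h \<in> hom Psh c c \<and> (\<forall>j\<in>Obj J. h \<circ>\<^bsub>Psh\<^esub> \<kappa> j = \<kappa> j)"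
    using conjunct2[OF colim[unfolded is_colimit_def], rule_format, OF coc] c by (simp add: hom_PM_iff)
  moreover have "i' \<circ>\<^bsub>Psh\<^esub> i \<in> hom Psh c c \<and> (\<forall>j\<in>Obj J. (i' \<circ>\<^bsub>Psh\<^esub> i) \<circ>\<^bsub>Psh\<^esub> \<kappa> j = \<kappa> j)"
    using Psh.comp_hom[OF i(1) i'(1)] Psh.comp_assoc[OF \<kappa> i(1) i'(1)] i(2) i'(2) by simp
  moreover have idc: "Ident Psh c \<in> hom Psh c c" using Psh.id_hom small_presheaf_psh[OF c] by simp
  then have "Ident Psh c \<in> hom Psh c c \<and> (\<forall>j\<in>Obj J. Ident Psh c \<circ>\<^bsub>Psh\<^esub> \<kappa> j = \<kappa> j)"
    using Psh.comp_id_left[OF \<kappa>] by simp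
  \<comment> \<open>Uniqueness for \<open>c\<close> among small presheaves suffices here, as \<open>c\<close> itself is small.\<close>
  ultimately have i'i: "i' \<circ>\<^bsub>Psh\<^esub> i = Ident Psh c" by blast
  show ?thesis
    unfolding is_colimit_def
  proof (intro conjI allI impI)
    show "is_cocone J Psh T c \<kappa>" using cocPsh .
    fix d \<mu> assume \<mu>: "is_cocone J Psh T d \<mu>"
    have ex1: "\<exists>!h. h \<in> hom Psh c' d \<and> (\<forall>j\<in>Obj J. h \<circ>\<^bsub>Psh\<^esub> \<kappa>' j = \<mu> j)"
      using colim' \<mu> unfolding is_colimit_def by blast
    then obtain h' where h': "h' \<in> hom Psh c' d" "\<And>j. j \<in> Obj J \<Longrightarrow> h' \<circ>\<^bsub>Psh\<^esub> \<kappa>' j = \<mu> j" by blast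
    show "\<exists>!h. h \<in> hom Psh c d \<and> (\<forall>j\<in>Obj J. h \<circ>\<^bsub>Psh\<^esub> \<kappa> j = \<mu> j)"
    proof (rule ex1I[of _ "h' \<circ>\<^bsub>Psh\<^esub> i"])
      show "h' \<circ>\<^bsub>Psh\<^esub> i \<in> hom Psh c d \<and> (\<forall>j\<in>Obj J. (h' \<circ>\<^bsub>Psh\<^esub> i) \<circ>\<^bsub>Psh\<^esub> \<kappa> j = \<mu> j)"
        using Psh.comp_hom[OF i(1) h'(1)] Psh.comp_assoc[OF \<kappa> i(1) h'(1)] i(2) h'(2) by simp
      fix h assume h: "h \<in> hom Psh c d \<and> (\<forall>j\<in>Obj J. h \<circ>\<^bsub>Psh\<^esub> \<kappa> j = \<mu> j)"
      then have hh: "h \<in> hom Psh c d" by blast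
      have "h \<circ>\<^bsub>Psh\<^esub> i' \<in> hom Psh c' d \<and> (\<forall>j\<in>Obj J. (h \<circ>\<^bsub>Psh\<^esub> i') \<circ>\<^bsub>Psh\<^esub> \<kappa>' j = \<mu> j)"
        using Psh.comp_hom[OF i'(1) hh] Psh.comp_assoc[OF \<kappa>' i'(1) hh] i'(2) h by simp
      with ex1 h' have "h \<circ>\<^bsub>Psh\<^esub> i' = h'" by blast
      then show "h = h' \<circ>\<^bsub>Psh\<^esub> i"
        using Psh.comp_assoc[OF i(1) i'(1) hh] i'i Psh.comp_id_right[OF hh] by simp
    qed
  qed
qed

lemma elem_map_inject:
  assumes "elem_map C P X x = elem_map C P X y" "psh P" "X \<in> Obj C" "x \<in> FObj P X" "y \<in> FObj P X"
  shows "x = y"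
  using app_elem_map_id[OF assms(2,3,4)] app_elem_map_id[OF assms(2,3,5)] assms(1) by metis

text \<open>A pullback of presheaves is one pointwise: test it on representables, which are small.\<close>

lemma pullback_PM_elem:
  assumes pb: "pullback (PM U C) p q f g"
    and "p \<in> hom (PM U C) W A" "q \<in> hom (PM U C) W B" "f \<in> hom (PM U C) A X" "g \<in> hom (PM U C) B X"
    and Z: "Z \<in> Obj C" "a \<in> FObj A Z" "b \<in> FObj B Z" "app f Z a = app g Z b"
  shows "\<exists>!w. w \<in> FObj W Z \<and> app p Z w = a \<and> app q Z w = b"
proof -
  have W: "small_presheaf U C W" "small_presheaf U C A" "small_presheaf U C B"
    using assms(2,3) by (auto simp: hom_PM_iff)
  note p = PM_Psh[OF assms(2)] and q = PM_Psh[OF assms(3)] and f = PM_Psh[OF assms(4)]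
      and g = PM_Psh[OF assms(5)]
  have pw: "p \<circ>\<^bsub>Psh\<^esub> elem_map C W Z w = elem_map C A Z a \<longleftrightarrow> app p Z w = a" if "w \<in> FObj W Z" for w
    using comp_elem_map[OF p Z(1) that] elem_map_inject[OF _ map_psh(2)[OF p] Z(1)
        app_in[OF p Z(1) that] Z(2)] by auto
  have qw: "q \<circ>\<^bsub>Psh\<^esub> elem_map C W Z w = elem_map C B Z b \<longleftrightarrow> app q Z w = b" if "w \<in> FObj W Z" for w
    using comp_elem_map[OF q Z(1) that] elem_map_inject[OF _ map_psh(2)[OF q] Z(1)
        app_in[OF q Z(1) that] Z(3)] by auto
  have "f \<circ>\<^bsub>PM U C\<^esub> elem_map C A Z a = g \<circ>\<^bsub>PM U C\<^esub> elem_map C B Z b"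
    using comp_elem_map[OF f Z(1,2)] comp_elem_map[OF g Z(1,3)] Z(4) by simp
  from PM.pullback_universal[OF pb assms(2,3) elem_map_PM[OF W(2) Z(1,2)] elem_map_PM[OF W(3) Z(1,3)] this]
  obtain h where h0: "h \<in> hom (PM U C) (rep Z) W" and h: "p \<circ>\<^bsub>Psh\<^esub> h = elem_map C A Z a"
      "q \<circ>\<^bsub>Psh\<^esub> h = elem_map C B Z b"
    and uniq: "\<And>k. k \<in> hom (PM U C) (rep Z) W \<Longrightarrow> p \<circ>\<^bsub>Psh\<^esub> k = elem_map C A Z a \<Longrightarrow>
      q \<circ>\<^bsub>Psh\<^esub> k = elem_map C B Z b \<Longrightarrow> k = h"
    unfolding PM_sel by (elim ex1E) blast
  note h1 = PM_Psh[OF h0]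
  define w where "w = app h Z (Inl (Ident C Z))"
  have w: "w \<in> FObj W Z" "elem_map C W Z w = h"
    unfolding w_def using app_in[OF h1 Z(1) rep_id[OF Z(1)]] elem_map_app[OF h1 Z(1)] .
  show ?thesis
  proof (rule ex1I[of _ w])
    show "w \<in> FObj W Z \<and> app p Z w = a \<and> app q Z w = b"
      using w pw[OF w(1)] qw[OF w(1)] h by simp
    fix v assume v: "v \<in> FObj W Z \<and> app p Z v = a \<and> app q Z v = b"
    then have "elem_map C W Z v = h"
      using uniq[OF elem_map_PM[OF W(1) Z(1)]] pw qw by blast
    then show "v = w"
      using elem_map_inject[OF _ map_psh(1)[OF p] Z(1) conjunct1[OF v] w(1)] w(2) by simp
  qed
qed

lemma pullback_PM_elemI:
  assumes "p \<in> hom (PM U C) W A" "q \<in> hom (PM U C) W B" "f \<in> hom (PM U C) A X" "g \<in> hom (PM U C) B X"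
    and comm: "\<And>Z w. Z \<in> Obj C \<Longrightarrow> w \<in> FObj W Z \<Longrightarrow> app f Z (app p Z w) = app g Z (app q Z w)"
    and univ: "\<And>Z a b. Z \<in> Obj C \<Longrightarrow> a \<in> FObj A Z \<Longrightarrow> b \<in> FObj B Z \<Longrightarrow> app f Z a = app g Z b \<Longrightarrow>
      \<exists>!w. w \<in> FObj W Z \<and> app p Z w = a \<and> app q Z w = b"
  shows "pullback (PM U C) p q f g"
proof (rule PM.pullbackI[OF assms(1-4)])
  note p = PM_Psh[OF assms(1)] and q = PM_Psh[OF assms(2)] and f = PM_Psh[OF assms(3)]
      and g = PM_Psh[OF assms(4)]
  show "f \<circ>\<^bsub>PM U C\<^esub> p = g \<circ>\<^bsub>PM U C\<^esub> q"
    using map_eqI[OF Psh.comp_hom[OF p f] Psh.comp_hom[OF q g]] app_comp[OF p f] app_comp[OF q g] comm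
        by simp
  fix V a b assume ab: "a \<in> hom (PM U C) V A" "b \<in> hom (PM U C) V B"
    and eq: "f \<circ>\<^bsub>PM U C\<^esub> a = g \<circ>\<^bsub>PM U C\<^esub> b"
  note a = PM_Psh[OF ab(1)] and b = PM_Psh[OF ab(2)]
  have V: "psh V" "small_presheaf U C V" "small_presheaf U C W"
    using map_psh(1)[OF a] ab(1) assms(1) by (auto simp: hom_PM_iff)
  have W: "psh W" using map_psh(1)[OF p] .
  have ex1: "\<exists>!w. w \<in> FObj W Z \<and> app p Z w = app a Z v \<and> app q Z w = app b Z v"
    if "Z \<in> Obj C" "v \<in> FObj V Z" for Z v
    using univ[OF that(1) app_in[OF a that] app_in[OF b that]] app_comp[OF a f that]
        app_comp[OF b g that] eq by simp
  then have "\<forall>Z v. \<exists>w. Z \<in> Obj C \<and> v \<in> FObj V Z \<longrightarrow> w \<in> FObj W Z \<and> app p Z w = app a Z v \<and>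
      app q Z w = app b Z v"
    by blast
  then obtain t where t: "\<And>Z v. Z \<in> Obj C \<Longrightarrow> v \<in> FObj V Z \<Longrightarrow>
      t Z v \<in> FObj W Z \<and> app p Z (t Z v) = app a Z v \<and> app q Z (t Z v) = app b Z v"
    by metis
  let ?t = "mk_presheaf_map C V W t"
  have th: "?t \<in> hom Psh V W"
  proof (rule mk_presheaf_map_hom[OF V(1) W])
    show "t Z v \<in> FObj W Z" if "Z \<in> Obj C" "v \<in> FObj V Z" for Z v using t[OF that] by blast
    show "t Z' (act V h v) = act W h (t Z v)" if h: "h \<in> hom C Z' Z" and v: "v \<in> FObj V Z" for Z' Z h v
    proof -
      have Z: "Z \<in> Obj C" "Z' \<in> Obj C" using cod_obj[OF h] dom_obj[OF h] .
      have hv: "act V h v \<in> FObj V Z'" using act_in[OF V(1) h v] .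
      have tv: "t Z v \<in> FObj W Z" using t[OF Z(1) v] by blast
      have "act W h (t Z v) \<in> FObj W Z' \<and> app p Z' (act W h (t Z v)) = app a Z' (act V h v) \<and>
          app q Z' (act W h (t Z v)) = app b Z' (act V h v)"
        using act_in[OF W h tv] app_natural[OF p h tv] app_natural[OF q h tv] app_natural[OF a h v]
          app_natural[OF b h v] t[OF Z(1) v] by simp
      with t[OF Z(2) hv] ex1[OF Z(2) hv] show ?thesis by blast
    qed
  qed
  show "\<exists>!h. h \<in> hom (PM U C) V W \<and> p \<circ>\<^bsub>PM U C\<^esub> h = a \<and> q \<circ>\<^bsub>PM U C\<^esub> h = b"
  proof (rule ex1I[of _ ?t])
    have "p \<circ>\<^bsub>Psh\<^esub> ?t = a"
      by (rule map_eqI[OF Psh.comp_hom[OF th p] a]) (use app_comp[OF th p] t in simp)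
    moreover have "q \<circ>\<^bsub>Psh\<^esub> ?t = b"
      by (rule map_eqI[OF Psh.comp_hom[OF th q] b]) (use app_comp[OF th q] t in simp)
    ultimately show "?t \<in> hom (PM U C) V W \<and> p \<circ>\<^bsub>PM U C\<^esub> ?t = a \<and> q \<circ>\<^bsub>PM U C\<^esub> ?t = b"
      using th V by (simp add: hom_PM_iff)
    fix h assume h: "h \<in> hom (PM U C) V W \<and> p \<circ>\<^bsub>PM U C\<^esub> h = a \<and> q \<circ>\<^bsub>PM U C\<^esub> h = b"
    then have hh: "h \<in> hom Psh V W" "p \<circ>\<^bsub>Psh\<^esub> h = a" "q \<circ>\<^bsub>Psh\<^esub> h = b" by (auto simp: hom_PM_iff)
    show "h = ?t"
    proof (rule map_eqI[OF hh(1) th])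
      fix Z v assume Z: "Z \<in> Obj C" "v \<in> FObj V Z"
      have "app h Z v \<in> FObj W Z \<and> app p Z (app h Z v) = app a Z v \<and> app q Z (app h Z v) = app b Z v"
        using app_in[OF hh(1) Z] app_comp[OF hh(1) p Z] app_comp[OF hh(1) q Z] hh(2,3) by simp
      with t[OF Z] ex1[OF Z] have "app h Z v = t Z v" by blast
      then show "app h Z v = app ?t Z v" using Z by simp
    qed
  qed
qed

text \<open>The monics of the M-category of small presheaves, in terms of elements: for each element \<open>x\<close>
  of \<open>Q\<close>, the sieve of maps along which \<open>x\<close> restricts to an element of \<open>P\<close> is generated by a single
  chosen monic.\<close>

definition classifies ::
  "('o, 'a, 'u) presheaf_map \<Rightarrow> ('o, 'a, 'u) presheaf \<Rightarrow> ('o, 'a, 'u) presheaf \<Rightarrow> 'o \<Rightarrow> 'a + 'u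
     \<Rightarrow> 'a \<Rightarrow> 'a + 'u \<Rightarrow> bool" where
  "classifies \<mu> P Q X x m z \<longleftrightarrow> m \<in> Mon C \<and> Cod C m = X \<and> z \<in> FObj P (Dom C m) \<and>
     app \<mu> (Dom C m) z = act Q m x \<and>
     (\<forall>W. \<forall>f\<in>hom C W X. \<forall>p\<in>FObj P W. app \<mu> W p = act Q f x \<longrightarrow>
        (\<exists>h\<in>hom C W (Dom C m). m \<circ>\<^bsub>C\<^esub> h = f \<and> act P h z = p))"

lemma classifiesD:
  assumes "classifies \<mu> P Q X x m z"
  shows "m \<in> Mon C" "m \<in> hom C (Dom C m) X" "z \<in> FObj P (Dom C m)" "app \<mu> (Dom C m) z = act Q m x"
    "f \<in> hom C W X \<Longrightarrow> p \<in> FObj P W \<Longrightarrow> app \<mu> W p = act Q f x \<Longrightarrow>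
      \<exists>h\<in>hom C W (Dom C m). m \<circ>\<^bsub>C\<^esub> h = f \<and> act P h z = p"
proof -
  show "m \<in> hom C (Dom C m) X"
    using assms mon_hom[of m] unfolding classifies_def by auto
qed (use assms in \<open>unfold classifies_def, blast+\<close>)

text \<open>The element \<open>x\<close> is a map out of a representable. The monic that represents its pullback
  along \<open>\<mu>\<close> classifies \<open>x\<close>, with \<open>z\<close> the image of the identity under the other projection.\<close>

lemma presheaf_monic_classifies:
  assumes \<mu>: "\<mu> \<in> presheaf_monics U C" "\<mu> \<in> hom (PM U C) P Q" and X: "X \<in> Obj C" "x \<in> FObj Q X"
  obtains m z where "classifies \<mu> P Q X x m z"
proof -
  have Q: "small_presheaf U C Q" and P: "small_presheaf U C P" using \<mu>(2) by (auto simp: hom_PM_iff)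
  note \<mu>' = PM_Psh[OF \<mu>(2)] and psh = small_presheaf_psh[OF Q] small_presheaf_psh[OF P]
  let ?\<gamma> = "elem_map C Q X x"
  have \<gamma>: "?\<gamma> \<in> hom (PM U C) (rep X) Q" using elem_map_PM[OF Q X] .
  have "tgt \<mu> = Q" using \<mu>(2) by (simp add: hom_iff)
  then obtain m q where m: "m \<in> Mon C" "Cod C m = X" and pb: "pullback (PM U C) (FArr yo m) q ?\<gamma> \<mu>"
    using \<mu>(1) \<gamma> X(1) unfolding presheaf_monics_def hom_small_presheaf_cat pullback_small_presheaf_cat
        by blast
  have mh: "m \<in> hom C (Dom C m) X" using mon_hom[OF m(1)] m(2) by simp
  have W: "Dom C m \<in> Obj C" using dom_obj[OF mh] .
  note ym = yo_PM[OF mh]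
  have q: "q \<in> hom (PM U C) (rep (Dom C m)) P"
    using PM.pullbackD(2)[OF pb] hom_dom[OF ym] hom_dom[OF \<mu>(2)] by simp
  note q' = PM_Psh[OF q] and ym' = PM_Psh[OF ym] and \<gamma>' = PM_Psh[OF \<gamma>]
  define z where "z = app q (Dom C m) (Inl (Ident C (Dom C m)))"
  have z: "z \<in> FObj P (Dom C m)" unfolding z_def using app_in[OF q' W rep_id[OF W]] .
  have qz: "app q W' (Inl h) = act P h z" if "h \<in> hom C W' (Dom C m)" for W' h
    using app_natural[OF q' that rep_id[OF W]] rep_act[OF that id_hom[OF W]] comp_id_left[OF that]
    unfolding z_def by simp
  have "classifies \<mu> P Q X x m z"
    unfolding classifies_def
  proof (intro conjI allI ballI impI)
    show "m \<in> Mon C" "Cod C m = X" "z \<in> FObj P (Dom C m)" using m z .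
    have "?\<gamma> \<circ>\<^bsub>Psh\<^esub> FArr yo m = \<mu> \<circ>\<^bsub>Psh\<^esub> q" using PM.pullbackD(5)[OF pb] by simp
    then show "app \<mu> (Dom C m) z = act Q m x"
      using app_comp[OF ym' \<gamma>' W rep_id[OF W]] app_comp[OF q' \<mu>' W rep_id[OF W]]
        app_yo[OF mh id_hom[OF W]] comp_id_right[OF mh] app_elem_map[OF mh, of Q x] unfolding z_def by simp
    fix W' f p assume f: "f \<in> hom C W' X" and p: "p \<in> FObj P W'" and eq: "app \<mu> W' p = act Q f x"
    have W': "W' \<in> Obj C" using dom_obj[OF f] .
    have "Inl f \<in> FObj (rep X) W'" using f rep_obj[OF W'] by simp
    moreover have "app ?\<gamma> W' (Inl f) = app \<mu> W' p" using eq app_elem_map[OF f, of Q x] by simp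
    ultimately obtain w where w: "w \<in> FObj (rep (Dom C m)) W'" "app (FArr yo m) W' w = Inl f"
        "app q W' w = p"
      using pullback_PM_elem[OF pb ym q \<gamma> \<mu>(2) W' _ p] by blast
    then obtain h where h: "w = Inl h" "h \<in> hom C W' (Dom C m)" using rep_obj[OF W'] by auto
    then show "\<exists>h\<in>hom C W' (Dom C m). m \<circ>\<^bsub>C\<^esub> h = f \<and> act P h z = p"
      using w(2,3) app_yo[OF mh h(2)] qz[OF h(2)] by auto
  qed
  with that show thesis .
qed

lemma presheaf_monicI:
  assumes \<mu>: "\<mu> \<in> hom (PM U C) P Q"
    and cl: "\<And>X x. X \<in> Obj C \<Longrightarrow> x \<in> FObj Q X \<Longrightarrow> \<exists>m z. classifies \<mu> P Q X x m z"
  shows "\<mu> \<in> presheaf_monics U C"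
proof -
  have Q: "small_presheaf U C Q" and P: "small_presheaf U C P" using \<mu> by (auto simp: hom_PM_iff)
  note \<mu>' = PM_Psh[OF \<mu>] and psh = small_presheaf_psh[OF Q] small_presheaf_psh[OF P]
  have "\<exists>m\<in>Mon C. Cod C m = X \<and> (\<exists>q. pullback (PM U C) (FArr yo m) q \<gamma> \<mu>)"
    if X: "X \<in> Obj C" and \<gamma>: "\<gamma> \<in> hom (PM U C) (rep X) Q" for X \<gamma>
  proof -
    define x where "x = app \<gamma> X (Inl (Ident C X))"
    have x: "x \<in> FObj Q X" "\<gamma> = elem_map C Q X x"
      unfolding x_def using app_in[OF PM_Psh[OF \<gamma>] X rep_id[OF X]] elem_map_app[OF PM_Psh[OF \<gamma>] X]
          by simp_all
    obtain m z where mz: "classifies \<mu> P Q X x m z" using cl[OF X x(1)] by blast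
    note m = classifiesD[OF mz]
    have W: "Dom C m \<in> Obj C" using dom_obj[OF m(2)] .
    have z: "elem_map C P (Dom C m) z \<in> hom (PM U C) (rep (Dom C m)) P" using elem_map_PM[OF P W m(3)] .
    have "pullback (PM U C) (FArr yo m) (elem_map C P (Dom C m) z) \<gamma> \<mu>"
    proof (rule pullback_PM_elemI[OF yo_PM[OF m(2)] z \<gamma> \<mu>])
      fix Z w assume Z: "Z \<in> Obj C" and "w \<in> FObj (rep (Dom C m)) Z"
      then obtain h where h: "w = Inl h" "h \<in> hom C Z (Dom C m)" by (auto simp: rep_obj)
      show "app \<gamma> Z (app (FArr yo m) Z w) = app \<mu> Z (app (elem_map C P (Dom C m) z) Z w)"
        using app_yo[OF m(2) h(2)] app_elem_map[OF comp_hom[OF h(2) m(2)], of Q x]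
            app_elem_map[OF h(2), of P z]
          act_comp[OF psh(1) h(2) m(2) x(1)] app_natural[OF \<mu>' h(2) m(3)] m(4) h(1) x(2) by simp
    next
      fix Z e p assume Z: "Z \<in> Obj C" and "e \<in> FObj (rep X) Z" and p: "p \<in> FObj P Z"
        and eq: "app \<gamma> Z e = app \<mu> Z p"
      then obtain f where f: "e = Inl f" "f \<in> hom C Z X" by (auto simp: rep_obj)
      have "app \<mu> Z p = act Q f x" using eq f x(2) app_elem_map[OF f(2), of Q x] by simp
      from m(5)[OF f(2) p this]
      obtain h where h: "h \<in> hom C Z (Dom C m)" "m \<circ>\<^bsub>C\<^esub> h = f" "act P h z = p" by blast
      show "\<exists>!w. w \<in> FObj (rep (Dom C m)) Z \<and> app (FArr yo m) Z w = e \<and>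
          app (elem_map C P (Dom C m) z) Z w = p"
      proof (rule ex1I[of _ "Inl h"])
        show "Inl h \<in> FObj (rep (Dom C m)) Z \<and> app (FArr yo m) Z (Inl h) = e \<and>
            app (elem_map C P (Dom C m) z) Z (Inl h) = p"
          using h f(1) app_yo[OF m(2) h(1)] rep_obj[OF Z] app_elem_map[OF h(1), of P z] by simp
        fix w assume w: "w \<in> FObj (rep (Dom C m)) Z \<and> app (FArr yo m) Z w = e \<and>
            app (elem_map C P (Dom C m) z) Z w = p"
        then obtain k where k: "w = Inl k" "k \<in> hom C Z (Dom C m)" using rep_obj[OF Z] by auto
        have "m \<circ>\<^bsub>C\<^esub> k = m \<circ>\<^bsub>C\<^esub> h" using w k(1) app_yo[OF m(2) k(2)] f(1) h(2) by simp
        then show "w = Inl h" using monicD[OF mon_monic[OF m(1)] m(2) k(2) h(1)] k(1) by simp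
      qed
    qed
    with m(1) hom_cod[OF m(2)] show ?thesis by blast
  qed
  moreover have "tgt \<mu> = Q"
    using \<mu> by (simp add: hom_iff)
  moreover have "\<mu> \<in> Arr (small_presheaf_cat U C)"
    using hom_arr[OF \<mu>] by (simp add: PM_def cat.defs)
  ultimately show ?thesis
    unfolding presheaf_monics_def hom_small_presheaf_cat pullback_small_presheaf_cat by blast
qed

lemma yo_pullback:
  assumes "pullback C p q f g"
  shows "pullback (PM U C) (FArr yo p) (FArr yo q) (FArr yo f) (FArr yo g)"
proof -
  obtain W A B X where pb: "p \<in> hom C W A" "q \<in> hom C W B" "f \<in> hom C A X" "g \<in> hom C B X"
    "f \<circ>\<^bsub>C\<^esub> p = g \<circ>\<^bsub>C\<^esub> q"
    using pullbackE[OF assms] .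
  show ?thesis
  proof (rule pullback_PM_elemI[OF pb(1-4)[THEN yo_PM]])
    fix Z w assume Z: "Z \<in> Obj C" and "w \<in> FObj (rep W) Z"
    then obtain h where h: "w = Inl h" "h \<in> hom C Z W" by (auto simp: rep_obj)
    show "app (FArr yo f) Z (app (FArr yo p) Z w) = app (FArr yo g) Z (app (FArr yo q) Z w)"
      using h(1) app_yo[OF pb(1) h(2)] app_yo[OF pb(2) h(2)] app_yo[OF pb(3) comp_hom[OF h(2) pb(1)]]
        app_yo[OF pb(4) comp_hom[OF h(2) pb(2)]] comp_assoc[OF h(2) pb(1,3)]
            comp_assoc[OF h(2) pb(2,4)] pb(5)
      by simp
  next
    fix Z a b assume Z: "Z \<in> Obj C" and "a \<in> FObj (rep A) Z" "b \<in> FObj (rep B) Z"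
      and eq: "app (FArr yo f) Z a = app (FArr yo g) Z b"
    then obtain k l where k: "a = Inl k" "k \<in> hom C Z A" and l: "b = Inl l" "l \<in> hom C Z B"
      by (auto simp: rep_obj)
    have "f \<circ>\<^bsub>C\<^esub> k = g \<circ>\<^bsub>C\<^esub> l"
      using eq k(1) l(1) app_yo[OF pb(3) k(2)] app_yo[OF pb(4) l(2)] by simp
    from pullback_universal[OF assms pb(1,2) k(2) l(2) this]
    obtain h where h: "h \<in> hom C Z W" "p \<circ>\<^bsub>C\<^esub> h = k" "q \<circ>\<^bsub>C\<^esub> h = l"
      and uniq: "\<And>h'. h' \<in> hom C Z W \<Longrightarrow> p \<circ>\<^bsub>C\<^esub> h' = k \<Longrightarrow> q \<circ>\<^bsub>C\<^esub> h' = l \<Longrightarrow> h' = h"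
      by (elim ex1E) blast
    show "\<exists>!w. w \<in> FObj (rep W) Z \<and> app (FArr yo p) Z w = a \<and> app (FArr yo q) Z w = b"
    proof (rule ex1I[of _ "Inl h"])
      show "Inl h \<in> FObj (rep W) Z \<and> app (FArr yo p) Z (Inl h) = a \<and> app (FArr yo q) Z (Inl h) = b"
        using h k(1) l(1) app_yo[OF pb(1) h(1)] app_yo[OF pb(2) h(1)] rep_obj[OF Z] by simp
      fix w assume w: "w \<in> FObj (rep W) Z \<and> app (FArr yo p) Z w = a \<and> app (FArr yo q) Z w = b"
      then obtain h' where h': "w = Inl h'" "h' \<in> hom C Z W" using rep_obj[OF Z] by auto
      show "w = Inl h"
        using uniq[OF h'(2)] w h'(1) app_yo[OF pb(1) h'(2)] app_yo[OF pb(2) h'(2)] k(1) l(1) by simp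
    qed
  qed
qed

lemma yo_mon:
  assumes "m \<in> Mon C"
  shows "FArr yo m \<in> presheaf_monics U C"
proof -
  let ?A = "Dom C m" and ?B = "Cod C m"
  have m: "m \<in> hom C ?A ?B" using mon_hom[OF assms] .
  show ?thesis
  proof (rule presheaf_monicI[OF yo_PM[OF m]])
    fix X x assume X: "X \<in> Obj C" and "x \<in> FObj (rep ?B) X"
    then obtain f where f: "x = Inl f" "f \<in> hom C X ?B" by (auto simp: rep_obj)
    obtain p q where pq: "pullback C p q f m" using mon_pullbackE[OF assms f(2)] .
    have p: "p \<in> hom C (Dom C p) X" and q: "q \<in> hom C (Dom C p) ?A" and comm: "f \<circ>\<^bsub>C\<^esub> p = m \<circ>\<^bsub>C\<^esub> q"
      using pullbackD[OF pq] hom_dom[OF f(2)] by auto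
    have "classifies (FArr yo m) (rep ?A) (rep ?B) X x p (Inl q)"
      unfolding classifies_def
    proof (intro conjI allI ballI impI)
      show "p \<in> Mon C" using mon_pullback[OF assms pq] .
      show "Cod C p = X" using hom_cod[OF p] .
      show "Inl q \<in> FObj (rep ?A) (Dom C p)" using q rep_obj[OF dom_obj[OF p]] by simp
      show "app (FArr yo m) (Dom C p) (Inl q) = act (rep ?B) p x"
        using app_yo[OF m q] rep_act[OF p f(2)] comm f(1) by simp
      fix W g e assume g: "g \<in> hom C W X" and e: "e \<in> FObj (rep ?A) W"
        and eq: "app (FArr yo m) W e = act (rep ?B) g x"
      obtain k where k: "e = Inl k" "k \<in> hom C W ?A" using e rep_obj[OF dom_obj[OF g]] by auto
      have "f \<circ>\<^bsub>C\<^esub> g = m \<circ>\<^bsub>C\<^esub> k" using eq k(1) app_yo[OF m k(2)] rep_act[OF g f(2)] f(1) by simp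
      then obtain h where h: "h \<in> hom C W (Dom C p)" "p \<circ>\<^bsub>C\<^esub> h = g" "q \<circ>\<^bsub>C\<^esub> h = k"
        using pullback_lift[OF pq p q g k(2)] by metis
      have "act (rep ?A) h (Inl q) = e" using rep_act[OF h(1) q] h(3) k(1) by simp
      with h show "\<exists>h\<in>hom C W (Dom C p). p \<circ>\<^bsub>C\<^esub> h = g \<and> act (rep ?A) h (Inl q) = e" by blast
    qed
    then show "\<exists>m' z. classifies (FArr yo m) (rep ?A) (rep ?B) X x m' z" by blast
  qed
qed

text \<open>Since \<open>W\<close> is pointwise a pullback, \<open>r\<close> restricts into \<open>W\<close> exactly where \<open>g r\<close> restricts into
  \<open>P\<close>, so that the same monic classifies both.\<close>

lemma classifies_pullback:
  assumes pb: "pullback (PM U C) p q g \<mu>" and p: "p \<in> hom (PM U C) W R" and q: "q \<in> hom (PM U C) W P"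
    and g: "g \<in> hom (PM U C) R Q" and \<mu>: "\<mu> \<in> hom (PM U C) P Q" and X: "X \<in> Obj C" and r: "r \<in> FObj R X"
    and cl: "classifies \<mu> P Q X (app g X r) m z"
  obtains w where "classifies p W R X r m w" "app q (Dom C m) w = z"
proof -
  note m = classifiesD[OF cl] and p' = PM_Psh[OF p] and q' = PM_Psh[OF q] and g' = PM_Psh[OF g]
      and \<mu>' = PM_Psh[OF \<mu>]
  have D: "Dom C m \<in> Obj C" using dom_obj[OF m(2)] .
  have R: "psh R" and W: "psh W" using map_psh[OF p'] by blast+
  have "app g (Dom C m) (act R m r) = app \<mu> (Dom C m) z" using app_natural[OF g' m(2) r] m(4) by simp
  then obtain w where w: "w \<in> FObj W (Dom C m)" "app p (Dom C m) w = act R m r" "app q (Dom C m) w = z"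
    using pullback_PM_elem[OF pb p q g \<mu> D act_in[OF R m(2) r] m(3)] by blast
  have "classifies p W R X r m w"
    unfolding classifies_def
  proof (intro conjI allI ballI impI)
    show "m \<in> Mon C" "Cod C m = X" "w \<in> FObj W (Dom C m)" "app p (Dom C m) w = act R m r"
      using m(1) hom_cod[OF m(2)] w(1,2) .
    fix V f w' assume f: "f \<in> hom C V X" and w': "w' \<in> FObj W V" and eq: "app p V w' = act R f r"
    have V: "V \<in> Obj C" using dom_obj[OF f] .
    have comm: "app \<mu> V (app q V w') = app g V (app p V w')"
      using app_comp[OF q' \<mu>' V w'] app_comp[OF p' g' V w'] PM.pullbackD(5)[OF pb] by simp
    then have "app \<mu> V (app q V w') = act Q f (app g X r)"
      using app_natural[OF g' f r] eq by simp
    from m(5)[OF f app_in[OF q' V w'] this]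
    obtain h where h: "h \<in> hom C V (Dom C m)" "m \<circ>\<^bsub>C\<^esub> h = f" "act P h z = app q V w'" by blast
    have "act W h w \<in> FObj W V \<and> app p V (act W h w) = app p V w' \<and> app q V (act W h w) = app q V w'"
      using act_in[OF W h(1) w(1)] app_natural[OF p' h(1) w(1)] app_natural[OF q' h(1) w(1)]
        act_comp[OF R h(1) m(2) r] w(2,3) h(2,3) eq by simp
    moreover have "\<exists>!v. v \<in> FObj W V \<and> app p V v = app p V w' \<and> app q V v = app q V w'"
      using pullback_PM_elem[OF pb p q g \<mu> V app_in[OF p' V w'] app_in[OF q' V w']] comm by simp
    ultimately have "act W h w = w'" using w' by blast
    with h show "\<exists>h\<in>hom C V (Dom C m). m \<circ>\<^bsub>C\<^esub> h = f \<and> act W h w = w'" by blast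
  qed
  with that w(3) show thesis by blast
qed

lemma presheaf_monic_pullback:
  assumes pb: "pullback (PM U C) p q g \<mu>" and \<mu>: "\<mu> \<in> presheaf_monics U C"
  shows "p \<in> presheaf_monics U C"
proof -
  obtain W R P Q where h: "p \<in> hom (PM U C) W R" "q \<in> hom (PM U C) W P" "g \<in> hom (PM U C) R Q"
      "\<mu> \<in> hom (PM U C) P Q"
    using PM.pullbackE[OF pb] .
  show ?thesis
  proof (rule presheaf_monicI[OF h(1)])
    fix X r assume X: "X \<in> Obj C" "r \<in> FObj R X"
    obtain m z where "classifies \<mu> P Q X (app g X r) m z"
      using presheaf_monic_classifies[OF \<mu> h(4) X(1) app_in[OF PM_Psh[OF h(3)] X]] .
    then show "\<exists>m w. classifies p W R X r m w"
      using classifies_pullback[OF pb h X] by metis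
  qed
qed

end

section \<open>Colimits weighted by a presheaf\<close>

locale Extension = MPresheaves C U + D: Cocomplete D U
  for C :: "('o, 'a, 'm) mcat_scheme" and D :: "('p, 'b, 'n) mcat_scheme" and U :: "'u itself" +
  assumes D_hom_small: "X \<in> Obj D \<Longrightarrow> Y \<in> Obj D \<Longrightarrow> small U (hom D X Y)"
begin

text \<open>A cocone on the composite of \<open>F\<close> with the projection from the category of elements of \<open>P\<close>.
  These index categories need not be small; colimits over them exist because small presheaves have
  small presentations.\<close>

definition wcocone ::
  "('o, 'a, 'p, 'b) fctr \<Rightarrow> ('o, 'a, 'u) presheaf \<Rightarrow> 'p \<Rightarrow> ('o \<Rightarrow> 'a + 'u \<Rightarrow> 'b) \<Rightarrow> bool" where
  "wcocone F P d \<phi> \<longleftrightarrow> d \<in> Obj D \<and>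
     (\<forall>X\<in>Obj C. \<forall>x\<in>FObj P X. \<phi> X x \<in> hom D (FObj F X) d) \<and>
     (\<forall>W X. \<forall>f\<in>hom C W X. \<forall>x\<in>FObj P X. \<phi> W (act P f x) = \<phi> X x \<circ>\<^bsub>D\<^esub> FArr F f)"

definition wcolim ::
  "('o, 'a, 'p, 'b) fctr \<Rightarrow> ('o, 'a, 'u) presheaf \<Rightarrow> 'p \<Rightarrow> ('o \<Rightarrow> 'a + 'u \<Rightarrow> 'b) \<Rightarrow> bool" where
  "wcolim F P c l \<longleftrightarrow> wcocone F P c l \<and>
     (\<forall>d \<phi>. wcocone F P d \<phi> \<longrightarrow>
        (\<exists>!h. h \<in> hom D c d \<and> (\<forall>X\<in>Obj C. \<forall>x\<in>FObj P X. h \<circ>\<^bsub>D\<^esub> l X x = \<phi> X x)))"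

lemma wcoconeD:
  assumes "wcocone F P d \<phi>"
  shows "d \<in> Obj D" "X \<in> Obj C \<Longrightarrow> x \<in> FObj P X \<Longrightarrow> \<phi> X x \<in> hom D (FObj F X) d"
    "f \<in> hom C W X \<Longrightarrow> x \<in> FObj P X \<Longrightarrow> \<phi> W (act P f x) = \<phi> X x \<circ>\<^bsub>D\<^esub> FArr F f"
  using assms unfolding wcocone_def by blast+

lemma wcoconeI:
  assumes "d \<in> Obj D" "\<And>X x. X \<in> Obj C \<Longrightarrow> x \<in> FObj P X \<Longrightarrow> \<phi> X x \<in> hom D (FObj F X) d"
    "\<And>W X f x. f \<in> hom C W X \<Longrightarrow> x \<in> FObj P X \<Longrightarrow> \<phi> W (act P f x) = \<phi> X x \<circ>\<^bsub>D\<^esub> FArr F f"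
  shows "wcocone F P d \<phi>"
  using assms unfolding wcocone_def by blast

lemma wcolim_wcocone: "wcolim F P c l \<Longrightarrow> wcocone F P c l"
  unfolding wcolim_def by blast

lemma wcolim_map_ex:
  assumes "wcolim F P c l" "wcocone F P d \<phi>"
  obtains h where "h \<in> hom D c d" "\<And>X x. X \<in> Obj C \<Longrightarrow> x \<in> FObj P X \<Longrightarrow> h \<circ>\<^bsub>D\<^esub> l X x = \<phi> X x"
proof -
  have "\<exists>!h. h \<in> hom D c d \<and> (\<forall>X\<in>Obj C. \<forall>x\<in>FObj P X. h \<circ>\<^bsub>D\<^esub> l X x = \<phi> X x)"
    using assms unfolding wcolim_def by simp
  then show thesis using that by (elim ex1E) blast
qed

lemma wcocone_postcomp:
  assumes "is_functor C D F" "wcocone F P c l" "h \<in> hom D c d"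
  shows "wcocone F P d (\<lambda>X x. h \<circ>\<^bsub>D\<^esub> l X x)"
proof (rule wcoconeI)
  note l = wcoconeD[OF assms(2)]
  show "d \<in> Obj D" using D.cod_obj[OF assms(3)] .
  show "h \<circ>\<^bsub>D\<^esub> l X x \<in> hom D (FObj F X) d" if "X \<in> Obj C" "x \<in> FObj P X" for X x
    using D.comp_hom[OF l(2)[OF that] assms(3)] .
  show "h \<circ>\<^bsub>D\<^esub> l W (act P f x) = (h \<circ>\<^bsub>D\<^esub> l X x) \<circ>\<^bsub>D\<^esub> FArr F f"
    if f: "f \<in> hom C W X" and x: "x \<in> FObj P X" for W X f x
    using D.comp_assoc[OF is_functorD(2)[OF assms(1) f] l(2)[OF cod_obj[OF f] x] assms(3)] l(3)[OF f x]
        by simp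
qed

lemma wcolim_map_unique:
  assumes "is_functor C D F" "wcolim F P c l" "h \<in> hom D c d" "k \<in> hom D c d"
    "\<And>X x. X \<in> Obj C \<Longrightarrow> x \<in> FObj P X \<Longrightarrow> h \<circ>\<^bsub>D\<^esub> l X x = k \<circ>\<^bsub>D\<^esub> l X x"
  shows "h = k"
proof -
  have "\<exists>!g. g \<in> hom D c d \<and> (\<forall>X\<in>Obj C. \<forall>x\<in>FObj P X. g \<circ>\<^bsub>D\<^esub> l X x = k \<circ>\<^bsub>D\<^esub> l X x)"
    using wcocone_postcomp[OF assms(1) wcolim_wcocone[OF assms(2)] assms(4)] assms(2)
        unfolding wcolim_def by simp
  with assms(3-5) show ?thesis by blast
qed

lemma wcolim_iso:
  assumes "is_functor C D F" "wcolim F P c l" "wcolim F P c' l'"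
  obtains i j where "i \<in> hom D c c'" "iso D i" "j \<in> hom D c' c" "iso D j"
    "i \<circ>\<^bsub>D\<^esub> j = Ident D c'" "j \<circ>\<^bsub>D\<^esub> i = Ident D c"
    "\<And>X x. X \<in> Obj C \<Longrightarrow> x \<in> FObj P X \<Longrightarrow> i \<circ>\<^bsub>D\<^esub> l X x = l' X x"
    "\<And>X x. X \<in> Obj C \<Longrightarrow> x \<in> FObj P X \<Longrightarrow> j \<circ>\<^bsub>D\<^esub> l' X x = l X x"
proof -
  have roundtrip: "g \<circ>\<^bsub>D\<^esub> f = Ident D a"
    if a: "wcolim F P a r" and f: "f \<in> hom D a b" and g: "g \<in> hom D b a"
      and fr: "\<And>X x. X \<in> Obj C \<Longrightarrow> x \<in> FObj P X \<Longrightarrow> f \<circ>\<^bsub>D\<^esub> r X x = s X x"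
      and gs: "\<And>X x. X \<in> Obj C \<Longrightarrow> x \<in> FObj P X \<Longrightarrow> g \<circ>\<^bsub>D\<^esub> s X x = r X x" for a b r s f g
  proof (rule wcolim_map_unique[OF assms(1) a D.comp_hom[OF f g] D.id_hom[OF D.dom_obj[OF f]]])
    fix X x assume Xx: "X \<in> Obj C" "x \<in> FObj P X"
    note rx = wcoconeD(2)[OF wcolim_wcocone[OF a] Xx]
    show "(g \<circ>\<^bsub>D\<^esub> f) \<circ>\<^bsub>D\<^esub> r X x = Ident D a \<circ>\<^bsub>D\<^esub> r X x"
      using D.comp_assoc[OF rx f g] fr[OF Xx] gs[OF Xx] D.comp_id_left[OF rx] by simp
  qed
  obtain i where i: "i \<in> hom D c c'" "\<And>X x. X \<in> Obj C \<Longrightarrow> x \<in> FObj P X \<Longrightarrow> i \<circ>\<^bsub>D\<^esub> l X x = l' X x"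
    using wcolim_map_ex[OF assms(2) wcolim_wcocone[OF assms(3)]] by metis
  obtain j where j: "j \<in> hom D c' c" "\<And>X x. X \<in> Obj C \<Longrightarrow> x \<in> FObj P X \<Longrightarrow> j \<circ>\<^bsub>D\<^esub> l' X x = l X x"
    using wcolim_map_ex[OF assms(3) wcolim_wcocone[OF assms(2)]] by metis
  have ij: "i \<circ>\<^bsub>D\<^esub> j = Ident D c'"
    by (rule roundtrip[OF assms(3) j(1) i(1) j(2) i(2)])
  have ji: "j \<circ>\<^bsub>D\<^esub> i = Ident D c"
    by (rule roundtrip[OF assms(2) i(1) j(1) i(2) j(2)])
  show thesis
    by (rule that[OF i(1) D.isoI[OF i(1) j(1) ji ij] j(1) D.isoI[OF j(1) i(1) ij ji] ij ji i(2) j(2)])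
qed

lemma wcocone_unique:
  assumes "is_functor C D F" "category J" "presents J K P x" "wcocone F P d \<phi>" "wcocone F P d \<psi>"
    and eq: "\<And>j. j \<in> Obj J \<Longrightarrow> \<phi> (FObj K j) (x j) = \<psi> (FObj K j) (x j)"
    and "X \<in> Obj C" "y \<in> FObj P X"
  shows "\<phi> X y = \<psi> X y"
proof -
  obtain j f where f: "j \<in> Obj J" "f \<in> hom C X (FObj K j)" "y = act P f (x j)"
    using presents_surj[OF assms(2,3,7,8)] .
  have xj: "x j \<in> FObj P (FObj K j)" using presentsD(3)[OF assms(3) f(1)] .
  show ?thesis
    using wcoconeD(3)[OF assms(4) f(2) xj] wcoconeD(3)[OF assms(5) f(2) xj] eq[OF f(1)] f(3) by simp
qed

text \<open>The presheaf \<open>D(F -, d)\<close>. Its elements are codes of maps into \<open>d\<close>, given by \<open>en\<close>, as the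
  arrows of the two categories are of different types.\<close>

lemma nerve_ex:
  assumes F: "is_functor C D F" and d: "d \<in> Obj D"
  obtains N :: "('o, 'a, 'u) presheaf" and en where "psh N"
    "\<And>X. X \<in> Obj C \<Longrightarrow> bij_betw (en X) (hom D (FObj F X) d) (FObj N X)"
    "\<And>W X f t. f \<in> hom C W X \<Longrightarrow> t \<in> hom D (FObj F X) d \<Longrightarrow> act N f (en X t) = en W (t \<circ>\<^bsub>D\<^esub> FArr F f)"
proof -
  note F = is_functorD[OF F]
  have "\<exists>e :: 'b \<Rightarrow> 'u. inj_on e (hom D (FObj F X) d)" if "X \<in> Obj C" for X
    using small_embedding[OF D_hom_small[OF F(1)[OF that] d]] by metis
  then obtain e :: "'o \<Rightarrow> 'b \<Rightarrow> 'u" where e: "\<And>X. X \<in> Obj C \<Longrightarrow> inj_on (e X) (hom D (FObj F X) d)"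
    by metis
  define en :: "'o \<Rightarrow> 'b \<Rightarrow> 'a + 'u" where "en X t = Inr (e X t)" for X t
  have inj: "inj_on (en X) (hom D (FObj F X) d)" if "X \<in> Obj C" for X
    using e[OF that] unfolding en_def inj_on_def by simp
  define de where "de X y = the_inv_into (hom D (FObj F X) d) (en X) y" for X y
  have de: "de X (en X t) = t" if "X \<in> Obj C" "t \<in> hom D (FObj F X) d" for X t
    unfolding de_def using the_inv_into_f_f[OF inj[OF that(1)] that(2)] .
  let ?E = "\<lambda>X. en X ` hom D (FObj F X) d"
  let ?a = "\<lambda>f y. en (Dom C f) (de (Cod C f) y \<circ>\<^bsub>D\<^esub> FArr F f)"
  have a: "?a f (en X t) = en W (t \<circ>\<^bsub>D\<^esub> FArr F f)" if f: "f \<in> hom C W X" and t: "t \<in> hom D (FObj F X) d"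
      for W X f t
    using de[OF cod_obj[OF f] t] hom_dom[OF f] hom_cod[OF f] by simp
  let ?N = "mk_presheaf C ?E ?a"
  have N: "psh ?N"
  proof (rule psh_mk_presheaf)
    show "small U (?E X)" if "X \<in> Obj C" for X
      using small_image[OF D_hom_small[OF F(1)[OF that] d]] .
    show "?a f y \<in> ?E W" if f: "f \<in> hom C W X" and y: "y \<in> ?E X" for W X f y
    proof -
      obtain t where t: "y = en X t" "t \<in> hom D (FObj F X) d" using y by blast
      show ?thesis using a[OF f t(2)] t(1) D.comp_hom[OF F(2)[OF f] t(2)] by simp
    qed
    show "?a (Ident C X) y = y" if X: "X \<in> Obj C" and y: "y \<in> ?E X" for X y
    proof -
      obtain t where t: "y = en X t" "t \<in> hom D (FObj F X) d" using y by blast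
      show ?thesis using a[OF id_hom[OF X] t(2)] t(1) F(3)[OF X] D.comp_id_right[OF t(2)] by simp
    qed
    show "?a (g \<circ>\<^bsub>C\<^esub> f) y = ?a f (?a g y)"
      if f: "f \<in> hom C V W" and g: "g \<in> hom C W X" and y: "y \<in> ?E X" for V W X f g y
    proof -
      obtain t where t: "y = en X t" "t \<in> hom D (FObj F X) d" using y by blast
      show ?thesis
        using a[OF comp_hom[OF f g] t(2)] a[OF g t(2)] a[OF f D.comp_hom[OF F(2)[OF g] t(2)]] F(4)[OF f g]
          D.comp_assoc[OF F(2)[OF f] F(2)[OF g] t(2)] t(1) by simp
    qed
  qed
  have "bij_betw (en X) (hom D (FObj F X) d) (FObj ?N X)" if "X \<in> Obj C" for X
    using inj[OF that] that by (simp add: bij_betw_def)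
  moreover have "act ?N f (en X t) = en W (t \<circ>\<^bsub>D\<^esub> FArr F f)"
    if f: "f \<in> hom C W X" and t: "t \<in> hom D (FObj F X) d" for W X f t
  proof -
    have "en X t \<in> ?E X" using t by blast
    then show ?thesis using mk_presheaf_act[where E = ?E, OF f] a[OF f t] by simp
  qed
  ultimately show thesis using that[of ?N en] N by blast
qed

text \<open>Maps from \<open>P\<close> to \<open>D(F -, d)\<close> are the weighted cocones. This gives access to the universal
  properties of \<open>P\<close>, which speak about maps of presheaves.\<close>

lemma wcocone_representation:
  assumes F: "is_functor C D F" and d: "d \<in> Obj D"
  obtains N :: "('o, 'a, 'u) presheaf" and en de where "psh N"
    "\<And>P \<phi>. psh P \<Longrightarrow> wcocone F P d \<phi> \<Longrightarrow>
      mk_presheaf_map C P N (\<lambda>X x. en X (\<phi> X x)) \<in> hom Psh P N"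
    "\<And>P \<tau>. \<tau> \<in> hom Psh P N \<Longrightarrow> wcocone F P d (\<lambda>X x. de X (app \<tau> X x))"
    "\<And>X t. X \<in> Obj C \<Longrightarrow> t \<in> hom D (FObj F X) d \<Longrightarrow> de X (en X t) = t"
    "\<And>X t. X \<in> Obj C \<Longrightarrow> t \<in> hom D (FObj F X) d \<Longrightarrow> en X t \<in> FObj N X"
    "\<And>W X f t. f \<in> hom C W X \<Longrightarrow> t \<in> hom D (FObj F X) d \<Longrightarrow> act N f (en X t) = en W (t \<circ>\<^bsub>D\<^esub> FArr F f)"
proof -
  obtain N :: "('o, 'a, 'u) presheaf" and en where N: "psh N"
    and bij: "\<And>X. X \<in> Obj C \<Longrightarrow> bij_betw (en X) (hom D (FObj F X) d) (FObj N X)"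
    and act: "\<And>W X f t. f \<in> hom C W X \<Longrightarrow> t \<in> hom D (FObj F X) d \<Longrightarrow> act N f (en X t) = en W (t \<circ>\<^bsub>D\<^esub> FArr F f)"
    by (rule nerve_ex[OF assms]) (rule that)
  define de where "de X y = the_inv_into (hom D (FObj F X) d) (en X) y" for X y
  have de: "de X (en X t) = t" if "X \<in> Obj C" "t \<in> hom D (FObj F X) d" for X t
    unfolding de_def using the_inv_into_f_f[OF bij_betw_imp_inj_on[OF bij[OF that(1)]] that(2)] .
  have en_in: "en X t \<in> FObj N X" if "X \<in> Obj C" "t \<in> hom D (FObj F X) d" for X t
    using bij[OF that(1)] that(2) unfolding bij_betw_def by blast
  have en: "en X (de X y) = y" "de X y \<in> hom D (FObj F X) d" if X: "X \<in> Obj C" and y: "y \<in> FObj N X" for X y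
  proof -
    obtain t where "t \<in> hom D (FObj F X) d" "y = en X t" using bij[OF X] y unfolding bij_betw_def by blast
    then show "en X (de X y) = y" "de X y \<in> hom D (FObj F X) d" using de[OF X] by simp_all
  qed
  have 1: "mk_presheaf_map C P N (\<lambda>X x. en X (\<phi> X x)) \<in> hom Psh P N" if P: "psh P"
      and \<phi>: "wcocone F P d \<phi>" for P \<phi>
  proof (rule mk_presheaf_map_hom[OF P N])
    show "en X (\<phi> X x) \<in> FObj N X" if "X \<in> Obj C" "x \<in> FObj P X" for X x
      using en_in[OF that(1) wcoconeD(2)[OF \<phi> that]] .
    show "en W (\<phi> W (act P f x)) = act N f (en X (\<phi> X x))" if f: "f \<in> hom C W X" and x: "x \<in> FObj P X"
        for W X f x
      using wcoconeD(3)[OF \<phi> f x] act[OF f wcoconeD(2)[OF \<phi> cod_obj[OF f] x]] by simp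
  qed
  have 2: "wcocone F P d (\<lambda>X x. de X (app \<tau> X x))" if \<tau>: "\<tau> \<in> hom Psh P N" for P \<tau>
  proof (rule wcoconeI[OF d])
    show h: "de X (app \<tau> X x) \<in> hom D (FObj F X) d" if "X \<in> Obj C" "x \<in> FObj P X" for X x
      using en(2)[OF that(1) app_in[OF \<tau> that]] .
    show "de W (app \<tau> W (act P f x)) = de X (app \<tau> X x) \<circ>\<^bsub>D\<^esub> FArr F f"
      if f: "f \<in> hom C W X" and x: "x \<in> FObj P X" for W X f x
    proof -
      have X: "X \<in> Obj C" "W \<in> Obj C" using cod_obj[OF f] dom_obj[OF f] .
      have "app \<tau> W (act P f x) = en W (de X (app \<tau> X x) \<circ>\<^bsub>D\<^esub> FArr F f)"
        using app_natural[OF \<tau> f x] act[OF f h[OF X(1) x]] en(1)[OF X(1) app_in[OF \<tau> X(1) x]] by simp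
      then show ?thesis
        using de[OF X(2) D.comp_hom[OF is_functorD(2)[OF F f] h[OF X(1) x]]] by simp
    qed
  qed
  show thesis using that[OF N 1 2 de en_in act] .
qed

text \<open>The maps \<open>\<psi> j\<close> are a compatible family of elements of \<open>D(F -, d)\<close>, hence extend to a map
  from \<open>P\<close>. Together with \<open>wcocone_restrict\<close> this identifies weighted cocones with cocones on the
  diagram of a presentation.\<close>

lemma wcocone_extend:
  assumes F: "is_functor C D F" and J: "category J" "presents J K P x"
    and \<psi>: "is_cocone J D (comp_functor J F K) d \<psi>"
  obtains \<phi> where "wcocone F P d \<phi>" "\<And>j. j \<in> Obj J \<Longrightarrow> \<phi> (FObj K j) (x j) = \<psi> j"
proof -
  interpret J: Category J using J(1) by unfold_locales
  note p = presentsD[OF J(2)]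
  note K = is_functorD[OF p(1)]
  have d: "d \<in> Obj D" and \<psi>j: "\<And>j. j \<in> Obj J \<Longrightarrow> \<psi> j \<in> hom D (FObj F (FObj K j)) d"
    and \<psi>u: "\<And>u. u \<in> Arr J \<Longrightarrow> \<psi> (Cod J u) \<circ>\<^bsub>D\<^esub> FArr F (FArr K u) = \<psi> (Dom J u)"
    using \<psi> unfolding is_cocone_def by (auto simp: comp_functor_def)
  obtain N :: "('o, 'a, 'u) presheaf" and en de where N: "psh N"
    and to_wcocone: "\<And>P \<tau>. \<tau> \<in> hom Psh P N \<Longrightarrow> wcocone F P d (\<lambda>X x. de X (app \<tau> X x))"
    and de: "\<And>X t. X \<in> Obj C \<Longrightarrow> t \<in> hom D (FObj F X) d \<Longrightarrow> de X (en X t) = t"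
    and en: "\<And>X t. X \<in> Obj C \<Longrightarrow> t \<in> hom D (FObj F X) d \<Longrightarrow> en X t \<in> FObj N X"
    and act: "\<And>W X f t. f \<in> hom C W X \<Longrightarrow> t \<in> hom D (FObj F X) d \<Longrightarrow> act N f (en X t) = en W (t \<circ>\<^bsub>D\<^esub> FArr F f)"
    by (rule wcocone_representation[OF F d]) (rule that)
  obtain \<tau> where \<tau>: "\<tau> \<in> hom Psh P N" "\<And>j. j \<in> Obj J \<Longrightarrow> app \<tau> (FObj K j) (x j) = en (FObj K j) (\<psi> j)"
  proof (rule presents_map_ex[OF J(2) N, of "\<lambda>j. en (FObj K j) (\<psi> j)"])
    show "en (FObj K j) (\<psi> j) \<in> FObj N (FObj K j)" if "j \<in> Obj J" for j
      using en[OF K(1)[OF that] \<psi>j[OF that]] .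
    show "act N (FArr K u) (en (FObj K (Cod J u)) (\<psi> (Cod J u))) = en (FObj K (Dom J u)) (\<psi> (Dom J u))"
      if u: "u \<in> Arr J" for u
      using act[OF K(2)[OF arr_hom[OF u]] \<psi>j[OF J.cod_obj[OF arr_hom[OF u]]]] \<psi>u[OF u] by simp
  qed blast
  have "de (FObj K j) (app \<tau> (FObj K j) (x j)) = \<psi> j" if "j \<in> Obj J" for j
    using \<tau>(2)[OF that] de[OF K(1)[OF that] \<psi>j[OF that]] by simp
  with that[OF to_wcocone[OF \<tau>(1)]] show thesis by blast
qed

lemma wcocone_restrict:
  assumes F: "is_functor C D F" and J: "category J" "presents J K P x" and \<phi>: "wcocone F P d \<phi>"
  shows "is_cocone J D (comp_functor J F K) d (\<lambda>j. \<phi> (FObj K j) (x j))"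
proof -
  interpret J: Category J using J(1) by unfold_locales
  note p = presentsD[OF J(2)]
  note K = is_functorD[OF p(1)]
  show ?thesis
    unfolding is_cocone_def
  proof (intro conjI ballI)
    show "d \<in> Obj D" using wcoconeD(1)[OF \<phi>] .
    show "\<phi> (FObj K j) (x j) \<in> hom D (FObj (comp_functor J F K) j) d" if "j \<in> Obj J" for j
      using wcoconeD(2)[OF \<phi> K(1)[OF that] p(3)[OF that]] that by (simp add: comp_functor_def)
    fix u assume u: "u \<in> Arr J"
    show "\<phi> (FObj K (Cod J u)) (x (Cod J u)) \<circ>\<^bsub>D\<^esub> FArr (comp_functor J F K) u = \<phi>
        (FObj K (Dom J u)) (x (Dom J u))"
      using wcoconeD(3)[OF \<phi> K(2)[OF arr_hom[OF u]] p(3)[OF J.cod_obj[OF arr_hom[OF u]]]] p(4)[OF u] u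
      by (simp add: comp_functor_def)
  qed
qed

text \<open>A weighted colimit is a colimit of \<open>F\<close> over any diagram that presents \<open>P\<close>; the converse is
  \<open>colimit_of_wcolim\<close>. The first direction gives existence and applies to the values of a
  cocontinuous functor; the second is needed for statements about colimits in \<open>D\<close>.\<close>

lemma wcolim_of_colimit:
  assumes F: "is_functor C D F" and J: "category J" "presents J K P x"
    and colim: "is_colimit J D (comp_functor J F K) c \<iota>"
    and l: "wcocone F P c l" "\<And>j. j \<in> Obj J \<Longrightarrow> l (FObj K j) (x j) = \<iota> j"
  shows "wcolim F P c l"
  unfolding wcolim_def
proof (intro conjI allI impI)
  note K = is_functorD[OF presentsD(1)[OF J(2)]]
  show "wcocone F P c l" using l(1) .
  fix d \<phi> assume \<phi>: "wcocone F P d \<phi>"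
  have ex1: "\<exists>!h. h \<in> hom D c d \<and> (\<forall>j\<in>Obj J. h \<circ>\<^bsub>D\<^esub> \<iota> j = \<phi> (FObj K j) (x j))"
    using colim wcocone_restrict[OF F J \<phi>] unfolding is_colimit_def by blast
  then obtain h where h: "h \<in> hom D c d" "\<And>j. j \<in> Obj J \<Longrightarrow> h \<circ>\<^bsub>D\<^esub> \<iota> j = \<phi> (FObj K j) (x j)" by blast
  have hl: "h \<circ>\<^bsub>D\<^esub> l X y = \<phi> X y" if "X \<in> Obj C" "y \<in> FObj P X" for X y
    by (rule wcocone_unique[OF F J wcocone_postcomp[OF F l(1) h(1)] \<phi> _ that]) (use h(2) l(2) in simp)
  show "\<exists>!h. h \<in> hom D c d \<and> (\<forall>X\<in>Obj C. \<forall>x\<in>FObj P X. h \<circ>\<^bsub>D\<^esub> l X x = \<phi> X x)"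
  proof (rule ex1I[of _ h])
    show "h \<in> hom D c d \<and> (\<forall>X\<in>Obj C. \<forall>x\<in>FObj P X. h \<circ>\<^bsub>D\<^esub> l X x = \<phi> X x)" using h(1) hl by blast
    fix k assume k: "k \<in> hom D c d \<and> (\<forall>X\<in>Obj C. \<forall>x\<in>FObj P X. k \<circ>\<^bsub>D\<^esub> l X x = \<phi> X x)"
    have "k \<circ>\<^bsub>D\<^esub> \<iota> j = \<phi> (FObj K j) (x j)" if "j \<in> Obj J" for j
      using k K(1)[OF that] presentsD(3)[OF J(2) that] l(2)[OF that] by metis
    with ex1 h k show "k = h" by blast
  qed
qed

lemma colimit_of_wcolim:
  assumes F: "is_functor C D F" and J: "category J" "presents J K P x" and c: "wcolim F P c l"
  shows "is_colimit J D (comp_functor J F K) c (\<lambda>j. l (FObj K j) (x j))"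
  unfolding is_colimit_def
proof (intro conjI allI impI)
  note K = is_functorD[OF presentsD(1)[OF J(2)]]
  note l = wcolim_wcocone[OF c]
  show "is_cocone J D (comp_functor J F K) c (\<lambda>j. l (FObj K j) (x j))"
    using wcocone_restrict[OF F J l] .
  fix d \<mu> assume "is_cocone J D (comp_functor J F K) d \<mu>"
  then obtain \<phi> where \<phi>: "wcocone F P d \<phi>" "\<And>j. j \<in> Obj J \<Longrightarrow> \<phi> (FObj K j) (x j) = \<mu> j"
    using wcocone_extend[OF F J] by metis
  obtain h where h: "h \<in> hom D c d" "\<And>X x. X \<in> Obj C \<Longrightarrow> x \<in> FObj P X \<Longrightarrow> h \<circ>\<^bsub>D\<^esub> l X x = \<phi> X x"
    using wcolim_map_ex[OF c \<phi>(1)] by metis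
  show "\<exists>!h. h \<in> hom D c d \<and> (\<forall>j\<in>Obj J. h \<circ>\<^bsub>D\<^esub> l (FObj K j) (x j) = \<mu> j)"
  proof (rule ex1I[of _ h])
    show "h \<in> hom D c d \<and> (\<forall>j\<in>Obj J. h \<circ>\<^bsub>D\<^esub> l (FObj K j) (x j) = \<mu> j)"
      using h(1) h(2)[OF K(1) presentsD(3)[OF J(2)]] \<phi>(2) by simp
    fix k assume k: "k \<in> hom D c d \<and> (\<forall>j\<in>Obj J. k \<circ>\<^bsub>D\<^esub> l (FObj K j) (x j) = \<mu> j)"
    show "k = h"
    proof (rule wcolim_map_unique[OF F c conjunct1[OF k] h(1)])
      fix X y assume Xy: "X \<in> Obj C" "y \<in> FObj P X"
      have "k \<circ>\<^bsub>D\<^esub> l X y = \<phi> X y"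
        by (rule wcocone_unique[OF F J wcocone_postcomp[OF F l
            conjunct1[OF k]] \<phi>(1) _ Xy]) (use k \<phi>(2) in simp)
      then show "k \<circ>\<^bsub>D\<^esub> l X y = h \<circ>\<^bsub>D\<^esub> l X y" using h(2)[OF Xy] by simp
    qed
  qed
qed

lemma wcolim_ex:
  assumes F: "is_functor C D F" and P: "small_presheaf U C P"
  obtains c l where "wcolim F P c l"
proof -
  obtain J :: "('u, 'u) cat" and K x where J: "small_category U J" "category J" "presents J K P x"
    using small_presheafE[OF P] .
  obtain c \<iota> where c: "is_colimit J D (comp_functor J F K) c \<iota>"
    using D.colimit_ex[OF J(1) comp_functor_is_functor[OF J(2) presentsD(1)[OF J(3)] F]] by blast
  obtain l where "wcocone F P c l" "\<And>j. j \<in> Obj J \<Longrightarrow> l (FObj K j) (x j) = \<iota> j"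
    using wcocone_extend[OF F J(2,3)] c unfolding is_colimit_def by metis
  with wcolim_of_colimit[OF F J(2,3) c] that show thesis by blast
qed

lemma wcolim_rep:
  assumes F: "is_functor C D F" and X: "X \<in> Obj C"
  shows "wcolim F (rep X) (FObj F X) (\<lambda>W e. FArr F (projl e))"
  unfolding wcolim_def
proof (intro conjI allI impI)
  note F = is_functorD[OF F]
  show "wcocone F (rep X) (FObj F X) (\<lambda>W e. FArr F (projl e))"
  proof (rule wcoconeI[OF F(1)[OF X]])
    show "FArr F (projl e) \<in> hom D (FObj F W) (FObj F X)" if "W \<in> Obj C" "e \<in> FObj (rep X) W" for W e
      using that F(2) by (auto simp: rep_obj)
    show "FArr F (projl (act (rep X) f e)) = FArr F (projl e) \<circ>\<^bsub>D\<^esub> FArr F f"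
      if f: "f \<in> hom C V W" and e: "e \<in> FObj (rep X) W" for V W f e
      using e rep_obj[OF cod_obj[OF f]] F(4)[OF f] rep_act[OF f] by auto
  qed
  fix d \<phi> assume \<phi>: "wcocone F (rep X) d \<phi>"
  let ?h = "\<phi> X (Inl (Ident C X))"
  have h: "?h \<in> hom D (FObj F X) d" using wcoconeD(2)[OF \<phi> X rep_id[OF X]] .
  show "\<exists>!h. h \<in> hom D (FObj F X) d \<and> (\<forall>W\<in>Obj C. \<forall>e\<in>FObj (rep X) W. h \<circ>\<^bsub>D\<^esub> FArr F (projl e) = \<phi> W e)"
  proof (rule ex1I[of _ ?h])
    have "?h \<circ>\<^bsub>D\<^esub> FArr F f = \<phi> W (Inl f)" if f: "f \<in> hom C W X" for W f
      using wcoconeD(3)[OF \<phi> f rep_id[OF X]] rep_act[OF f id_hom[OF X]] comp_id_left[OF f] by simp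
    then show "?h \<in> hom D (FObj F X) d \<and> (\<forall>W\<in>Obj C. \<forall>e\<in>FObj (rep X) W. ?h \<circ>\<^bsub>D\<^esub> FArr F (projl e) = \<phi> W e)"
      using h by (auto simp: rep_obj)
    fix k assume k: "k \<in> hom D (FObj F X) d \<and> (\<forall>W\<in>Obj C. \<forall>e\<in>FObj (rep X) W. k \<circ>\<^bsub>D\<^esub> FArr F (projl e) =
        \<phi> W e)"
    have "k \<circ>\<^bsub>D\<^esub> FArr F (Ident C X) = ?h"
      using conjunct2[OF k, rule_format, OF X rep_id[OF X]] by simp
    then show "k = ?h" using F(3)[OF X] D.comp_id_right[OF conjunct1[OF k]] by simp
  qed
qed

section \<open>Weighted colimits of monics\<close>

text \<open>Compatibility of the choices of classifying monics: along the arrows of a presenting diagram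
  they form a cartesian family.\<close>

lemma classifies_restrict:
  assumes \<mu>: "\<mu> \<in> hom (PM U C) P Q" and x: "x \<in> FObj Q X" and f: "f \<in> hom C W X"
    and cl: "classifies \<mu> P Q X x m z" and cl': "classifies \<mu> P Q W (act Q f x) m' z'"
  obtains h where "pullback C m' h f m" "h \<in> hom C (Dom C m') (Dom C m)" "act P h z = z'"
proof -
  note m = classifiesD[OF cl] and m' = classifiesD[OF cl'] and \<mu>' = PM_Psh[OF \<mu>]
  have Q: "psh Q" using map_psh(2)[OF \<mu>'] .
  have "app \<mu> (Dom C m') z' = act Q (f \<circ>\<^bsub>C\<^esub> m') x"
    using m'(4) act_comp[OF Q m'(2) f x] by simp
  from m(5)[OF comp_hom[OF m'(2) f] m'(3) this]
  obtain h where h: "h \<in> hom C (Dom C m') (Dom C m)" "m \<circ>\<^bsub>C\<^esub> h = f \<circ>\<^bsub>C\<^esub> m'" "act P h z = z'" by blast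
  have "pullback C m' h f m"
  proof (rule pullback_monicI[OF m'(2) h(1) f m(2) h(2)[symmetric] mon_monic[OF m'(1)] mon_monic[OF m(1)]])
    fix V a b assume ab: "a \<in> hom C V W" "b \<in> hom C V (Dom C m)" "f \<circ>\<^bsub>C\<^esub> a = m \<circ>\<^bsub>C\<^esub> b"
    have P: "psh P" using map_psh(1)[OF \<mu>'] .
    have "app \<mu> V (act P b z) = act Q a (act Q f x)"
      using app_natural[OF \<mu>' ab(2) m(3)] m(4) act_comp[OF Q ab(2) m(2) x]
          act_comp[OF Q ab(1) f x] ab(3) by simp
    from m'(5)[OF ab(1) act_in[OF P ab(2) m(3)] this]
    show "\<exists>h\<in>hom C V (Dom C m'). m' \<circ>\<^bsub>C\<^esub> h = a" by blast
  qed
  with that h show thesis by blast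
qed

text \<open>Glue the images under \<open>F\<close> of the monics \<open>m j\<close> that classify the elements presenting \<open>Q\<close> to a
  monic \<open>n'\<close> into \<open>q\<close>. An element \<open>w\<close> of \<open>P\<close> has an image in \<open>Q\<close> that is a restriction of some
  \<open>y j\<close> along a map factoring through \<open>m j\<close>. This provides a map \<open>\<zeta> w\<close> into the domain of \<open>n'\<close>,
  and shows that the weighted cocone \<open>\<zeta>\<close> is generated by the coprojections \<open>\<theta> j\<close> of the domains.
  Hence that domain is a weighted colimit for \<open>P\<close>, and \<open>n\<close> is \<open>n'\<close> up to isomorphism.\<close>

lemma wcolim_monic:
  assumes F: "is_mfunctor C D F" and \<mu>: "\<mu> \<in> presheaf_monics U C" "\<mu> \<in> hom (PM U C) P Q"
    and c: "wcolim F P p l" and q: "wcolim F Q q r"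
    and n: "n \<in> hom D p q" "\<And>X x. X \<in> Obj C \<Longrightarrow> x \<in> FObj P X \<Longrightarrow> n \<circ>\<^bsub>D\<^esub> l X x = r X (app \<mu> X x)"
  shows "n \<in> Mon D"
    and "X \<in> Obj C \<Longrightarrow> x \<in> FObj Q X \<Longrightarrow> classifies \<mu> P Q X x m z \<Longrightarrow>
      pullback D (FArr F m) (l (Dom C m) z) (r X x) n"
proof -
  have Ff: "is_functor C D F" using F unfolding is_mfunctor_def by blast
  note F' = is_functorD[OF Ff]
  have FMon: "FArr F m \<in> Mon D" if "m \<in> Mon C" for m using F that unfolding is_mfunctor_def by blast
  have Fpb: "pullback D (FArr F a) (FArr F b) (FArr F f) (FArr F m)" if "m \<in> Mon C" "pullback C a b f m"
      for a b f m
    using F that unfolding is_mfunctor_def by blast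
  have Q: "small_presheaf U C Q" and P: "small_presheaf U C P" using \<mu>(2) by (auto simp: hom_PM_iff)
  note \<mu>' = PM_Psh[OF \<mu>(2)] and psh = small_presheaf_psh[OF Q] small_presheaf_psh[OF P]
  note r = wcoconeD[OF wcolim_wcocone[OF q]] and l = wcoconeD[OF wcolim_wcocone[OF c]]
  obtain J :: "('u, 'u) cat" and K y where J: "small_category U J" "category J" "presents J K Q y"
    using small_presheafE[OF Q] .
  interpret J: Category J using J(2) by unfold_locales
  note K = is_functorD[OF presentsD(1)[OF J(3)]] and y = presentsD(3)[OF J(3)]
      and yu = presentsD(4)[OF J(3)]
  have "\<exists>m z. classifies \<mu> P Q (FObj K j) (y j) m z" if "j \<in> Obj J" for j
    using presheaf_monic_classifies[OF \<mu> K(1)[OF that] y[OF that]] by metis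
  then obtain m z where cl: "\<And>j. j \<in> Obj J \<Longrightarrow> classifies \<mu> P Q (FObj K j) (y j) (m j) (z j)"
    by metis
  note m = classifiesD[OF cl]
  have "\<exists>h. pullback C (m (Dom J u)) h (FArr K u) (m (Cod J u)) \<and>
      h \<in> hom C (Dom C (m (Dom J u))) (Dom C (m (Cod J u))) \<and>
      act P h (z (Cod J u)) = z (Dom J u)" if u: "u \<in> Arr J" for u
  proof -
    have jk: "Dom J u \<in> Obj J" "Cod J u \<in> Obj J"
      using J.dom_obj[OF arr_hom[OF u]] J.cod_obj[OF arr_hom[OF u]] .
    have "classifies \<mu> P Q (FObj K (Dom J u)) (act Q (FArr K u) (y (Cod J u))) (m (Dom J u)) (z (Dom J u))"
      using cl[OF jk(1)] yu[OF u] by simp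
    from classifies_restrict[OF \<mu>(2) y[OF jk(2)] K(2)[OF arr_hom[OF u]] cl[OF jk(2)] this]
    show ?thesis by metis
  qed
  then obtain Z where Zpb: "\<And>u. u \<in> Arr J \<Longrightarrow> pullback C (m (Dom J u)) (Z u) (FArr K u) (m (Cod J u))"
    and Z: "\<And>u. u \<in> Arr J \<Longrightarrow> Z u \<in> hom C (Dom C (m (Dom J u))) (Dom C (m (Cod J u)))"
    and Zz: "\<And>u. u \<in> Arr J \<Longrightarrow> act P (Z u) (z (Cod J u)) = z (Dom J u)"
    by metis
  have T: "is_functor J D (comp_functor J F K)"
    using comp_functor_is_functor[OF J(2) presentsD(1)[OF J(3)] Ff] .
  have colim: "is_colimit J D (comp_functor J F K) q (\<lambda>j. r (FObj K j) (y j))"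
    using colimit_of_wcolim[OF Ff J(2,3) q] .
  have Fm: "FArr F (m j) \<in> hom D (FObj F (Dom C (m j))) (FObj F (FObj K j))" if "j \<in> Obj J" for j
    using F'(2)[OF m(2)[OF that]] .
  obtain n' \<theta> where n': "n' \<in> Mon D" "Cod D n' = q"
    and \<theta>: "\<And>j. j \<in> Obj J \<Longrightarrow> pullback D (FArr F (m j)) (\<theta> j) (r (FObj K j) (y j)) n'"
    and univ: "\<And>Y f. (\<And>j. j \<in> Obj J \<Longrightarrow> f j \<in> hom D (Dom D (FArr F (m j))) Y) \<Longrightarrow>
        (\<And>u. u \<in> Arr J \<Longrightarrow> f (Cod J u) \<circ>\<^bsub>D\<^esub> FArr F (Z u) = f (Dom J u)) \<Longrightarrow> Y \<in> Obj D \<Longrightarrow>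
        \<exists>!h. h \<in> hom D (Dom D n') Y \<and> (\<forall>j\<in>Obj J. h \<circ>\<^bsub>D\<^esub> \<theta> j = f j)"
  proof (rule D.mon_glue[OF J(1) T colim, of "\<lambda>j. FArr F (m j)" "\<lambda>u. FArr F (Z u)"])
    show "FArr F (m j) \<in> Mon D \<and> Cod D (FArr F (m j)) = FObj (comp_functor J F K) j" if "j \<in> Obj J" for j
      using FMon[OF m(1)[OF that]] hom_cod[OF Fm[OF that]] that by (simp add: comp_functor_def)
    show "pullback D (FArr F (m (Dom J u))) (FArr F (Z u)) (FArr (comp_functor J F K) u)
        (FArr F (m (Cod J u)))"
      if "u \<in> Arr J" for u
      using Fpb[OF m(1)[OF J.cod_obj[OF arr_hom[OF that]]] Zpb[OF that]] that
          by (simp add: comp_functor_def)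
  qed blast
  note n'h = D.mon_hom[OF n'(1), unfolded n'(2)] and n'm = D.mon_monic[OF n'(1)]
  have \<theta>h: "\<theta> j \<in> hom D (FObj F (Dom C (m j))) (Dom D n')"
      "r (FObj K j) (y j) \<circ>\<^bsub>D\<^esub> FArr F (m j) = n' \<circ>\<^bsub>D\<^esub> \<theta> j"
    if "j \<in> Obj J" for j
    using D.pullbackD[OF \<theta>[OF that]] hom_dom[OF Fm[OF that]] by simp_all
  \<comment> \<open>Every element of \<open>P\<close> is a restriction of one of the \<open>z j\<close>.\<close>
  have factor: "\<exists>j g. j \<in> Obj J \<and> g \<in> hom C X (Dom C (m j)) \<and> act P g (z j) = w \<and>
      app \<mu> X w = act Q (m j \<circ>\<^bsub>C\<^esub> g) (y j)"
    if X: "X \<in> Obj C" and w: "w \<in> FObj P X" for X w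
  proof -
    obtain j f where f: "j \<in> Obj J" "f \<in> hom C X (FObj K j)" "app \<mu> X w = act Q f (y j)"
      using presents_surj[OF J(2,3) X app_in[OF \<mu>' X w]] .
    from m(5)[OF f(1,2) w f(3)] f show ?thesis by metis
  qed
  have "\<exists>\<zeta>. \<zeta> \<in> hom D (FObj F X) (Dom D n') \<and> n' \<circ>\<^bsub>D\<^esub> \<zeta> = r X (app \<mu> X w)"
    if X: "X \<in> Obj C" and w: "w \<in> FObj P X" for X w
  proof -
    obtain j g where g: "j \<in> Obj J" "g \<in> hom C X (Dom C (m j))" "app \<mu> X w = act Q (m j \<circ>\<^bsub>C\<^esub> g) (y j)"
      using factor[OF X w] by blast
    note mj = m(2)[OF g(1)]
    have "n' \<circ>\<^bsub>D\<^esub> (\<theta> j \<circ>\<^bsub>D\<^esub> FArr F g) = r X (app \<mu> X w)"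
      using D.comp_assoc[OF F'(2)[OF g(2)] \<theta>h(1)[OF g(1)] n'h] \<theta>h(2)[OF g(1)] F'(4)[OF g(2) mj] g(3)
        D.comp_assoc[OF F'(2)[OF g(2)] Fm[OF g(1)] r(2)[OF K(1)[OF g(1)] y[OF g(1)]]]
        r(3)[OF comp_hom[OF g(2) mj] y[OF g(1)]] by simp
    then show ?thesis using D.comp_hom[OF F'(2)[OF g(2)] \<theta>h(1)[OF g(1)]] by blast
  qed
  \<comment> \<open>The factorisation of \<open>r X (app \<mu> X w)\<close> through the monic \<open>n'\<close> is unique, so the choice is
    harmless.\<close>
  then obtain \<zeta> where \<zeta>: "\<And>X w. X \<in> Obj C \<Longrightarrow> w \<in> FObj P X \<Longrightarrow> \<zeta> X w \<in> hom D (FObj F X) (Dom D n')"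
    and n'\<zeta>: "\<And>X w. X \<in> Obj C \<Longrightarrow> w \<in> FObj P X \<Longrightarrow> n' \<circ>\<^bsub>D\<^esub> \<zeta> X w = r X (app \<mu> X w)"
    by metis
  have \<zeta>co: "wcocone F P (Dom D n') \<zeta>"
  proof (rule wcoconeI[OF D.dom_obj[OF n'h] \<zeta>])
    fix W X f w assume f: "f \<in> hom C W X" and w: "w \<in> FObj P X"
    have X: "X \<in> Obj C" "W \<in> Obj C" using cod_obj[OF f] dom_obj[OF f] .
    have fw: "act P f w \<in> FObj P W" using act_in[OF psh(2) f w] .
    show "\<zeta> W (act P f w) = \<zeta> X w \<circ>\<^bsub>D\<^esub> FArr F f"
    proof (rule D.monicD[OF n'm n'h \<zeta>[OF X(2) fw] D.comp_hom[OF F'(2)[OF f] \<zeta>[OF X(1) w]]])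
      show "n' \<circ>\<^bsub>D\<^esub> \<zeta> W (act P f w) = n' \<circ>\<^bsub>D\<^esub> (\<zeta> X w \<circ>\<^bsub>D\<^esub> FArr F f)"
        using n'\<zeta>[OF X(2) fw] n'\<zeta>[OF X(1) w] D.comp_assoc[OF F'(2)[OF f] \<zeta>[OF X(1) w] n'h]
          app_natural[OF \<mu>' f w] r(3)[OF f app_in[OF \<mu>' X(1) w]] by simp
    qed
  qed
  have Dm: "Dom C (m j) \<in> Obj C" if "j \<in> Obj J" for j using dom_obj[OF m(2)[OF that]] .
  have \<zeta>\<theta>: "\<zeta> (Dom C (m j)) (z j) = \<theta> j" if j: "j \<in> Obj J" for j
  proof (rule D.monicD[OF n'm n'h \<zeta>[OF Dm[OF j] m(3)[OF j]] \<theta>h(1)[OF j]])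
    show "n' \<circ>\<^bsub>D\<^esub> \<zeta> (Dom C (m j)) (z j) = n' \<circ>\<^bsub>D\<^esub> \<theta> j"
      using n'\<zeta>[OF Dm[OF j] m(3)[OF j]] \<theta>h(2)[OF j] m(4)[OF j] r(3)[OF m(2)[OF j] y[OF j]] by simp
  qed
  have \<zeta>g: "\<zeta> X w = \<theta> j \<circ>\<^bsub>D\<^esub> FArr F g" if "j \<in> Obj J" "g \<in> hom C X (Dom C (m j))" "act P g (z j) = w"
      for X w j g
    using wcoconeD(3)[OF \<zeta>co that(2) m(3)[OF that(1)]] \<zeta>\<theta>[OF that(1)] that(3) by simp
  \<comment> \<open>Maps out of the domain of \<open>n'\<close> are families on the \<open>\<theta> j\<close>, and a weighted cocone on \<open>P\<close> is
    determined by its values at the \<open>z j\<close>.\<close>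
  have wc: "wcolim F P (Dom D n') \<zeta>"
    unfolding wcolim_def
  proof (intro conjI allI impI)
    show "wcocone F P (Dom D n') \<zeta>" using \<zeta>co .
    fix d \<phi> assume \<phi>: "wcocone F P d \<phi>"
    have ex1: "\<exists>!h. h \<in> hom D (Dom D n') d \<and> (\<forall>j\<in>Obj J. h \<circ>\<^bsub>D\<^esub> \<theta> j = \<phi> (Dom C (m j)) (z j))"
    proof (rule univ)
      show "\<phi> (Dom C (m j)) (z j) \<in> hom D (Dom D (FArr F (m j))) d" if "j \<in> Obj J" for j
        using wcoconeD(2)[OF \<phi> Dm[OF that] m(3)[OF that]] hom_dom[OF Fm[OF that]] by simp
      show "\<phi> (Dom C (m (Cod J u))) (z (Cod J u)) \<circ>\<^bsub>D\<^esub> FArr F (Z u) = \<phi> (Dom C (m (Dom J u))) (z (Dom J u))"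
        if u: "u \<in> Arr J" for u
        using wcoconeD(3)[OF \<phi> Z[OF u] m(3)[OF J.cod_obj[OF arr_hom[OF u]]]] Zz[OF u] by simp
      show "d \<in> Obj D" using wcoconeD(1)[OF \<phi>] .
    qed
    then obtain h where h: "h \<in> hom D (Dom D n') d" "\<And>j. j \<in> Obj J \<Longrightarrow> h \<circ>\<^bsub>D\<^esub> \<theta> j = \<phi> (Dom C (m j)) (z j)"
        by blast
    have h\<zeta>: "h \<circ>\<^bsub>D\<^esub> \<zeta> X w = \<phi> X w" if X: "X \<in> Obj C" and w: "w \<in> FObj P X" for X w
    proof -
      obtain j g where g: "j \<in> Obj J" "g \<in> hom C X (Dom C (m j))" "act P g (z j) = w"
        using factor[OF X w] by blast
      show ?thesis
        using \<zeta>g[OF g] D.comp_assoc[OF F'(2)[OF g(2)] \<theta>h(1)[OF g(1)] h(1)] h(2)[OF g(1)]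
          wcoconeD(3)[OF \<phi> g(2) m(3)[OF g(1)]] g(3) by simp
    qed
    show "\<exists>!h. h \<in> hom D (Dom D n') d \<and> (\<forall>X\<in>Obj C. \<forall>x\<in>FObj P X. h \<circ>\<^bsub>D\<^esub> \<zeta> X x = \<phi> X x)"
    proof (rule ex1I[of _ h])
      show "h \<in> hom D (Dom D n') d \<and> (\<forall>X\<in>Obj C. \<forall>x\<in>FObj P X. h \<circ>\<^bsub>D\<^esub> \<zeta> X x = \<phi> X x)" using h(1) h\<zeta> by blast
      fix k assume k: "k \<in> hom D (Dom D n') d \<and> (\<forall>X\<in>Obj C. \<forall>x\<in>FObj P X. k \<circ>\<^bsub>D\<^esub> \<zeta> X x = \<phi> X x)"
      have "k \<circ>\<^bsub>D\<^esub> \<theta> j = \<phi> (Dom C (m j)) (z j)" if "j \<in> Obj J" for j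
        using k Dm[OF that] m(3)[OF that] \<zeta>\<theta>[OF that] by metis
      with ex1 h k show "k = h" by blast
    qed
  qed
  obtain i i' where i: "i \<in> hom D p (Dom D n')" "iso D i" "i' \<in> hom D (Dom D n') p" "iso D i'"
    "i \<circ>\<^bsub>D\<^esub> i' = Ident D (Dom D n')" "i' \<circ>\<^bsub>D\<^esub> i = Ident D p"
    and il: "\<And>X x. X \<in> Obj C \<Longrightarrow> x \<in> FObj P X \<Longrightarrow> i \<circ>\<^bsub>D\<^esub> l X x = \<zeta> X x"
    and il': "\<And>X x. X \<in> Obj C \<Longrightarrow> x \<in> FObj P X \<Longrightarrow> i' \<circ>\<^bsub>D\<^esub> \<zeta> X x = l X x"
    by (rule wcolim_iso[OF Ff c wc]) blast
  have n'i: "n' \<circ>\<^bsub>D\<^esub> i = n"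
  proof (rule wcolim_map_unique[OF Ff c D.comp_hom[OF i(1) n'h] n(1)])
    fix X x assume Xx: "X \<in> Obj C" "x \<in> FObj P X"
    show "(n' \<circ>\<^bsub>D\<^esub> i) \<circ>\<^bsub>D\<^esub> l X x = n \<circ>\<^bsub>D\<^esub> l X x"
      using D.comp_assoc[OF l(2)[OF Xx] i(1) n'h] il[OF Xx] n'\<zeta>[OF Xx] n(2)[OF Xx] by simp
  qed
  show "n \<in> Mon D"
    using D.mon_comp[OF D.iso_mon[OF i(2)] n'(1)] hom_cod[OF i(1)] n'i by simp
  have ni': "n \<circ>\<^bsub>D\<^esub> i' = n'"
    using D.comp_assoc[OF i(3,1) n'h] i(5) D.comp_id_right[OF n'h] n'i by simp
  show "pullback D (FArr F m0) (l (Dom C m0) z0) (r X x) n"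
    if X: "X \<in> Obj C" and x: "x \<in> FObj Q X" and cl0: "classifies \<mu> P Q X x m0 z0" for X x m0 z0
  proof -
    note m0 = classifiesD[OF cl0]
    have D0: "Dom C m0 \<in> Obj C" using dom_obj[OF m0(2)] .
    obtain j f where f: "j \<in> Obj J" "f \<in> hom C X (FObj K j)" "x = act Q f (y j)"
      using presents_surj[OF J(2,3) X x] .
    obtain h where h: "pullback C m0 h f (m j)" "h \<in> hom C (Dom C m0) (Dom C (m j))" "act P h (z j) = z0"
      using classifies_restrict[OF \<mu>(2) y[OF f(1)] f(2) cl[OF f(1)]] cl0 f(3) by metis
    have "pullback D (FArr F m0) (\<theta> j \<circ>\<^bsub>D\<^esub> FArr F h) (r (FObj K j) (y j) \<circ>\<^bsub>D\<^esub> FArr F f) n'"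
      using D.pullback_paste[OF \<theta>[OF f(1)] Fpb[OF m(1)[OF f(1)] h(1)]] .
    then have pb: "pullback D (FArr F m0) (\<zeta> (Dom C m0) z0) (r X x) n'"
      using \<zeta>g[OF f(1) h(2,3)] r(3)[OF f(2) y[OF f(1)]] f(3) by simp
    have rx: "r X x \<in> hom D (FObj F X) q" using r(2)[OF X x] .
    note idX = D.id_hom[OF F'(1)[OF X]] D.id_iso[OF F'(1)[OF X]]
    have "pullback D (Ident D (FObj F X) \<circ>\<^bsub>D\<^esub> FArr F m0) (i' \<circ>\<^bsub>D\<^esub> \<zeta> (Dom C m0) z0) (r X x) n"
      using D.pullback_cospan_isos[OF _ idX i(3,4) rx n(1)] pb ni' D.comp_id_right[OF rx] by simp
    then show ?thesis
      using il'[OF D0 m0(3)] D.comp_id_left[OF F'(2)[OF m0(2)]] by simp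
  qed
qed

text \<open>By \<open>wcolim_monic\<close> the restrictions of \<open>n\<close> to the presenting diagram of \<open>Q\<close> are the images
  under \<open>F\<close> of the classifying monics, so this is a case of \<open>pullback_over_colimit\<close>.\<close>

lemma wcolim_pullback:
  assumes F: "is_mfunctor C D F" and \<mu>: "\<mu> \<in> presheaf_monics U C" "\<mu> \<in> hom (PM U C) P Q"
    and c: "wcolim F P p l" and q: "wcolim F Q q r"
    and n: "n \<in> hom D p q" "\<And>X x. X \<in> Obj C \<Longrightarrow> x \<in> FObj P X \<Longrightarrow> n \<circ>\<^bsub>D\<^esub> l X x = r X (app \<mu> X x)"
    and k: "k \<in> Mon D" and t: "t \<in> hom D q (Cod D k)" and s: "s \<in> hom D p (Dom D k)"
    and local: "\<And>X x. X \<in> Obj C \<Longrightarrow> x \<in> FObj Q X \<Longrightarrow>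
      \<exists>m z. classifies \<mu> P Q X x m z \<and> pullback D (FArr F m) (s \<circ>\<^bsub>D\<^esub> l (Dom C m) z) (t \<circ>\<^bsub>D\<^esub> r X x) k"
  shows "pullback D n s t k"
proof -
  have Ff: "is_functor C D F" using F unfolding is_mfunctor_def by blast
  have Q: "small_presheaf U C Q" using \<mu>(2) by (simp add: hom_PM_iff)
  obtain J :: "('u, 'u) cat" and K y where J: "small_category U J" "category J" "presents J K Q y"
    using small_presheafE[OF Q] .
  note K = is_functorD[OF presentsD(1)[OF J(3)]] and y = presentsD(3)[OF J(3)]
  have "\<exists>m z. classifies \<mu> P Q (FObj K j) (y j) m z \<and>
      pullback D (FArr F m) (s \<circ>\<^bsub>D\<^esub> l (Dom C m) z) (t \<circ>\<^bsub>D\<^esub> r (FObj K j) (y j)) k" if "j \<in> Obj J" for j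
    using local[OF K(1)[OF that] y[OF that]] .
  then obtain m z where mz: "\<And>j. j \<in> Obj J \<Longrightarrow> classifies \<mu> P Q (FObj K j) (y j) (m j) (z j)"
    and pb: "\<And>j. j \<in> Obj J \<Longrightarrow>
      pullback D (FArr F (m j)) (s \<circ>\<^bsub>D\<^esub> l (Dom C (m j)) (z j)) (t \<circ>\<^bsub>D\<^esub> r (FObj K j) (y j)) k"
    by metis
  have s': "s \<in> hom D (Dom D n) (Dom D k)" using s hom_dom[OF n(1)] by simp
  show ?thesis
  proof (rule D.pullback_over_colimit[OF J(1) comp_functor_is_functor[OF J(2) presentsD(1)[OF J(3)] Ff]
        colimit_of_wcolim[OF Ff J(2,3) q] wcolim_monic(1)[OF F \<mu> c q n] hom_cod[OF n(1)] k t s'])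
    show "pullback D (FArr F (m j)) (l (Dom C (m j)) (z j)) (r (FObj K j) (y j)) n" if "j \<in> Obj J" for j
      using wcolim_monic(2)[OF F \<mu> c q n K(1)[OF that] y[OF that] mz[OF that]] .
  qed (assumption | rule pb)+
qed

end

section \<open>Extension along the Yoneda embedding\<close>

lemma is_cocont_mfunctorD:
  assumes "is_cocont_mfunctor U A B F"
  shows "is_mfunctor A B F" "is_functor A B F" "preserves_small_colimits U A B F"
  using assms unfolding is_cocont_mfunctor_def is_mfunctor_def by blast+

lemma is_mfunctorD:
  assumes "is_mfunctor A B F"
  shows "is_functor A B F" "m \<in> Mon A \<Longrightarrow> FArr F m \<in> Mon B"
    "m \<in> Mon A \<Longrightarrow> pullback A p q f m \<Longrightarrow> pullback B (FArr F p) (FArr F q) (FArr F f) (FArr F m)"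
  using assms unfolding is_mfunctor_def by blast+

context Extension
begin

lemma rep_inject:
  assumes "rep X = rep Y" "X \<in> Obj C" "Y \<in> Obj C"
  shows "X = Y"
proof -
  have "Inl (Ident C X) \<in> FObj (rep Y) X" using rep_id[OF assms(2)] assms(1) by simp
  then have "Ident C X \<in> hom C X Y" using rep_obj[OF assms(2)] by auto
  then show ?thesis using id_hom[OF assms(2)] hom_cod by metis
qed

lemma wcocone_precomp:
  assumes \<phi>: "wcocone F Q d \<phi>" and \<mu>: "\<mu> \<in> hom Psh P Q"
  shows "wcocone F P d (\<lambda>X x. \<phi> X (app \<mu> X x))"
proof (rule wcoconeI[OF wcoconeD(1)[OF \<phi>]])
  show "\<phi> X (app \<mu> X x) \<in> hom D (FObj F X) d" if "X \<in> Obj C" "x \<in> FObj P X" for X x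
    using wcoconeD(2)[OF \<phi> that(1) app_in[OF \<mu> that]] .
  show "\<phi> W (app \<mu> W (act P f x)) = \<phi> X (app \<mu> X x) \<circ>\<^bsub>D\<^esub> FArr F f"
    if f: "f \<in> hom C W X" and x: "x \<in> FObj P X" for W X f x
    using wcoconeD(3)[OF \<phi> f app_in[OF \<mu> cod_obj[OF f] x]] app_natural[OF \<mu> f x] by simp
qed

text \<open>\<open>L\<close> is a left Kan extension of \<open>F\<close> along the Yoneda embedding, with chosen coprojections
  \<open>l\<close>. This covers both the functors constructed from weighted colimits and the cocontinuous
  functors that are given, for which \<open>l\<close> consists of the images of maps out of representables.\<close>

definition extends ::
  "('o, 'a, 'p, 'b) fctr \<Rightarrow> (('o, 'a, 'u) presheaf, ('o, 'a, 'u) presheaf_map, 'p, 'b) fctr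
     \<Rightarrow> (('o, 'a, 'u) presheaf \<Rightarrow> 'o \<Rightarrow> 'a + 'u \<Rightarrow> 'b) \<Rightarrow> bool" where
  "extends F L l \<longleftrightarrow> is_functor C D F \<and> is_functor (PM U C) D L \<and>
     (\<forall>P. small_presheaf U C P \<longrightarrow> wcolim F P (FObj L P) (l P)) \<and>
     (\<forall>P Q. \<forall>\<mu>\<in>hom (PM U C) P Q. \<forall>X\<in>Obj C. \<forall>x\<in>FObj P X.
        FArr L \<mu> \<circ>\<^bsub>D\<^esub> l P X x = l Q X (app \<mu> X x))"

lemma extendsD:
  assumes "extends F L l"
  shows "is_functor C D F" "is_functor (PM U C) D L" "small_presheaf U C P \<Longrightarrow> wcolim F P (FObj L P) (l P)"
    "\<mu> \<in> hom (PM U C) P Q \<Longrightarrow> X \<in> Obj C \<Longrightarrow> x \<in> FObj P X \<Longrightarrow> FArr L \<mu> \<circ>\<^bsub>D\<^esub> l P X x = l Q X (app \<mu> X x)"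
    "small_presheaf U C P \<Longrightarrow> X \<in> Obj C \<Longrightarrow> x \<in> FObj P X \<Longrightarrow> l P X x \<in> hom D (FObj F X) (FObj L P)"
proof -
  show wc: "small_presheaf U C P \<Longrightarrow> wcolim F P (FObj L P) (l P)" for P
    using assms unfolding extends_def by blast
  show "small_presheaf U C P \<Longrightarrow> X \<in> Obj C \<Longrightarrow> x \<in> FObj P X \<Longrightarrow> l P X x \<in> hom D (FObj F X) (FObj L P)"
    using wcoconeD(2)[OF wcolim_wcocone[OF wc]] by blast
qed (use assms in \<open>unfold extends_def, blast+\<close>)

text \<open>At representables the weighted colimit is chosen to be a value of \<open>F\<close>, with the maps in the
  image of \<open>F\<close> as coprojections. Therefore the extension restricts to \<open>F\<close> itself, and not only to
  an isomorphic functor.\<close>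

lemma extension_ex:
  assumes F: "is_functor C D F"
  obtains L l where "extends F L l" "comp_functor C L yo = F"
proof -
  \<comment> \<open>As the Yoneda embedding is injective on objects, the choice can be prescribed at
    representables.\<close>
  have "\<exists>c l. (small_presheaf U C P \<longrightarrow> wcolim F P c l) \<and>
      (\<forall>X\<in>Obj C. P = rep X \<longrightarrow> c = FObj F X \<and> (\<forall>W. \<forall>f\<in>hom C W X. l W (Inl f) = FArr F f))" for P
  proof (cases "\<exists>X\<in>Obj C. P = rep X")
    case True
    then obtain X where X: "X \<in> Obj C" "P = rep X" by blast
    have "\<forall>Y\<in>Obj C. P = rep Y \<longrightarrow> FObj F X = FObj F Y \<and> (\<forall>W. \<forall>f\<in>hom C W Y. FArr F (projl (Inl f)) = FArr F f)"
      using rep_inject X by auto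
    with wcolim_rep[OF F X(1)] X(2) show ?thesis
      by (intro exI[of _ "FObj F X"] exI[of _ "\<lambda>W e. FArr F (projl e)"]) auto
  next
    case False
    show ?thesis
    proof (cases "small_presheaf U C P")
      case True
      obtain c l where "wcolim F P c l" using wcolim_ex[OF F True] .
      with False show ?thesis by blast
    qed (use False in blast)
  qed
  then obtain c l where wc: "\<And>P. small_presheaf U C P \<Longrightarrow> wcolim F P (c P) (l P)"
    and c_rep: "\<And>X. X \<in> Obj C \<Longrightarrow> c (rep X) = FObj F X"
    and l_rep: "\<And>X W f. X \<in> Obj C \<Longrightarrow> f \<in> hom C W X \<Longrightarrow> l (rep X) W (Inl f) = FArr F f"
    by metis
  note F' = is_functorD[OF F]
  note l = wcoconeD[OF wcolim_wcocone[OF wc]]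
  define La where "La \<mu> = (SOME h. h \<in> hom D (c (src \<mu>)) (c (tgt \<mu>)) \<and>
    (\<forall>X\<in>Obj C. \<forall>x\<in>FObj (src \<mu>) X. h \<circ>\<^bsub>D\<^esub> l (src \<mu>) X x = l (tgt \<mu>) X (app \<mu> X x)))" for \<mu>
  have La: "La \<mu> \<in> hom D (c P) (c Q) \<and> (\<forall>X\<in>Obj C. \<forall>x\<in>FObj P X. La \<mu> \<circ>\<^bsub>D\<^esub> l P X x = l Q X (app \<mu> X x))"
    if \<mu>: "\<mu> \<in> hom (PM U C) P Q" for \<mu> P Q
  proof -
    have s: "src \<mu> = P" "tgt \<mu> = Q" "small_presheaf U C P" "small_presheaf U C Q"
      using hom_dom[OF \<mu>] hom_cod[OF \<mu>] \<mu> by (simp_all add: hom_PM_iff)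
    have "\<exists>h. h \<in> hom D (c P) (c Q) \<and> (\<forall>X\<in>Obj C. \<forall>x\<in>FObj P X. h \<circ>\<^bsub>D\<^esub> l P X x = l Q X (app \<mu> X x))"
      using wcolim_map_ex[OF wc[OF s(3)] wcocone_precomp[OF wcolim_wcocone[OF wc[OF s(4)]]
          PM_Psh[OF \<mu>]]] by metis
    from someI_ex[OF this] show ?thesis unfolding La_def s(1,2) .
  qed
  define L :: "(('o, 'a, 'u) presheaf, ('o, 'a, 'u) presheaf_map, 'p, 'b) fctr" where
    "L = \<lparr>FObj = (\<lambda>P\<in>Obj (PM U C). c P), FArr = (\<lambda>\<mu>\<in>Arr (PM U C). La \<mu>)\<rparr>"
  have Lo: "FObj L P = c P" if "small_presheaf U C P" for P using that by (simp add: L_def)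
  have Lm: "FArr L \<mu> = La \<mu>" if "\<mu> \<in> hom (PM U C) P Q" for \<mu> P Q
    using hom_arr[OF that] by (simp add: L_def)
  have small: "small_presheaf U C P" "small_presheaf U C Q" if "\<mu> \<in> hom (PM U C) P Q" for \<mu> P Q
    using that by (auto simp: hom_PM_iff)
  have Lfun: "is_functor (PM U C) D L"
  proof (rule is_functorI)
    show "FObj L \<in> extensional (Obj (PM U C))" "FArr L \<in> extensional (Arr (PM U C))"
        by (simp_all add: L_def)
    show "FObj L P \<in> Obj D" if "P \<in> Obj (PM U C)" for P
      using that Lo l(1) by simp
    show "FArr L \<mu> \<in> hom D (FObj L P) (FObj L Q)" if "\<mu> \<in> hom (PM U C) P Q" for \<mu> P Q
      using La[OF that] Lm[OF that] Lo[OF small(1)[OF that]] Lo[OF small(2)[OF that]] by simp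
    show "FArr L (Ident (PM U C) P) = Ident D (FObj L P)" if "P \<in> Obj (PM U C)" for P
    proof -
      have P: "small_presheaf U C P" using that by simp
      have i: "Ident (PM U C) P \<in> hom (PM U C) P P" using PM.id_hom[OF that] .
      have "La (Ident (PM U C) P) = Ident D (c P)"
      proof (rule wcolim_map_unique[OF F wc[OF P] conjunct1[OF La[OF i]] D.id_hom[OF l(1)[OF P]]])
        show "La (Ident (PM U C) P) \<circ>\<^bsub>D\<^esub> l P X x = Ident D (c P) \<circ>\<^bsub>D\<^esub> l P X x"
            if "X \<in> Obj C" "x \<in> FObj P X" for X x
          using La[OF i] that app_id[OF that] D.comp_id_left[OF l(2)[OF P that]] by simp
      qed
      then show ?thesis using Lm[OF i] Lo[OF P] by simp
    qed
    show "FArr L (\<nu> \<circ>\<^bsub>PM U C\<^esub> \<mu>) = FArr L \<nu> \<circ>\<^bsub>D\<^esub> FArr L \<mu>"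
      if \<mu>: "\<mu> \<in> hom (PM U C) P Q" and \<nu>: "\<nu> \<in> hom (PM U C) Q R" for \<mu> \<nu> P Q R
    proof -
      note \<nu>\<mu> = PM.comp_hom[OF \<mu> \<nu>] and P = small(1)[OF \<mu>]
      note hm = conjunct1[OF La[OF \<mu>]] and hn = conjunct1[OF La[OF \<nu>]]
      have "La (\<nu> \<circ>\<^bsub>PM U C\<^esub> \<mu>) = La \<nu> \<circ>\<^bsub>D\<^esub> La \<mu>"
      proof (rule wcolim_map_unique[OF F wc[OF P] conjunct1[OF La[OF \<nu>\<mu>]] D.comp_hom[OF hm hn]])
        fix X x assume Xx: "X \<in> Obj C" "x \<in> FObj P X"
        show "La (\<nu> \<circ>\<^bsub>PM U C\<^esub> \<mu>) \<circ>\<^bsub>D\<^esub> l P X x = (La \<nu> \<circ>\<^bsub>D\<^esub> La \<mu>) \<circ>\<^bsub>D\<^esub> l P X x"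
          using La[OF \<nu>\<mu>] La[OF \<mu>] La[OF \<nu>] Xx app_in[OF PM_Psh[OF \<mu>] Xx] app_comp[OF PM_Psh[OF \<mu>]
              PM_Psh[OF \<nu>] Xx]
            D.comp_assoc[OF l(2)[OF P Xx] hm hn] by simp
      qed
      then show ?thesis using Lm[OF \<mu>] Lm[OF \<nu>] Lm[OF \<nu>\<mu>] by simp
    qed
  qed
  have ext: "extends F L l"
    unfolding extends_def using F Lfun Lo wc Lm La by simp
  have "comp_functor C L yo = F"
  proof (rule fctr_eqI[OF comp_functor_is_functor[OF category yo_functor_PM Lfun] F])
    show "FObj (comp_functor C L yo) X = FObj F X" if "X \<in> Obj C" for X
      using that Lo[OF small_presheaf_rep[OF that]] c_rep[OF that] by (simp add: comp_functor_def yo_obj)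
    show "FArr (comp_functor C L yo) f = FArr F f" if "f \<in> Arr C" for f
    proof -
      have f: "f \<in> hom C (Dom C f) (Cod C f)" using arr_hom[OF that] .
      have W: "Dom C f \<in> Obj C" "Cod C f \<in> Obj C" using dom_obj[OF f] cod_obj[OF f] .
      note yf = yo_PM[OF f]
      have "La (FArr yo f) \<in> hom D (FObj F (Dom C f)) (FObj F (Cod C f))"
        using La[OF yf] c_rep[OF W(1)] c_rep[OF W(2)] by simp
      then have "La (FArr yo f) = La (FArr yo f) \<circ>\<^bsub>D\<^esub> FArr F (Ident C (Dom C f))"
        using F'(3)[OF W(1)] D.comp_id_right by simp
      also have "\<dots> = l (rep (Cod C f)) (Dom C f) (Inl (f \<circ>\<^bsub>C\<^esub> Ident C (Dom C f)))"
        using conjunct2[OF La[OF yf], rule_format, OF W(1) rep_id[OF W(1)]] l_rep[OF W(1) id_hom[OF W(1)]]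
          app_yo[OF f id_hom[OF W(1)]] by simp
      also have "\<dots> = FArr F f"
        using comp_id_right[OF f] l_rep[OF W(2) f] by simp
      finally show ?thesis using that Lm[OF yf] by (simp add: comp_functor_def)
    qed
  qed
  with that ext show thesis by blast
qed

lemma presheaf_monics_hom: "\<mu> \<in> presheaf_monics U C \<Longrightarrow> \<mu> \<in> hom (PM U C) (src \<mu>) (tgt \<mu>)"
  unfolding presheaf_monics_def by (auto simp: hom_iff PM_def cat.defs small_presheaf_cat_def)

text \<open>A pullback of \<open>\<mu>\<close> along \<open>g\<close> is preserved because, over an element \<open>r\<close> of \<open>R\<close>, both sides of
  the square restrict to the image of one monic: the one that classifies \<open>g r\<close>.\<close>

lemma extends_mfunctor:
  assumes F: "is_mfunctor C D F" and L: "extends F L l"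
  shows "is_mfunctor (PM U C) D L"
  unfolding is_mfunctor_def
proof (intro conjI ballI allI impI)
  note e = extendsD[OF L]
  show "is_functor (PM U C) D L" using e(2) .
  have small: "small_presheaf U C P" "small_presheaf U C Q" if "\<mu> \<in> hom (PM U C) P Q" for \<mu> P Q
    using that by (auto simp: hom_PM_iff)
  have mon: "FArr L \<mu> \<in> Mon D"
      "\<And>X x m z. X \<in> Obj C \<Longrightarrow> x \<in> FObj Q X \<Longrightarrow> classifies \<mu> P Q X x m z \<Longrightarrow>
        pullback D (FArr F m) (l P (Dom C m) z) (l Q X x) (FArr L \<mu>)"
    if "\<mu> \<in> presheaf_monics U C" and \<mu>: "\<mu> \<in> hom (PM U C) P Q" for \<mu> P Q
    using wcolim_monic[OF F that e(3)[OF small(1)[OF \<mu>]] e(3)[OF small(2)[OF \<mu>]] is_functorD(2)[OF e(2) \<mu>] e(4)[OF \<mu>]]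
    by blast+
  show "FArr L \<mu> \<in> Mon D" if "\<mu> \<in> Mon (PM U C)" for \<mu>
    using that mon(1)[OF _ presheaf_monics_hom] by simp
  fix p q g \<mu> assume "\<mu> \<in> Mon (PM U C)" and pb: "pullback (PM U C) p q g \<mu>"
  then have \<mu>: "\<mu> \<in> presheaf_monics U C" by simp
  obtain W R P Q where h: "p \<in> hom (PM U C) W R" "q \<in> hom (PM U C) W P" "g \<in> hom (PM U C) R Q"
      "\<mu> \<in> hom (PM U C) P Q"
    using PM.pullbackE[OF pb] .
  have p: "p \<in> presheaf_monics U C" using presheaf_monic_pullback[OF pb \<mu>] .
  note Lh = h[THEN is_functorD(2)[OF e(2)]]
  show "pullback D (FArr L p) (FArr L q) (FArr L g) (FArr L \<mu>)"
  proof (rule wcolim_pullback[OF F p h(1) e(3)[OF small(1)[OF h(1)]] e(3)[OF small(2)[OF h(1)]] Lh(1) e(4)[OF h(1)] mon(1)[OF \<mu> h(4)]])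
    show "FArr L g \<in> hom D (FObj L R) (Cod D (FArr L \<mu>))" "FArr L q \<in> hom D (FObj L W) (Dom D (FArr L \<mu>))"
      using Lh(2,3) hom_cod[OF Lh(4)] hom_dom[OF Lh(4)] by simp_all
    fix X r assume X: "X \<in> Obj C" "r \<in> FObj R X"
    note gr = app_in[OF PM_Psh[OF h(3)] X]
    obtain m z where mz: "classifies \<mu> P Q X (app g X r) m z"
      using presheaf_monic_classifies[OF \<mu> h(4) X(1) gr] .
    obtain w where w: "classifies p W R X r m w" "app q (Dom C m) w = z"
      using classifies_pullback[OF pb h X mz] .
    have "pullback D (FArr F m) (FArr L q \<circ>\<^bsub>D\<^esub> l W (Dom C m) w) (FArr L g \<circ>\<^bsub>D\<^esub> l R X r) (FArr L \<mu>)"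
      using mon(2)[OF \<mu> h(4) X(1) gr mz] e(4)[OF h(3) X]
        e(4)[OF h(2) dom_obj[OF classifiesD(2)[OF w(1)]] classifiesD(3)[OF w(1)]] w(2) by simp
    with w(1) show "\<exists>m z. classifies p W R X r m z \<and>
        pullback D (FArr F m) (FArr L q \<circ>\<^bsub>D\<^esub> l W (Dom C m) z) (FArr L g \<circ>\<^bsub>D\<^esub> l R X r) (FArr L \<mu>)" by blast
  qed assumption+
qed

text \<open>Over an element \<open>x\<close> with classifying monic \<open>m\<close>, the square restricts to the paste of the
  square for \<open>M\<close> from \<open>wcolim_monic\<close> with the naturality square of \<open>\<alpha>\<close> at \<open>m\<close>.\<close>

lemma extends_cartesian:
  assumes F: "is_mfunctor C D F" "extends F L l" and G: "is_mfunctor C D G" "extends G M r"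
    and \<alpha>: "mcartesian C D \<alpha>" "src \<alpha> = F" "tgt \<alpha> = G"
    and a: "\<And>P. small_presheaf U C P \<Longrightarrow> a P \<in> hom D (FObj L P) (FObj M P)"
      "\<And>P X x. small_presheaf U C P \<Longrightarrow> X \<in> Obj C \<Longrightarrow> x \<in> FObj P X \<Longrightarrow>
        a P \<circ>\<^bsub>D\<^esub> l P X x = r P X x \<circ>\<^bsub>D\<^esub> body \<alpha> X"
    and \<mu>: "\<mu> \<in> presheaf_monics U C" "\<mu> \<in> hom (PM U C) P Q"
  shows "pullback D (FArr L \<mu>) (a P) (a Q) (FArr M \<mu>)"
proof -
  note e = extendsD[OF F(2)] and e' = extendsD[OF G(2)]
  have P: "small_presheaf U C P" and Q: "small_presheaf U C Q" using \<mu>(2) by (auto simp: hom_PM_iff)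
  note M\<mu> = is_functorD(2)[OF e'(2) \<mu>(2)] and L\<mu> = is_functorD(2)[OF e(2) \<mu>(2)]
  note monM = wcolim_monic[OF G(1) \<mu> e'(3)[OF P] e'(3)[OF Q] M\<mu> e'(4)[OF \<mu>(2)]]
  show ?thesis
  proof (rule wcolim_pullback[OF F(1) \<mu> e(3)[OF P] e(3)[OF Q] L\<mu> e(4)[OF \<mu>(2)]])
    show "FArr M \<mu> \<in> Mon D" using monM(1) by blast
    show "a Q \<in> hom D (FObj L Q) (Cod D (FArr M \<mu>))" "a P \<in> hom D (FObj L P) (Dom D (FArr M \<mu>))"
      using a(1)[OF P] a(1)[OF Q] hom_cod[OF M\<mu>] hom_dom[OF M\<mu>] by simp_all
    fix X x assume X: "X \<in> Obj C" "x \<in> FObj Q X"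
    obtain m z where mz: "classifies \<mu> P Q X x m z"
      using presheaf_monic_classifies[OF \<mu> X] .
    note m = classifiesD[OF mz]
    have "pullback D (FArr G m) (r P (Dom C m) z) (r Q X x) (FArr M \<mu>)"
      using monM(2)[OF _ _ X mz] by blast
    moreover have "pullback D (FArr F m) (body \<alpha> (Dom C m)) (body \<alpha> X) (FArr G m)"
      using \<alpha> m(1) hom_cod[OF m(2)] unfolding mcartesian_def by blast
    ultimately have "pullback D (FArr F m) (r P (Dom C m) z \<circ>\<^bsub>D\<^esub> body \<alpha> (Dom C m)) (r Q X x \<circ>\<^bsub>D\<^esub> body \<alpha> X) (FArr M \<mu>)"
      by (rule D.pullback_paste)
    then have "pullback D (FArr F m) (a P \<circ>\<^bsub>D\<^esub> l P (Dom C m) z) (a Q \<circ>\<^bsub>D\<^esub> l Q X x) (FArr M \<mu>)"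
      using a(2)[OF P dom_obj[OF m(2)] m(3)] a(2)[OF Q X] by simp
    with mz show "\<exists>m z. classifies \<mu> P Q X x m z \<and>
        pullback D (FArr F m) (a P \<circ>\<^bsub>D\<^esub> l P (Dom C m) z) (a Q \<circ>\<^bsub>D\<^esub> l Q X x) (FArr M \<mu>)" by blast
  qed assumption+
qed

text \<open>A cocone under the \<open>L (T j)\<close> with vertex \<open>d\<close> is a cocone under the \<open>T j\<close> with vertex the
  presheaf \<open>D(F -, d)\<close>. It factors through \<open>c\<close>, which is a colimit among all presheaves, and the
  factorisation is a weighted cocone for \<open>c\<close>.\<close>

lemma extends_cocontinuous:
  assumes L: "extends F L l"
  shows "preserves_small_colimits U (PM U C) D L"
  unfolding preserves_small_colimits_def
proof (intro allI impI)
  fix J :: "('u, 'u) cat" and T c \<kappa>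
  assume *: "small_category U J \<and> is_functor J (PM U C) T \<and> is_colimit J (PM U C) T c \<kappa>"
  then have J: "category J" "small U (Obj J)" and T: "is_functor J (PM U C) T"
      and colim: "is_colimit J (PM U C) T c \<kappa>"
    unfolding small_category_def by blast+
  interpret J: Category J using J(1) by unfold_locales
  note e = extendsD[OF L] and T' = is_functorD[OF T]
  note F = e(1) and L' = is_functorD[OF e(2)]
  have Psh: "is_colimit J Psh T c \<kappa>" using colimit_PM_Psh[OF J T colim] .
  have coc: "is_cocone J (PM U C) T c \<kappa>" using colim unfolding is_colimit_def by blast
  then have c: "small_presheaf U C c" and \<kappa>: "\<And>j. j \<in> Obj J \<Longrightarrow> \<kappa> j \<in> hom (PM U C) (FObj T j) c"
    and \<kappa>u: "\<And>u. u \<in> Arr J \<Longrightarrow> \<kappa> (Cod J u) \<circ>\<^bsub>PM U C\<^esub> FArr T u = \<kappa> (Dom J u)"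
    unfolding is_cocone_def by auto
  have Tj: "small_presheaf U C (FObj T j)" if "j \<in> Obj J" for j using T'(1)[OF that] by simp
  note L\<kappa> = L'(2)[OF \<kappa>]
  show "is_colimit J D (comp_functor J L T) (FObj L c) (\<lambda>j. FArr L (\<kappa> j))"
    unfolding is_colimit_def
  proof (intro conjI allI impI)
    show "is_cocone J D (comp_functor J L T) (FObj L c) (\<lambda>j. FArr L (\<kappa> j))"
      unfolding is_cocone_def
    proof (intro conjI ballI)
      show "FObj L c \<in> Obj D" using L'(1) c by simp
      show "FArr L (\<kappa> j) \<in> hom D (FObj (comp_functor J L T) j) (FObj L c)" if "j \<in> Obj J" for j
        using L\<kappa>[OF that] that by (simp add: comp_functor_def)
      fix u assume u: "u \<in> Arr J"
      show "FArr L (\<kappa> (Cod J u)) \<circ>\<^bsub>D\<^esub> FArr (comp_functor J L T) u = FArr L (\<kappa> (Dom J u))"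
        using L'(4)[OF T'(2)[OF arr_hom[OF u]] \<kappa>[OF J.cod_obj[OF arr_hom[OF u]]]] \<kappa>u[OF u] u
        by (simp add: comp_functor_def)
    qed
    fix d \<psi> assume "is_cocone J D (comp_functor J L T) d \<psi>"
    then have d: "d \<in> Obj D" and \<psi>: "\<And>j. j \<in> Obj J \<Longrightarrow> \<psi> j \<in> hom D (FObj L (FObj T j)) d"
      and \<psi>u: "\<And>u. u \<in> Arr J \<Longrightarrow> \<psi> (Cod J u) \<circ>\<^bsub>D\<^esub> FArr L (FArr T u) = \<psi> (Dom J u)"
      unfolding is_cocone_def by (auto simp: comp_functor_def)
    obtain N :: "('o, 'a, 'u) presheaf" and en de where N: "psh N"
      and to_map: "\<And>P \<phi>. psh P \<Longrightarrow> wcocone F P d \<phi> \<Longrightarrow> mk_presheaf_map C P N (\<lambda>X x. en X (\<phi> X x)) \<in> hom Psh P N"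
      and to_wcocone: "\<And>P \<tau>. \<tau> \<in> hom Psh P N \<Longrightarrow> wcocone F P d (\<lambda>X x. de X (app \<tau> X x))"
      and de: "\<And>X t. X \<in> Obj C \<Longrightarrow> t \<in> hom D (FObj F X) d \<Longrightarrow> de X (en X t) = t"
      by (rule wcocone_representation[OF F d]) (rule that)
    note lT = e(5)[OF Tj]
    have \<psi>l: "wcocone F (FObj T j) d (\<lambda>X x. \<psi> j \<circ>\<^bsub>D\<^esub> l (FObj T j) X x)" if "j \<in> Obj J" for j
      using wcocone_postcomp[OF F wcolim_wcocone[OF e(3)[OF Tj[OF that]]] \<psi>[OF that]] .
    define \<tau> where "\<tau> j = mk_presheaf_map C (FObj T j) N (\<lambda>X x. en X (\<psi> j \<circ>\<^bsub>D\<^esub> l (FObj T j) X x))" for j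
    have \<tau>: "\<tau> j \<in> hom Psh (FObj T j) N" if "j \<in> Obj J" for j
      unfolding \<tau>_def using to_map[OF small_presheaf_psh[OF Tj[OF that]] \<psi>l[OF that]] .
    have app\<tau>: "app (\<tau> j) X x = en X (\<psi> j \<circ>\<^bsub>D\<^esub> l (FObj T j) X x)" if "X \<in> Obj C" "x \<in> FObj (FObj T j) X"
        for j X x
      unfolding \<tau>_def using that by simp
    have "is_cocone J Psh T N \<tau>"
      unfolding is_cocone_def
    proof (intro conjI ballI)
      show "N \<in> Obj Psh" using N by simp
      show "\<tau> j \<in> hom Psh (FObj T j) N" if "j \<in> Obj J" for j using \<tau>[OF that] .
      fix u assume u: "u \<in> Arr J"
      have jk: "Dom J u \<in> Obj J" "Cod J u \<in> Obj J"
        using J.dom_obj[OF arr_hom[OF u]] J.cod_obj[OF arr_hom[OF u]] .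
      note TuM = T'(2)[OF arr_hom[OF u]]
      note Tu = PM_Psh[OF TuM]
      show "\<tau> (Cod J u) \<circ>\<^bsub>Psh\<^esub> FArr T u = \<tau> (Dom J u)"
      proof (rule map_eqI[OF Psh.comp_hom[OF Tu \<tau>[OF jk(2)]] \<tau>[OF jk(1)]])
        fix X x assume Xx: "X \<in> Obj C" "x \<in> FObj (FObj T (Dom J u)) X"
        show "app (\<tau> (Cod J u) \<circ>\<^bsub>Psh\<^esub> FArr T u) X x = app (\<tau> (Dom J u)) X x"
          using app_comp[OF Tu \<tau>[OF jk(2)] Xx] app\<tau>[OF Xx] app\<tau>[OF Xx(1) app_in[OF Tu Xx]] e(4)[OF TuM Xx]
            D.comp_assoc[OF lT[OF jk(1) Xx] L'(2)[OF TuM] \<psi>[OF jk(2)]] \<psi>u[OF u] by simp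
      qed
    qed
    from is_colimitD(2)[OF Psh this]
    obtain t where t: "t \<in> hom Psh c N" "\<And>j. j \<in> Obj J \<Longrightarrow> t \<circ>\<^bsub>Psh\<^esub> \<kappa> j = \<tau> j" by metis
    obtain h where h: "h \<in> hom D (FObj L c) d"
      "\<And>X x. X \<in> Obj C \<Longrightarrow> x \<in> FObj c X \<Longrightarrow> h \<circ>\<^bsub>D\<^esub> l c X x = de X (app t X x)"
      using wcolim_map_ex[OF e(3)[OF c] to_wcocone[OF t(1)]] by metis
    have L\<kappa>l: "(g \<circ>\<^bsub>D\<^esub> FArr L (\<kappa> j)) \<circ>\<^bsub>D\<^esub> l (FObj T j) X x = g \<circ>\<^bsub>D\<^esub> l c X (app (\<kappa> j) X x)"
      if "g \<in> hom D (FObj L c) d" "j \<in> Obj J" "X \<in> Obj C" "x \<in> FObj (FObj T j) X" for g j X x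
      using D.comp_assoc[OF lT[OF that(2-4)] L\<kappa>[OF that(2)] that(1)] e(4)[OF \<kappa>[OF that(2)] that(3,4)]
          by simp
    have h\<psi>: "h \<circ>\<^bsub>D\<^esub> FArr L (\<kappa> j) = \<psi> j" if j: "j \<in> Obj J" for j
    proof (rule wcolim_map_unique[OF F e(3)[OF Tj[OF j]] D.comp_hom[OF L\<kappa>[OF j] h(1)] \<psi>[OF j]])
      fix X x assume Xx: "X \<in> Obj C" "x \<in> FObj (FObj T j) X"
      note \<kappa>j = PM_Psh[OF \<kappa>[OF j]]
      show "(h \<circ>\<^bsub>D\<^esub> FArr L (\<kappa> j)) \<circ>\<^bsub>D\<^esub> l (FObj T j) X x = \<psi> j \<circ>\<^bsub>D\<^esub> l (FObj T j) X x"
        using L\<kappa>l[OF h(1) j Xx] h(2)[OF Xx(1) app_in[OF \<kappa>j Xx]] app_comp[OF \<kappa>j t(1) Xx] t(2)[OF j]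
            app\<tau>[OF Xx]
          de[OF Xx(1) D.comp_hom[OF lT[OF j Xx] \<psi>[OF j]]] by simp
    qed
    show "\<exists>!h. h \<in> hom D (FObj L c) d \<and> (\<forall>j\<in>Obj J. h \<circ>\<^bsub>D\<^esub> FArr L (\<kappa> j) = \<psi> j)"
    proof (rule ex1I[of _ h])
      show "h \<in> hom D (FObj L c) d \<and> (\<forall>j\<in>Obj J. h \<circ>\<^bsub>D\<^esub> FArr L (\<kappa> j) = \<psi> j)" using h(1) h\<psi> by blast
      fix k assume k: "k \<in> hom D (FObj L c) d \<and> (\<forall>j\<in>Obj J. k \<circ>\<^bsub>D\<^esub> FArr L (\<kappa> j) = \<psi> j)"
      then have kh: "k \<in> hom D (FObj L c) d" by blast
      let ?m = "\<lambda>g. mk_presheaf_map C c N (\<lambda>X x. en X (g \<circ>\<^bsub>D\<^esub> l c X x))"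
      have m: "?m g \<in> hom Psh c N" if "g \<in> hom D (FObj L c) d" for g
        using to_map[OF small_presheaf_psh[OF c] wcocone_postcomp[OF F
            wcolim_wcocone[OF e(3)[OF c]] that]] .
      have m\<kappa>: "?m g \<circ>\<^bsub>Psh\<^esub> \<kappa> j = \<tau> j" if g: "g \<in> hom D (FObj L c) d" and j: "j \<in> Obj J"
        and g\<psi>: "g \<circ>\<^bsub>D\<^esub> FArr L (\<kappa> j) = \<psi> j" for g j
      proof -
        note \<kappa>j = PM_Psh[OF \<kappa>[OF j]]
        show ?thesis
        proof (rule map_eqI[OF Psh.comp_hom[OF \<kappa>j m[OF g]] \<tau>[OF j]])
          fix X x assume Xx: "X \<in> Obj C" "x \<in> FObj (FObj T j) X"
          show "app (?m g \<circ>\<^bsub>Psh\<^esub> \<kappa> j) X x = app (\<tau> j) X x"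
            using app_comp[OF \<kappa>j m[OF g] Xx] app\<tau>[OF Xx] L\<kappa>l[OF g j Xx] g\<psi> app_in[OF \<kappa>j Xx] Xx(1) by simp
        qed
      qed
      have "\<exists>!t. t \<in> hom Psh c N \<and> (\<forall>j\<in>Obj J. t \<circ>\<^bsub>Psh\<^esub> \<kappa> j = \<tau> j)"
        using Psh \<open>is_cocone J Psh T N \<tau>\<close> unfolding is_colimit_def by blast
      moreover have "?m k \<in> hom Psh c N \<and> (\<forall>j\<in>Obj J. ?m k \<circ>\<^bsub>Psh\<^esub> \<kappa> j = \<tau> j)"
        using m[OF kh] m\<kappa>[OF kh] k by simp
      moreover have "?m h \<in> hom Psh c N \<and> (\<forall>j\<in>Obj J. ?m h \<circ>\<^bsub>Psh\<^esub> \<kappa> j = \<tau> j)"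
        using m[OF h(1)] m\<kappa>[OF h(1)] h\<psi> by simp
      ultimately have eq: "?m k = ?m h" by blast
      show "k = h"
      proof (rule wcolim_map_unique[OF F e(3)[OF c] kh h(1)])
        fix X x assume Xx: "X \<in> Obj C" "x \<in> FObj c X"
        have "app (?m k) X x = app (?m h) X x" using eq by simp
        then have "de X (en X (k \<circ>\<^bsub>D\<^esub> l c X x)) = de X (en X (h \<circ>\<^bsub>D\<^esub> l c X x))" using Xx by simp
        then show "k \<circ>\<^bsub>D\<^esub> l c X x = h \<circ>\<^bsub>D\<^esub> l c X x"
          using de[OF Xx(1) D.comp_hom[OF e(5)[OF c Xx] kh]] de[OF Xx(1)
              D.comp_hom[OF e(5)[OF c Xx] h(1)]] by simp
      qed
    qed
  qed
qed

lemma cocontinuous_extends: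
  assumes G: "is_functor (PM U C) D G" "preserves_small_colimits U (PM U C) D G"
  shows "extends (comp_functor C G yo) G (\<lambda>P X x. FArr G (elem_map C P X x))"
proof -
  let ?F = "comp_functor C G yo"
  note G' = is_functorD[OF G(1)]
  have F: "is_functor C D ?F" using comp_functor_is_functor[OF category yo_functor_PM G(1)] .
  have Fo: "FObj ?F X = FObj G (rep X)" if "X \<in> Obj C" for X using that
      by (simp add: comp_functor_def yo_obj)
  have Fa: "FArr ?F f = FArr G (FArr yo f)" if "f \<in> hom C W X" for f W X
    using hom_arr[OF that] by (simp add: comp_functor_def)
  have wc: "wcolim ?F P (FObj G P) (\<lambda>X x. FArr G (elem_map C P X x))" if P: "small_presheaf U C P" for P
  proof -
    note psh = small_presheaf_psh[OF P]
    obtain J :: "('u, 'u) cat" and K y where J: "small_category U J" "category J" "presents J K P y"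
      using small_presheafE[OF P] .
    note K = presentsD(1)[OF J(3)]
    have yK: "is_functor J (PM U C) (comp_functor J yo K)"
      using comp_functor_is_functor[OF J(2) K yo_functor_PM] .
    have colim: "is_colimit J Psh (comp_functor J yo K) P (\<lambda>j. elem_map C P (FObj K j) (y j))"
      using presents_colimit[OF J(2,3)] .
    have yKo: "small_presheaf U C (FObj (comp_functor J yo K) j)" if "j \<in> Obj J" for j
      using is_functorD(1)[OF yK that] by simp
    have coc_iff: "is_cocone J (PM U C) (comp_functor J yo K) Q \<mu> \<longleftrightarrow>
        is_cocone J Psh (comp_functor J yo K) Q \<mu> \<and> small_presheaf U C Q" for Q \<mu>
      using yKo small_presheaf_psh unfolding is_cocone_def by (auto simp: hom_PM_iff)
    have "is_colimit J (PM U C) (comp_functor J yo K) P (\<lambda>j. elem_map C P (FObj K j) (y j))"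
      unfolding is_colimit_def coc_iff using colim P unfolding is_colimit_def by (simp add: hom_PM_iff)
    then have "is_colimit J D (comp_functor J G (comp_functor J yo K)) (FObj G P)
        (\<lambda>j. FArr G (elem_map C P (FObj K j) (y j)))"
      using G(2) J(1) yK unfolding preserves_small_colimits_def by blast
    moreover have "comp_functor J G (comp_functor J yo K) = comp_functor J ?F K"
    proof -
      have "FObj K j \<in> Obj C" if "j \<in> Obj J" for j using is_functorD(1)[OF K that] .
      moreover have "FArr K u \<in> Arr C" if "u \<in> Arr J" for u
        using hom_arr[OF is_functorD(2)[OF K arr_hom[OF that]]] .
      ultimately show ?thesis by (auto simp: comp_functor_def intro!: restrict_ext)
    qed
    ultimately have colimD: "is_colimit J D (comp_functor J ?F K) (FObj G P)
        (\<lambda>j. FArr G (elem_map C P (FObj K j) (y j)))" by simp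
    show ?thesis
    proof (rule wcolim_of_colimit[OF F J(2,3) colimD])
      show "wcocone ?F P (FObj G P) (\<lambda>X x. FArr G (elem_map C P X x))"
      proof (rule wcoconeI)
        show "FObj G P \<in> Obj D" using G'(1) P by simp
        show "FArr G (elem_map C P X x) \<in> hom D (FObj ?F X) (FObj G P)" if "X \<in> Obj C" "x \<in> FObj P X"
            for X x
          using G'(2)[OF elem_map_PM[OF P that]] Fo[OF that(1)] by simp
        show "FArr G (elem_map C P W (act P f x)) = FArr G (elem_map C P X x) \<circ>\<^bsub>D\<^esub> FArr ?F f"
          if f: "f \<in> hom C W X" and x: "x \<in> FObj P X" for W X f x
          using G'(4)[OF yo_PM[OF f] elem_map_PM[OF P cod_obj[OF f] x]] elem_map_yo[OF psh x f] Fa[OF f]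
              by simp
      qed
    qed simp
  qed
  show ?thesis
    unfolding extends_def
  proof (intro conjI allI impI ballI)
    fix P Q \<mu> X x assume \<mu>: "\<mu> \<in> hom (PM U C) P Q" and X: "X \<in> Obj C" "x \<in> FObj P X"
    then have P: "small_presheaf U C P" by (simp add: hom_PM_iff)
    show "FArr G \<mu> \<circ>\<^bsub>D\<^esub> FArr G (elem_map C P X x) = FArr G (elem_map C Q X (app \<mu> X x))"
      using G'(4)[OF elem_map_PM[OF P X] \<mu>] comp_elem_map[OF PM_Psh[OF \<mu>] X] by simp
  qed (use F G wc in auto)
qed

end

section \<open>The equivalence\<close>

lemma (in Category) id_functor_is_functor: "is_functor C C (id_functor C)"
proof (rule is_functorI)
  show "FArr (id_functor C) f \<in> hom C (FObj (id_functor C) X) (FObj (id_functor C) Y)"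
    if "f \<in> hom C X Y" for f X Y
    using that dom_obj[OF that] cod_obj[OF that] hom_arr[OF that] by (simp add: id_functor_def)
  show "FArr (id_functor C) (g \<circ>\<^bsub>C\<^esub> f) = FArr (id_functor C) g \<circ>\<^bsub>C\<^esub> FArr (id_functor C) f"
    if "f \<in> hom C X Y" "g \<in> hom C Y Z" for f g X Y Z
    using that[THEN hom_arr] hom_arr[OF comp_hom[OF that]] by (simp add: id_functor_def)
  show "FArr (id_functor C) (Ident C X) = Ident C (FObj (id_functor C) X)" if "X \<in> Obj C" for X
    using that hom_arr[OF id_hom[OF that]] by (simp add: id_functor_def)
qed (simp_all add: id_functor_def)

text \<open>A section on objects extends to a functor that is strictly inverse on one side; on the other
  side the unit is obtained by lifting identities.\<close>

lemma equivalence_of_fully_faithful_surjective: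
  assumes A: "category A" and B: "category B" and R: "is_functor A B R"
    and surj: "\<And>b. b \<in> Obj B \<Longrightarrow> \<exists>a\<in>Obj A. FObj R a = b"
    and ff: "\<And>a a' g. a \<in> Obj A \<Longrightarrow> a' \<in> Obj A \<Longrightarrow> g \<in> hom B (FObj R a) (FObj R a') \<Longrightarrow>
      \<exists>!f. f \<in> hom A a a' \<and> FArr R f = g"
  shows "equivalence A B R"
proof -
  interpret A: Category A using A by unfold_locales
  interpret B: Category B using B by unfold_locales
  note R' = is_functorD[OF R]
  obtain s where s: "\<And>b. b \<in> Obj B \<Longrightarrow> s b \<in> Obj A" "\<And>b. b \<in> Obj B \<Longrightarrow> FObj R (s b) = b"
    using surj by metis
  have faithful: "f = f'" if "f \<in> hom A a a'" "f' \<in> hom A a a'" "FArr R f = FArr R f'" for f f' a a'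
    using ff[OF A.dom_obj[OF that(1)] A.cod_obj[OF that(1)] R'(2)[OF that(2)]] that by metis
  have full: "\<exists>f. f \<in> hom A a a' \<and> FArr R f = g"
    if "a \<in> Obj A" "a' \<in> Obj A" "g \<in> hom B (FObj R a) (FObj R a')" for a a' g
    using ex1_implies_ex[OF ff[OF that]] .
  define Ga where "Ga g = (SOME f. f \<in> hom A (s (Dom B g)) (s (Cod B g)) \<and> FArr R f = g)" for g
  have Ga: "Ga g \<in> hom A (s b) (s b') \<and> FArr R (Ga g) = g" if g: "g \<in> hom B b b'" for g b b'
  proof -
    have b: "b \<in> Obj B" "b' \<in> Obj B" using B.dom_obj[OF g] B.cod_obj[OF g] .
    have "\<exists>f. f \<in> hom A (s b) (s b') \<and> FArr R f = g"
      using full[OF s(1)[OF b(1)] s(1)[OF b(2)]] s(2)[OF b(1)] s(2)[OF b(2)] g by simp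
    from someI_ex[OF this] show ?thesis
      unfolding Ga_def hom_dom[OF g] hom_cod[OF g] .
  qed
  define G where "G = \<lparr>FObj = (\<lambda>b\<in>Obj B. s b), FArr = (\<lambda>g\<in>Arr B. Ga g)\<rparr>"
  have Go: "FObj G b = s b" if "b \<in> Obj B" for b using that by (simp add: G_def)
  have Gm: "FArr G g = Ga g" if "g \<in> hom B b b'" for g b b' using hom_arr[OF that] by (simp add: G_def)
  have G: "is_functor B A G"
  proof (rule is_functorI)
    show "FObj G \<in> extensional (Obj B)" "FArr G \<in> extensional (Arr B)" by (simp_all add: G_def)
    show "FObj G b \<in> Obj A" if "b \<in> Obj B" for b using that s Go by simp
    show "FArr G g \<in> hom A (FObj G b) (FObj G b')" if "g \<in> hom B b b'" for g b b'
      using Ga[OF that] Gm[OF that] Go[OF B.dom_obj[OF that]] Go[OF B.cod_obj[OF that]] by simp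
    show "FArr G (Ident B b) = Ident A (FObj G b)" if b: "b \<in> Obj B" for b
    proof -
      note i = B.id_hom[OF b]
      have "Ga (Ident B b) = Ident A (s b)"
        by (rule faithful[OF conjunct1[OF Ga[OF i]] A.id_hom[OF s(1)[OF b]]])
          (use Ga[OF i] R'(3)[OF s(1)[OF b]] s(2)[OF b] in simp)
      then show ?thesis using Gm[OF i] Go[OF b] by simp
    qed
    show "FArr G (h \<circ>\<^bsub>B\<^esub> g) = FArr G h \<circ>\<^bsub>A\<^esub> FArr G g" if g: "g \<in> hom B b b'" and h: "h \<in> hom B b' b''"
        for g h b b' b''
    proof -
      note hg = B.comp_hom[OF g h]
      note Gg = Ga[OF g] and Gh = Ga[OF h]
      have "Ga (h \<circ>\<^bsub>B\<^esub> g) = Ga h \<circ>\<^bsub>A\<^esub> Ga g"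
        by (rule faithful[OF conjunct1[OF Ga[OF hg]] A.comp_hom[OF conjunct1[OF Gg] conjunct1[OF Gh]]])
          (use Ga[OF hg] R'(4)[OF conjunct1[OF Gg] conjunct1[OF Gh]] Gg Gh in simp)
      then show ?thesis using Gm[OF g] Gm[OF h] Gm[OF hg] by simp
    qed
  qed
  note RG = comp_functor_is_functor[OF B G R] and GR = comp_functor_is_functor[OF A R G]
  have idA: "is_functor A A (id_functor A)" and idB: "is_functor B B (id_functor B)"
    using A.id_functor_is_functor B.id_functor_is_functor .
  have "comp_functor B R G = id_functor B"
  proof (rule fctr_eqI[OF RG idB])
    show "FObj (comp_functor B R G) b = FObj (id_functor B) b" if "b \<in> Obj B" for b
      using that Go s(2) by (simp add: comp_functor_def id_functor_def)
    show "FArr (comp_functor B R G) g = FArr (id_functor B) g" if "g \<in> Arr B" for g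
      using that Gm[OF arr_hom[OF that]] Ga[OF arr_hom[OF that]]
          by (simp add: comp_functor_def id_functor_def)
  qed
  moreover have "isomorphic (functor_cat B B) (id_functor B) (id_functor B)"
  proof -
    interpret BB: Category "functor_cat B B" using category_functor_cat[OF B B] by unfold_locales
    have "id_functor B \<in> Obj (functor_cat B B)" using idB by simp
    from BB.id_hom[OF this] BB.id_iso[OF this] show ?thesis unfolding isomorphic_def by blast
  qed
  moreover have "isomorphic (functor_cat A A) (id_functor A) (comp_functor A G R)"
  proof -
    interpret AA: Category "functor_cat A A" using category_functor_cat[OF A A] by unfold_locales
    have Ro: "FObj R a \<in> Obj B" if "a \<in> Obj A" for a using R'(1)[OF that] .
    have "\<exists>f. f \<in> hom A a (s (FObj R a)) \<and> FArr R f = Ident B (FObj R a)" if "a \<in> Obj A" for a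
      using full[OF that s(1)[OF Ro[OF that]]] s(2)[OF Ro[OF that]] B.id_hom[OF Ro[OF that]] by simp
    then obtain \<eta> where \<eta>: "\<And>a. a \<in> Obj A \<Longrightarrow> \<eta> a \<in> hom A a (s (FObj R a))"
      and R\<eta>: "\<And>a. a \<in> Obj A \<Longrightarrow> FArr R (\<eta> a) = Ident B (FObj R a)" by metis
    have "\<exists>f. f \<in> hom A (s (FObj R a)) a \<and> FArr R f = Ident B (FObj R a)" if "a \<in> Obj A" for a
      using full[OF s(1)[OF Ro[OF that]] that] s(2)[OF Ro[OF that]] B.id_hom[OF Ro[OF that]] by simp
    then obtain \<epsilon> where \<epsilon>: "\<And>a. a \<in> Obj A \<Longrightarrow> \<epsilon> a \<in> hom A (s (FObj R a)) a"
      and R\<epsilon>: "\<And>a. a \<in> Obj A \<Longrightarrow> FArr R (\<epsilon> a) = Ident B (FObj R a)" by metis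
    have GRo: "FObj (comp_functor A G R) a = s (FObj R a)" "FObj (id_functor A) a = a" if "a \<in> Obj A" for a
      using that Go[OF Ro[OF that]] by (simp_all add: comp_functor_def id_functor_def)
    have GRa: "FArr (comp_functor A G R) f = Ga (FArr R f)" "FArr (id_functor A) f = f"
        if "f \<in> hom A a a'" for f a a'
      using hom_arr[OF that] Gm[OF R'(2)[OF that]] by (simp_all add: comp_functor_def id_functor_def)
    have \<eta>nat: "\<eta> a' \<circ>\<^bsub>A\<^esub> f = Ga (FArr R f) \<circ>\<^bsub>A\<^esub> \<eta> a" and \<epsilon>nat: "\<epsilon> a' \<circ>\<^bsub>A\<^esub> Ga (FArr R f) = f \<circ>\<^bsub>A\<^esub> \<epsilon> a"
      if f: "f \<in> hom A a a'" for f a a'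
    proof -
      have a: "a \<in> Obj A" "a' \<in> Obj A" using A.dom_obj[OF f] A.cod_obj[OF f] .
      note Rf = R'(2)[OF f]
      note Gf = Ga[OF Rf]
      show "\<eta> a' \<circ>\<^bsub>A\<^esub> f = Ga (FArr R f) \<circ>\<^bsub>A\<^esub> \<eta> a"
        by (rule faithful[OF A.comp_hom[OF f \<eta>[OF a(2)]] A.comp_hom[OF \<eta>[OF a(1)] conjunct1[OF Gf]]])
          (use R'(4)[OF f \<eta>[OF a(2)]] R'(4)[OF \<eta>[OF a(1)] conjunct1[OF Gf]] R\<eta>[OF a(1)] R\<eta>[OF a(2)] Gf
            B.comp_id_left[OF Rf] B.comp_id_right[OF Rf] in simp)
      show "\<epsilon> a' \<circ>\<^bsub>A\<^esub> Ga (FArr R f) = f \<circ>\<^bsub>A\<^esub> \<epsilon> a"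
        by (rule faithful[OF A.comp_hom[OF conjunct1[OF Gf] \<epsilon>[OF a(2)]] A.comp_hom[OF \<epsilon>[OF a(1)] f]])
          (use R'(4)[OF \<epsilon>[OF a(1)] f] R'(4)[OF conjunct1[OF Gf] \<epsilon>[OF a(2)]] R\<epsilon>[OF a(1)] R\<epsilon>[OF a(2)] Gf
            B.comp_id_left[OF Rf] B.comp_id_right[OF Rf] in simp)
    qed
    have \<epsilon>\<eta>: "\<epsilon> a \<circ>\<^bsub>A\<^esub> \<eta> a = Ident A a" and \<eta>\<epsilon>: "\<eta> a \<circ>\<^bsub>A\<^esub> \<epsilon> a = Ident A (s (FObj R a))"
        if a: "a \<in> Obj A" for a
    proof -
      have sa: "s (FObj R a) \<in> Obj A" using s(1)[OF Ro[OF a]] .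
      note iB = B.comp_id_left[OF B.id_hom[OF Ro[OF a]]]
      show "\<epsilon> a \<circ>\<^bsub>A\<^esub> \<eta> a = Ident A a"
        by (rule faithful[OF A.comp_hom[OF \<eta>[OF a] \<epsilon>[OF a]] A.id_hom[OF a]])
          (use R'(4)[OF \<eta>[OF a] \<epsilon>[OF a]] R\<eta>[OF a] R\<epsilon>[OF a] iB R'(3)[OF a] in simp)
      show "\<eta> a \<circ>\<^bsub>A\<^esub> \<epsilon> a = Ident A (s (FObj R a))"
        by (rule faithful[OF A.comp_hom[OF \<epsilon>[OF a] \<eta>[OF a]] A.id_hom[OF sa]])
          (use R'(4)[OF \<epsilon>[OF a] \<eta>[OF a]] R\<eta>[OF a] R\<epsilon>[OF a] iB R'(3)[OF sa] s(2)[OF Ro[OF a]] in simp)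
    qed
    let ?\<eta> = "Tagged (id_functor A) (\<lambda>a\<in>Obj A. \<eta> a) (comp_functor A G R)"
    let ?\<epsilon> = "Tagged (comp_functor A G R) (\<lambda>a\<in>Obj A. \<epsilon> a) (id_functor A)"
    have "is_nat_trans A A ?\<eta>"
      by (rule nat_transI[OF idA GR])
        (use \<eta> GRo \<eta>nat GRa A.dom_obj A.cod_obj in \<open>simp_all\<close>)
    then have \<eta>h: "?\<eta> \<in> hom (functor_cat A A) (id_functor A) (comp_functor A G R)" by (simp add: hom_iff)
    have "is_nat_trans A A ?\<epsilon>"
      by (rule nat_transI[OF GR idA])
        (use \<epsilon> GRo \<epsilon>nat GRa A.dom_obj A.cod_obj in \<open>simp_all\<close>)
    then have \<epsilon>h: "?\<epsilon> \<in> hom (functor_cat A A) (comp_functor A G R) (id_functor A)" by (simp add: hom_iff)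
    have "iso (functor_cat A A) ?\<eta>"
      by (rule AA.isoI[OF \<eta>h \<epsilon>h]) (use \<epsilon>\<eta> \<eta>\<epsilon> GRo in \<open>auto intro!: restrict_ext\<close>)
    with \<eta>h show ?thesis unfolding isomorphic_def by blast
  qed
  ultimately show ?thesis
    unfolding equivalence_def using A B R G by metis
qed

lemma mcartesian_id:
  assumes A: "category A" "Mon A \<subseteq> Arr A" and B: "category B" and F: "is_mfunctor A B F"
  shows "mcartesian A B (Ident (functor_cat A B) F)"
proof -
  interpret A: Category A using A(1) by unfold_locales
  interpret B: Category B using B by unfold_locales
  interpret AB: Category "functor_cat A B" using category_functor_cat[OF A(1) B] by unfold_locales
  note F' = is_functorD[OF is_mfunctorD(1)[OF F]]
  have "Ident (functor_cat A B) F \<in> Arr (functor_cat A B)"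
    using hom_arr[OF AB.id_hom] is_mfunctorD(1)[OF F] by simp
  moreover have "pullback B (FArr F m) (Ident B (FObj F (Dom A m))) (Ident B (FObj F (Cod A m))) (FArr F m)"
    if "m \<in> Mon A" for m
  proof -
    have "m \<in> hom A (Dom A m) (Cod A m)" using that A(2) by (intro arr_hom) blast
    note Fm = F'(2)[OF this]
    note d = B.dom_obj[OF Fm] and c = B.cod_obj[OF Fm]
    show ?thesis
      using B.pullback_of_isos[OF Fm B.id_hom[OF d] B.id_hom[OF c] Fm _ B.id_iso[OF d] B.id_iso[OF c]]
        B.comp_id_left[OF Fm] B.comp_id_right[OF Fm] by simp
  qed
  moreover have "Dom A m \<in> Obj A" "Cod A m \<in> Obj A" if "m \<in> Mon A" for m
    using A.dom_obj[OF arr_hom[OF subsetD[OF A(2) that]]] A.cod_obj[OF arr_hom[OF subsetD[OF A(2) that]]] .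
  ultimately show ?thesis unfolding mcartesian_def by simp
qed

lemma mcartesian_comp:
  assumes A: "category A" "Mon A \<subseteq> Arr A" and B: "category B"
    and \<alpha>: "mcartesian A B \<alpha>" and \<beta>: "mcartesian A B \<beta>" and eq: "tgt \<alpha> = src \<beta>"
  shows "mcartesian A B (\<beta> \<circ>\<^bsub>functor_cat A B\<^esub> \<alpha>)"
proof -
  interpret A: Category A using A(1) by unfold_locales
  interpret B: Category B using B by unfold_locales
  interpret AB: Category "functor_cat A B" using category_functor_cat[OF A(1) B] by unfold_locales
  have "\<beta> \<circ>\<^bsub>functor_cat A B\<^esub> \<alpha> \<in> Arr (functor_cat A B)"
    by (rule AB.comp_arr) (use \<alpha> \<beta> eq in \<open>simp_all add: mcartesian_def\<close>)
  moreover have "pullback B (FArr (src \<alpha>) m) (body \<beta> (Dom A m) \<circ>\<^bsub>B\<^esub> body \<alpha> (Dom A m))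
      (body \<beta> (Cod A m) \<circ>\<^bsub>B\<^esub> body \<alpha> (Cod A m)) (FArr (tgt \<beta>) m)" if "m \<in> Mon A" for m
    using B.pullback_paste[of "FArr (src \<beta>) m" "body \<beta> (Dom A m)" "body \<beta> (Cod A m)" "FArr (tgt \<beta>) m"
        "FArr (src \<alpha>) m" "body \<alpha> (Dom A m)" "body \<alpha> (Cod A m)"] \<alpha> \<beta> eq that
    unfolding mcartesian_def by simp
  moreover have "Dom A m \<in> Obj A" "Cod A m \<in> Obj A" if "m \<in> Mon A" for m
    using A.dom_obj[OF arr_hom[OF subsetD[OF A(2) that]]] A.cod_obj[OF arr_hom[OF subsetD[OF A(2) that]]] .
  ultimately show ?thesis unfolding mcartesian_def by simp
qed

lemma category_MCAT_hom:
  assumes A: "category A" "Mon A \<subseteq> Arr A" and B: "category B"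
  shows "category (MCAT_hom A B)"
  unfolding MCAT_hom_def
proof (rule category_subcategory[OF category_functor_cat[OF A(1) B]])
  show "F \<in> Obj (functor_cat A B) \<and> Ident (functor_cat A B) F \<in>
      {\<alpha>. mcartesian A B \<alpha> \<and> is_mfunctor A B (src \<alpha>) \<and> is_mfunctor A B (tgt \<alpha>)}"
    if "F \<in> {F. is_mfunctor A B F}" for F
    using that mcartesian_id[OF A B, of F] is_mfunctorD(1)[of A B F] by simp
  show "g \<circ>\<^bsub>functor_cat A B\<^esub> f \<in> {\<alpha>. mcartesian A B \<alpha> \<and> is_mfunctor A B (src \<alpha>) \<and> is_mfunctor A B (tgt \<alpha>)}"
    if "f \<in> {\<alpha>. mcartesian A B \<alpha> \<and> is_mfunctor A B (src \<alpha>) \<and> is_mfunctor A B (tgt \<alpha>)}"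
      "g \<in> {\<alpha>. mcartesian A B \<alpha> \<and> is_mfunctor A B (src \<alpha>) \<and> is_mfunctor A B (tgt \<alpha>)}"
      "f \<in> hom (functor_cat A B) X Y" "g \<in> hom (functor_cat A B) Y Z" for X Y Z f g
    using that mcartesian_comp[OF A B, of f g] by (simp add: hom_iff)
qed (simp add: mcartesian_def)

lemma category_MCocomp_hom:
  assumes A: "category A" "Mon A \<subseteq> Arr A" and B: "category B"
  shows "category (MCocomp_hom U A B)"
  unfolding MCocomp_hom_def
proof (rule category_subcategory[OF category_functor_cat[OF A(1) B]])
  show "F \<in> Obj (functor_cat A B) \<and> Ident (functor_cat A B) F \<in>
      {\<alpha>. mcartesian A B \<alpha> \<and> is_cocont_mfunctor U A B (src \<alpha>) \<and> is_cocont_mfunctor U A B (tgt \<alpha>)}"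
    if "F \<in> {F. is_cocont_mfunctor U A B F}" for F
    using that mcartesian_id[OF A B, of F] is_cocont_mfunctorD[of U A B F] by simp
  show "g \<circ>\<^bsub>functor_cat A B\<^esub> f \<in>
      {\<alpha>. mcartesian A B \<alpha> \<and> is_cocont_mfunctor U A B (src \<alpha>) \<and> is_cocont_mfunctor U A B (tgt \<alpha>)}"
    if "f \<in> {\<alpha>. mcartesian A B \<alpha> \<and> is_cocont_mfunctor U A B (src \<alpha>) \<and> is_cocont_mfunctor U A B (tgt \<alpha>)}"
      "g \<in> {\<alpha>. mcartesian A B \<alpha> \<and> is_cocont_mfunctor U A B (src \<alpha>) \<and> is_cocont_mfunctor U A B (tgt \<alpha>)}"
      "f \<in> hom (functor_cat A B) X Y" "g \<in> hom (functor_cat A B) Y Z" for X Y Z f g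
    using that mcartesian_comp[OF A B, of f g] by (simp add: hom_iff)
qed (simp add: mcartesian_def)

lemma MCAT_hom_sel [simp]:
  "Obj (MCAT_hom A B) = {F. is_mfunctor A B F}"
  "Arr (MCAT_hom A B) = {\<alpha>. mcartesian A B \<alpha> \<and> is_mfunctor A B (src \<alpha>) \<and> is_mfunctor A B (tgt \<alpha>)}"
  "Dom (MCAT_hom A B) = src" "Cod (MCAT_hom A B) = tgt"
  "Ident (MCAT_hom A B) = Ident (functor_cat A B)" "Comp (MCAT_hom A B) = Comp (functor_cat A B)"
  by (simp_all add: MCAT_hom_def)

lemma MCocomp_hom_sel [simp]:
  "Obj (MCocomp_hom U A B) = {F. is_cocont_mfunctor U A B F}"
  "Arr (MCocomp_hom U A B) =
    {\<alpha>. mcartesian A B \<alpha> \<and> is_cocont_mfunctor U A B (src \<alpha>) \<and> is_cocont_mfunctor U A B (tgt \<alpha>)}"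
  "Dom (MCocomp_hom U A B) = src" "Cod (MCocomp_hom U A B) = tgt"
  "Ident (MCocomp_hom U A B) = Ident (functor_cat A B)" "Comp (MCocomp_hom U A B) = Comp (functor_cat A B)"
  by (simp_all add: MCocomp_hom_def)

context Extension
begin

abbreviation restr where
  "restr \<equiv> precomposition C yo (MCocomp_hom U (PM U C) D)"

lemma mon_PM_arr: "Mon (PM U C) \<subseteq> Arr (PM U C)"
  using hom_arr[OF presheaf_monics_hom] by auto

lemma mfunctor_comp_yo:
  assumes G: "is_mfunctor (PM U C) D G"
  shows "is_mfunctor C D (comp_functor C G yo)"
  unfolding is_mfunctor_def
proof (intro conjI ballI allI impI)
  show "is_functor C D (comp_functor C G yo)"
    using comp_functor_is_functor[OF category yo_functor_PM is_mfunctorD(1)[OF G]] .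
  show "FArr (comp_functor C G yo) m \<in> Mon D" if "m \<in> Mon C" for m
    using is_mfunctorD(2)[OF G, of "FArr yo m"] yo_mon[OF that] mon_arr[OF that]
        by (simp add: comp_functor_def)
  fix p q f m assume m: "m \<in> Mon C" and pb: "pullback C p q f m"
  have "FArr yo m \<in> Mon (PM U C)" using yo_mon[OF m] by simp
  from is_mfunctorD(3)[OF G this yo_pullback[OF pb]]
  show "pullback D (FArr (comp_functor C G yo) p) (FArr (comp_functor C G yo) q)
      (FArr (comp_functor C G yo) f) (FArr (comp_functor C G yo) m)"
    using pullbackD(1-4)[OF pb, THEN hom_arr] by (simp add: comp_functor_def)
qed

lemma cocont_comp_yo: "is_cocont_mfunctor U (PM U C) D G \<Longrightarrow> is_mfunctor C D (comp_functor C G yo)"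
  using mfunctor_comp_yo is_cocont_mfunctorD(1) by blast

lemma restr_obj: "is_cocont_mfunctor U (PM U C) D G \<Longrightarrow> FObj restr G = comp_functor C G yo"
  by (simp add: precomposition_def)

lemma restr_arr:
  assumes "\<alpha> \<in> Arr (MCocomp_hom U (PM U C) D)"
  shows "FArr restr \<alpha> = Tagged (comp_functor C (src \<alpha>) yo) (\<lambda>X\<in>Obj C. body \<alpha> (rep X))
      (comp_functor C (tgt \<alpha>) yo)"
  using assms by (auto simp: precomposition_def yo_obj intro!: restrict_ext)

lemma restr_mcartesian:
  assumes "\<alpha> \<in> Arr (MCocomp_hom U (PM U C) D)"
  shows "mcartesian C D (FArr restr \<alpha>)"
proof -
  have \<alpha>: "mcartesian (PM U C) D \<alpha>" "is_cocont_mfunctor U (PM U C) D (src \<alpha>)"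
      "is_cocont_mfunctor U (PM U C) D (tgt \<alpha>)"
    using assms by simp_all
  then have nt: "is_nat_trans (PM U C) D \<alpha>" unfolding mcartesian_def by blast
  note nat = nat_transD[OF nt]
  have src: "is_functor C D (comp_functor C (src \<alpha>) yo)"
      and tgt: "is_functor C D (comp_functor C (tgt \<alpha>) yo)"
    using is_mfunctorD(1)[OF cocont_comp_yo] \<alpha>(2,3) by blast+
  have "is_nat_trans C D (FArr restr \<alpha>)"
    unfolding restr_arr[OF assms]
  proof (rule nat_transI[OF src tgt])
    show "(\<lambda>X\<in>Obj C. body \<alpha> (rep X)) X \<in> hom D (FObj (comp_functor C (src \<alpha>) yo) X) (FObj
        (comp_functor C (tgt \<alpha>) yo) X)"
      if "X \<in> Obj C" for X
      using that nat(3)[of "rep X"] small_presheaf_rep[OF that] by (simp add: comp_functor_def yo_obj)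
    show "(\<lambda>X\<in>Obj C. body \<alpha> (rep X)) Y \<circ>\<^bsub>D\<^esub> FArr (comp_functor C (src \<alpha>) yo) f =
        FArr (comp_functor C (tgt \<alpha>) yo) f \<circ>\<^bsub>D\<^esub> (\<lambda>X\<in>Obj C. body \<alpha> (rep X)) X" if f: "f \<in> hom C X Y" for X Y f
      using nat(4)[OF yo_PM[OF f]] dom_obj[OF f] cod_obj[OF f] hom_arr[OF f] by (simp add: comp_functor_def)
  qed simp
  moreover have "pullback D (FArr (comp_functor C (src \<alpha>) yo) m) (body \<alpha> (rep (Dom C m)))
      (body \<alpha> (rep (Cod C m))) (FArr (comp_functor C (tgt \<alpha>) yo) m)" if m: "m \<in> Mon C" for m
  proof -
    have "FArr yo m \<in> Mon (PM U C)" using yo_mon[OF m] by simp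
    then have "pullback D (FArr (src \<alpha>) (FArr yo m)) (body \<alpha> (src (FArr yo m))) (body \<alpha> (tgt (FArr yo m)))
        (FArr (tgt \<alpha>) (FArr yo m))"
      using \<alpha>(1) unfolding mcartesian_def by (metis PM_sel(2,3))
    moreover have "src (FArr yo m) = rep (Dom C m)" "tgt (FArr yo m) = rep (Cod C m)"
      using hom_dom[OF yo_PM[OF mon_hom[OF m]]] hom_cod[OF yo_PM[OF mon_hom[OF m]]] by simp_all
    ultimately show ?thesis using mon_arr[OF m] by (simp add: comp_functor_def)
  qed
  moreover have "Dom C m \<in> Obj C" "Cod C m \<in> Obj C" if "m \<in> Mon C" for m
    using dom_obj[OF mon_hom[OF that]] cod_obj[OF mon_hom[OF that]] .
  ultimately show ?thesis
    unfolding mcartesian_def by (simp add: restr_arr[OF assms])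
qed

lemma restr_functor: "is_functor (MCocomp_hom U (PM U C) D) (MCAT_hom C D) restr"
proof (rule is_functorI)
  let ?A = "MCocomp_hom U (PM U C) D"
  show "FObj restr \<in> extensional (Obj ?A)" "FArr restr \<in> extensional (Arr ?A)"
    by (simp_all add: precomposition_def)
  show "FObj restr G \<in> Obj (MCAT_hom C D)" if "G \<in> Obj ?A" for G
    using that restr_obj[of G] cocont_comp_yo[of G] by simp
  show "FArr restr \<alpha> \<in> hom (MCAT_hom C D) (FObj restr G) (FObj restr H)" if "\<alpha> \<in> hom ?A G H" for \<alpha> G H
  proof -
    have "\<alpha> \<in> Arr ?A" "src \<alpha> = G" "tgt \<alpha> = H" using that by (auto simp: hom_iff)
    moreover from this have "is_cocont_mfunctor U (PM U C) D G" "is_cocont_mfunctor U (PM U C) D H" by auto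
    ultimately show ?thesis
      using restr_mcartesian[of \<alpha>] cocont_comp_yo[of G] cocont_comp_yo[of H] restr_arr[of \<alpha>]
        restr_obj[of G] restr_obj[of H] by (simp add: hom_iff)
  qed
  show "FArr restr (Ident ?A G) = Ident (MCAT_hom C D) (FObj restr G)" if G: "G \<in> Obj ?A" for G
  proof -
    have cG: "is_cocont_mfunctor U (PM U C) D G" using G by simp
    have "Ident ?A G \<in> Arr ?A"
      using hom_arr[OF Category.id_hom[OF Category.intro[OF
          category_MCocomp_hom[OF category_PM mon_PM_arr D.category]] G]] .
    from restr_arr[OF this] show ?thesis
      using small_presheaf_rep restr_obj[OF cG] by (auto simp: comp_functor_def yo_obj intro!: restrict_ext)
  qed
  show "FArr restr (\<beta> \<circ>\<^bsub>?A\<^esub> \<alpha>) = FArr restr \<beta> \<circ>\<^bsub>MCAT_hom C D\<^esub> FArr restr \<alpha>"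
    if \<alpha>: "\<alpha> \<in> hom ?A G H" and \<beta>: "\<beta> \<in> hom ?A H K" for \<alpha> \<beta> G H K
  proof -
    have "\<beta> \<circ>\<^bsub>?A\<^esub> \<alpha> \<in> Arr ?A"
      using hom_arr[OF Category.comp_hom[OF Category.intro[OF
          category_MCocomp_hom[OF category_PM mon_PM_arr D.category]] \<alpha> \<beta>]] .
    from restr_arr[OF this] restr_arr[OF hom_arr[OF \<alpha>]] restr_arr[OF hom_arr[OF \<beta>]] show ?thesis
      using small_presheaf_rep by (auto intro!: restrict_ext)
  qed
qed

text \<open>Both functors extend their restrictions, so that the component at \<open>P\<close> is forced by the
  components at representables: composed with the coprojection of an element \<open>x\<close>, it is the
  component at \<open>X\<close> followed by the coprojection of \<open>x\<close>.\<close>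

lemma restr_fully_faithful:
  assumes G: "is_cocont_mfunctor U (PM U C) D G" and H: "is_cocont_mfunctor U (PM U C) D H"
    and \<beta>: "\<beta> \<in> hom (MCAT_hom C D) (FObj restr G) (FObj restr H)"
  shows "\<exists>!\<alpha>. \<alpha> \<in> hom (MCocomp_hom U (PM U C) D) G H \<and> FArr restr \<alpha> = \<beta>"
proof -
  let ?A = "MCocomp_hom U (PM U C) D"
  let ?g = "\<lambda>P X x. FArr G (elem_map C P X x)" and ?h = "\<lambda>P X x. FArr H (elem_map C P X x)"
  have \<beta>c: "mcartesian C D \<beta>" "src \<beta> = comp_functor C G yo" "tgt \<beta> = comp_functor C H yo"
    using \<beta> restr_obj[OF G] restr_obj[OF H] by (auto simp: hom_iff)
  note Gf = is_cocont_mfunctorD[OF G] and Hf = is_cocont_mfunctorD[OF H]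
  note extG = cocontinuous_extends[OF Gf(2,3)] and extH = cocontinuous_extends[OF Hf(2,3)]
  note eG = extendsD[OF extG] and eH = extendsD[OF extH]
  note G' = is_functorD[OF Gf(2)] and H' = is_functorD[OF Hf(2)]
  have \<beta>nt: "is_nat_trans C D \<beta>" using \<beta>c(1) unfolding mcartesian_def by blast
  note \<beta>n = nat_transD[OF \<beta>nt, unfolded \<beta>c(2,3)]
  have \<beta>X: "body \<beta> X \<in> hom D (FObj G (rep X)) (FObj H (rep X))" if "X \<in> Obj C" for X
    using \<beta>n(3)[OF that] that by (simp add: comp_functor_def yo_obj)
  have h\<beta>: "wcocone (comp_functor C G yo) P (FObj H P) (\<lambda>X x. ?h P X x \<circ>\<^bsub>D\<^esub> body \<beta> X)"
    if P: "small_presheaf U C P" for P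
  proof (rule wcoconeI)
    note hw = wcoconeD[OF wcolim_wcocone[OF eH(3)[OF P]]]
    show "FObj H P \<in> Obj D" using hw(1) .
    show "?h P X x \<circ>\<^bsub>D\<^esub> body \<beta> X \<in> hom D (FObj (comp_functor C G yo) X) (FObj H P)"
      if "X \<in> Obj C" "x \<in> FObj P X" for X x
      using D.comp_hom[OF \<beta>n(3)[OF that(1)] hw(2)[OF that]] .
    show "?h P W (act P f x) \<circ>\<^bsub>D\<^esub> body \<beta> W = (?h P X x \<circ>\<^bsub>D\<^esub> body \<beta> X) \<circ>\<^bsub>D\<^esub> FArr (comp_functor C G yo) f"
      if f: "f \<in> hom C W X" and x: "x \<in> FObj P X" for W X f x
      using hw(3)[OF f x] \<beta>n(4)[OF f] hw(2)[OF cod_obj[OF f] x]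
        D.comp_assoc[OF is_functorD(2)[OF eG(1) f] \<beta>n(3)[OF cod_obj[OF f]] hw(2)[OF cod_obj[OF f] x]]
        D.comp_assoc[OF \<beta>n(3)[OF dom_obj[OF f]] is_functorD(2)[OF eH(1) f] hw(2)[OF cod_obj[OF f] x]]
            by simp
  qed
  have "\<exists>a. a \<in> hom D (FObj G P) (FObj H P) \<and>
      (\<forall>X\<in>Obj C. \<forall>x\<in>FObj P X. a \<circ>\<^bsub>D\<^esub> ?g P X x = ?h P X x \<circ>\<^bsub>D\<^esub> body \<beta> X)" if P: "small_presheaf U C P" for P
    using wcolim_map_ex[OF eG(3)[OF P] h\<beta>[OF P]] by metis
  then obtain a where a: "\<And>P. small_presheaf U C P \<Longrightarrow> a P \<in> hom D (FObj G P) (FObj H P)"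
    and ag: "\<And>P X x. small_presheaf U C P \<Longrightarrow> X \<in> Obj C \<Longrightarrow> x \<in> FObj P X \<Longrightarrow>
      a P \<circ>\<^bsub>D\<^esub> ?g P X x = ?h P X x \<circ>\<^bsub>D\<^esub> body \<beta> X"
    by metis
  let ?\<alpha> = "Tagged G (\<lambda>P\<in>Obj (PM U C). a P) H"
  have nt: "is_nat_trans (PM U C) D ?\<alpha>"
  proof (rule nat_transI[OF Gf(2) Hf(2)])
    show "(\<lambda>P\<in>Obj (PM U C). a P) P \<in> hom D (FObj G P) (FObj H P)" if "P \<in> Obj (PM U C)" for P
      using that a by simp
    show "(\<lambda>P\<in>Obj (PM U C). a P) Q \<circ>\<^bsub>D\<^esub> FArr G \<mu> = FArr H \<mu> \<circ>\<^bsub>D\<^esub> (\<lambda>P\<in>Obj (PM U C). a P) P"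
      if \<mu>: "\<mu> \<in> hom (PM U C) P Q" for P Q \<mu>
    proof -
      have P: "small_presheaf U C P" and Q: "small_presheaf U C Q" using \<mu> by (auto simp: hom_PM_iff)
      have "a Q \<circ>\<^bsub>D\<^esub> FArr G \<mu> = FArr H \<mu> \<circ>\<^bsub>D\<^esub> a P"
      proof (rule wcolim_map_unique[OF eG(1) eG(3)[OF P] D.comp_hom[OF G'(2)[OF \<mu>] a[OF Q]]
          D.comp_hom[OF a[OF P] H'(2)[OF \<mu>]]])
        fix X x assume Xx: "X \<in> Obj C" "x \<in> FObj P X"
        note \<mu>x = app_in[OF PM_Psh[OF \<mu>] Xx]
        show "(a Q \<circ>\<^bsub>D\<^esub> FArr G \<mu>) \<circ>\<^bsub>D\<^esub> ?g P X x = (FArr H \<mu> \<circ>\<^bsub>D\<^esub> a P) \<circ>\<^bsub>D\<^esub> ?g P X x"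
          using D.comp_assoc[OF eG(5)[OF P Xx] G'(2)[OF \<mu>] a[OF Q]] D.comp_assoc[OF eG(5)[OF P Xx]
              a[OF P] H'(2)[OF \<mu>]]
            D.comp_assoc[OF \<beta>n(3)[OF Xx(1)] eH(5)[OF P Xx] H'(2)[OF \<mu>]] eG(4)[OF \<mu> Xx] eH(4)[OF \<mu> Xx]
            ag[OF P Xx] ag[OF Q Xx(1) \<mu>x] by simp
      qed
      then show ?thesis using P Q by simp
    qed
  qed simp
  have "mcartesian (PM U C) D ?\<alpha>"
    unfolding mcartesian_def
  proof (intro conjI ballI)
    show "is_nat_trans (PM U C) D ?\<alpha>" using nt .
    fix \<mu> assume "\<mu> \<in> Mon (PM U C)"
    then have \<mu>: "\<mu> \<in> presheaf_monics U C" by simp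
    note \<mu>h = presheaf_monics_hom[OF \<mu>]
    have "small_presheaf U C (src \<mu>)" "small_presheaf U C (tgt \<mu>)" using \<mu>h by (auto simp: hom_PM_iff)
    moreover have "pullback D (FArr G \<mu>) (a (src \<mu>)) (a (tgt \<mu>)) (FArr H \<mu>)"
      by (rule extends_cartesian[OF mfunctor_comp_yo[OF Gf(1)] extG
          mfunctor_comp_yo[OF Hf(1)] extH \<beta>c a ag \<mu> \<mu>h])
    ultimately show "pullback D (FArr (src ?\<alpha>) \<mu>) (body ?\<alpha> (Dom (PM U C) \<mu>)) (body ?\<alpha> (Cod (PM U C) \<mu>))
        (FArr (tgt ?\<alpha>) \<mu>)"
      by simp
  qed
  then have \<alpha>h: "?\<alpha> \<in> hom ?A G H" using G H by (simp add: hom_iff)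
  \<comment> \<open>By naturality along maps out of representables, the component at \<open>P\<close> is determined by those
    at representables; for the component at a representable itself, the identity map is the one
    that corresponds to the element given by the identity.\<close>
  have elem_id: "elem_map C (rep X) X (Inl (Ident C X)) = Ident (PM U C) (rep X)" if X: "X \<in> Obj C" for X
    using is_functorD(3)[OF yo_functor X] yo_arr[OF id_hom[OF X]] yo_obj[OF X] by simp
  have component: "body \<gamma> P \<circ>\<^bsub>D\<^esub> ?g P X x = ?h P X x \<circ>\<^bsub>D\<^esub> body \<gamma> (rep X)"
    if "is_nat_trans (PM U C) D \<gamma>" "src \<gamma> = G" "tgt \<gamma> = H" "small_presheaf U C P" "X \<in> Obj C"
        "x \<in> FObj P X" for \<gamma> P X x
    using nat_transD(4)[OF that(1) elem_map_PM[OF that(4-6)]] that(2,3) by simp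
  have a_rep: "a (rep X) = body \<beta> X" if X: "X \<in> Obj C" for X
  proof -
    have P: "small_presheaf U C (rep X)" using small_presheaf_rep[OF X] .
    then have o: "rep X \<in> Obj (PM U C)" by simp
    show ?thesis
      using ag[OF P X rep_id[OF X]] elem_id[OF X] G'(3)[OF o] H'(3)[OF o]
        D.comp_id_right[OF a[OF P]] D.comp_id_left[OF \<beta>X[OF X]] by simp
  qed
  have \<beta>ext: "body \<beta> \<in> extensional (Obj C)" using \<beta>nt unfolding is_nat_trans_def by blast
  have "(\<lambda>X\<in>Obj C. body ?\<alpha> (rep X)) = body \<beta>"
    by (rule extensionalityI[of _ "Obj C"]) (use \<beta>ext a_rep small_presheaf_rep in auto)
  then have R\<alpha>: "FArr restr ?\<alpha> = \<beta>"
    using restr_arr[OF hom_arr[OF \<alpha>h]] \<beta>c(2,3) by (cases \<beta>) simp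
  show ?thesis
  proof (rule ex1I[of _ ?\<alpha>])
    show "?\<alpha> \<in> hom ?A G H \<and> FArr restr ?\<alpha> = \<beta>" using \<alpha>h R\<alpha> by blast
    fix \<gamma> assume \<gamma>: "\<gamma> \<in> hom ?A G H \<and> FArr restr \<gamma> = \<beta>"
    then have \<gamma>': "is_nat_trans (PM U C) D \<gamma>" "src \<gamma> = G" "tgt \<gamma> = H" "\<gamma> \<in> Arr ?A"
      by (auto simp: hom_iff mcartesian_def)
    have \<gamma>rep: "body \<gamma> (rep X) = body \<beta> X" if "X \<in> Obj C" for X
    proof -
      have "body (FArr restr \<gamma>) X = body \<gamma> (rep X)"
        using that by (simp add: restr_arr[OF \<gamma>'(4)])
      with \<gamma> show ?thesis by simp
    qed
    show "\<gamma> = ?\<alpha>"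
    proof (rule nat_trans_eqI[OF \<gamma>'(1) nt])
      fix P assume "P \<in> Obj (PM U C)"
      then have P: "small_presheaf U C P" by simp
      have \<gamma>P: "body \<gamma> P \<in> hom D (FObj G P) (FObj H P)" using nat_transD(3)[OF \<gamma>'(1), of P] \<gamma>'(2,3) P
          by simp
      have "body \<gamma> P = a P"
      proof (rule wcolim_map_unique[OF eG(1) eG(3)[OF P] \<gamma>P a[OF P]])
        show "body \<gamma> P \<circ>\<^bsub>D\<^esub> ?g P X x = a P \<circ>\<^bsub>D\<^esub> ?g P X x" if "X \<in> Obj C" "x \<in> FObj P X" for X x
          using component[OF \<gamma>'(1-3) P that] ag[OF P that] \<gamma>rep[OF that(1)] by simp
      qed
      then show "body \<gamma> P = body ?\<alpha> P" using P by simp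
    qed (use \<gamma>' in simp_all)
  qed
qed

lemma restr_equivalence: "equivalence (MCocomp_hom U (PM U C) D) (MCAT_hom C D) restr"
proof (rule equivalence_of_fully_faithful_surjective)
  show "category (MCocomp_hom U (PM U C) D)"
    using category_MCocomp_hom[OF category_PM mon_PM_arr D.category] .
  show "category (MCAT_hom C D)"
    using category_MCAT_hom[OF category _ D.category] mon_arr by blast
  show "is_functor (MCocomp_hom U (PM U C) D) (MCAT_hom C D) restr" using restr_functor .
  show "\<exists>G\<in>Obj (MCocomp_hom U (PM U C) D). FObj restr G = F" if "F \<in> Obj (MCAT_hom C D)" for F
  proof -
    have F: "is_mfunctor C D F" using that by simp
    obtain L l where L: "extends F L l" "comp_functor C L yo = F"
      using extension_ex[OF is_mfunctorD(1)[OF F]] .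
    have "is_cocont_mfunctor U (PM U C) D L"
      unfolding is_cocont_mfunctor_def using extends_mfunctor[OF F L(1)] extends_cocontinuous[OF L(1)]
          by blast
    then show ?thesis using restr_obj L(2) by (intro bexI[of _ L]) simp_all
  qed
  show "\<exists>!\<alpha>. \<alpha> \<in> hom (MCocomp_hom U (PM U C) D) G H \<and> FArr restr \<alpha> = \<beta>"
    if "G \<in> Obj (MCocomp_hom U (PM U C) D)" "H \<in> Obj (MCocomp_hom U (PM U C) D)"
      "\<beta> \<in> hom (MCAT_hom C D) (FObj restr G) (FObj restr H)" for G H \<beta>
    using restr_fully_faithful[of G H \<beta>] that by simp
qed

end

theorem theorem44:
  fixes C :: "('o, 'a) mcat" and D :: "('p, 'b) mcat"
  assumes "inaccessible TYPE('u)"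
    and "locally_small_mcategory TYPE('u) C"
    and "locally_small_mcategory TYPE('u) D"
    and "cocomplete TYPE('u) D"
  shows "equivalence
           (MCocomp_hom TYPE('u) (PM TYPE('u) C) D)
           (MCAT_hom C D)
           (precomposition C (yoneda C) (MCocomp_hom TYPE('u) (PM TYPE('u) C) D))"
proof -
  interpret Extension C D "TYPE('u)"
    using assms unfolding locally_small_mcategory_def mcategory_def
    by unfold_locales (auto simp: mcategory_def)
  show ?thesis by (rule restr_equivalence)
qed

end
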